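(* Let $\mathcal{C}$ and $\mathcal{D}$ be two algebraic triangulated categories, let $F:\mathcal{C}\to\mathcal{D}$ and $G:\mathcal{D}\to\mathcal{C}$ be two functors and let $\Phi$ be a self-equivalence of $\mathcal{C}$. Let there be given two adjoint pairs $(F,G)$ and $(G,F\Phi)$, with units and counits $$\eta:1_{\mathcal{D}}\to F\Phi G,\quad \varepsilon:GF\Phi\to 1_{\mathcal{C}}\quad\text{(for the pair }(G,F\Phi)),$$ $$\eta':1_{\mathcal{C}}\to GF,\quad \varepsilon':FG\to 1_{\mathcal{D}}\quad\text{(for the pair }(F,G)).$$ Let $\Upsilon$ be the cocone of $\varepsilon'$ and $\Upsilon'$ the cone of $\eta$, so that there are distinguished triangles of functors $$\Upsilon\to FG\xrightarrow{\varepsilon'}1_{\mathcal{D}}\to\Upsilon[1],\qquad 1_{\mathcal{D}}\xrightarrow{\eta}F\Phi G\to\Upsilon'\to 1_{\mathcal{D}}[1].$$ Assume that $$1_{\mathcal{C}}\xrightarrow{\eta'}GF\xrightarrow{\varepsilon\Phi^{-1}}\Phi^{-1}\xrightarrow{0}1_{\mathcal{C}}[1]$$ is a distinguished triangle (with zero connecting morphism). Then the functors $\Upsilon$ and $\Upsilon'$ are inverse self-equivalences of $\mathcal{D}$.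
   Context: Algebraic triangulated categories, functors between them, and their cones are understood as follows. A Frobenius category $\mathcal{E}$ is an exact category with enough projectives and injectives in which projectives and injectives coincide; $\bar{\mathcal{E}}$ denotes its stable category, and $\mathrm{Comp}_{\mathrm{acyc}}(\mathcal{E}\text{-proj})$ is the category of acyclic complexes of projective objects of $\mathcal{E}$. The $2$-category of algebraic triangulated categories has as objects the Frobenius categories $\mathcal{E}$ (representing the triangulated category $\bar{\mathcal{E}}$). The category of $1$-arrows from $\mathcal{E}$ to $\mathcal{E}'$ is the stable category of the Frobenius category of exact functors $\mathrm{Comp}_{\mathrm{acyc}}(\mathcal{E}\text{-proj})\to\mathrm{Comp}_{\mathrm{acyc}}(\mathcal{E}'\text{-proj})$ preserving projectives: its objects are these functors, and the morphisms $F\to G$ are the image of $\mathrm{Hom}(F,G)$ in the natural transformations between the induced functors $\bar{F},\bar{G}:\bar{\mathcal{E}}\to\bar{\mathcal{E}'}$. Since $\mathrm{Comp}_{\mathrm{acyc}}(\mathcal{E}'\text{-proj})$ has functorial cones, a morphism $\phi:F\to G$ of such functors has a well-defined cone functor $C(\phi)$ with morphisms $G\to C(\phi)\to F[1]$ such that $F\to G\to C(\phi)\to F[1]$ gives a distinguished triangle of functors $\bar{\mathcal{E}}\to\bar{\mathcal{E}'}$; the cocone is $C(\phi)[-1]$. All functors, self-equivalences, adjunctions and natural transformations in the statement are taken in this $2$-category, and all functors are additive and triangulated.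
   Formalization: Isomorphisms of functors in "self-equivalence" and "inverse self-equivalences" are generated by 2-arrows invertible on every object of the stable category and their inverses (zigzags); if the inverse must itself be a 2-arrow, the claim is false. *)

theory Defs
  imports "HOL-Algebra.Group"
begin

section \<open>Additive and exact categories\<close>

text \<open>Arrows carry their source and target, so different hom-sets are disjoint.
  \<open>Cmp A g f\<close> is the composite "\<open>g\<close> after \<open>f\<close>"; \<open>Zer A x y\<close> is the zero arrow from
  \<open>x\<close> to \<open>y\<close>; \<open>Add\<close> is meaningful for parallel arrows only.\<close>

record ('o, 'm) acat =
  Ob :: "'o set"
  Ar :: "'m set"
  Dom :: "'m \<Rightarrow> 'o"
  Cod :: "'m \<Rightarrow> 'o"
  Idt :: "'o \<Rightarrow> 'm"
  Cmp :: "'m \<Rightarrow> 'm \<Rightarrow> 'm"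
  Add :: "'m \<Rightarrow> 'm \<Rightarrow> 'm"
  Zer :: "'o \<Rightarrow> 'o \<Rightarrow> 'm"

definition homset :: "('o, 'm, 'z) acat_scheme \<Rightarrow> 'o \<Rightarrow> 'o \<Rightarrow> 'm set" where
  "homset A x y = {f \<in> Ar A. Dom A f = x \<and> Cod A f = y}"

definition hom_group :: "('o, 'm, 'z) acat_scheme \<Rightarrow> 'o \<Rightarrow> 'o \<Rightarrow> 'm monoid" where
  "hom_group A x y = \<lparr>carrier = homset A x y, monoid.mult = Add A, one = Zer A x y\<rparr>"

definition Neg :: "('o, 'm, 'z) acat_scheme \<Rightarrow> 'm \<Rightarrow> 'm" where
  "Neg A f = m_inv (hom_group A (Dom A f) (Cod A f)) f"

definition inverse_arrows :: "('o, 'm, 'z) acat_scheme \<Rightarrow> 'm \<Rightarrow> 'm \<Rightarrow> bool" where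
  "inverse_arrows A f g \<longleftrightarrow> f \<in> Ar A \<and> g \<in> homset A (Cod A f) (Dom A f) \<and>
     Cmp A g f = Idt A (Dom A f) \<and> Cmp A f g = Idt A (Cod A f)"

definition is_iso :: "('o, 'm, 'z) acat_scheme \<Rightarrow> 'm \<Rightarrow> bool" where
  "is_iso A f \<longleftrightarrow> (\<exists>g. inverse_arrows A f g)"

definition is_biproduct ::
  "('o, 'm, 'z) acat_scheme \<Rightarrow> 'o \<Rightarrow> 'o \<Rightarrow> 'o \<times> 'm \<times> 'm \<times> 'm \<times> 'm \<Rightarrow> bool" where
  "is_biproduct A x y = (\<lambda>(b, i1, i2, p1, p2). b \<in> Ob A \<and>
     i1 \<in> homset A x b \<and> i2 \<in> homset A y b \<and> p1 \<in> homset A b x \<and> p2 \<in> homset A b y \<and>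
     Cmp A p1 i1 = Idt A x \<and> Cmp A p2 i2 = Idt A y \<and>
     Cmp A p2 i1 = Zer A x y \<and> Cmp A p1 i2 = Zer A y x \<and>
     Add A (Cmp A i1 p1) (Cmp A i2 p2) = Idt A b)"

locale preadditive_category =
  fixes A :: "('o, 'm, 'z) acat_scheme"
  assumes Dom_in: "f \<in> Ar A \<Longrightarrow> Dom A f \<in> Ob A"
    and Cod_in: "f \<in> Ar A \<Longrightarrow> Cod A f \<in> Ob A"
    and Idt_in: "x \<in> Ob A \<Longrightarrow> Idt A x \<in> homset A x x"
    and Cmp_in: "f \<in> homset A x y \<Longrightarrow> g \<in> homset A y z \<Longrightarrow> Cmp A g f \<in> homset A x z"
    and Idt_left: "f \<in> homset A x y \<Longrightarrow> Cmp A (Idt A y) f = f"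
    and Idt_right: "f \<in> homset A x y \<Longrightarrow> Cmp A f (Idt A x) = f"
    and Cmp_assoc: "f \<in> homset A w x \<Longrightarrow> g \<in> homset A x y \<Longrightarrow> h \<in> homset A y z \<Longrightarrow>
          Cmp A h (Cmp A g f) = Cmp A (Cmp A h g) f"
    and hom_comm_group: "x \<in> Ob A \<Longrightarrow> y \<in> Ob A \<Longrightarrow> comm_group (hom_group A x y)"
    and Cmp_Add_left: "f \<in> homset A x y \<Longrightarrow> f' \<in> homset A x y \<Longrightarrow> g \<in> homset A y z \<Longrightarrow>
          Cmp A g (Add A f f') = Add A (Cmp A g f) (Cmp A g f')"
    and Cmp_Add_right: "f \<in> homset A x y \<Longrightarrow> g \<in> homset A y z \<Longrightarrow> g' \<in> homset A y z \<Longrightarrow>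
          Cmp A (Add A g g') f = Add A (Cmp A g f) (Cmp A g' f)"

locale additive_category = preadditive_category A
  for A :: "('o, 'm, 'z) acat_scheme" +
  assumes zero_object: "\<exists>z \<in> Ob A. Idt A z = Zer A z z"
    and biproduct: "x \<in> Ob A \<Longrightarrow> y \<in> Ob A \<Longrightarrow> \<exists>B. is_biproduct A x y B"

definition is_kernel :: "('o, 'm, 'z) acat_scheme \<Rightarrow> 'm \<Rightarrow> 'm \<Rightarrow> bool" where
  "is_kernel A i p \<longleftrightarrow> i \<in> Ar A \<and> p \<in> Ar A \<and> Cod A i = Dom A p \<and>
     Cmp A p i = Zer A (Dom A i) (Cod A p) \<and>
     (\<forall>f \<in> Ar A. Cod A f = Dom A p \<and> Cmp A p f = Zer A (Dom A f) (Cod A p) \<longrightarrow>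
        (\<exists>!g. g \<in> homset A (Dom A f) (Dom A i) \<and> Cmp A i g = f))"

definition is_cokernel :: "('o, 'm, 'z) acat_scheme \<Rightarrow> 'm \<Rightarrow> 'm \<Rightarrow> bool" where
  "is_cokernel A i p \<longleftrightarrow> i \<in> Ar A \<and> p \<in> Ar A \<and> Cod A i = Dom A p \<and>
     Cmp A p i = Zer A (Dom A i) (Cod A p) \<and>
     (\<forall>f \<in> Ar A. Dom A f = Cod A i \<and> Cmp A f i = Zer A (Dom A i) (Cod A f) \<longrightarrow>
        (\<exists>!g. g \<in> homset A (Cod A p) (Cod A f) \<and> Cmp A g p = f))"

text \<open>The square \<open>f' i = i' f\<close> with \<open>i : x \<rightarrow> y\<close>, \<open>f : x \<rightarrow> x'\<close>, \<open>f' : y \<rightarrow> y'\<close>, \<open>i' : x' \<rightarrow> y'\<close>.\<close>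

definition is_pushout :: "('o, 'm, 'z) acat_scheme \<Rightarrow> 'm \<Rightarrow> 'm \<Rightarrow> 'm \<Rightarrow> 'm \<Rightarrow> bool" where
  "is_pushout A i f f' i' \<longleftrightarrow> i \<in> Ar A \<and> f \<in> homset A (Dom A i) (Cod A f) \<and>
     f' \<in> homset A (Cod A i) (Cod A i') \<and> i' \<in> homset A (Cod A f) (Cod A i') \<and>
     f \<in> Ar A \<and> Cmp A f' i = Cmp A i' f \<and>
     (\<forall>a b w. a \<in> homset A (Cod A i) w \<and> b \<in> homset A (Cod A f) w \<and> Cmp A a i = Cmp A b f \<longrightarrow>
        (\<exists>!g. g \<in> homset A (Cod A i') w \<and> Cmp A g f' = a \<and> Cmp A g i' = b))"

text \<open>The square \<open>p f' = f p'\<close> with \<open>p : y \<rightarrow> z\<close>, \<open>f : z' \<rightarrow> z\<close>, \<open>f' : y' \<rightarrow> y\<close>, \<open>p' : y' \<rightarrow> z'\<close>.\<close>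

definition is_pullback :: "('o, 'm, 'z) acat_scheme \<Rightarrow> 'm \<Rightarrow> 'm \<Rightarrow> 'm \<Rightarrow> 'm \<Rightarrow> bool" where
  "is_pullback A p f f' p' \<longleftrightarrow> p \<in> Ar A \<and> f \<in> homset A (Dom A f) (Cod A p) \<and>
     f' \<in> homset A (Dom A p') (Dom A p) \<and> p' \<in> homset A (Dom A p') (Dom A f) \<and>
     Cmp A p f' = Cmp A f p' \<and>
     (\<forall>a b w. a \<in> homset A w (Dom A p) \<and> b \<in> homset A w (Dom A f) \<and> Cmp A p a = Cmp A f b \<longrightarrow>
        (\<exists>!g. g \<in> homset A w (Dom A p') \<and> Cmp A f' g = a \<and> Cmp A p' g = b))"

text \<open>Exact categories in the sense of Quillen, given by a class of conflations
  \<open>(i, p)\<close>, i.e. of admissible short exact sequences \<open>x \<rightarrow> y \<rightarrow> z\<close>.\<close>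

record ('o, 'm) excat = "('o, 'm) acat" +
  Confl :: "('m \<times> 'm) set"

definition inflation :: "('o, 'm, 'z) excat_scheme \<Rightarrow> 'm \<Rightarrow> bool" where
  "inflation A i \<longleftrightarrow> (\<exists>p. (i, p) \<in> Confl A)"

definition deflation :: "('o, 'm, 'z) excat_scheme \<Rightarrow> 'm \<Rightarrow> bool" where
  "deflation A p \<longleftrightarrow> (\<exists>i. (i, p) \<in> Confl A)"

locale exact_category = additive_category A
  for A :: "('o, 'm, 'z) excat_scheme" +
  assumes Confl_kernel: "(i, p) \<in> Confl A \<Longrightarrow> is_kernel A i p"
    and Confl_cokernel: "(i, p) \<in> Confl A \<Longrightarrow> is_cokernel A i p"
    and Confl_iso: "(i, p) \<in> Confl A \<Longrightarrow> is_iso A a \<Longrightarrow> is_iso A b \<Longrightarrow> is_iso A c \<Longrightarrow>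
          Dom A a = Dom A i \<Longrightarrow> Dom A b = Cod A i \<Longrightarrow> Dom A c = Cod A p \<Longrightarrow>
          i' \<in> homset A (Cod A a) (Cod A b) \<Longrightarrow> p' \<in> homset A (Cod A b) (Cod A c) \<Longrightarrow>
          Cmp A i' a = Cmp A b i \<Longrightarrow> Cmp A p' b = Cmp A c p \<Longrightarrow> (i', p') \<in> Confl A"
    and inflation_Idt: "x \<in> Ob A \<Longrightarrow> inflation A (Idt A x)"
    and deflation_Idt: "x \<in> Ob A \<Longrightarrow> deflation A (Idt A x)"
    and inflation_Cmp: "inflation A i \<Longrightarrow> inflation A j \<Longrightarrow> Cod A i = Dom A j \<Longrightarrow>
          inflation A (Cmp A j i)"
    and deflation_Cmp: "deflation A p \<Longrightarrow> deflation A q \<Longrightarrow> Cod A p = Dom A q \<Longrightarrow>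
          deflation A (Cmp A q p)"
    and inflation_pushout: "inflation A i \<Longrightarrow> f \<in> Ar A \<Longrightarrow> Dom A f = Dom A i \<Longrightarrow>
          \<exists>f' i'. is_pushout A i f f' i' \<and> inflation A i'"
    and deflation_pullback: "deflation A p \<Longrightarrow> f \<in> Ar A \<Longrightarrow> Cod A f = Cod A p \<Longrightarrow>
          \<exists>f' p'. is_pullback A p f f' p' \<and> deflation A p'"

definition projective :: "('o, 'm, 'z) excat_scheme \<Rightarrow> 'o \<Rightarrow> bool" where
  "projective A x \<longleftrightarrow> x \<in> Ob A \<and>
     (\<forall>p f. deflation A p \<and> f \<in> homset A x (Cod A p) \<longrightarrow>
        (\<exists>g \<in> homset A x (Dom A p). Cmp A p g = f))"

definition injective :: "('o, 'm, 'z) excat_scheme \<Rightarrow> 'o \<Rightarrow> bool" where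
  "injective A x \<longleftrightarrow> x \<in> Ob A \<and>
     (\<forall>i f. inflation A i \<and> f \<in> homset A (Dom A i) x \<longrightarrow>
        (\<exists>g \<in> homset A (Cod A i) x. Cmp A g i = f))"

locale frobenius_category = exact_category A
  for A :: "('o, 'm, 'z) excat_scheme" +
  assumes enough_projectives: "x \<in> Ob A \<Longrightarrow> \<exists>p. deflation A p \<and> Cod A p = x \<and> projective A (Dom A p)"
    and enough_injectives: "x \<in> Ob A \<Longrightarrow> \<exists>i. inflation A i \<and> Dom A i = x \<and> injective A (Cod A i)"
    and projective_iff_injective: "projective A x \<longleftrightarrow> injective A x"

section \<open>The stable category\<close>

definition stably_null :: "('o, 'm, 'z) excat_scheme \<Rightarrow> 'm \<Rightarrow> bool" where
  "stably_null A f \<longleftrightarrow> (\<exists>q g h. projective A q \<and> g \<in> homset A (Dom A f) q \<and>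
     h \<in> homset A q (Cod A f) \<and> f = Cmp A h g)"

definition stable_class :: "('o, 'm, 'z) excat_scheme \<Rightarrow> 'm \<Rightarrow> 'm set" where
  "stable_class A f = {g \<in> homset A (Dom A f) (Cod A f). stably_null A (Add A g (Neg A f))}"

definition rep :: "'m set \<Rightarrow> 'm" where
  "rep c = (SOME f. f \<in> c)"

definition stable :: "('o, 'm, 'z) excat_scheme \<Rightarrow> ('o, 'm set) acat" where
  "stable A = \<lparr>Ob = Ob A, Ar = stable_class A ` Ar A,
     Dom = (\<lambda>c. Dom A (rep c)), Cod = (\<lambda>c. Cod A (rep c)),
     Idt = (\<lambda>x. stable_class A (Idt A x)),
     Cmp = (\<lambda>c d. stable_class A (Cmp A (rep c) (rep d))),
     Add = (\<lambda>c d. stable_class A (Add A (rep c) (rep d))),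
     Zer = (\<lambda>x y. stable_class A (Zer A x y))\<rparr>"

section \<open>Functors and natural transformations\<close>

record ('o, 'm, 'p, 'n) fctr =
  fo :: "'o \<Rightarrow> 'p"
  fa :: "'m \<Rightarrow> 'n"

definition idf :: "('o, 'm, 'o, 'm) fctr" where
  "idf = \<lparr>fo = (\<lambda>x. x), fa = (\<lambda>f. f)\<rparr>"

definition compf :: "('p, 'n, 'q, 'k) fctr \<Rightarrow> ('o, 'm, 'p, 'n) fctr \<Rightarrow> ('o, 'm, 'q, 'k) fctr"
    (infixr \<open>\<circ>\<^sub>F\<close> 55) where
  "G \<circ>\<^sub>F F = \<lparr>fo = (\<lambda>x. fo G (fo F x)), fa = (\<lambda>f. fa G (fa F f))\<rparr>"

definition additive_functor ::
  "('o, 'm, 'y) acat_scheme \<Rightarrow> ('p, 'n, 'z) acat_scheme \<Rightarrow> ('o, 'm, 'p, 'n) fctr \<Rightarrow> bool" where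
  "additive_functor A B F \<longleftrightarrow>
     (\<forall>x \<in> Ob A. fo F x \<in> Ob B \<and> fa F (Idt A x) = Idt B (fo F x)) \<and>
     (\<forall>f \<in> Ar A. fa F f \<in> homset B (fo F (Dom A f)) (fo F (Cod A f))) \<and>
     (\<forall>f \<in> Ar A. \<forall>g \<in> Ar A. Cod A f = Dom A g \<longrightarrow>
        fa F (Cmp A g f) = Cmp B (fa F g) (fa F f)) \<and>
     (\<forall>f \<in> Ar A. \<forall>g \<in> Ar A. Dom A f = Dom A g \<and> Cod A f = Cod A g \<longrightarrow>
        fa F (Add A f g) = Add B (fa F f) (fa F g))"

definition exact_functor ::
  "('o, 'm, 'y) excat_scheme \<Rightarrow> ('p, 'n, 'z) excat_scheme \<Rightarrow> ('o, 'm, 'p, 'n) fctr \<Rightarrow> bool" where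
  "exact_functor A B F \<longleftrightarrow> additive_functor A B F \<and>
     (\<forall>(i, p) \<in> Confl A. (fa F i, fa F p) \<in> Confl B)"

definition nat_trans ::
  "('o, 'm, 'y) acat_scheme \<Rightarrow> ('p, 'n, 'z) acat_scheme \<Rightarrow>
   ('o, 'm, 'p, 'n) fctr \<Rightarrow> ('o, 'm, 'p, 'n) fctr \<Rightarrow> ('o \<Rightarrow> 'n) \<Rightarrow> bool" where
  "nat_trans A B F G \<tau> \<longleftrightarrow>
     (\<forall>x \<in> Ob A. \<tau> x \<in> homset B (fo F x) (fo G x)) \<and>
     (\<forall>f \<in> Ar A. Cmp B (fa G f) (\<tau> (Dom A f)) = Cmp B (\<tau> (Cod A f)) (fa F f))"

text \<open>The functor induced on stable categories; meaningful if \<open>F\<close> preserves projectives.\<close>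

definition bar :: "('p, 'n, 'z) excat_scheme \<Rightarrow> ('o, 'm, 'p, 'n) fctr \<Rightarrow> ('o, 'm set, 'p, 'n set) fctr" where
  "bar B F = \<lparr>fo = fo F, fa = (\<lambda>c. stable_class B (fa F (rep c)))\<rparr>"

section \<open>Acyclic complexes of projectives, shifts and cones\<close>

record ('o, 'm) cpx =
  trm :: "int \<Rightarrow> 'o"
  dif :: "int \<Rightarrow> 'm"

record ('o, 'm) chmap =
  csrc :: "('o, 'm) cpx"
  ctgt :: "('o, 'm) cpx"
  cmap :: "int \<Rightarrow> 'm"

text \<open>Acyclicity in the exact category \<open>E\<close>: the differential \<open>d\<^sup>n\<close> is a deflation
  \<open>X\<^sup>n \<rightarrow> Z\<^sup>n\<^sup>+\<^sup>1\<close> followed by an inflation \<open>Z\<^sup>n\<^sup>+\<^sup>1 \<rightarrow> X\<^sup>n\<^sup>+\<^sup>1\<close>, with \<open>Z\<^sup>n \<rightarrow> X\<^sup>n \<rightarrow> Z\<^sup>n\<^sup>+\<^sup>1\<close> conflations.\<close>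

definition acyclic_proj_complex :: "('o, 'm) excat \<Rightarrow> ('o, 'm) cpx \<Rightarrow> bool" where
  "acyclic_proj_complex E X \<longleftrightarrow>
     (\<forall>n. projective E (trm X n) \<and> dif X n \<in> homset E (trm X n) (trm X (n + 1))) \<and>
     (\<exists>Z i p. \<forall>n. (i n, p n) \<in> Confl E \<and>
        i n \<in> homset E (Z n) (trm X n) \<and> p n \<in> homset E (trm X n) (Z (n + 1)) \<and>
        dif X n = Cmp E (i (n + 1)) (p n))"

definition chain_map :: "('o, 'm) excat \<Rightarrow> ('o, 'm) chmap \<Rightarrow> bool" where
  "chain_map E u \<longleftrightarrow> (\<forall>n. cmap u n \<in> homset E (trm (csrc u) n) (trm (ctgt u) n) \<and>
     Cmp E (dif (ctgt u) n) (cmap u n) = Cmp E (cmap u (n + 1)) (dif (csrc u) n))"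

text \<open>\<open>Comp\<^sub>a\<^sub>c\<^sub>y\<^sub>c(E-proj)\<close> with the exact structure of complexes: a pair of chain maps is a
  conflation iff it is one in every degree.\<close>

definition Acyc :: "('o, 'm) excat \<Rightarrow> (('o, 'm) cpx, ('o, 'm) chmap) excat" where
  "Acyc E = \<lparr>Ob = {X. acyclic_proj_complex E X},
     Ar = {u. acyclic_proj_complex E (csrc u) \<and> acyclic_proj_complex E (ctgt u) \<and> chain_map E u},
     Dom = csrc, Cod = ctgt,
     Idt = (\<lambda>X. \<lparr>csrc = X, ctgt = X, cmap = (\<lambda>n. Idt E (trm X n))\<rparr>),
     Cmp = (\<lambda>v u. \<lparr>csrc = csrc u, ctgt = ctgt v, cmap = (\<lambda>n. Cmp E (cmap v n) (cmap u n))\<rparr>),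
     Add = (\<lambda>u v. \<lparr>csrc = csrc u, ctgt = ctgt u, cmap = (\<lambda>n. Add E (cmap u n) (cmap v n))\<rparr>),
     Zer = (\<lambda>X Y. \<lparr>csrc = X, ctgt = Y, cmap = (\<lambda>n. Zer E (trm X n) (trm Y n))\<rparr>),
     Confl = {(u, v). acyclic_proj_complex E (csrc u) \<and> acyclic_proj_complex E (ctgt u) \<and>
        acyclic_proj_complex E (ctgt v) \<and> chain_map E u \<and> chain_map E v \<and> ctgt u = csrc v \<and>
        (\<forall>n. (cmap u n, cmap v n) \<in> Confl E)}\<rparr>"

definition shift_cpx :: "('o, 'm) excat \<Rightarrow> int \<Rightarrow> ('o, 'm) cpx \<Rightarrow> ('o, 'm) cpx" where
  "shift_cpx E k X = \<lparr>trm = (\<lambda>n. trm X (n + k)),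
     dif = (\<lambda>n. if even k then dif X (n + k) else Neg E (dif X (n + k)))\<rparr>"

definition shift ::
  "('o, 'm) excat \<Rightarrow> int \<Rightarrow> (('o, 'm) cpx, ('o, 'm) chmap, ('o, 'm) cpx, ('o, 'm) chmap) fctr" where
  "shift E k = \<lparr>fo = shift_cpx E k,
     fa = (\<lambda>u. \<lparr>csrc = shift_cpx E k (csrc u), ctgt = shift_cpx E k (ctgt u),
                cmap = (\<lambda>n. cmap u (n + k))\<rparr>)\<rparr>"

definition biprod :: "('o, 'm, 'z) acat_scheme \<Rightarrow> 'o \<Rightarrow> 'o \<Rightarrow> 'o \<times> 'm \<times> 'm \<times> 'm \<times> 'm" where
  "biprod A x y = (SOME B. is_biproduct A x y B)"

definition bsum :: "('o, 'm, 'z) acat_scheme \<Rightarrow> 'o \<Rightarrow> 'o \<Rightarrow> 'o" where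
  "bsum A x y = fst (biprod A x y)"

definition in1 :: "('o, 'm, 'z) acat_scheme \<Rightarrow> 'o \<Rightarrow> 'o \<Rightarrow> 'm" where
  "in1 A x y = fst (snd (biprod A x y))"

definition in2 :: "('o, 'm, 'z) acat_scheme \<Rightarrow> 'o \<Rightarrow> 'o \<Rightarrow> 'm" where
  "in2 A x y = fst (snd (snd (biprod A x y)))"

definition pr1 :: "('o, 'm, 'z) acat_scheme \<Rightarrow> 'o \<Rightarrow> 'o \<Rightarrow> 'm" where
  "pr1 A x y = fst (snd (snd (snd (biprod A x y))))"

definition pr2 :: "('o, 'm, 'z) acat_scheme \<Rightarrow> 'o \<Rightarrow> 'o \<Rightarrow> 'm" where
  "pr2 A x y = snd (snd (snd (snd (biprod A x y))))"

text \<open>The mapping cone of \<open>u : X \<rightarrow> Y\<close> is \<open>Y\<^sup>n \<oplus> X\<^sup>n\<^sup>+\<^sup>1\<close> in degree \<open>n\<close>, with differential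
  \<open>(y, x) \<mapsto> (d y + u x, - d x)\<close>.\<close>

definition cone_cpx :: "('o, 'm) excat \<Rightarrow> ('o, 'm) chmap \<Rightarrow> ('o, 'm) cpx" where
  "cone_cpx E u =
    (let X = csrc u; Y = ctgt u; y = trm Y; x = (\<lambda>n. trm X (n + 1)) in
     \<lparr>trm = (\<lambda>n. bsum E (y n) (x n)),
      dif = (\<lambda>n. Add E
        (Cmp E (in1 E (y (n + 1)) (x (n + 1)))
          (Add E (Cmp E (dif Y n) (pr1 E (y n) (x n)))
                 (Cmp E (cmap u (n + 1)) (pr2 E (y n) (x n)))))
        (Cmp E (in2 E (y (n + 1)) (x (n + 1)))
          (Cmp E (Neg E (dif X (n + 1))) (pr2 E (y n) (x n)))))\<rparr>)"

definition cone_in :: "('o, 'm) excat \<Rightarrow> ('o, 'm) chmap \<Rightarrow> ('o, 'm) chmap" where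
  "cone_in E u = \<lparr>csrc = ctgt u, ctgt = cone_cpx E u,
     cmap = (\<lambda>n. in1 E (trm (ctgt u) n) (trm (csrc u) (n + 1)))\<rparr>"

definition cone_pr :: "('o, 'm) excat \<Rightarrow> ('o, 'm) chmap \<Rightarrow> ('o, 'm) chmap" where
  "cone_pr E u = \<lparr>csrc = cone_cpx E u, ctgt = shift_cpx E 1 (csrc u),
     cmap = (\<lambda>n. pr2 E (trm (ctgt u) n) (trm (csrc u) (n + 1)))\<rparr>"

text \<open>The map from the cone of \<open>u : X \<rightarrow> Y\<close> to the cone of \<open>u' : X' \<rightarrow> Y'\<close> given by
  \<open>a : X \<rightarrow> X'\<close> and \<open>b : Y \<rightarrow> Y'\<close> with \<open>b u = u' a\<close>.\<close>

definition cone_map ::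
  "('o, 'm) excat \<Rightarrow> ('o, 'm) chmap \<Rightarrow> ('o, 'm) chmap \<Rightarrow> ('o, 'm) chmap \<Rightarrow> ('o, 'm) chmap \<Rightarrow>
   ('o, 'm) chmap" where
  "cone_map E u u' a b =
    (let y = trm (ctgt u); x = (\<lambda>n. trm (csrc u) (n + 1));
         y' = trm (ctgt u'); x' = (\<lambda>n. trm (csrc u') (n + 1)) in
     \<lparr>csrc = cone_cpx E u, ctgt = cone_cpx E u',
      cmap = (\<lambda>n. Add E
        (Cmp E (in1 E (y' n) (x' n)) (Cmp E (cmap b n) (pr1 E (y n) (x n))))
        (Cmp E (in2 E (y' n) (x' n)) (Cmp E (cmap a (n + 1)) (pr2 E (y n) (x n)))))\<rparr>)"

text \<open>Distinguished triangles \<open>X \<rightarrow> Y \<rightarrow> Z \<rightarrow> X[1]\<close> of the stable category: those isomorphic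
  to the standard triangle of a chain map.\<close>

definition dist_triangle ::
  "('o, 'm) excat \<Rightarrow> ('o, 'm) chmap set \<Rightarrow> ('o, 'm) chmap set \<Rightarrow> ('o, 'm) chmap set \<Rightarrow> bool" where
  "dist_triangle E f g h \<longleftrightarrow>
    (let S = stable (Acyc E); cl = stable_class (Acyc E) in
     \<exists>X Y Z u a b c.
       f \<in> homset S X Y \<and> g \<in> homset S Y Z \<and> h \<in> homset S Z (fo (shift E 1) X) \<and>
       u \<in> Ar (Acyc E) \<and>
       a \<in> homset S X (csrc u) \<and> b \<in> homset S Y (ctgt u) \<and> c \<in> homset S Z (cone_cpx E u) \<and>
       is_iso S a \<and> is_iso S b \<and> is_iso S c \<and>
       Cmp S b f = Cmp S (cl u) a \<and>
       Cmp S c g = Cmp S (cl (cone_in E u)) b \<and>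
       Cmp S (fa (bar (Acyc E) (shift E 1)) a) h = Cmp S (cl (cone_pr E u)) c)"

section \<open>The 2-category of algebraic triangulated categories\<close>

text \<open>Its objects are the Frobenius categories.  \<open>E\<close> represents the triangulated category
  \<open>stable (Acyc E)\<close>, which is canonically equivalent to \<open>stable E\<close> (send a complex
  to its object of 0-cocycles).\<close>

type_synonym ('o, 'm, 'p, 'n) arrow1 = "(('o, 'm) cpx, ('o, 'm) chmap, ('p, 'n) cpx, ('p, 'n) chmap) fctr"

definition one_arrow ::
  "('o, 'm) excat \<Rightarrow> ('p, 'n) excat \<Rightarrow> ('o, 'm, 'p, 'n) arrow1 \<Rightarrow> bool" where
  "one_arrow E E' F \<longleftrightarrow> exact_functor (Acyc E) (Acyc E') F \<and>
     (\<forall>X. projective (Acyc E) X \<longrightarrow> projective (Acyc E') (fo F X))"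

text \<open>\<open>hom1 E E' F G\<close> is \<open>Hom(F, G)\<close>; the image of \<open>\<tau> \<in> Hom(F, G)\<close> in the natural transformations
  between the induced functors is \<open>two_arrow E' \<tau>\<close>, and \<open>two_eq\<close> is equality of these images.\<close>

definition hom1 ::
  "('o, 'm) excat \<Rightarrow> ('p, 'n) excat \<Rightarrow> ('o, 'm, 'p, 'n) arrow1 \<Rightarrow> ('o, 'm, 'p, 'n) arrow1 \<Rightarrow>
   (('o, 'm) cpx \<Rightarrow> ('p, 'n) chmap) set" where
  "hom1 E E' F G = {\<tau>. nat_trans (Acyc E) (Acyc E') F G \<tau>}"

definition two_arrow ::
  "('p, 'n) excat \<Rightarrow> (('o, 'm) cpx \<Rightarrow> ('p, 'n) chmap) \<Rightarrow> ('o, 'm) cpx \<Rightarrow> ('p, 'n) chmap set" where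
  "two_arrow E' \<tau> = (\<lambda>X. stable_class (Acyc E') (\<tau> X))"

definition two_eq ::
  "('o, 'm) excat \<Rightarrow> ('p, 'n) excat \<Rightarrow> (('o, 'm) cpx \<Rightarrow> ('p, 'n) chmap) \<Rightarrow>
   (('o, 'm) cpx \<Rightarrow> ('p, 'n) chmap) \<Rightarrow> bool" where
  "two_eq E E' \<sigma> \<tau> \<longleftrightarrow> (\<forall>X \<in> Ob (Acyc E). two_arrow E' \<sigma> X = two_arrow E' \<tau> X)"

text \<open>\<open>L\<close> is left adjoint to \<open>R\<close>, with unit \<open>u\<close> and counit \<open>c\<close>.  The transformations are
  genuine ones, the triangle identities are equalities of 2-arrows.\<close>

definition adjoint_pair ::
  "('o, 'm) excat \<Rightarrow> ('p, 'n) excat \<Rightarrow> ('o, 'm, 'p, 'n) arrow1 \<Rightarrow> ('p, 'n, 'o, 'm) arrow1 \<Rightarrow>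
   (('o, 'm) cpx \<Rightarrow> ('o, 'm) chmap) \<Rightarrow> (('p, 'n) cpx \<Rightarrow> ('p, 'n) chmap) \<Rightarrow> bool" where
  "adjoint_pair E E' L R u c \<longleftrightarrow>
     one_arrow E E' L \<and> one_arrow E' E R \<and>
     u \<in> hom1 E E idf (R \<circ>\<^sub>F L) \<and> c \<in> hom1 E' E' (L \<circ>\<^sub>F R) idf \<and>
     two_eq E E' (\<lambda>X. Cmp (Acyc E') (c (fo L X)) (fa L (u X))) (\<lambda>X. Idt (Acyc E') (fo L X)) \<and>
     two_eq E' E (\<lambda>Y. Cmp (Acyc E) (fa R (c Y)) (u (fo R Y))) (\<lambda>Y. Idt (Acyc E) (fo R Y))"

text \<open>Isomorphisms between 1-arrows \<open>F\<close> and \<open>G\<close>, as natural transformations between the induced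
  functors.  A 2-arrow that is an isomorphism on every object of the stable category is
  inverted even if its inverse is not induced by a transformation from \<open>G\<close> to \<open>F\<close>: the inverse of
  a natural homotopy equivalence is in general natural only up to homotopy.  For instance the
  canonical isomorphism of \<open>F(X[1])\<close> and \<open>F(X)[1]\<close> is the zigzag of natural homotopy
  equivalences \<open>F(X[1]) \<leftarrow> C(F(X) \<rightarrow> F(I X)) \<rightarrow> F(X)[1]\<close>, with \<open>I X\<close> the cone of the identity.\<close>

inductive two_iso ::
  "('o, 'm) excat \<Rightarrow> ('p, 'n) excat \<Rightarrow> ('o, 'm, 'p, 'n) arrow1 \<Rightarrow> ('o, 'm, 'p, 'n) arrow1 \<Rightarrow>
   (('o, 'm) cpx \<Rightarrow> ('p, 'n) chmap set) \<Rightarrow> bool" for E E' where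
  two_iso_arrow: "one_arrow E E' F \<Longrightarrow> one_arrow E E' G \<Longrightarrow> \<tau> \<in> hom1 E E' F G \<Longrightarrow>
     (\<And>X. X \<in> Ob (Acyc E) \<Longrightarrow> is_iso (stable (Acyc E')) (two_arrow E' \<tau> X)) \<Longrightarrow>
     two_iso E E' F G (two_arrow E' \<tau>)"
| two_iso_inverse: "two_iso E E' F G s \<Longrightarrow>
     (\<And>X. X \<in> Ob (Acyc E) \<Longrightarrow> inverse_arrows (stable (Acyc E')) (s X) (t X)) \<Longrightarrow>
     two_iso E E' G F t"
| two_iso_comp: "two_iso E E' F G s \<Longrightarrow> two_iso E E' G H t \<Longrightarrow>
     two_iso E E' F H (\<lambda>X. Cmp (stable (Acyc E')) (t X) (s X))"

definition inverse_self_equivalences ::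
  "('o, 'm) excat \<Rightarrow> ('o, 'm, 'o, 'm) arrow1 \<Rightarrow> ('o, 'm, 'o, 'm) arrow1 \<Rightarrow> bool" where
  "inverse_self_equivalences E F G \<longleftrightarrow> one_arrow E E F \<and> one_arrow E E G \<and>
     (\<exists>s. two_iso E E idf (F \<circ>\<^sub>F G) s) \<and> (\<exists>t. two_iso E E (G \<circ>\<^sub>F F) idf t)"

definition cone_functor ::
  "('p, 'n) excat \<Rightarrow> ('o, 'm, 'p, 'n) arrow1 \<Rightarrow> ('o, 'm, 'p, 'n) arrow1 \<Rightarrow>
   (('o, 'm) cpx \<Rightarrow> ('p, 'n) chmap) \<Rightarrow> ('o, 'm, 'p, 'n) arrow1" where
  "cone_functor E' F G \<phi> = \<lparr>fo = (\<lambda>X. cone_cpx E' (\<phi> X)),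
     fa = (\<lambda>f. cone_map E' (\<phi> (csrc f)) (\<phi> (ctgt f)) (fa F f) (fa G f))\<rparr>"

definition cocone_functor ::
  "('p, 'n) excat \<Rightarrow> ('o, 'm, 'p, 'n) arrow1 \<Rightarrow> ('o, 'm, 'p, 'n) arrow1 \<Rightarrow>
   (('o, 'm) cpx \<Rightarrow> ('p, 'n) chmap) \<Rightarrow> ('o, 'm, 'p, 'n) arrow1" where
  "cocone_functor E' F G \<phi> = shift E' (-1) \<circ>\<^sub>F cone_functor E' F G \<phi>"

text \<open>Distinguished triangles \<open>F \<rightarrow> G \<rightarrow> H \<rightarrow> F[1]\<close> of functors between the stable categories.\<close>

definition dist_triangle_functors ::
  "('o, 'm) excat \<Rightarrow> ('p, 'n) excat \<Rightarrow>
   ('o, 'm, 'p, 'n) arrow1 \<Rightarrow> ('o, 'm, 'p, 'n) arrow1 \<Rightarrow> ('o, 'm, 'p, 'n) arrow1 \<Rightarrow>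
   (('o, 'm) cpx \<Rightarrow> ('p, 'n) chmap set) \<Rightarrow> (('o, 'm) cpx \<Rightarrow> ('p, 'n) chmap set) \<Rightarrow>
   (('o, 'm) cpx \<Rightarrow> ('p, 'n) chmap set) \<Rightarrow> bool" where
  "dist_triangle_functors E E' F G H f g h \<longleftrightarrow>
    (let S = stable (Acyc E); S' = stable (Acyc E'); b = bar (Acyc E') in
     nat_trans S S' (b F) (b G) f \<and> nat_trans S S' (b G) (b H) g \<and>
     nat_trans S S' (b H) (b (shift E' 1 \<circ>\<^sub>F F)) h \<and>
     (\<forall>X \<in> Ob S. dist_triangle E' (f X) (g X) (h X)))"

end

theory Submission
  imports Defs
begin

text \<open>
  The zero connecting map and the adjunction identities split the
  functors \<open>G F \<Phi> G\<close> and \<open>F \<Phi> G F G\<close>, and this yields stable isomorphisms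
  \<open>\<theta> : \<Phi> G \<rightarrow> G \<Upsilon>'\<close> and \<open>\<beta> : F G \<rightarrow> Q\<close>, \<open>\<delta> : F \<Phi> G \<Upsilon> \<rightarrow> Q\<close>, where \<open>Q\<close> is the cone of
  \<open>F \<Phi> \<eta>' G\<close>.  Up to a shift, \<open>\<Upsilon> \<Upsilon>'\<close> is the cone of \<open>\<epsilon>' \<Upsilon>'\<close>; precomposing with \<open>F \<theta>\<close>
  replaces this map by \<open>in u : F \<Phi> G \<rightarrow> \<Upsilon>'\<close>, where \<open>in\<close> is the inclusion into the cone of \<open>\<eta>\<close>
  and \<open>u\<close> is stably the identity, and the cone of \<open>in\<close> is the shift of the identity functor.
  Dually, \<open>\<Upsilon>' \<Upsilon>\<close> is the cone of \<open>\<eta> \<Upsilon>\<close>, and \<open>\<delta>\<close> and \<open>\<beta>\<close> identify it with the cone of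
  \<open>\<Upsilon> \<rightarrow> F G\<close>, which is the identity functor.  All squares commute at the level of complexes, so that they
  induce maps of cone functors; these are isomorphisms as soon as they are so at each object.
\<close>

section \<open>Preadditive categories\<close>

text \<open>Two features of the setting shape the argument. A 1-arrow need not commute strictly with
  the shift, and the triangle identities hold only stably, whereas a functorial map of cones needs
  strictly commuting squares of genuine transformations. Stable inverses are therefore never
  inserted into a square: each comparison is a composite of given units, counits and structural cone
  maps, in whichever direction it exists on complexes, and the resulting isomorphisms of functors
  are joined to zigzags. The isomorphism \<open>\<alpha>\<close> is itself only a zigzag; the
  splitting that it provides is used object by object, to show that genuine maps are stably
  invertible.

  To apply functors to triangles without comparing shifts, the connecting map is forgotten. An exact
  functor preserves conflations, hence also pairs stably isomorphic to conflations, and such pairs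
  still have the weak kernel, weak cokernel and splitting properties of triangles. The projectives
  among acyclic complexes that make this calculus available are supplied by the cones of identity
  maps.\<close>

lemma homset_iff: "f \<in> homset A x y \<longleftrightarrow> f \<in> Ar A \<and> Dom A f = x \<and> Cod A f = y"
  by (simp add: homset_def)

abbreviation Cmp_syntax (\<open>(_ \<cdot>\<^bsub>_\<^esub> _)\<close> [71, 0, 70] 70) where
  "g \<cdot>\<^bsub>A\<^esub> f \<equiv> Cmp A g f"

abbreviation Add_syntax (\<open>(_ \<oplus>\<^bsub>_\<^esub> _)\<close> [66, 0, 65] 65) where
  "f \<oplus>\<^bsub>A\<^esub> g \<equiv> Add A f g"

abbreviation Neg_syntax (\<open>(\<ominus>\<^bsub>_\<^esub> _)\<close> [0, 80] 80) where
  "\<ominus>\<^bsub>A\<^esub> f \<equiv> Neg A f"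

lemma hom_group_simps [simp]:
  "carrier (hom_group A x y) = homset A x y"
  "monoid.mult (hom_group A x y) = Add A"
  "one (hom_group A x y) = Zer A x y"
  by (simp_all add: hom_group_def)

context preadditive_category
begin

lemma Dom_Ob [simp]: "f \<in> Ar A \<Longrightarrow> Dom A f \<in> Ob A"
  and Cod_Ob [simp]: "f \<in> Ar A \<Longrightarrow> Cod A f \<in> Ob A"
  by (simp_all add: Dom_in Cod_in)

lemma Idt_simps [simp]:
  assumes "x \<in> Ob A"
  shows "Idt A x \<in> Ar A" "Dom A (Idt A x) = x" "Cod A (Idt A x) = x"
  using Idt_in[OF assms] by (simp_all add: homset_iff)

lemma Cmp_simps [simp]:
  assumes "f \<in> Ar A" "g \<in> Ar A" "Cod A f = Dom A g"
  shows "g \<cdot>\<^bsub>A\<^esub> f \<in> Ar A" "Dom A (g \<cdot>\<^bsub>A\<^esub> f) = Dom A f" "Cod A (g \<cdot>\<^bsub>A\<^esub> f) = Cod A g"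
  using Cmp_in[of f "Dom A f" "Cod A f" g "Cod A g"] assms by (simp_all add: homset_iff)

lemma Cmp_Idt_left [simp]: "f \<in> Ar A \<Longrightarrow> Cod A f = y \<Longrightarrow> Idt A y \<cdot>\<^bsub>A\<^esub> f = f"
  using Idt_left[of f "Dom A f" y] by (simp add: homset_iff)

lemma Cmp_Idt_right [simp]: "f \<in> Ar A \<Longrightarrow> Dom A f = x \<Longrightarrow> f \<cdot>\<^bsub>A\<^esub> Idt A x = f"
  using Idt_right[of f x "Cod A f"] by (simp add: homset_iff)

lemma Cmp_assoc' [simp]:
  "f \<in> Ar A \<Longrightarrow> g \<in> Ar A \<Longrightarrow> h \<in> Ar A \<Longrightarrow> Cod A f = Dom A g \<Longrightarrow> Cod A g = Dom A h \<Longrightarrow>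
   (h \<cdot>\<^bsub>A\<^esub> g) \<cdot>\<^bsub>A\<^esub> f = h \<cdot>\<^bsub>A\<^esub> g \<cdot>\<^bsub>A\<^esub> f"
  using Cmp_assoc[of f "Dom A f" "Cod A f" g "Cod A g" h "Cod A h"] by (simp add: homset_iff)

lemma Cmp_Add [simp]:
  "f \<in> Ar A \<Longrightarrow> f' \<in> Ar A \<Longrightarrow> g \<in> Ar A \<Longrightarrow> Dom A f = Dom A f' \<Longrightarrow> Cod A f = Cod A f' \<Longrightarrow>
   Cod A f' = Dom A g \<Longrightarrow> g \<cdot>\<^bsub>A\<^esub> (f \<oplus>\<^bsub>A\<^esub> f') = g \<cdot>\<^bsub>A\<^esub> f \<oplus>\<^bsub>A\<^esub> g \<cdot>\<^bsub>A\<^esub> f'"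
  using Cmp_Add_left[of f "Dom A f" "Cod A f" f' g "Cod A g"] by (simp add: homset_iff)

lemma Add_Cmp [simp]:
  "f \<in> Ar A \<Longrightarrow> g \<in> Ar A \<Longrightarrow> g' \<in> Ar A \<Longrightarrow> Dom A g = Dom A g' \<Longrightarrow> Cod A g = Cod A g' \<Longrightarrow>
   Cod A f = Dom A g' \<Longrightarrow> (g \<oplus>\<^bsub>A\<^esub> g') \<cdot>\<^bsub>A\<^esub> f = g \<cdot>\<^bsub>A\<^esub> f \<oplus>\<^bsub>A\<^esub> g' \<cdot>\<^bsub>A\<^esub> f"
  using Cmp_Add_right[of f "Dom A f" "Cod A f" g "Cod A g" g'] by (simp add: homset_iff)

lemma Zer_simps [simp]:
  assumes "x \<in> Ob A" "y \<in> Ob A"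
  shows "Zer A x y \<in> Ar A" "Dom A (Zer A x y) = x" "Cod A (Zer A x y) = y"
proof -
  interpret H: comm_group "hom_group A x y" by (rule hom_comm_group[OF assms])
  show "Zer A x y \<in> Ar A" "Dom A (Zer A x y) = x" "Cod A (Zer A x y) = y"
    using H.one_closed by (simp_all add: homset_iff)
qed

lemma Add_simps [simp]:
  assumes "f \<in> Ar A" "g \<in> Ar A" "Dom A f = Dom A g" "Cod A f = Cod A g"
  shows "f \<oplus>\<^bsub>A\<^esub> g \<in> Ar A" "Dom A (f \<oplus>\<^bsub>A\<^esub> g) = Dom A g" "Cod A (f \<oplus>\<^bsub>A\<^esub> g) = Cod A g"
proof -
  interpret H: comm_group "hom_group A (Dom A g) (Cod A g)"
    by (rule hom_comm_group) (simp_all add: assms)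
  show "f \<oplus>\<^bsub>A\<^esub> g \<in> Ar A" "Dom A (f \<oplus>\<^bsub>A\<^esub> g) = Dom A g" "Cod A (f \<oplus>\<^bsub>A\<^esub> g) = Cod A g"
    using H.m_closed[of f g] assms by (simp_all add: homset_iff)
qed

lemma Neg_simps [simp]:
  assumes "f \<in> Ar A"
  shows "\<ominus>\<^bsub>A\<^esub> f \<in> Ar A" "Dom A (\<ominus>\<^bsub>A\<^esub> f) = Dom A f" "Cod A (\<ominus>\<^bsub>A\<^esub> f) = Cod A f"
proof -
  interpret H: comm_group "hom_group A (Dom A f) (Cod A f)"
    by (rule hom_comm_group) (simp_all add: assms)
  show "\<ominus>\<^bsub>A\<^esub> f \<in> Ar A" "Dom A (\<ominus>\<^bsub>A\<^esub> f) = Dom A f" "Cod A (\<ominus>\<^bsub>A\<^esub> f) = Cod A f"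
    using H.inv_closed[of f] assms by (simp_all add: homset_iff Neg_def)
qed

lemma Add_assoc [simp]:
  assumes "f \<in> Ar A" "g \<in> Ar A" "h \<in> Ar A" "Dom A f = Dom A h" "Cod A f = Cod A h"
    "Dom A g = Dom A h" "Cod A g = Cod A h"
  shows "(f \<oplus>\<^bsub>A\<^esub> g) \<oplus>\<^bsub>A\<^esub> h = f \<oplus>\<^bsub>A\<^esub> g \<oplus>\<^bsub>A\<^esub> h"
proof -
  interpret H: comm_group "hom_group A (Dom A h) (Cod A h)"
    by (rule hom_comm_group) (simp_all add: assms)
  show ?thesis using H.m_assoc[of f g h] assms by (simp add: homset_iff)
qed

lemma Add_commute:
  assumes "f \<in> Ar A" "g \<in> Ar A" "Dom A f = Dom A g" "Cod A f = Cod A g"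
  shows "f \<oplus>\<^bsub>A\<^esub> g = g \<oplus>\<^bsub>A\<^esub> f"
proof -
  interpret H: comm_group "hom_group A (Dom A g) (Cod A g)"
    by (rule hom_comm_group) (simp_all add: assms)
  show ?thesis using H.m_comm[of f g] assms by (simp add: homset_iff)
qed

lemma Add_left_commute:
  assumes "f \<in> Ar A" "g \<in> Ar A" "h \<in> Ar A" "Dom A f = Dom A h" "Cod A f = Cod A h"
    "Dom A g = Dom A h" "Cod A g = Cod A h"
  shows "f \<oplus>\<^bsub>A\<^esub> g \<oplus>\<^bsub>A\<^esub> h = g \<oplus>\<^bsub>A\<^esub> f \<oplus>\<^bsub>A\<^esub> h"
  using assms Add_assoc[of f g h] Add_assoc[of g f h] Add_commute[of f g] by simp

lemma Add_Zer [simp]: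
  assumes "f \<in> Ar A" "Dom A f = x" "Cod A f = y"
  shows "f \<oplus>\<^bsub>A\<^esub> Zer A x y = f" "Zer A x y \<oplus>\<^bsub>A\<^esub> f = f"
proof -
  interpret H: comm_group "hom_group A x y" by (rule hom_comm_group) (use assms in auto)
  show "f \<oplus>\<^bsub>A\<^esub> Zer A x y = f" "Zer A x y \<oplus>\<^bsub>A\<^esub> f = f"
    using H.r_one[of f] H.l_one[of f] assms by (simp_all add: homset_iff)
qed

lemma Add_Neg [simp]:
  assumes "f \<in> Ar A"
  shows "f \<oplus>\<^bsub>A\<^esub> \<ominus>\<^bsub>A\<^esub> f = Zer A (Dom A f) (Cod A f)" "\<ominus>\<^bsub>A\<^esub> f \<oplus>\<^bsub>A\<^esub> f = Zer A (Dom A f) (Cod A f)"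
proof -
  interpret H: comm_group "hom_group A (Dom A f) (Cod A f)"
    by (rule hom_comm_group) (simp_all add: assms)
  show "f \<oplus>\<^bsub>A\<^esub> \<ominus>\<^bsub>A\<^esub> f = Zer A (Dom A f) (Cod A f)" "\<ominus>\<^bsub>A\<^esub> f \<oplus>\<^bsub>A\<^esub> f = Zer A (Dom A f) (Cod A f)"
    using H.r_inv[of f] H.l_inv[of f] assms by (simp_all add: homset_iff Neg_def)
qed

lemma Add_Neg_cancel [simp]:
  assumes "f \<in> Ar A" "g \<in> Ar A" "Dom A f = Dom A g" "Cod A f = Cod A g"
  shows "f \<oplus>\<^bsub>A\<^esub> \<ominus>\<^bsub>A\<^esub> f \<oplus>\<^bsub>A\<^esub> g = g" "\<ominus>\<^bsub>A\<^esub> f \<oplus>\<^bsub>A\<^esub> f \<oplus>\<^bsub>A\<^esub> g = g"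
  using assms Add_assoc[of f "\<ominus>\<^bsub>A\<^esub> f" g] Add_assoc[of "\<ominus>\<^bsub>A\<^esub> f" f g] by simp_all

lemma Add_left_cancel:
  assumes "f \<in> Ar A" "g \<in> Ar A" "h \<in> Ar A" "Dom A f = Dom A g" "Cod A f = Cod A g"
    "Dom A h = Dom A g" "Cod A h = Cod A g"
  shows "f \<oplus>\<^bsub>A\<^esub> g = f \<oplus>\<^bsub>A\<^esub> h \<longleftrightarrow> g = h"
  using Add_Neg_cancel(2)[of f g] Add_Neg_cancel(2)[of f h] assms by metis

lemma Neg_unique:
  assumes "f \<in> Ar A" "g \<in> Ar A" "Dom A f = Dom A g" "Cod A f = Cod A g"
    "f \<oplus>\<^bsub>A\<^esub> g = Zer A (Dom A f) (Cod A f)"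
  shows "g = \<ominus>\<^bsub>A\<^esub> f"
  using Add_left_cancel[of f g "\<ominus>\<^bsub>A\<^esub> f"] assms by simp

lemma Neg_Neg [simp]: "f \<in> Ar A \<Longrightarrow> \<ominus>\<^bsub>A\<^esub> \<ominus>\<^bsub>A\<^esub> f = f"
  using Neg_unique[of "\<ominus>\<^bsub>A\<^esub> f" f] by simp

lemma Neg_Zer [simp]: "x \<in> Ob A \<Longrightarrow> y \<in> Ob A \<Longrightarrow> \<ominus>\<^bsub>A\<^esub> Zer A x y = Zer A x y"
  using Neg_unique[of "Zer A x y" "Zer A x y"] by simp

lemma Neg_Add [simp]:
  "f \<in> Ar A \<Longrightarrow> g \<in> Ar A \<Longrightarrow> Dom A f = Dom A g \<Longrightarrow> Cod A f = Cod A g \<Longrightarrow>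
   \<ominus>\<^bsub>A\<^esub> (f \<oplus>\<^bsub>A\<^esub> g) = \<ominus>\<^bsub>A\<^esub> f \<oplus>\<^bsub>A\<^esub> \<ominus>\<^bsub>A\<^esub> g"
  using Neg_unique[of "f \<oplus>\<^bsub>A\<^esub> g" "\<ominus>\<^bsub>A\<^esub> f \<oplus>\<^bsub>A\<^esub> \<ominus>\<^bsub>A\<^esub> g"] Add_left_commute[of g "\<ominus>\<^bsub>A\<^esub> f" "\<ominus>\<^bsub>A\<^esub> g"] by simp

text \<open>Source of the zero laws for composition, which are not axioms: by distributivity a
  composite with a zero arrow is additively idempotent.\<close>

lemma Add_self_zero:
  "f \<in> Ar A \<Longrightarrow> f \<oplus>\<^bsub>A\<^esub> f = f \<Longrightarrow> f = Zer A (Dom A f) (Cod A f)"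
  using Add_left_cancel[of f f "Zer A (Dom A f) (Cod A f)"] by simp

lemma Cmp_Zer [simp]:
  assumes "f \<in> Ar A" "x \<in> Ob A" "Dom A f = y"
  shows "f \<cdot>\<^bsub>A\<^esub> Zer A x y = Zer A x (Cod A f)"
proof -
  have y: "y \<in> Ob A" using assms by auto
  show ?thesis
    using Add_self_zero[of "f \<cdot>\<^bsub>A\<^esub> Zer A x y"] Cmp_Add[of "Zer A x y" "Zer A x y" f] assms y by simp
qed

lemma Zer_Cmp [simp]:
  assumes "f \<in> Ar A" "y \<in> Ob A" "Cod A f = x"
  shows "Zer A x y \<cdot>\<^bsub>A\<^esub> f = Zer A (Dom A f) y"
proof -
  have x: "x \<in> Ob A" using assms by auto
  show ?thesis
    using Add_self_zero[of "Zer A x y \<cdot>\<^bsub>A\<^esub> f"] Add_Cmp[of f "Zer A x y" "Zer A x y"] assms x by simp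
qed

lemma Cmp_Neg [simp]:
  "f \<in> Ar A \<Longrightarrow> g \<in> Ar A \<Longrightarrow> Cod A f = Dom A g \<Longrightarrow> g \<cdot>\<^bsub>A\<^esub> \<ominus>\<^bsub>A\<^esub> f = \<ominus>\<^bsub>A\<^esub> (g \<cdot>\<^bsub>A\<^esub> f)"
  using Neg_unique[of "g \<cdot>\<^bsub>A\<^esub> f" "g \<cdot>\<^bsub>A\<^esub> \<ominus>\<^bsub>A\<^esub> f"] Cmp_Add[of f "\<ominus>\<^bsub>A\<^esub> f" g] by simp

lemma Neg_Cmp [simp]:
  "f \<in> Ar A \<Longrightarrow> g \<in> Ar A \<Longrightarrow> Cod A f = Dom A g \<Longrightarrow> \<ominus>\<^bsub>A\<^esub> g \<cdot>\<^bsub>A\<^esub> f = \<ominus>\<^bsub>A\<^esub> (g \<cdot>\<^bsub>A\<^esub> f)"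
  using Neg_unique[of "g \<cdot>\<^bsub>A\<^esub> f" "\<ominus>\<^bsub>A\<^esub> g \<cdot>\<^bsub>A\<^esub> f"] Add_Cmp[of f g "\<ominus>\<^bsub>A\<^esub> g"] by simp

lemma Neg_eq_iff: "f \<in> Ar A \<Longrightarrow> g \<in> Ar A \<Longrightarrow> \<ominus>\<^bsub>A\<^esub> f = \<ominus>\<^bsub>A\<^esub> g \<longleftrightarrow> f = g"
  by (metis Neg_Neg)

section \<open>Isomorphisms in a preadditive category\<close>

lemma is_isoE:
  assumes "is_iso A f"
  obtains g where "f \<in> Ar A" "g \<in> Ar A" "Dom A g = Cod A f" "Cod A g = Dom A f"
    "g \<cdot>\<^bsub>A\<^esub> f = Idt A (Dom A f)" "f \<cdot>\<^bsub>A\<^esub> g = Idt A (Cod A f)"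
  using assms unfolding is_iso_def inverse_arrows_def homset_iff by blast

lemma is_isoI:
  assumes "f \<in> Ar A" "g \<in> Ar A" "Dom A g = Cod A f" "Cod A g = Dom A f"
    "g \<cdot>\<^bsub>A\<^esub> f = Idt A (Dom A f)" "f \<cdot>\<^bsub>A\<^esub> g = Idt A (Cod A f)"
  shows "is_iso A f"
  using assms unfolding is_iso_def inverse_arrows_def homset_iff by blast

lemma is_iso_Ar [simp]: "is_iso A f \<Longrightarrow> f \<in> Ar A"
  by (auto simp: is_iso_def inverse_arrows_def)

text \<open>Composites are normalised to the right by \<open>Cmp_assoc'\<close>, so
  \<open>g f\<close> is not a subterm of \<open>g (f k)\<close>. This is the form in which an
  inverse cancels inside a longer composite.\<close>

lemma Cmp_inverse_cancel:
  assumes "f \<in> Ar A" "g \<in> Ar A" "Dom A g = Cod A f" "g \<cdot>\<^bsub>A\<^esub> f = Idt A (Dom A f)"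
    "k \<in> Ar A" "Cod A k = Dom A f"
  shows "g \<cdot>\<^bsub>A\<^esub> f \<cdot>\<^bsub>A\<^esub> k = k"
  using assms by (metis Cmp_Idt_left Cmp_assoc')

lemma paste_squares:
  assumes "f \<in> Ar A" "f' \<in> Ar A" "f'' \<in> Ar A" "a \<in> Ar A" "a' \<in> Ar A" "b \<in> Ar A" "b' \<in> Ar A"
    "Dom A f' = Cod A a" "Dom A f = Dom A a" "Dom A b = Cod A f" "Cod A b = Cod A f'"
    "Dom A a' = Dom A f'" "Dom A b' = Cod A f'" "Cod A a' = Dom A f''" "Cod A b' = Cod A f''"
    and 1: "b \<cdot>\<^bsub>A\<^esub> f = f' \<cdot>\<^bsub>A\<^esub> a" and 2: "b' \<cdot>\<^bsub>A\<^esub> f' = f'' \<cdot>\<^bsub>A\<^esub> a'"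
  shows "(b' \<cdot>\<^bsub>A\<^esub> b) \<cdot>\<^bsub>A\<^esub> f = f'' \<cdot>\<^bsub>A\<^esub> a' \<cdot>\<^bsub>A\<^esub> a"
proof -
  have "(b' \<cdot>\<^bsub>A\<^esub> b) \<cdot>\<^bsub>A\<^esub> f = b' \<cdot>\<^bsub>A\<^esub> (b \<cdot>\<^bsub>A\<^esub> f)" using assms(1-15) by simp
  also have "\<dots> = (b' \<cdot>\<^bsub>A\<^esub> f') \<cdot>\<^bsub>A\<^esub> a" unfolding 1 using assms(1-15) by simp
  also have "\<dots> = f'' \<cdot>\<^bsub>A\<^esub> a' \<cdot>\<^bsub>A\<^esub> a" unfolding 2 using assms(1-15) by simp
  finally show ?thesis .
qed

text \<open>Serves the case in which a left and a right inverse come from separate constructions, as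
  for maps of cones; associativity identifies the two.\<close>

lemma is_iso_left_right:
  assumes "f \<in> Ar A" "g \<in> Ar A" "Dom A g = Cod A f" "Cod A g = Dom A f"
    "h \<in> Ar A" "Dom A h = Cod A f" "Cod A h = Dom A f"
    "g \<cdot>\<^bsub>A\<^esub> f = Idt A (Dom A f)" "f \<cdot>\<^bsub>A\<^esub> h = Idt A (Cod A f)"
  shows "is_iso A f"
proof -
  have "g = g \<cdot>\<^bsub>A\<^esub> f \<cdot>\<^bsub>A\<^esub> h" using assms by simp
  also have "\<dots> = h" using assms Cmp_inverse_cancel by metis
  finally show ?thesis using assms is_isoI by metis
qed

lemma is_iso_Idt [simp]: "x \<in> Ob A \<Longrightarrow> is_iso A (Idt A x)"
  by (rule is_isoI[of _ "Idt A x"]) simp_all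

lemma is_iso_Neg: assumes "is_iso A f" shows "is_iso A (\<ominus>\<^bsub>A\<^esub> f)"
proof -
  obtain g where g: "f \<in> Ar A" "g \<in> Ar A" "Dom A g = Cod A f" "Cod A g = Dom A f"
    "g \<cdot>\<^bsub>A\<^esub> f = Idt A (Dom A f)" "f \<cdot>\<^bsub>A\<^esub> g = Idt A (Cod A f)"
    using is_isoE[OF assms] .
  show ?thesis by (rule is_isoI[of _ "\<ominus>\<^bsub>A\<^esub> g"]) (simp_all add: g)
qed

lemma is_iso_Cmp:
  assumes "is_iso A f" "is_iso A g" "Cod A f = Dom A g"
  shows "is_iso A (g \<cdot>\<^bsub>A\<^esub> f)"
proof -
  obtain f' where f': "f \<in> Ar A" "f' \<in> Ar A" "Dom A f' = Cod A f" "Cod A f' = Dom A f"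
    "f' \<cdot>\<^bsub>A\<^esub> f = Idt A (Dom A f)" "f \<cdot>\<^bsub>A\<^esub> f' = Idt A (Cod A f)"
    using is_isoE[OF assms(1)] .
  obtain g' where g': "g \<in> Ar A" "g' \<in> Ar A" "Dom A g' = Cod A g" "Cod A g' = Dom A g"
    "g' \<cdot>\<^bsub>A\<^esub> g = Idt A (Dom A g)" "g \<cdot>\<^bsub>A\<^esub> g' = Idt A (Cod A g)"
    using is_isoE[OF assms(2)] .
  show ?thesis
    by (rule is_isoI[of _ "f' \<cdot>\<^bsub>A\<^esub> g'"])
      (simp_all add: f' g' assms(3) Cmp_inverse_cancel[of g g' f] Cmp_inverse_cancel[of f' f g'])
qed

lemma is_iso_cancel_left:
  assumes "is_iso A (g \<cdot>\<^bsub>A\<^esub> f)" "is_iso A g" "f \<in> Ar A" "Cod A f = Dom A g"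
  shows "is_iso A f"
proof -
  obtain g' where g': "g \<in> Ar A" "g' \<in> Ar A" "Dom A g' = Cod A g" "Cod A g' = Dom A g"
    "g' \<cdot>\<^bsub>A\<^esub> g = Idt A (Dom A g)" "g \<cdot>\<^bsub>A\<^esub> g' = Idt A (Cod A g)"
    using is_isoE[OF assms(2)] .
  have "is_iso A (g' \<cdot>\<^bsub>A\<^esub> g \<cdot>\<^bsub>A\<^esub> f)"
    by (rule is_iso_Cmp[OF assms(1)]) (use g' assms in \<open>auto intro: is_isoI[of g' g]\<close>)
  then show ?thesis using Cmp_inverse_cancel[of g g' f] g' assms by simp
qed

end

section \<open>Additive functors\<close>

locale additive_functor_between =
  A: preadditive_category A + B: preadditive_category B
  for A :: "('o, 'm, 'y) acat_scheme" and B :: "('p, 'n, 'z) acat_scheme" +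
  fixes H :: "('o, 'm, 'p, 'n) fctr"
  assumes additive: "additive_functor A B H"
begin

lemma fo_Ob [simp]: "x \<in> Ob A \<Longrightarrow> fo H x \<in> Ob B"
  and fa_Idt [simp]: "x \<in> Ob A \<Longrightarrow> fa H (Idt A x) = Idt B (fo H x)"
  and fa_Ar [simp]: "f \<in> Ar A \<Longrightarrow> fa H f \<in> Ar B"
  and fa_Dom [simp]: "f \<in> Ar A \<Longrightarrow> Dom B (fa H f) = fo H (Dom A f)"
  and fa_Cod [simp]: "f \<in> Ar A \<Longrightarrow> Cod B (fa H f) = fo H (Cod A f)"
  and fa_Cmp [simp]: "f \<in> Ar A \<Longrightarrow> g \<in> Ar A \<Longrightarrow> Cod A f = Dom A g \<Longrightarrow>
        fa H (g \<cdot>\<^bsub>A\<^esub> f) = fa H g \<cdot>\<^bsub>B\<^esub> fa H f"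
  and fa_Add [simp]: "f \<in> Ar A \<Longrightarrow> g \<in> Ar A \<Longrightarrow> Dom A f = Dom A g \<Longrightarrow> Cod A f = Cod A g \<Longrightarrow>
        fa H (f \<oplus>\<^bsub>A\<^esub> g) = fa H f \<oplus>\<^bsub>B\<^esub> fa H g"
  using additive unfolding additive_functor_def homset_iff by blast+

text \<open>Preservation of zero is not part of \<open>additive_functor\<close>; it follows from
  \<open>0 + 0 = 0\<close>, and negatives are handled after it.\<close>

lemma fa_Zer [simp]:
  assumes "x \<in> Ob A" "y \<in> Ob A"
  shows "fa H (Zer A x y) = Zer B (fo H x) (fo H y)"
  using B.Add_self_zero[of "fa H (Zer A x y)"] fa_Add[of "Zer A x y" "Zer A x y"] assms by simp

lemma fa_Neg [simp]: "f \<in> Ar A \<Longrightarrow> fa H (\<ominus>\<^bsub>A\<^esub> f) = \<ominus>\<^bsub>B\<^esub> fa H f"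
  using B.Neg_unique[of "fa H f" "fa H (\<ominus>\<^bsub>A\<^esub> f)"] fa_Add[of f "\<ominus>\<^bsub>A\<^esub> f"] by simp

lemma fa_is_iso: assumes "is_iso A f" shows "is_iso B (fa H f)"
proof -
  obtain g where g: "f \<in> Ar A" "g \<in> Ar A" "Dom A g = Cod A f" "Cod A g = Dom A f"
    "g \<cdot>\<^bsub>A\<^esub> f = Idt A (Dom A f)" "f \<cdot>\<^bsub>A\<^esub> g = Idt A (Cod A f)"
    using A.is_isoE[OF assms] .
  show ?thesis
    by (rule B.is_isoI[of _ "fa H g"])
      (use g fa_Cmp[of f g] fa_Cmp[of g f] in auto)
qed

end

section \<open>The stable category\<close>

text \<open>Common ground of exact categories and of complexes with degreewise conflations. For
  complexes the kernel and cokernel properties can be checked degree by degree, and the calculus of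
  lifting and descending rests on these alone.\<close>

locale conflation_category = preadditive_category A
  for A :: "('o, 'm, 'z) excat_scheme" +
  assumes Confl_kernel: "(i, p) \<in> Confl A \<Longrightarrow> is_kernel A i p"
    and Confl_cokernel: "(i, p) \<in> Confl A \<Longrightarrow> is_cokernel A i p"
begin

lemma Confl_simps [simp]:
  assumes "(i, p) \<in> Confl A"
  shows "i \<in> Ar A" "p \<in> Ar A" "Dom A p = Cod A i" "p \<cdot>\<^bsub>A\<^esub> i = Zer A (Dom A i) (Cod A p)"
  using Confl_kernel[OF assms] by (simp_all add: is_kernel_def)

lemma Confl_lift:
  assumes "(i, p) \<in> Confl A" "f \<in> Ar A" "Cod A f = Cod A i" "Dom A f = x"
    "p \<cdot>\<^bsub>A\<^esub> f = Zer A x (Cod A p)"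
  obtains g where "g \<in> Ar A" "Dom A g = x" "Cod A g = Dom A i" "i \<cdot>\<^bsub>A\<^esub> g = f"
  using Confl_kernel[OF assms(1)] assms unfolding is_kernel_def homset_iff by metis

lemma Confl_descend:
  assumes "(i, p) \<in> Confl A" "f \<in> Ar A" "Dom A f = Cod A i" "Cod A f = y"
    "f \<cdot>\<^bsub>A\<^esub> i = Zer A (Dom A i) y"
  obtains g where "g \<in> Ar A" "Dom A g = Cod A p" "Cod A g = y" "g \<cdot>\<^bsub>A\<^esub> p = f"
  using Confl_cokernel[OF assms(1)] assms unfolding is_cokernel_def homset_iff by metis

lemma Confl_mono:
  assumes "(i, p) \<in> Confl A" "f \<in> Ar A" "g \<in> Ar A" "Dom A f = Dom A g"
    "Cod A f = Dom A i" "Cod A g = Dom A i" "i \<cdot>\<^bsub>A\<^esub> f = i \<cdot>\<^bsub>A\<^esub> g"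
  shows "f = g"
proof -
  have "p \<cdot>\<^bsub>A\<^esub> i \<cdot>\<^bsub>A\<^esub> g = (p \<cdot>\<^bsub>A\<^esub> i) \<cdot>\<^bsub>A\<^esub> g" using assms by (simp del: Confl_simps(4))
  then have "p \<cdot>\<^bsub>A\<^esub> i \<cdot>\<^bsub>A\<^esub> g = Zer A (Dom A g) (Cod A p)" using assms by simp
  moreover have "i \<cdot>\<^bsub>A\<^esub> g \<in> Ar A" "Cod A (i \<cdot>\<^bsub>A\<^esub> g) = Dom A p" "Dom A (i \<cdot>\<^bsub>A\<^esub> g) = Dom A g"
    using assms by simp_all
  ultimately show ?thesis
    using Confl_kernel[OF assms(1)] assms unfolding is_kernel_def homset_iff by metis
qed

lemma Confl_epi:
  assumes "(i, p) \<in> Confl A" "f \<in> Ar A" "g \<in> Ar A" "Cod A f = Cod A g"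
    "Dom A f = Cod A p" "Dom A g = Cod A p" "f \<cdot>\<^bsub>A\<^esub> p = g \<cdot>\<^bsub>A\<^esub> p"
  shows "f = g"
proof -
  have "(g \<cdot>\<^bsub>A\<^esub> p) \<cdot>\<^bsub>A\<^esub> i = Zer A (Dom A i) (Cod A g)" using assms by simp
  moreover have "g \<cdot>\<^bsub>A\<^esub> p \<in> Ar A" "Dom A (g \<cdot>\<^bsub>A\<^esub> p) = Cod A i" "Cod A (g \<cdot>\<^bsub>A\<^esub> p) = Cod A g"
    using assms by simp_all
  ultimately show ?thesis
    using Confl_cokernel[OF assms(1)] assms unfolding is_cokernel_def homset_iff by metis
qed

lemma projective_Ob [simp]: "projective A x \<Longrightarrow> x \<in> Ob A"
  by (simp add: projective_def)

lemma projective_lift: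
  assumes "projective A x" "(i, p) \<in> Confl A" "f \<in> Ar A" "Dom A f = x" "Cod A f = Cod A p"
  obtains g where "g \<in> Ar A" "Dom A g = x" "Cod A g = Cod A i" "p \<cdot>\<^bsub>A\<^esub> g = f"
proof -
  have "deflation A p" using assms(2) by (auto simp: deflation_def)
  then have "\<exists>g\<in>homset A x (Dom A p). p \<cdot>\<^bsub>A\<^esub> g = f"
    using assms unfolding projective_def homset_iff by blast
  then show ?thesis using that assms(2) by (auto simp: homset_iff)
qed

end

text \<open>Maps out of a projective lift along deflations by definition, maps into one extend along
  inflations by \<open>projective_injective\<close>, and \<open>enough\<close> embeds every object
  into a projective. Both a Frobenius category and its category of acyclic complexes are instances,
  so the stable calculus is developed once for both.\<close>

locale stable_base = conflation_category A
  for A :: "('o, 'm, 'z) excat_scheme" +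
  assumes projective_injective: "projective A x \<Longrightarrow> injective A x"
    and enough: "x \<in> Ob A \<Longrightarrow> \<exists>i. inflation A i \<and> Dom A i = x \<and> projective A (Cod A i)"
begin

abbreviation S where "S \<equiv> stable A"
abbreviation cl where "cl \<equiv> stable_class A"

lemma injective_extend:
  assumes "projective A x" "(i, p) \<in> Confl A" "f \<in> Ar A" "Cod A f = x" "Dom A f = Dom A i"
  obtains g where "g \<in> Ar A" "Cod A g = x" "Dom A g = Cod A i" "g \<cdot>\<^bsub>A\<^esub> i = f"
proof -
  have "inflation A i" using assms(2) by (auto simp: inflation_def)
  then have "\<exists>g\<in>homset A (Cod A i) x. g \<cdot>\<^bsub>A\<^esub> i = f"
    using projective_injective[OF assms(1)] assms unfolding injective_def homset_iff by blast
  then show ?thesis using that by (auto simp: homset_iff)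
qed

lemma enough_Confl:
  assumes "x \<in> Ob A"
  obtains i p where "(i, p) \<in> Confl A" "Dom A i = x" "projective A (Cod A i)"
  using enough[OF assms] unfolding inflation_def by blast

lemma nullI:
  assumes "projective A q" "g \<in> Ar A" "h \<in> Ar A" "Cod A g = q" "Dom A h = q"
  shows "stably_null A (h \<cdot>\<^bsub>A\<^esub> g)"
  unfolding stably_null_def homset_iff
  by (rule exI[of _ q], rule exI[of _ g], rule exI[of _ h]) (use assms in simp)

lemma nullE:
  assumes "stably_null A f"
  obtains q g h where "projective A q" "g \<in> Ar A" "h \<in> Ar A" "Cod A g = q" "Dom A h = q"
    "Dom A g = Dom A f" "Cod A h = Cod A f" "f = h \<cdot>\<^bsub>A\<^esub> g"
  using assms unfolding stably_null_def homset_iff by metis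

text \<open>The projective through which \<open>f\<close> factors is injective, so the first factor
  extends along \<open>i\<close>. That the extension is null again is part of the conclusion because
  it will be subtracted from arrows whose stable class must not change.\<close>

lemma null_extend:
  assumes "stably_null A f" "(i, p) \<in> Confl A" "Dom A i = Dom A f" "Cod A f = y"
  obtains h where "h \<in> Ar A" "Dom A h = Cod A i" "Cod A h = y" "f = h \<cdot>\<^bsub>A\<^esub> i"
    "stably_null A h"
proof -
  obtain q g h where *: "projective A q" "g \<in> Ar A" "h \<in> Ar A" "Cod A g = q" "Dom A h = q"
    "Dom A g = Dom A f" "Cod A h = Cod A f" "f = h \<cdot>\<^bsub>A\<^esub> g" using nullE[OF assms(1)] .
  obtain k where "k \<in> Ar A" "Cod A k = q" "Dom A k = Cod A i" "k \<cdot>\<^bsub>A\<^esub> i = g"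
    using injective_extend[OF *(1) assms(2) *(2)] * assms by metis
  then show ?thesis using * assms nullI[of q k h] by (intro that[of "h \<cdot>\<^bsub>A\<^esub> k"]) auto
qed

lemma null_lift:
  assumes "stably_null A f" "(i, p) \<in> Confl A" "Cod A p = Cod A f" "Dom A f = x"
  obtains h where "h \<in> Ar A" "Dom A h = x" "Cod A h = Cod A i" "f = p \<cdot>\<^bsub>A\<^esub> h"
    "stably_null A h"
proof -
  obtain q g h where *: "projective A q" "g \<in> Ar A" "h \<in> Ar A" "Cod A g = q" "Dom A h = q"
    "Dom A g = Dom A f" "Cod A h = Cod A f" "f = h \<cdot>\<^bsub>A\<^esub> g" using nullE[OF assms(1)] .
  obtain k where "k \<in> Ar A" "Dom A k = q" "Cod A k = Cod A i" "p \<cdot>\<^bsub>A\<^esub> k = h"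
    using projective_lift[OF *(1) assms(2) *(3)] * assms by metis
  then show ?thesis using * assms nullI[of q g k] by (intro that[of "k \<cdot>\<^bsub>A\<^esub> g"]) auto
qed

lemma null_Ar: "stably_null A f \<Longrightarrow> f \<in> Ar A"
  by (erule nullE) simp

lemma null_Cmp_left:
  assumes "stably_null A f" "g \<in> Ar A" "Dom A g = Cod A f"
  shows "stably_null A (g \<cdot>\<^bsub>A\<^esub> f)"
proof -
  obtain q a b where *: "projective A q" "a \<in> Ar A" "b \<in> Ar A" "Cod A a = q" "Dom A b = q"
    "Dom A a = Dom A f" "Cod A b = Cod A f" "f = b \<cdot>\<^bsub>A\<^esub> a" using nullE[OF assms(1)] .
  then show ?thesis using nullI[of q a "g \<cdot>\<^bsub>A\<^esub> b"] assms by simp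
qed

lemma null_Cmp_right:
  assumes "stably_null A f" "g \<in> Ar A" "Cod A g = Dom A f"
  shows "stably_null A (f \<cdot>\<^bsub>A\<^esub> g)"
proof -
  obtain q a b where *: "projective A q" "a \<in> Ar A" "b \<in> Ar A" "Cod A a = q" "Dom A b = q"
    "Dom A a = Dom A f" "Cod A b = Cod A f" "f = b \<cdot>\<^bsub>A\<^esub> a" using nullE[OF assms(1)] .
  then show ?thesis using nullI[of q "a \<cdot>\<^bsub>A\<^esub> g" b] assms by simp
qed

text \<open>Biproducts are not part of this locale, so the two factorizations cannot be joined
  through a direct sum of projectives. Instead both summands are extended along one inflation
  \<open>i\<close> into a projective, which becomes the common middle object.\<close>

lemma null_Add:
  assumes "stably_null A f" "stably_null A g" "Dom A f = Dom A g" "Cod A f = Cod A g"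
  shows "stably_null A (f \<oplus>\<^bsub>A\<^esub> g)"
proof -
  have "Dom A g \<in> Ob A" using assms(2) null_Ar by simp
  from enough_Confl[OF this]
  obtain i p where ip: "(i, p) \<in> Confl A" "Dom A i = Dom A g" "projective A (Cod A i)" .
  have ip': "Dom A i = Dom A f" using ip assms by simp
  obtain h where h: "h \<in> Ar A" "Dom A h = Cod A i" "Cod A h = Cod A f" "f = h \<cdot>\<^bsub>A\<^esub> i"
    "stably_null A h" using null_extend[OF assms(1) ip(1) ip' refl] .
  obtain k where k: "k \<in> Ar A" "Dom A k = Cod A i" "Cod A k = Cod A g" "g = k \<cdot>\<^bsub>A\<^esub> i"
    "stably_null A k" using null_extend[OF assms(2) ip(1,2) refl] .
  have "(h \<oplus>\<^bsub>A\<^esub> k) \<cdot>\<^bsub>A\<^esub> i = h \<cdot>\<^bsub>A\<^esub> i \<oplus>\<^bsub>A\<^esub> k \<cdot>\<^bsub>A\<^esub> i"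
    using h(1-3) k(1-3) ip(1) assms(4) by simp
  then have "f \<oplus>\<^bsub>A\<^esub> g = (h \<oplus>\<^bsub>A\<^esub> k) \<cdot>\<^bsub>A\<^esub> i" by (simp only: h(4)[symmetric] k(4)[symmetric])
  moreover have "stably_null A ((h \<oplus>\<^bsub>A\<^esub> k) \<cdot>\<^bsub>A\<^esub> i)"
    by (rule nullI[OF ip(3)]) (use h(1-3) k(1-3) ip assms in simp_all)
  ultimately show ?thesis by simp
qed

lemma null_Zer:
  assumes "x \<in> Ob A" "y \<in> Ob A"
  shows "stably_null A (Zer A x y)"
proof -
  obtain i p where ip: "(i, p) \<in> Confl A" "Dom A i = x" "projective A (Cod A i)"
    using enough_Confl[OF assms(1)] .
  show ?thesis using nullI[OF ip(3), of i "Zer A (Cod A i) y"] ip assms by simp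
qed

lemma null_Neg: "stably_null A f \<Longrightarrow> stably_null A (\<ominus>\<^bsub>A\<^esub> f)"
  using null_Cmp_left[of f "\<ominus>\<^bsub>A\<^esub> Idt A (Cod A f)"] null_Ar[of f] by simp

text \<open>Stable equality of genuine arrows, with the endpoint conditions built in; for an arrow
  \<open>f\<close> the class \<open>cl f\<close> is exactly the set of arrows related to
  \<open>f\<close>.\<close>

definition eqv where
  "eqv f g \<longleftrightarrow> f \<in> Ar A \<and> g \<in> Ar A \<and> Dom A f = Dom A g \<and> Cod A f = Cod A g \<and>
     stably_null A (f \<oplus>\<^bsub>A\<^esub> \<ominus>\<^bsub>A\<^esub> g)"

lemma eqv_refl: "f \<in> Ar A \<Longrightarrow> eqv f f"
  by (simp add: eqv_def null_Zer)

lemma eqv_sym: assumes "eqv f g" shows "eqv g f"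
proof -
  have "\<ominus>\<^bsub>A\<^esub> (f \<oplus>\<^bsub>A\<^esub> \<ominus>\<^bsub>A\<^esub> g) = g \<oplus>\<^bsub>A\<^esub> \<ominus>\<^bsub>A\<^esub> f" using assms by (simp add: eqv_def Add_commute)
  then show ?thesis using assms null_Neg[of "f \<oplus>\<^bsub>A\<^esub> \<ominus>\<^bsub>A\<^esub> g"] unfolding eqv_def by simp
qed

lemma eqv_trans: assumes "eqv f g" "eqv g h" shows "eqv f h"
proof -
  have "(f \<oplus>\<^bsub>A\<^esub> \<ominus>\<^bsub>A\<^esub> g) \<oplus>\<^bsub>A\<^esub> (g \<oplus>\<^bsub>A\<^esub> \<ominus>\<^bsub>A\<^esub> h) = f \<oplus>\<^bsub>A\<^esub> \<ominus>\<^bsub>A\<^esub> h"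
    using assms by (simp add: eqv_def)
  then show ?thesis
    using assms null_Add[of "f \<oplus>\<^bsub>A\<^esub> \<ominus>\<^bsub>A\<^esub> g" "g \<oplus>\<^bsub>A\<^esub> \<ominus>\<^bsub>A\<^esub> h"] unfolding eqv_def by simp
qed

lemma eqv_Add:
  assumes "eqv f f'" "eqv g g'" "Dom A f = Dom A g" "Cod A f = Cod A g"
  shows "eqv (f \<oplus>\<^bsub>A\<^esub> g) (f' \<oplus>\<^bsub>A\<^esub> g')"
proof -
  have "(f \<oplus>\<^bsub>A\<^esub> g) \<oplus>\<^bsub>A\<^esub> \<ominus>\<^bsub>A\<^esub> (f' \<oplus>\<^bsub>A\<^esub> g') = (f \<oplus>\<^bsub>A\<^esub> \<ominus>\<^bsub>A\<^esub> f') \<oplus>\<^bsub>A\<^esub> (g \<oplus>\<^bsub>A\<^esub> \<ominus>\<^bsub>A\<^esub> g')"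
    using assms Add_left_commute[of g "\<ominus>\<^bsub>A\<^esub> f'" "\<ominus>\<^bsub>A\<^esub> g'"] by (simp add: eqv_def)
  then show ?thesis
    using assms null_Add[of "f \<oplus>\<^bsub>A\<^esub> \<ominus>\<^bsub>A\<^esub> f'" "g \<oplus>\<^bsub>A\<^esub> \<ominus>\<^bsub>A\<^esub> g'"] unfolding eqv_def by simp
qed

lemma eqv_Cmp:
  assumes "eqv f f'" "eqv g g'" "Cod A f = Dom A g"
  shows "eqv (g \<cdot>\<^bsub>A\<^esub> f) (g' \<cdot>\<^bsub>A\<^esub> f')"
proof (rule eqv_trans)
  have "stably_null A (g \<cdot>\<^bsub>A\<^esub> (f \<oplus>\<^bsub>A\<^esub> \<ominus>\<^bsub>A\<^esub> f'))"
    by (rule null_Cmp_left) (use assms in \<open>simp_all add: eqv_def\<close>)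
  then show "eqv (g \<cdot>\<^bsub>A\<^esub> f) (g \<cdot>\<^bsub>A\<^esub> f')" using assms by (simp add: eqv_def)
  have "stably_null A ((g \<oplus>\<^bsub>A\<^esub> \<ominus>\<^bsub>A\<^esub> g') \<cdot>\<^bsub>A\<^esub> f')"
    by (rule null_Cmp_right) (use assms in \<open>simp_all add: eqv_def\<close>)
  then show "eqv (g \<cdot>\<^bsub>A\<^esub> f') (g' \<cdot>\<^bsub>A\<^esub> f')" using assms by (simp add: eqv_def)
qed

lemma cl_eq: "f \<in> Ar A \<Longrightarrow> cl f = {g. eqv g f}"
  by (auto simp: stable_class_def eqv_def homset_iff)

lemma cl_eq_iff:
  assumes "f \<in> Ar A" "g \<in> Ar A"
  shows "cl f = cl g \<longleftrightarrow> eqv f g"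
proof
  assume "cl f = cl g"
  then show "eqv f g" using assms eqv_refl[of f] by (auto simp: cl_eq)
next
  assume "eqv f g"
  then have "eqv h f \<longleftrightarrow> eqv h g" for h using eqv_trans eqv_sym by blast
  then show "cl f = cl g" using assms by (simp add: cl_eq)
qed

text \<open>Ties the representatives chosen in the definition of \<open>stable\<close> to arbitrary
  ones. Together with the congruence laws of \<open>eqv\<close> it lets all stable operations be
  computed on \<open>cl f\<close>.\<close>

lemma rep_cl: assumes "f \<in> Ar A" shows "eqv (rep (cl f)) f"
  using someI[of "\<lambda>g. g \<in> cl f" f] eqv_refl[OF assms] by (simp add: rep_def cl_eq[OF assms])

lemma S_simps:
  "Ob S = Ob A" "Ar S = cl ` Ar A" "Dom S c = Dom A (rep c)" "Cod S c = Cod A (rep c)"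
  "Idt S x = cl (Idt A x)" "Cmp S c d = cl (rep c \<cdot>\<^bsub>A\<^esub> rep d)"
  "Add S c d = cl (rep c \<oplus>\<^bsub>A\<^esub> rep d)" "Zer S x y = cl (Zer A x y)"
  by (simp_all add: stable_def)

lemma Ob_S [simp]: "Ob S = Ob A"
  by (simp add: S_simps)

lemma cl_simps [simp]:
  assumes "f \<in> Ar A"
  shows "cl f \<in> Ar S" "Dom S (cl f) = Dom A f" "Cod S (cl f) = Cod A f"
  using rep_cl[OF assms] assms by (auto simp: S_simps eqv_def)

lemma cl_Cmp:
  assumes "f \<in> Ar A" "g \<in> Ar A" "Cod A f = Dom A g"
  shows "cl g \<cdot>\<^bsub>S\<^esub> cl f = cl (g \<cdot>\<^bsub>A\<^esub> f)"
proof -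
  have "eqv (rep (cl g) \<cdot>\<^bsub>A\<^esub> rep (cl f)) (g \<cdot>\<^bsub>A\<^esub> f)"
    by (rule eqv_Cmp[OF rep_cl rep_cl]) (use rep_cl[of f] rep_cl[of g] assms in \<open>auto simp: eqv_def\<close>)
  then show ?thesis by (subst S_simps, subst cl_eq_iff) (auto simp: eqv_def)
qed

lemma cl_Add:
  assumes "f \<in> Ar A" "g \<in> Ar A" "Dom A f = Dom A g" "Cod A f = Cod A g"
  shows "cl f \<oplus>\<^bsub>S\<^esub> cl g = cl (f \<oplus>\<^bsub>A\<^esub> g)"
proof -
  have "eqv (rep (cl f) \<oplus>\<^bsub>A\<^esub> rep (cl g)) (f \<oplus>\<^bsub>A\<^esub> g)"
    by (rule eqv_Add[OF rep_cl rep_cl]) (use rep_cl[of f] rep_cl[of g] assms in \<open>auto simp: eqv_def\<close>)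
  then show ?thesis by (subst S_simps, subst cl_eq_iff) (auto simp: eqv_def)
qed

lemma cl_Idt: "Idt S x = cl (Idt A x)" and cl_Zer: "Zer S x y = cl (Zer A x y)"
  by (simp_all add: S_simps)

lemma S_Ar_E:
  assumes "c \<in> Ar S"
  obtains f where "f \<in> Ar A" "c = cl f"
  using assms by (auto simp: S_simps)

lemma stable_preadditive: "preadditive_category S"
proof (rule preadditive_category.intro)
  fix f assume "f \<in> Ar S"
  then show "Dom S f \<in> Ob S" "Cod S f \<in> Ob S" by (auto elim!: S_Ar_E)
next
  fix x assume "x \<in> Ob S"
  then show "Idt S x \<in> homset S x x" by (simp add: homset_iff cl_Idt)
next
  fix f g x y z assume "f \<in> homset S x y" "g \<in> homset S y z"
  then show "g \<cdot>\<^bsub>S\<^esub> f \<in> homset S x z" by (auto elim!: S_Ar_E simp: homset_iff cl_Cmp)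
next
  fix f x y assume "f \<in> homset S x y"
  then show "Idt S y \<cdot>\<^bsub>S\<^esub> f = f" "f \<cdot>\<^bsub>S\<^esub> Idt S x = f"
    by (auto elim!: S_Ar_E simp: homset_iff cl_Cmp cl_Idt)
next
  fix f g h w x y z assume "f \<in> homset S w x" "g \<in> homset S x y" "h \<in> homset S y z"
  then show "h \<cdot>\<^bsub>S\<^esub> g \<cdot>\<^bsub>S\<^esub> f = (h \<cdot>\<^bsub>S\<^esub> g) \<cdot>\<^bsub>S\<^esub> f"
    by (auto elim!: S_Ar_E simp: homset_iff cl_Cmp)
next
  fix x y assume xy: "x \<in> Ob S" "y \<in> Ob S"
  show "comm_group (hom_group S x y)"
  proof (rule comm_groupI; (unfold hom_group_simps)?)
    fix f g h assume f: "f \<in> homset S x y"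
    show "Zer S x y \<oplus>\<^bsub>S\<^esub> f = f"
      using f xy by (auto elim!: S_Ar_E simp: homset_iff cl_Add cl_Zer)
    show "\<exists>g\<in>homset S x y. g \<oplus>\<^bsub>S\<^esub> f = Zer S x y"
    proof -
      from f obtain g where g: "g \<in> Ar A" "f = cl g" "Dom A g = x" "Cod A g = y"
        by (auto elim!: S_Ar_E simp: homset_iff)
      then show ?thesis
        by (intro bexI[of _ "cl (\<ominus>\<^bsub>A\<^esub> g)"]) (auto simp: homset_iff cl_Add cl_Zer)
    qed
    assume g: "g \<in> homset S x y"
    show "f \<oplus>\<^bsub>S\<^esub> g \<in> homset S x y" "f \<oplus>\<^bsub>S\<^esub> g = g \<oplus>\<^bsub>S\<^esub> f"
      using f g by (auto elim!: S_Ar_E simp: homset_iff cl_Add Add_commute)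
    assume h: "h \<in> homset S x y"
    show "(f \<oplus>\<^bsub>S\<^esub> g) \<oplus>\<^bsub>S\<^esub> h = f \<oplus>\<^bsub>S\<^esub> g \<oplus>\<^bsub>S\<^esub> h"
      using f g h by (auto elim!: S_Ar_E simp: homset_iff cl_Add)
  next
    show "Zer S x y \<in> homset S x y" using xy by (auto simp: homset_iff cl_Zer)
  qed
next
  fix f f' g x y z assume "f \<in> homset S x y" "f' \<in> homset S x y" "g \<in> homset S y z"
  then show "g \<cdot>\<^bsub>S\<^esub> (f \<oplus>\<^bsub>S\<^esub> f') = g \<cdot>\<^bsub>S\<^esub> f \<oplus>\<^bsub>S\<^esub> g \<cdot>\<^bsub>S\<^esub> f'"
    by (auto elim!: S_Ar_E simp: homset_iff cl_Add cl_Cmp)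
next
  fix f g g' x y z assume "f \<in> homset S x y" "g \<in> homset S y z" "g' \<in> homset S y z"
  then show "(g \<oplus>\<^bsub>S\<^esub> g') \<cdot>\<^bsub>S\<^esub> f = g \<cdot>\<^bsub>S\<^esub> f \<oplus>\<^bsub>S\<^esub> g' \<cdot>\<^bsub>S\<^esub> f"
    by (auto elim!: S_Ar_E simp: homset_iff cl_Add cl_Cmp)
qed

end

sublocale stable_base \<subseteq> S: preadditive_category "stable A"
  by (rule stable_preadditive)

context stable_base
begin

lemma S_Ob [simp]: "f \<in> Ar S \<Longrightarrow> Dom S f \<in> Ob A" "f \<in> Ar S \<Longrightarrow> Cod S f \<in> Ob A"
  using S.Dom_Ob S.Cod_Ob by simp_all

lemma cl_Neg: "f \<in> Ar A \<Longrightarrow> \<ominus>\<^bsub>S\<^esub> cl f = cl (\<ominus>\<^bsub>A\<^esub> f)"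
  using S.Neg_unique[of "cl f" "cl (\<ominus>\<^bsub>A\<^esub> f)"] by (simp add: cl_Add cl_Zer)

lemma cl_zero_iff:
  assumes "f \<in> Ar A" "Dom A f = x" "Cod A f = y"
  shows "cl f = Zer S x y \<longleftrightarrow> stably_null A f"
proof -
  have "x \<in> Ob A" "y \<in> Ob A" using assms by auto
  then show ?thesis using assms by (simp add: cl_Zer cl_eq_iff eqv_def)
qed

text \<open>If the identity of \<open>x\<close> is null, every arrow out of \<open>x\<close> is null
  and hence lifts along any deflation by \<open>null_lift\<close>. Projectivity thereby becomes a
  vanishing statement in the stable category.\<close>

lemma projective_iff_null_Idt: "projective A x \<longleftrightarrow> x \<in> Ob A \<and> stably_null A (Idt A x)"
proof
  assume "projective A x"
  then show "x \<in> Ob A \<and> stably_null A (Idt A x)" using nullI[of x "Idt A x" "Idt A x"] by simp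
next
  assume x: "x \<in> Ob A \<and> stably_null A (Idt A x)"
  show "projective A x"
    unfolding projective_def
  proof (intro conjI allI impI)
    show "x \<in> Ob A" using x by simp
    fix p f assume pf: "deflation A p \<and> f \<in> homset A x (Cod A p)"
    then obtain i where i: "(i, p) \<in> Confl A" by (auto simp: deflation_def)
    have "stably_null A f"
      using null_Cmp_left[of "Idt A x" f] x pf by (simp add: homset_iff)
    then obtain h where "h \<in> Ar A" "Dom A h = Dom A f" "Cod A h = Cod A i" "f = p \<cdot>\<^bsub>A\<^esub> h"
      using null_lift[OF _ i, of f] pf by (auto simp: homset_iff)
    then show "\<exists>g\<in>homset A x (Dom A p). p \<cdot>\<^bsub>A\<^esub> g = f"
      using pf i by (auto simp: homset_iff)
  qed
qed

subsection \<open>Stably exact pairs\<close>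

text \<open>Two consecutive maps of a triangle up to stable isomorphism, with the connecting map
  forgotten. As no shift occurs, exact functors that preserve projectives preserve such pairs
  without any comparison of shifts.\<close>

definition stably_exact where
  "stably_exact f g \<longleftrightarrow> f \<in> Ar S \<and> g \<in> Ar S \<and> Cod S f = Dom S g \<and>
     (\<exists>i p a b c. (i, p) \<in> Confl A \<and> is_iso S a \<and> is_iso S b \<and> is_iso S c \<and>
        Dom S a = Dom S f \<and> Cod S a = Dom A i \<and> Dom S b = Dom S g \<and> Cod S b = Cod A i \<and>
        Dom S c = Cod S g \<and> Cod S c = Cod A p \<and>
        b \<cdot>\<^bsub>S\<^esub> f = cl i \<cdot>\<^bsub>S\<^esub> a \<and> c \<cdot>\<^bsub>S\<^esub> g = cl p \<cdot>\<^bsub>S\<^esub> b)"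

lemma stably_exact_simps [simp]:
  "stably_exact f g \<Longrightarrow> f \<in> Ar S" "stably_exact f g \<Longrightarrow> g \<in> Ar S"
  "stably_exact f g \<Longrightarrow> Cod S f = Dom S g"
  by (simp_all add: stably_exact_def)

lemma stably_exact_Confl:
  assumes "(i, p) \<in> Confl A" shows "stably_exact (cl i) (cl p)"
  unfolding stably_exact_def
  by (intro conjI exI[of _ i] exI[of _ p] exI[of _ "Idt S (Dom A i)"] exI[of _ "Idt S (Cod A i)"]
      exI[of _ "Idt S (Cod A p)"]) (use assms in auto)

lemma stably_exact_iso:
  assumes "stably_exact f g" "is_iso S a" "is_iso S b" "is_iso S c"
    "f' \<in> Ar S" "g' \<in> Ar S" "Cod S f' = Dom S g'"
    "Dom S a = Dom S f'" "Cod S a = Dom S f" "Dom S b = Dom S g'" "Cod S b = Dom S g"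
    "Dom S c = Cod S g'" "Cod S c = Cod S g"
    "b \<cdot>\<^bsub>S\<^esub> f' = f \<cdot>\<^bsub>S\<^esub> a" "c \<cdot>\<^bsub>S\<^esub> g' = g \<cdot>\<^bsub>S\<^esub> b"
  shows "stably_exact f' g'"
proof -
  obtain i p a' b' c' where *: "f \<in> Ar S" "g \<in> Ar S" "Cod S f = Dom S g"
     "(i, p) \<in> Confl A" "is_iso S a'" "is_iso S b'" "is_iso S c'"
     "Dom S a' = Dom S f" "Cod S a' = Dom A i" "Dom S b' = Dom S g" "Cod S b' = Cod A i"
     "Dom S c' = Cod S g" "Cod S c' = Cod A p"
     "b' \<cdot>\<^bsub>S\<^esub> f = cl i \<cdot>\<^bsub>S\<^esub> a'" "c' \<cdot>\<^bsub>S\<^esub> g = cl p \<cdot>\<^bsub>S\<^esub> b'"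
    using assms(1) unfolding stably_exact_def by blast
  have ar: "a \<in> Ar S" "b \<in> Ar S" "c \<in> Ar S" "a' \<in> Ar S" "b' \<in> Ar S" "c' \<in> Ar S"
    using assms * by auto
  have ip: "cl i \<in> Ar S" "cl p \<in> Ar S" "Dom S (cl i) = Dom A i" "Cod S (cl i) = Cod A i"
    "Dom S (cl p) = Cod A i" "Cod S (cl p) = Cod A p" using *(4) by simp_all
  have 1: "(b' \<cdot>\<^bsub>S\<^esub> b) \<cdot>\<^bsub>S\<^esub> f' = cl i \<cdot>\<^bsub>S\<^esub> a' \<cdot>\<^bsub>S\<^esub> a"
    by (rule S.paste_squares[OF _ _ _ _ _ _ _ _ _ _ _ _ _ _ _ assms(14) *(14)])
      (simp_all add: ar ip * assms(5-13))
  have 2: "(c' \<cdot>\<^bsub>S\<^esub> c) \<cdot>\<^bsub>S\<^esub> g' = cl p \<cdot>\<^bsub>S\<^esub> b' \<cdot>\<^bsub>S\<^esub> b"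
    by (rule S.paste_squares[OF _ _ _ _ _ _ _ _ _ _ _ _ _ _ _ assms(15) *(15)])
      (simp_all add: ar ip * assms(5-13))
  have 3: "is_iso S (a' \<cdot>\<^bsub>S\<^esub> a)" "is_iso S (b' \<cdot>\<^bsub>S\<^esub> b)" "is_iso S (c' \<cdot>\<^bsub>S\<^esub> c)"
    by (rule S.is_iso_Cmp; simp add: * assms(2-13))+
  show ?thesis
    unfolding stably_exact_def
    by (intro conjI exI[of _ i] exI[of _ p] exI[of _ "a' \<cdot>\<^bsub>S\<^esub> a"] exI[of _ "b' \<cdot>\<^bsub>S\<^esub> b"]
        exI[of _ "c' \<cdot>\<^bsub>S\<^esub> c"] 1 2 3) (simp_all add: ar *(1-13) assms(5-13))
qed

end

section \<open>Weak kernels, weak cokernels and splittings of conflations in the stable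
  category\<close>

context stable_base
begin

text \<open>A representative \<open>k0\<close> of \<open>k\<close> kills \<open>i\<close> only up to
  a null map. That null map extends along \<open>i\<close> to a null \<open>h\<close>; then
  \<open>k0 - h\<close> kills \<open>i\<close> exactly, descends along \<open>p\<close>, and still
  represents \<open>k\<close>.\<close>

lemma Confl_weak_cokernel:
  assumes "(i, p) \<in> Confl A" "k \<in> Ar S" "Dom S k = Cod A i" "Cod S k = w"
    "k \<cdot>\<^bsub>S\<^esub> cl i = Zer S (Dom A i) w"
  obtains m where "m \<in> Ar S" "Dom S m = Cod A p" "Cod S m = w" "k = m \<cdot>\<^bsub>S\<^esub> cl p"
proof -
  obtain k0 where k0: "k0 \<in> Ar A" "k = cl k0" using S_Ar_E[OF assms(2)] .
  have w: "Dom A k0 = Cod A i" "Cod A k0 = w" using k0 assms by simp_all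
  have "stably_null A (k0 \<cdot>\<^bsub>A\<^esub> i)"
    using cl_zero_iff[of "k0 \<cdot>\<^bsub>A\<^esub> i" "Dom A i" w] assms(1,5) k0 w by (simp add: cl_Cmp)
  moreover have "Dom A i = Dom A (k0 \<cdot>\<^bsub>A\<^esub> i)" "Cod A (k0 \<cdot>\<^bsub>A\<^esub> i) = w"
    using assms(1) k0 w by simp_all
  ultimately obtain h where h: "h \<in> Ar A" "Dom A h = Cod A i" and hw: "Cod A h = w"
    and h': "k0 \<cdot>\<^bsub>A\<^esub> i = h \<cdot>\<^bsub>A\<^esub> i" "stably_null A h"
    using null_extend[OF _ assms(1), of "k0 \<cdot>\<^bsub>A\<^esub> i"] by blast
  have "(k0 \<oplus>\<^bsub>A\<^esub> \<ominus>\<^bsub>A\<^esub> h) \<cdot>\<^bsub>A\<^esub> i = k0 \<cdot>\<^bsub>A\<^esub> i \<oplus>\<^bsub>A\<^esub> \<ominus>\<^bsub>A\<^esub> (h \<cdot>\<^bsub>A\<^esub> i)"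
    using h hw k0 w assms(1) by simp
  also have "\<dots> = Zer A (Dom A i) w"
    unfolding h'(1) using h hw assms(1) by simp
  finally obtain m where m: "m \<in> Ar A" "Dom A m = Cod A p" "Cod A m = w"
    "m \<cdot>\<^bsub>A\<^esub> p = k0 \<oplus>\<^bsub>A\<^esub> \<ominus>\<^bsub>A\<^esub> h"
    by (rule Confl_descend[OF assms(1), rotated 3]) (simp_all add: h hw k0 w)
  have "k0 \<oplus>\<^bsub>A\<^esub> \<ominus>\<^bsub>A\<^esub> (m \<cdot>\<^bsub>A\<^esub> p) = h"
    unfolding m(4) using h hw k0 w by simp
  then have "k = cl m \<cdot>\<^bsub>S\<^esub> cl p"
    using m(1-3) k0 w assms(1) h'(2) by (simp add: cl_Cmp cl_eq_iff eqv_def)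
  then show thesis using that[of "cl m"] m by simp
qed

text \<open>Dual correction: the null composite \<open>p k0\<close> lifts along \<open>p\<close> to
  a null \<open>h\<close>, and \<open>k0 - h\<close> factors through \<open>i\<close>.\<close>

lemma Confl_weak_kernel:
  assumes "(i, p) \<in> Confl A" "k \<in> Ar S" "Cod S k = Cod A i" "Dom S k = w"
    "cl p \<cdot>\<^bsub>S\<^esub> k = Zer S w (Cod A p)"
  obtains m where "m \<in> Ar S" "Cod S m = Dom A i" "Dom S m = w" "k = cl i \<cdot>\<^bsub>S\<^esub> m"
proof -
  obtain k0 where k0: "k0 \<in> Ar A" "k = cl k0" using S_Ar_E[OF assms(2)] .
  have w: "Cod A k0 = Cod A i" "Dom A k0 = w" using k0 assms by simp_all
  have "stably_null A (p \<cdot>\<^bsub>A\<^esub> k0)"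
    using cl_zero_iff[of "p \<cdot>\<^bsub>A\<^esub> k0" w "Cod A p"] assms(1,5) k0 w by (simp add: cl_Cmp)
  moreover have "Cod A p = Cod A (p \<cdot>\<^bsub>A\<^esub> k0)" "Dom A (p \<cdot>\<^bsub>A\<^esub> k0) = w"
    using assms(1) k0 w by simp_all
  ultimately obtain h where h: "h \<in> Ar A" "Cod A h = Cod A i" and hw: "Dom A h = w"
    and h': "p \<cdot>\<^bsub>A\<^esub> k0 = p \<cdot>\<^bsub>A\<^esub> h" "stably_null A h"
    using null_lift[OF _ assms(1), of "p \<cdot>\<^bsub>A\<^esub> k0"] by blast
  have "p \<cdot>\<^bsub>A\<^esub> (k0 \<oplus>\<^bsub>A\<^esub> \<ominus>\<^bsub>A\<^esub> h) = p \<cdot>\<^bsub>A\<^esub> k0 \<oplus>\<^bsub>A\<^esub> \<ominus>\<^bsub>A\<^esub> (p \<cdot>\<^bsub>A\<^esub> h)"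
    using h hw k0 w assms(1) by simp
  also have "\<dots> = Zer A w (Cod A p)"
    unfolding h'(1) using h hw assms(1) by simp
  finally obtain m where m: "m \<in> Ar A" "Dom A m = w" "Cod A m = Dom A i"
    "i \<cdot>\<^bsub>A\<^esub> m = k0 \<oplus>\<^bsub>A\<^esub> \<ominus>\<^bsub>A\<^esub> h"
    by (rule Confl_lift[OF assms(1), rotated 3]) (simp_all add: h hw k0 w)
  have "k0 \<oplus>\<^bsub>A\<^esub> \<ominus>\<^bsub>A\<^esub> (i \<cdot>\<^bsub>A\<^esub> m) = h"
    unfolding m(4) using h hw k0 w by simp
  then have "k = cl i \<cdot>\<^bsub>S\<^esub> cl m"
    using m(1-3) k0 w assms(1) h'(2) by (simp add: cl_Cmp cl_eq_iff eqv_def)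
  then show thesis using that[of "cl m"] m by simp
qed

text \<open>A stable retraction is corrected by a null map to a strict one, so the conflation splits
  already in \<open>A\<close>. The section \<open>t\<close> is tied by its last equation to the
  prescribed \<open>r\<close>, so that a retraction known from elsewhere, such as a counit, can be
  used later.\<close>

lemma Confl_split_mono:
  assumes ip: "(i, p) \<in> Confl A" and r: "r \<in> Ar S" "Dom S r = Cod A i" "Cod S r = Dom A i"
    "r \<cdot>\<^bsub>S\<^esub> cl i = Idt S (Dom A i)"
  obtains t where "t \<in> Ar S" "Dom S t = Cod A p" "Cod S t = Cod A i"
    "cl p \<cdot>\<^bsub>S\<^esub> t = Idt S (Cod A p)" "t \<cdot>\<^bsub>S\<^esub> cl p = Idt S (Cod A i) \<oplus>\<^bsub>S\<^esub> \<ominus>\<^bsub>S\<^esub> (cl i \<cdot>\<^bsub>S\<^esub> r)"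
proof -
  obtain r0 where r0: "r0 \<in> Ar A" "r = cl r0" using S_Ar_E[OF r(1)] .
  have d: "Dom A r0 = Cod A i" "Cod A r0 = Dom A i" using r0 r by simp_all
  let ?n = "Idt A (Dom A i) \<oplus>\<^bsub>A\<^esub> \<ominus>\<^bsub>A\<^esub> (r0 \<cdot>\<^bsub>A\<^esub> i)"
  have "cl (Idt A (Dom A i)) = cl (r0 \<cdot>\<^bsub>A\<^esub> i)" using r(4) ip r0 d by (simp add: cl_Cmp cl_Idt)
  then have n: "stably_null A ?n" using ip r0 d by (simp add: cl_eq_iff eqv_def)
  have "Dom A i = Dom A ?n" "Cod A ?n = Dom A i" using ip r0 d by simp_all
  from null_extend[OF n ip this]
  obtain h where h: "h \<in> Ar A" "Dom A h = Cod A i" "Cod A h = Dom A i"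
    "Idt A (Dom A i) \<oplus>\<^bsub>A\<^esub> \<ominus>\<^bsub>A\<^esub> (r0 \<cdot>\<^bsub>A\<^esub> i) = h \<cdot>\<^bsub>A\<^esub> i" "stably_null A h"
    .
  \<comment> \<open>\<open>h i\<close> is the defect \<open>1 - r0 i\<close>, so adding the null map
    \<open>h\<close> makes the retraction strict without changing its class.\<close>
  define r1 where "r1 = h \<oplus>\<^bsub>A\<^esub> r0"
  have r1: "r1 \<in> Ar A" "Dom A r1 = Cod A i" "Cod A r1 = Dom A i"
    using h(1-3) r0 d by (simp_all add: r1_def)
  have "r1 \<cdot>\<^bsub>A\<^esub> i = h \<cdot>\<^bsub>A\<^esub> i \<oplus>\<^bsub>A\<^esub> r0 \<cdot>\<^bsub>A\<^esub> i" using h(1-3) r0 d ip by (simp add: r1_def)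
  also have "\<dots> = Idt A (Dom A i)" unfolding h(4)[symmetric] using ip r0 d by simp
  finally have r1i: "r1 \<cdot>\<^bsub>A\<^esub> i = Idt A (Dom A i)" .
  have "r1 \<oplus>\<^bsub>A\<^esub> \<ominus>\<^bsub>A\<^esub> r0 = h" using h(1-3) r0 d by (simp add: r1_def)
  then have r_r1: "r = cl r1" using h r0 r1 d eqv_sym[of r1 r0] by (simp add: cl_eq_iff eqv_def)
  let ?e = "Idt A (Cod A i) \<oplus>\<^bsub>A\<^esub> \<ominus>\<^bsub>A\<^esub> (i \<cdot>\<^bsub>A\<^esub> r1)"
  have e: "?e \<in> Ar A" "Dom A ?e = Cod A i" "Cod A ?e = Cod A i" using r1 ip by simp_all
  have "?e \<cdot>\<^bsub>A\<^esub> i = Zer A (Dom A i) (Cod A i)" using r1 ip r1i by simp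
  from Confl_descend[OF ip e this]
  obtain t where t: "t \<in> Ar A" "Dom A t = Cod A p" "Cod A t = Cod A i" "t \<cdot>\<^bsub>A\<^esub> p = ?e"
    .
  have "p \<cdot>\<^bsub>A\<^esub> i \<cdot>\<^bsub>A\<^esub> r1 = (p \<cdot>\<^bsub>A\<^esub> i) \<cdot>\<^bsub>A\<^esub> r1" using r1 ip by (simp del: Confl_simps(4))
  then have pir: "p \<cdot>\<^bsub>A\<^esub> i \<cdot>\<^bsub>A\<^esub> r1 = Zer A (Cod A i) (Cod A p)" using r1 ip by simp
  have "(p \<cdot>\<^bsub>A\<^esub> t) \<cdot>\<^bsub>A\<^esub> p = p \<cdot>\<^bsub>A\<^esub> ?e" using t ip by simp
  also have "\<dots> = p" using r1 ip pir by simp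
  finally have ptp: "(p \<cdot>\<^bsub>A\<^esub> t) \<cdot>\<^bsub>A\<^esub> p = p" .
  have "(p \<cdot>\<^bsub>A\<^esub> t) \<cdot>\<^bsub>A\<^esub> p = Idt A (Cod A p) \<cdot>\<^bsub>A\<^esub> p" unfolding ptp using ip by simp
  then have "p \<cdot>\<^bsub>A\<^esub> t = Idt A (Cod A p)"
    by (rule Confl_epi[OF ip, rotated 5]) (use t(1-3) ip in simp_all)
  then have "cl p \<cdot>\<^bsub>S\<^esub> cl t = Idt S (Cod A p)" using t(1-3) ip by (simp add: cl_Cmp cl_Idt)
  moreover have "cl t \<cdot>\<^bsub>S\<^esub> cl p = Idt S (Cod A i) \<oplus>\<^bsub>S\<^esub> \<ominus>\<^bsub>S\<^esub> (cl i \<cdot>\<^bsub>S\<^esub> r)"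
    using t ip r1 by (simp add: cl_Cmp cl_Idt cl_Neg cl_Add r_r1)
  ultimately show thesis using that[of "cl t"] t by simp
qed

text \<open>Dual: the stable section is corrected to a strict section \<open>s1\<close>, and the
  complementary idempotent \<open>1 - s1 p\<close> is killed by \<open>p\<close> and therefore
  factors through \<open>i\<close>.\<close>

lemma Confl_split_epi:
  assumes ip: "(i, p) \<in> Confl A" and s: "s \<in> Ar S" "Cod S s = Cod A i" "Dom S s = Cod A p"
    "cl p \<cdot>\<^bsub>S\<^esub> s = Idt S (Cod A p)"
  obtains l where "l \<in> Ar S" "Dom S l = Cod A i" "Cod S l = Dom A i"
    "l \<cdot>\<^bsub>S\<^esub> cl i = Idt S (Dom A i)" "cl i \<cdot>\<^bsub>S\<^esub> l = Idt S (Cod A i) \<oplus>\<^bsub>S\<^esub> \<ominus>\<^bsub>S\<^esub> (s \<cdot>\<^bsub>S\<^esub> cl p)"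
proof -
  obtain s0 where s0: "s0 \<in> Ar A" "s = cl s0" using S_Ar_E[OF s(1)] .
  have d: "Cod A s0 = Cod A i" "Dom A s0 = Cod A p" using s0 s by simp_all
  let ?n = "Idt A (Cod A p) \<oplus>\<^bsub>A\<^esub> \<ominus>\<^bsub>A\<^esub> (p \<cdot>\<^bsub>A\<^esub> s0)"
  have "cl (Idt A (Cod A p)) = cl (p \<cdot>\<^bsub>A\<^esub> s0)" using s(4) ip s0 d by (simp add: cl_Cmp cl_Idt)
  then have n: "stably_null A ?n" using ip s0 d by (simp add: cl_eq_iff eqv_def)
  have "Cod A p = Cod A ?n" "Dom A ?n = Cod A p" using ip s0 d by simp_all
  from null_lift[OF n ip this]
  obtain h where h: "h \<in> Ar A" "Dom A h = Cod A p" "Cod A h = Cod A i"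
    "Idt A (Cod A p) \<oplus>\<^bsub>A\<^esub> \<ominus>\<^bsub>A\<^esub> (p \<cdot>\<^bsub>A\<^esub> s0) = p \<cdot>\<^bsub>A\<^esub> h" "stably_null A h"
    .
  define s1 where "s1 = h \<oplus>\<^bsub>A\<^esub> s0"
  have s1: "s1 \<in> Ar A" "Cod A s1 = Cod A i" "Dom A s1 = Cod A p"
    using h(1-3) s0 d by (simp_all add: s1_def)
  have "p \<cdot>\<^bsub>A\<^esub> s1 = p \<cdot>\<^bsub>A\<^esub> h \<oplus>\<^bsub>A\<^esub> p \<cdot>\<^bsub>A\<^esub> s0" using h(1-3) s0 d ip by (simp add: s1_def)
  also have "\<dots> = Idt A (Cod A p)" unfolding h(4)[symmetric] using ip s0 d by simp
  finally have ps1: "p \<cdot>\<^bsub>A\<^esub> s1 = Idt A (Cod A p)" .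
  have "s1 \<oplus>\<^bsub>A\<^esub> \<ominus>\<^bsub>A\<^esub> s0 = h" using h(1-3) s0 d by (simp add: s1_def)
  then have s_s1: "s = cl s1" using h s0 s1 d eqv_sym[of s1 s0] by (simp add: cl_eq_iff eqv_def)
  let ?e = "Idt A (Cod A i) \<oplus>\<^bsub>A\<^esub> \<ominus>\<^bsub>A\<^esub> (s1 \<cdot>\<^bsub>A\<^esub> p)"
  have e: "?e \<in> Ar A" "Cod A ?e = Cod A i" "Dom A ?e = Cod A i" using s1 ip by simp_all
  have "p \<cdot>\<^bsub>A\<^esub> s1 \<cdot>\<^bsub>A\<^esub> p = (p \<cdot>\<^bsub>A\<^esub> s1) \<cdot>\<^bsub>A\<^esub> p" using s1 ip by simp
  then have "p \<cdot>\<^bsub>A\<^esub> ?e = Zer A (Cod A i) (Cod A p)" using s1 ip ps1 by simp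
  from Confl_lift[OF ip e this]
  obtain t where t: "t \<in> Ar A" "Dom A t = Cod A i" "Cod A t = Dom A i" "i \<cdot>\<^bsub>A\<^esub> t = ?e"
    .
  have "s1 \<cdot>\<^bsub>A\<^esub> p \<cdot>\<^bsub>A\<^esub> i = Zer A (Dom A i) (Cod A i)" using s1 ip by simp
  then have "?e \<cdot>\<^bsub>A\<^esub> i = i" using ip s1 by simp
  moreover have "(i \<cdot>\<^bsub>A\<^esub> t) \<cdot>\<^bsub>A\<^esub> i = i \<cdot>\<^bsub>A\<^esub> t \<cdot>\<^bsub>A\<^esub> i" using t(1-3) ip by simp
  ultimately have iti: "i \<cdot>\<^bsub>A\<^esub> t \<cdot>\<^bsub>A\<^esub> i = i" unfolding t(4) by simp
  have "i \<cdot>\<^bsub>A\<^esub> t \<cdot>\<^bsub>A\<^esub> i = i \<cdot>\<^bsub>A\<^esub> Idt A (Dom A i)" unfolding iti using ip by simp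
  then have "t \<cdot>\<^bsub>A\<^esub> i = Idt A (Dom A i)"
    by (rule Confl_mono[OF ip, rotated 5]) (use t(1-3) ip in simp_all)
  then have "cl t \<cdot>\<^bsub>S\<^esub> cl i = Idt S (Dom A i)" using t(1-3) ip by (simp add: cl_Cmp cl_Idt)
  moreover have "cl i \<cdot>\<^bsub>S\<^esub> cl t = Idt S (Cod A i) \<oplus>\<^bsub>S\<^esub> \<ominus>\<^bsub>S\<^esub> (s \<cdot>\<^bsub>S\<^esub> cl p)"
    using t ip s1 by (simp add: cl_Cmp cl_Idt cl_Neg cl_Add s_s1)
  ultimately show thesis using that[of "cl t"] t by simp
qed

end

text \<open>A pair \<open>(f, g)\<close> written as \<open>(b' i a, c' p b)\<close> with a conflation \<open>(i, p)\<close> and stable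
  isomorphisms \<open>a\<close>, \<open>b\<close>, \<open>c\<close>, whose cancellation laws are simplification rules.\<close>

locale stable_presentation = stable_base A
  for A :: "('o, 'm, 'z) excat_scheme" +
  fixes i p a b c a' b' c'
  assumes Confl [simp]: "(i, p) \<in> Confl A"
    and inverse: "inverse_arrows S a a'" "inverse_arrows S b b'" "inverse_arrows S c c'"
    and Cods [simp]: "Cod S a = Dom A i" "Cod S b = Cod A i" "Cod S c = Cod A p"
begin

lemma inv_simps [simp]:
  "a \<in> Ar S" "b \<in> Ar S" "c \<in> Ar S" "a' \<in> Ar S" "b' \<in> Ar S" "c' \<in> Ar S"
  "Cod S a' = Dom S a" "Cod S b' = Dom S b" "Cod S c' = Dom S c"
  "Dom S a' = Dom A i" "Dom S b' = Cod A i" "Dom S c' = Cod A p"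
  "a' \<cdot>\<^bsub>S\<^esub> a = Idt S (Dom S a)" "b' \<cdot>\<^bsub>S\<^esub> b = Idt S (Dom S b)" "c' \<cdot>\<^bsub>S\<^esub> c = Idt S (Dom S c)"
  "a \<cdot>\<^bsub>S\<^esub> a' = Idt S (Dom A i)" "b \<cdot>\<^bsub>S\<^esub> b' = Idt S (Cod A i)" "c \<cdot>\<^bsub>S\<^esub> c' = Idt S (Cod A p)"
  using inverse by (simp_all add: inverse_arrows_def homset_iff)

lemma cancel [simp]:
  assumes "k \<in> Ar S"
  shows "Cod S k = Dom S a \<Longrightarrow> a' \<cdot>\<^bsub>S\<^esub> a \<cdot>\<^bsub>S\<^esub> k = k" "Cod S k = Dom A i \<Longrightarrow> a \<cdot>\<^bsub>S\<^esub> a' \<cdot>\<^bsub>S\<^esub> k = k"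
    "Cod S k = Dom S b \<Longrightarrow> b' \<cdot>\<^bsub>S\<^esub> b \<cdot>\<^bsub>S\<^esub> k = k" "Cod S k = Cod A i \<Longrightarrow> b \<cdot>\<^bsub>S\<^esub> b' \<cdot>\<^bsub>S\<^esub> k = k"
    "Cod S k = Dom S c \<Longrightarrow> c' \<cdot>\<^bsub>S\<^esub> c \<cdot>\<^bsub>S\<^esub> k = k" "Cod S k = Cod A p \<Longrightarrow> c \<cdot>\<^bsub>S\<^esub> c' \<cdot>\<^bsub>S\<^esub> k = k"
  by (rule S.Cmp_inverse_cancel; simp add: assms)+

abbreviation "f \<equiv> b' \<cdot>\<^bsub>S\<^esub> cl i \<cdot>\<^bsub>S\<^esub> a"
abbreviation "g \<equiv> c' \<cdot>\<^bsub>S\<^esub> cl p \<cdot>\<^bsub>S\<^esub> b"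

lemma ip_simps [simp]:
  "i \<in> Ar A" "p \<in> Ar A" "Dom A p = Cod A i" "cl p \<cdot>\<^bsub>S\<^esub> cl i = Zer S (Dom A i) (Cod A p)"
  "k \<in> Ar S \<Longrightarrow> Cod S k = Dom A i \<Longrightarrow> cl p \<cdot>\<^bsub>S\<^esub> cl i \<cdot>\<^bsub>S\<^esub> k = Zer S (Dom S k) (Cod A p)"
proof -
  show *: "i \<in> Ar A" "p \<in> Ar A" "Dom A p = Cod A i" by (rule Confl_simps[OF Confl])+
  show **: "cl p \<cdot>\<^bsub>S\<^esub> cl i = Zer S (Dom A i) (Cod A p)"
    by (simp only: cl_Cmp[OF *(1,2) *(3)[symmetric]] Confl_simps(4)[OF Confl] cl_Zer)
  show "k \<in> Ar S \<Longrightarrow> Cod S k = Dom A i \<Longrightarrow> cl p \<cdot>\<^bsub>S\<^esub> cl i \<cdot>\<^bsub>S\<^esub> k = Zer S (Dom S k) (Cod A p)"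
    using S.Cmp_assoc'[of k "cl i" "cl p"] * ** by simp
qed

lemma zero: "g \<cdot>\<^bsub>S\<^esub> f = Zer S (Dom S f) (Cod S g)"
  by simp

lemma weak_cokernel:
  assumes k: "k \<in> Ar S" "Dom S k = Cod S f" "Cod S k = w" "k \<cdot>\<^bsub>S\<^esub> f = Zer S (Dom S f) w"
  obtains m where "m \<in> Ar S" "Dom S m = Cod S g" "Cod S m = w" "k = m \<cdot>\<^bsub>S\<^esub> g"
proof -
  have k': "Dom S k = Dom S b" using k(2) by simp
  have w: "w \<in> Ob S" using k(1,3) S.Cod_Ob by blast
  have "(k \<cdot>\<^bsub>S\<^esub> f) \<cdot>\<^bsub>S\<^esub> a' = Zer S (Dom A i) w" unfolding k(4) using w by simp
  then have *: "(k \<cdot>\<^bsub>S\<^esub> b') \<cdot>\<^bsub>S\<^esub> cl i = Zer S (Dom A i) w" using k(1) k' by simp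
  have "k \<cdot>\<^bsub>S\<^esub> b' \<in> Ar S" "Dom S (k \<cdot>\<^bsub>S\<^esub> b') = Cod A i" "Cod S (k \<cdot>\<^bsub>S\<^esub> b') = w"
    using k(1,3) k' by simp_all
  from Confl_weak_cokernel[OF Confl this *]
  obtain m where m: "m \<in> Ar S" "Dom S m = Cod A p" "Cod S m = w" "k \<cdot>\<^bsub>S\<^esub> b' = m \<cdot>\<^bsub>S\<^esub> cl p" .
  have "k = (k \<cdot>\<^bsub>S\<^esub> b') \<cdot>\<^bsub>S\<^esub> b" using k(1) k' by simp
  also have "\<dots> = (m \<cdot>\<^bsub>S\<^esub> c) \<cdot>\<^bsub>S\<^esub> g" unfolding m(4) using m(1-3) by simp
  finally have "k = (m \<cdot>\<^bsub>S\<^esub> c) \<cdot>\<^bsub>S\<^esub> g" .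
  then show thesis by (rule that[rotated 3]) (simp_all add: m(1-3))
qed

lemma weak_kernel:
  assumes k: "k \<in> Ar S" "Cod S k = Dom S g" "Dom S k = w" "g \<cdot>\<^bsub>S\<^esub> k = Zer S w (Cod S g)"
  obtains m where "m \<in> Ar S" "Cod S m = Dom S f" "Dom S m = w" "k = f \<cdot>\<^bsub>S\<^esub> m"
proof -
  have k': "Cod S k = Dom S b" using k(2) by simp
  have w: "w \<in> Ob S" using k(1,3) S.Dom_Ob by blast
  have "c \<cdot>\<^bsub>S\<^esub> (g \<cdot>\<^bsub>S\<^esub> k) = Zer S w (Cod A p)" unfolding k(4) using w by simp
  then have *: "cl p \<cdot>\<^bsub>S\<^esub> b \<cdot>\<^bsub>S\<^esub> k = Zer S w (Cod A p)" using k(1) k' by simp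
  have "b \<cdot>\<^bsub>S\<^esub> k \<in> Ar S" "Cod S (b \<cdot>\<^bsub>S\<^esub> k) = Cod A i" "Dom S (b \<cdot>\<^bsub>S\<^esub> k) = w"
    using k(1,3) k' by simp_all
  from Confl_weak_kernel[OF Confl this *]
  obtain m where m: "m \<in> Ar S" "Cod S m = Dom A i" "Dom S m = w" "b \<cdot>\<^bsub>S\<^esub> k = cl i \<cdot>\<^bsub>S\<^esub> m" .
  have "k = b' \<cdot>\<^bsub>S\<^esub> (b \<cdot>\<^bsub>S\<^esub> k)" using k(1) k' by simp
  also have "\<dots> = f \<cdot>\<^bsub>S\<^esub> a' \<cdot>\<^bsub>S\<^esub> m" unfolding m(4) using m(1-3) by simp
  finally have "k = f \<cdot>\<^bsub>S\<^esub> a' \<cdot>\<^bsub>S\<^esub> m" .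
  then show thesis by (rule that[rotated 3]) (simp_all add: m(1-3))
qed

lemma split_mono:
  assumes r: "r \<in> Ar S" "Dom S r = Cod S f" "Cod S r = Dom S f" "r \<cdot>\<^bsub>S\<^esub> f = Idt S (Dom S f)"
  obtains t where "t \<in> Ar S" "Dom S t = Cod S g" "Cod S t = Cod S f"
    "g \<cdot>\<^bsub>S\<^esub> t = Idt S (Cod S g)" "t \<cdot>\<^bsub>S\<^esub> g = Idt S (Cod S f) \<oplus>\<^bsub>S\<^esub> \<ominus>\<^bsub>S\<^esub> (f \<cdot>\<^bsub>S\<^esub> r)"
proof -
  have r': "Dom S r = Dom S b" "Cod S r = Dom S a" using r(2,3) by simp_all
  let ?r = "a \<cdot>\<^bsub>S\<^esub> r \<cdot>\<^bsub>S\<^esub> b'"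
  have "?r \<cdot>\<^bsub>S\<^esub> cl i = a \<cdot>\<^bsub>S\<^esub> (r \<cdot>\<^bsub>S\<^esub> f) \<cdot>\<^bsub>S\<^esub> a'" using r(1) r' by simp
  also have "\<dots> = Idt S (Dom A i)" unfolding r(4) by simp
  finally have *: "?r \<cdot>\<^bsub>S\<^esub> cl i = Idt S (Dom A i)" .
  have "?r \<in> Ar S" "Dom S ?r = Cod A i" "Cod S ?r = Dom A i" using r(1) r' by simp_all
  from Confl_split_mono[OF Confl this *]
  obtain t where t: "t \<in> Ar S" "Dom S t = Cod A p" "Cod S t = Cod A i"
    "cl p \<cdot>\<^bsub>S\<^esub> t = Idt S (Cod A p)" "t \<cdot>\<^bsub>S\<^esub> cl p = Idt S (Cod A i) \<oplus>\<^bsub>S\<^esub> \<ominus>\<^bsub>S\<^esub> (cl i \<cdot>\<^bsub>S\<^esub> ?r)" .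
  have "g \<cdot>\<^bsub>S\<^esub> b' \<cdot>\<^bsub>S\<^esub> t \<cdot>\<^bsub>S\<^esub> c = c' \<cdot>\<^bsub>S\<^esub> (cl p \<cdot>\<^bsub>S\<^esub> t) \<cdot>\<^bsub>S\<^esub> c" using t(1-3) by simp
  then have 1: "g \<cdot>\<^bsub>S\<^esub> b' \<cdot>\<^bsub>S\<^esub> t \<cdot>\<^bsub>S\<^esub> c = Idt S (Cod S g)" unfolding t(4) by simp
  have "(b' \<cdot>\<^bsub>S\<^esub> t \<cdot>\<^bsub>S\<^esub> c) \<cdot>\<^bsub>S\<^esub> g = b' \<cdot>\<^bsub>S\<^esub> (t \<cdot>\<^bsub>S\<^esub> cl p) \<cdot>\<^bsub>S\<^esub> b" using t(1-3) by simp
  then have 2: "(b' \<cdot>\<^bsub>S\<^esub> t \<cdot>\<^bsub>S\<^esub> c) \<cdot>\<^bsub>S\<^esub> g = Idt S (Cod S f) \<oplus>\<^bsub>S\<^esub> \<ominus>\<^bsub>S\<^esub> (f \<cdot>\<^bsub>S\<^esub> r)"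
    unfolding t(5) using r(1) r' by simp
  show thesis by (rule that[OF _ _ _ 1 2]) (simp_all add: t(1-3))
qed

lemma split_epi:
  assumes s: "s \<in> Ar S" "Cod S s = Dom S g" "Dom S s = Cod S g" "g \<cdot>\<^bsub>S\<^esub> s = Idt S (Cod S g)"
  obtains l where "l \<in> Ar S" "Dom S l = Dom S g" "Cod S l = Dom S f"
    "l \<cdot>\<^bsub>S\<^esub> f = Idt S (Dom S f)" "f \<cdot>\<^bsub>S\<^esub> l = Idt S (Dom S g) \<oplus>\<^bsub>S\<^esub> \<ominus>\<^bsub>S\<^esub> (s \<cdot>\<^bsub>S\<^esub> g)"
proof -
  have s': "Cod S s = Dom S b" "Dom S s = Dom S c" using s(2,3) by simp_all
  let ?s = "b \<cdot>\<^bsub>S\<^esub> s \<cdot>\<^bsub>S\<^esub> c'"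
  have "cl p \<cdot>\<^bsub>S\<^esub> ?s = c \<cdot>\<^bsub>S\<^esub> (g \<cdot>\<^bsub>S\<^esub> s) \<cdot>\<^bsub>S\<^esub> c'" using s(1) s' by simp
  also have "\<dots> = Idt S (Cod A p)" unfolding s(4) by simp
  finally have *: "cl p \<cdot>\<^bsub>S\<^esub> ?s = Idt S (Cod A p)" .
  have "?s \<in> Ar S" "Cod S ?s = Cod A i" "Dom S ?s = Cod A p" using s(1) s' by simp_all
  from Confl_split_epi[OF Confl this *]
  obtain l where l: "l \<in> Ar S" "Dom S l = Cod A i" "Cod S l = Dom A i"
    "l \<cdot>\<^bsub>S\<^esub> cl i = Idt S (Dom A i)" "cl i \<cdot>\<^bsub>S\<^esub> l = Idt S (Cod A i) \<oplus>\<^bsub>S\<^esub> \<ominus>\<^bsub>S\<^esub> (?s \<cdot>\<^bsub>S\<^esub> cl p)" .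
  have "(a' \<cdot>\<^bsub>S\<^esub> l \<cdot>\<^bsub>S\<^esub> b) \<cdot>\<^bsub>S\<^esub> f = a' \<cdot>\<^bsub>S\<^esub> (l \<cdot>\<^bsub>S\<^esub> cl i) \<cdot>\<^bsub>S\<^esub> a" using l(1-3) by simp
  then have 1: "(a' \<cdot>\<^bsub>S\<^esub> l \<cdot>\<^bsub>S\<^esub> b) \<cdot>\<^bsub>S\<^esub> f = Idt S (Dom S f)" unfolding l(4) by simp
  have "f \<cdot>\<^bsub>S\<^esub> a' \<cdot>\<^bsub>S\<^esub> l \<cdot>\<^bsub>S\<^esub> b = b' \<cdot>\<^bsub>S\<^esub> (cl i \<cdot>\<^bsub>S\<^esub> l) \<cdot>\<^bsub>S\<^esub> b" using l(1-3) by simp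
  then have 2: "f \<cdot>\<^bsub>S\<^esub> a' \<cdot>\<^bsub>S\<^esub> l \<cdot>\<^bsub>S\<^esub> b = Idt S (Dom S g) \<oplus>\<^bsub>S\<^esub> \<ominus>\<^bsub>S\<^esub> (s \<cdot>\<^bsub>S\<^esub> g)"
    unfolding l(5) using s(1) s' by simp
  show thesis by (rule that[OF _ _ _ 1 2]) (simp_all add: l(1-3))
qed

end

context stable_base
begin

lemma stably_exactE:
  assumes "stably_exact f g"
  obtains i p a b c a' b' c' where "stable_presentation A i p a b c a' b' c'"
    "f = b' \<cdot>\<^bsub>S\<^esub> cl i \<cdot>\<^bsub>S\<^esub> a" "g = c' \<cdot>\<^bsub>S\<^esub> cl p \<cdot>\<^bsub>S\<^esub> b"
proof -
  obtain i p a b c where *: "f \<in> Ar S" "g \<in> Ar S" "Cod S f = Dom S g"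
     "(i, p) \<in> Confl A" "is_iso S a" "is_iso S b" "is_iso S c"
     "Dom S a = Dom S f" "Cod S a = Dom A i" "Dom S b = Dom S g" "Cod S b = Cod A i"
     "Dom S c = Cod S g" "Cod S c = Cod A p"
     "b \<cdot>\<^bsub>S\<^esub> f = cl i \<cdot>\<^bsub>S\<^esub> a" "c \<cdot>\<^bsub>S\<^esub> g = cl p \<cdot>\<^bsub>S\<^esub> b"
    using assms unfolding stably_exact_def by blast
  obtain a' b' c' where inv: "inverse_arrows S a a'" "inverse_arrows S b b'" "inverse_arrows S c c'"
    using *(5-7) by (auto simp: is_iso_def)
  interpret stable_presentation A i p a b c a' b' c'
    by unfold_locales (simp_all add: * inv)
  have "f = b' \<cdot>\<^bsub>S\<^esub> (b \<cdot>\<^bsub>S\<^esub> f)" using *(1-3,10) by simp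
  then have f: "f = b' \<cdot>\<^bsub>S\<^esub> cl i \<cdot>\<^bsub>S\<^esub> a" unfolding *(14) .
  have "g = c' \<cdot>\<^bsub>S\<^esub> (c \<cdot>\<^bsub>S\<^esub> g)" using *(1-3,12) by simp
  then have g: "g = c' \<cdot>\<^bsub>S\<^esub> cl p \<cdot>\<^bsub>S\<^esub> b" unfolding *(15) .
  show thesis by (rule that[OF stable_presentation_axioms f g])
qed

lemma stably_exact_zero:
  assumes "stably_exact f g" shows "g \<cdot>\<^bsub>S\<^esub> f = Zer S (Dom S f) (Cod S g)"
proof -
  obtain i p a b c a' b' c' where *: "stable_presentation A i p a b c a' b' c'"
    "f = b' \<cdot>\<^bsub>S\<^esub> cl i \<cdot>\<^bsub>S\<^esub> a" "g = c' \<cdot>\<^bsub>S\<^esub> cl p \<cdot>\<^bsub>S\<^esub> b" using stably_exactE[OF assms] .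
  show ?thesis unfolding *(2,3) by (rule stable_presentation.zero[OF *(1)])
qed

lemma stably_exact_weak_cokernel:
  assumes "stably_exact f g" "k \<in> Ar S" "Dom S k = Cod S f" "Cod S k = w"
    "k \<cdot>\<^bsub>S\<^esub> f = Zer S (Dom S f) w"
  obtains m where "m \<in> Ar S" "Dom S m = Cod S g" "Cod S m = w" "k = m \<cdot>\<^bsub>S\<^esub> g"
proof -
  obtain i p a b c a' b' c' where *: "stable_presentation A i p a b c a' b' c'"
    "f = b' \<cdot>\<^bsub>S\<^esub> cl i \<cdot>\<^bsub>S\<^esub> a" "g = c' \<cdot>\<^bsub>S\<^esub> cl p \<cdot>\<^bsub>S\<^esub> b" using stably_exactE[OF assms(1)] .
  show thesis
    using stable_presentation.weak_cokernel[OF *(1) assms(2-5)[unfolded *(2)]] that[unfolded *(3)] .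
qed

lemma stably_exact_weak_kernel:
  assumes "stably_exact f g" "k \<in> Ar S" "Cod S k = Dom S g" "Dom S k = w"
    "g \<cdot>\<^bsub>S\<^esub> k = Zer S w (Cod S g)"
  obtains m where "m \<in> Ar S" "Cod S m = Dom S f" "Dom S m = w" "k = f \<cdot>\<^bsub>S\<^esub> m"
proof -
  obtain i p a b c a' b' c' where *: "stable_presentation A i p a b c a' b' c'"
    "f = b' \<cdot>\<^bsub>S\<^esub> cl i \<cdot>\<^bsub>S\<^esub> a" "g = c' \<cdot>\<^bsub>S\<^esub> cl p \<cdot>\<^bsub>S\<^esub> b" using stably_exactE[OF assms(1)] .
  show thesis
    using stable_presentation.weak_kernel[OF *(1) assms(2-5)[unfolded *(3)]] that[unfolded *(2)] .
qed

lemma stably_exact_split_mono: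
  assumes "stably_exact f g" "r \<in> Ar S" "Dom S r = Cod S f" "Cod S r = Dom S f"
    "r \<cdot>\<^bsub>S\<^esub> f = Idt S (Dom S f)"
  obtains t where "t \<in> Ar S" "Dom S t = Cod S g" "Cod S t = Cod S f"
    "g \<cdot>\<^bsub>S\<^esub> t = Idt S (Cod S g)" "t \<cdot>\<^bsub>S\<^esub> g = Idt S (Cod S f) \<oplus>\<^bsub>S\<^esub> \<ominus>\<^bsub>S\<^esub> (f \<cdot>\<^bsub>S\<^esub> r)"
proof -
  obtain i p a b c a' b' c' where *: "stable_presentation A i p a b c a' b' c'"
    "f = b' \<cdot>\<^bsub>S\<^esub> cl i \<cdot>\<^bsub>S\<^esub> a" "g = c' \<cdot>\<^bsub>S\<^esub> cl p \<cdot>\<^bsub>S\<^esub> b" using stably_exactE[OF assms(1)] .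
  show thesis
    using stable_presentation.split_mono[OF *(1) assms(2-5)[unfolded *(2)]] that[unfolded *(2,3)] .
qed

lemma stably_exact_split_epi:
  assumes "stably_exact f g" "s \<in> Ar S" "Cod S s = Dom S g" "Dom S s = Cod S g"
    "g \<cdot>\<^bsub>S\<^esub> s = Idt S (Cod S g)"
  obtains l where "l \<in> Ar S" "Dom S l = Dom S g" "Cod S l = Dom S f"
    "l \<cdot>\<^bsub>S\<^esub> f = Idt S (Dom S f)" "f \<cdot>\<^bsub>S\<^esub> l = Idt S (Dom S g) \<oplus>\<^bsub>S\<^esub> \<ominus>\<^bsub>S\<^esub> (s \<cdot>\<^bsub>S\<^esub> g)"
proof -
  obtain i p a b c a' b' c' where *: "stable_presentation A i p a b c a' b' c'"
    "f = b' \<cdot>\<^bsub>S\<^esub> cl i \<cdot>\<^bsub>S\<^esub> a" "g = c' \<cdot>\<^bsub>S\<^esub> cl p \<cdot>\<^bsub>S\<^esub> b" using stably_exactE[OF assms(1)] .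
  show thesis
    using stable_presentation.split_epi[OF *(1) assms(2-5)[unfolded *(3)]] that[unfolded *(2,3)] .
qed

section \<open>Projectives as zero objects of the stable category\<close>

lemma projective_Idt: "projective A x \<Longrightarrow> Idt S x = Zer S x x"
  using projective_iff_null_Idt[of x] cl_zero_iff[of "Idt A x" x x] by (simp add: cl_Idt)

lemma cl_zero_Dom:
  assumes "f \<in> Ar A" "projective A (Dom A f)" shows "cl f = Zer S (Dom A f) (Cod A f)"
  using nullI[of "Dom A f" "Idt A (Dom A f)" f] assms cl_zero_iff[of f] by simp

lemma cl_zero_Cod:
  assumes "f \<in> Ar A" "projective A (Cod A f)" shows "cl f = Zer S (Dom A f) (Cod A f)"
  using nullI[of "Cod A f" f "Idt A (Cod A f)"] assms cl_zero_iff[of f] by simp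

text \<open>The kernel is stably zero, so the zero map is a stable retraction of \<open>i\<close>.
  In the splitting obtained from it the correction term vanishes, and \<open>t\<close> is a
  two-sided inverse of the class of \<open>p\<close>.\<close>

lemma is_iso_if_projective_kernel:
  assumes ip: "(i, p) \<in> Confl A" and "projective A (Dom A i)"
  shows "is_iso S (cl p)"
proof -
  have i: "i \<in> Ar A" "p \<in> Ar A" "Dom A p = Cod A i" "cl i = Zer S (Dom A i) (Cod A i)"
    using assms cl_zero_Dom[of i] by simp_all
  have o: "Dom A i \<in> Ob A" "Cod A i \<in> Ob A" "Cod A p \<in> Ob A" using i by simp_all
  let ?z = "Zer S (Cod A i) (Dom A i)"
  have "?z \<in> Ar S" "Dom S ?z = Cod A i" "Cod S ?z = Dom A i" "?z \<cdot>\<^bsub>S\<^esub> cl i = Idt S (Dom A i)"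
    using i o projective_Idt[OF assms(2)] by simp_all
  from Confl_split_mono[OF ip this]
  obtain t where t: "t \<in> Ar S" "Dom S t = Cod A p" "Cod S t = Cod A i"
    "cl p \<cdot>\<^bsub>S\<^esub> t = Idt S (Cod A p)" "t \<cdot>\<^bsub>S\<^esub> cl p = Idt S (Cod A i) \<oplus>\<^bsub>S\<^esub> \<ominus>\<^bsub>S\<^esub> (cl i \<cdot>\<^bsub>S\<^esub> ?z)" .
  have "t \<cdot>\<^bsub>S\<^esub> cl p = Idt S (Cod A i)" unfolding t(5) using i o by simp
  then show ?thesis using i(1-3) t(1-4) by (intro S.is_isoI[of _ t]) simp_all
qed

lemma is_iso_if_projective_cokernel:
  assumes ip: "(i, p) \<in> Confl A" and "projective A (Cod A p)"
  shows "is_iso S (cl i)"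
proof -
  have p: "i \<in> Ar A" "p \<in> Ar A" "Dom A p = Cod A i" "cl p = Zer S (Cod A i) (Cod A p)"
    using assms cl_zero_Cod[of p] by simp_all
  have o: "Dom A i \<in> Ob A" "Cod A i \<in> Ob A" "Cod A p \<in> Ob A" using p by simp_all
  let ?z = "Zer S (Cod A p) (Cod A i)"
  have "?z \<in> Ar S" "Cod S ?z = Cod A i" "Dom S ?z = Cod A p" "cl p \<cdot>\<^bsub>S\<^esub> ?z = Idt S (Cod A p)"
    using p o projective_Idt[OF assms(2)] by simp_all
  from Confl_split_epi[OF ip this]
  obtain l where l: "l \<in> Ar S" "Dom S l = Cod A i" "Cod S l = Dom A i"
    "l \<cdot>\<^bsub>S\<^esub> cl i = Idt S (Dom A i)" "cl i \<cdot>\<^bsub>S\<^esub> l = Idt S (Cod A i) \<oplus>\<^bsub>S\<^esub> \<ominus>\<^bsub>S\<^esub> (?z \<cdot>\<^bsub>S\<^esub> cl p)" .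
  have "cl i \<cdot>\<^bsub>S\<^esub> l = Idt S (Cod A i)" unfolding l(5) using p o by simp
  then show ?thesis using p(1-3) l(1-4) by (intro S.is_isoI[of _ l]) simp_all
qed

end

section \<open>Functors between stable categories\<close>

locale stable_functor = A: stable_base A + B: stable_base B
  for A :: "('o, 'm, 'y) excat_scheme" and B :: "('p, 'n, 'z) excat_scheme" +
  fixes H :: "('o, 'm, 'p, 'n) fctr"
  assumes exact: "exact_functor A B H"
    and fo_projective: "projective A X \<Longrightarrow> projective B (fo H X)"
begin

sublocale additive_functor_between A B H
  by unfold_locales (use exact in \<open>simp add: exact_functor_def\<close>)

lemma fa_Confl: "(i, p) \<in> Confl A \<Longrightarrow> (fa H i, fa H p) \<in> Confl B"
  using exact by (auto simp: exact_functor_def)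

lemma fa_null: assumes "stably_null A f" shows "stably_null B (fa H f)"
proof -
  obtain q g h where *: "projective A q" "g \<in> Ar A" "h \<in> Ar A" "Cod A g = q" "Dom A h = q"
    "Dom A g = Dom A f" "Cod A h = Cod A f" "f = h \<cdot>\<^bsub>A\<^esub> g" using A.nullE[OF assms] .
  have "stably_null B (fa H h \<cdot>\<^bsub>B\<^esub> fa H g)"
    by (rule B.nullI[OF fo_projective[OF *(1)]]) (simp_all add: *(2-5))
  then show ?thesis unfolding *(8) using *(2-5) by simp
qed

lemma fo_bar [simp]: "fo (bar B H) = fo H"
  by (simp add: bar_def)

text \<open>\<open>bar\<close> applies \<open>H\<close> to a chosen representative. Two
  representatives differ by a null map, and \<open>H\<close> keeps it null because it preserves
  projectives.\<close>

lemma bar_cl: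
  assumes "f \<in> Ar A" shows "fa (bar B H) (A.cl f) = B.cl (fa H f)"
proof -
  have "A.eqv (rep (A.cl f)) f" by (rule A.rep_cl[OF assms])
  then have *: "rep (A.cl f) \<in> Ar A" "Dom A (rep (A.cl f)) = Dom A f"
    "Cod A (rep (A.cl f)) = Cod A f" "stably_null A (rep (A.cl f) \<oplus>\<^bsub>A\<^esub> \<ominus>\<^bsub>A\<^esub> f)"
    by (simp_all add: A.eqv_def)
  then show ?thesis using fa_null[OF *(4)] assms by (simp add: bar_def B.cl_eq_iff B.eqv_def)
qed

sublocale bar: additive_functor_between "stable A" "stable B" "bar B H"
  by unfold_locales
    (auto simp: additive_functor_def homset_iff bar_cl A.cl_Idt B.cl_Idt A.cl_Cmp B.cl_Cmp
      A.cl_Add B.cl_Add elim!: A.S_Ar_E)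

text \<open>The witnessing conflation goes to a conflation and the three comparison maps go to
  isomorphisms. This is the only form in which exactness of induced functors enters the adjunction
  argument.\<close>

lemma bar_stably_exact:
  assumes "A.stably_exact f g"
  shows "B.stably_exact (fa (bar B H) f) (fa (bar B H) g)"
proof -
  obtain i p a b c where *: "f \<in> Ar A.S" "g \<in> Ar A.S" "Cod A.S f = Dom A.S g"
     "(i, p) \<in> Confl A" "is_iso A.S a" "is_iso A.S b" "is_iso A.S c"
     "Dom A.S a = Dom A.S f" "Cod A.S a = Dom A i" "Dom A.S b = Dom A.S g" "Cod A.S b = Cod A i"
     "Dom A.S c = Cod A.S g" "Cod A.S c = Cod A p"
     and sq: "b \<cdot>\<^bsub>A.S\<^esub> f = A.cl i \<cdot>\<^bsub>A.S\<^esub> a" "c \<cdot>\<^bsub>A.S\<^esub> g = A.cl p \<cdot>\<^bsub>A.S\<^esub> b"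
    using assms unfolding A.stably_exact_def by blast
  have ip: "i \<in> Ar A" "p \<in> Ar A" "Dom A p = Cod A i" using *(4) by simp_all
  let ?H = "fa (bar B H)"
  have 1: "?H b \<cdot>\<^bsub>B.S\<^esub> ?H f = B.cl (fa H i) \<cdot>\<^bsub>B.S\<^esub> ?H a"
    using arg_cong[OF sq(1), of ?H] * ip by (simp add: bar_cl)
  have 2: "?H c \<cdot>\<^bsub>B.S\<^esub> ?H g = B.cl (fa H p) \<cdot>\<^bsub>B.S\<^esub> ?H b"
    using arg_cong[OF sq(2), of ?H] * ip by (simp add: bar_cl)
  show ?thesis
    by (rule B.stably_exact_iso[OF B.stably_exact_Confl[OF fa_Confl[OF *(4)]]
        bar.fa_is_iso[OF *(5)] bar.fa_is_iso[OF *(6)] bar.fa_is_iso[OF *(7)] _ _ _ _ _ _ _ _ _ 1 2])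
      (simp_all add: * ip)
qed

end

section \<open>Exact categories\<close>

sublocale exact_category \<subseteq> conflation_category A
  by unfold_locales (rule Confl_kernel Confl_cokernel, assumption)+

section \<open>Biproduct calculus\<close>

context additive_category
begin

lemma biprod:
  assumes "x \<in> Ob A" "y \<in> Ob A"
  shows "is_biproduct A x y (bsum A x y, in1 A x y, in2 A x y, pr1 A x y, pr2 A x y)"
proof -
  have "is_biproduct A x y (biprod A x y)"
    unfolding biprod_def by (rule someI_ex[OF biproduct[OF assms]])
  then show ?thesis by (simp add: bsum_def in1_def in2_def pr1_def pr2_def)
qed

lemma bsum_simps [simp]:
  assumes "x \<in> Ob A" "y \<in> Ob A"
  shows "bsum A x y \<in> Ob A"
    "in1 A x y \<in> Ar A" "Dom A (in1 A x y) = x" "Cod A (in1 A x y) = bsum A x y"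
    "in2 A x y \<in> Ar A" "Dom A (in2 A x y) = y" "Cod A (in2 A x y) = bsum A x y"
    "pr1 A x y \<in> Ar A" "Cod A (pr1 A x y) = x" "Dom A (pr1 A x y) = bsum A x y"
    "pr2 A x y \<in> Ar A" "Cod A (pr2 A x y) = y" "Dom A (pr2 A x y) = bsum A x y"
    "pr1 A x y \<cdot>\<^bsub>A\<^esub> in1 A x y = Idt A x" "pr2 A x y \<cdot>\<^bsub>A\<^esub> in2 A x y = Idt A y"
    "pr2 A x y \<cdot>\<^bsub>A\<^esub> in1 A x y = Zer A x y" "pr1 A x y \<cdot>\<^bsub>A\<^esub> in2 A x y = Zer A y x"
    "in1 A x y \<cdot>\<^bsub>A\<^esub> pr1 A x y \<oplus>\<^bsub>A\<^esub> in2 A x y \<cdot>\<^bsub>A\<^esub> pr2 A x y = Idt A (bsum A x y)"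
  using biprod[OF assms] unfolding is_biproduct_def homset_iff by simp_all

lemma bsum_cancel [simp]:
  assumes "x \<in> Ob A" "y \<in> Ob A" "k \<in> Ar A"
  shows "Cod A k = x \<Longrightarrow> pr1 A x y \<cdot>\<^bsub>A\<^esub> in1 A x y \<cdot>\<^bsub>A\<^esub> k = k"
    "Cod A k = y \<Longrightarrow> pr2 A x y \<cdot>\<^bsub>A\<^esub> in2 A x y \<cdot>\<^bsub>A\<^esub> k = k"
    "Cod A k = x \<Longrightarrow> pr2 A x y \<cdot>\<^bsub>A\<^esub> in1 A x y \<cdot>\<^bsub>A\<^esub> k = Zer A (Dom A k) y"
    "Cod A k = y \<Longrightarrow> pr1 A x y \<cdot>\<^bsub>A\<^esub> in2 A x y \<cdot>\<^bsub>A\<^esub> k = Zer A (Dom A k) x"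
  using Cmp_assoc'[of k "in1 A x y" "pr1 A x y"] Cmp_assoc'[of k "in2 A x y" "pr2 A x y"]
    Cmp_assoc'[of k "in1 A x y" "pr2 A x y"] Cmp_assoc'[of k "in2 A x y" "pr1 A x y"] assms
  by simp_all

lemma bsum_decomposition:
  assumes "x \<in> Ob A" "y \<in> Ob A" "k \<in> Ar A" "Cod A k = bsum A x y"
  shows "in1 A x y \<cdot>\<^bsub>A\<^esub> pr1 A x y \<cdot>\<^bsub>A\<^esub> k \<oplus>\<^bsub>A\<^esub> in2 A x y \<cdot>\<^bsub>A\<^esub> pr2 A x y \<cdot>\<^bsub>A\<^esub> k = k"
  using Add_Cmp[of k "in1 A x y \<cdot>\<^bsub>A\<^esub> pr1 A x y" "in2 A x y \<cdot>\<^bsub>A\<^esub> pr2 A x y"] assms by simp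

lemma bsum_into_eq:
  assumes xy: "x \<in> Ob A" "y \<in> Ob A"
    and fg: "f \<in> Ar A" "g \<in> Ar A" "Cod A f = bsum A x y" "Cod A g = bsum A x y"
    and eq: "pr1 A x y \<cdot>\<^bsub>A\<^esub> f = pr1 A x y \<cdot>\<^bsub>A\<^esub> g" "pr2 A x y \<cdot>\<^bsub>A\<^esub> f = pr2 A x y \<cdot>\<^bsub>A\<^esub> g"
  shows "f = g"
  using bsum_decomposition[OF xy fg(1,3)] unfolding eq bsum_decomposition[OF xy fg(2,4)] ..

lemma bsum_from_eq:
  assumes xy: "x \<in> Ob A" "y \<in> Ob A"
    and fg: "f \<in> Ar A" "g \<in> Ar A" "Dom A f = bsum A x y" "Dom A g = bsum A x y"
    and eq: "f \<cdot>\<^bsub>A\<^esub> in1 A x y = g \<cdot>\<^bsub>A\<^esub> in1 A x y" "f \<cdot>\<^bsub>A\<^esub> in2 A x y = g \<cdot>\<^bsub>A\<^esub> in2 A x y"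
  shows "f = g"
proof -
  let ?p1 = "pr1 A x y" and ?p2 = "pr2 A x y" and ?i1 = "in1 A x y" and ?i2 = "in2 A x y"
  have d: "h = (h \<cdot>\<^bsub>A\<^esub> ?i1) \<cdot>\<^bsub>A\<^esub> ?p1 \<oplus>\<^bsub>A\<^esub> (h \<cdot>\<^bsub>A\<^esub> ?i2) \<cdot>\<^bsub>A\<^esub> ?p2"
    if "h \<in> Ar A" "Dom A h = bsum A x y" for h
    using Cmp_Add[of "?i1 \<cdot>\<^bsub>A\<^esub> ?p1" "?i2 \<cdot>\<^bsub>A\<^esub> ?p2" h] that xy by simp
  show ?thesis using d[OF fg(1,3)] d[OF fg(2,4)] unfolding eq by simp
qed

end

section \<open>Pullbacks, deflations and split conflations\<close>

lemma is_pullbackI: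
  assumes "p \<in> Ar A" "f \<in> Ar A" "f' \<in> Ar A" "p' \<in> Ar A" "Cod A f = Cod A p" "Cod A f' = Dom A p"
    "Dom A f' = Dom A p'" "Cod A p' = Dom A f" "p \<cdot>\<^bsub>A\<^esub> f' = f \<cdot>\<^bsub>A\<^esub> p'"
    and ex: "\<And>a b. a \<in> Ar A \<Longrightarrow> b \<in> Ar A \<Longrightarrow> Cod A a = Dom A p \<Longrightarrow> Cod A b = Dom A f \<Longrightarrow>
      Dom A a = Dom A b \<Longrightarrow> p \<cdot>\<^bsub>A\<^esub> a = f \<cdot>\<^bsub>A\<^esub> b \<Longrightarrow>
      \<exists>g. g \<in> Ar A \<and> Dom A g = Dom A b \<and> Cod A g = Dom A p' \<and> f' \<cdot>\<^bsub>A\<^esub> g = a \<and> p' \<cdot>\<^bsub>A\<^esub> g = b"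
    and uniq: "\<And>g h. g \<in> Ar A \<Longrightarrow> h \<in> Ar A \<Longrightarrow> Dom A g = Dom A h \<Longrightarrow> Cod A g = Dom A p' \<Longrightarrow>
      Cod A h = Dom A p' \<Longrightarrow> f' \<cdot>\<^bsub>A\<^esub> g = f' \<cdot>\<^bsub>A\<^esub> h \<Longrightarrow> p' \<cdot>\<^bsub>A\<^esub> g = p' \<cdot>\<^bsub>A\<^esub> h \<Longrightarrow> g = h"
  shows "is_pullback A p f f' p'"
  unfolding is_pullback_def
proof (intro conjI allI impI)
  fix a b w
  assume *: "a \<in> homset A w (Dom A p) \<and> b \<in> homset A w (Dom A f) \<and> p \<cdot>\<^bsub>A\<^esub> a = f \<cdot>\<^bsub>A\<^esub> b"
  obtain g where g: "g \<in> Ar A" "Dom A g = Dom A b" "Cod A g = Dom A p'" "f' \<cdot>\<^bsub>A\<^esub> g = a" "p' \<cdot>\<^bsub>A\<^esub> g = b"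
    using ex[of a b] * by (auto simp: homset_iff)
  show "\<exists>!g. g \<in> homset A w (Dom A p') \<and> f' \<cdot>\<^bsub>A\<^esub> g = a \<and> p' \<cdot>\<^bsub>A\<^esub> g = b"
  proof (rule ex1I[of _ g])
    show "g \<in> homset A w (Dom A p') \<and> f' \<cdot>\<^bsub>A\<^esub> g = a \<and> p' \<cdot>\<^bsub>A\<^esub> g = b"
      using g * by (simp add: homset_iff)
    show "h = g" if "h \<in> homset A w (Dom A p') \<and> f' \<cdot>\<^bsub>A\<^esub> h = a \<and> p' \<cdot>\<^bsub>A\<^esub> h = b" for h
      by (rule uniq) (use that g * in \<open>simp_all add: homset_iff\<close>)
  qed
qed (use assms in \<open>simp_all add: homset_iff\<close>)

lemma is_pullbackD:
  assumes "is_pullback A p f f' p'"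
  shows "p \<in> Ar A" "f \<in> Ar A" "f' \<in> Ar A" "p' \<in> Ar A" "Cod A f = Cod A p" "Cod A f' = Dom A p"
    "Dom A f' = Dom A p'" "Cod A p' = Dom A f" "p \<cdot>\<^bsub>A\<^esub> f' = f \<cdot>\<^bsub>A\<^esub> p'"
  using assms by (simp_all add: is_pullback_def homset_iff)

lemma is_pullback_ex:
  assumes "is_pullback A p f f' p'" "a \<in> Ar A" "b \<in> Ar A" "Cod A a = Dom A p" "Cod A b = Dom A f"
    "Dom A a = w" "Dom A b = w" "p \<cdot>\<^bsub>A\<^esub> a = f \<cdot>\<^bsub>A\<^esub> b"
  obtains g where "g \<in> Ar A" "Dom A g = w" "Cod A g = Dom A p'" "f' \<cdot>\<^bsub>A\<^esub> g = a" "p' \<cdot>\<^bsub>A\<^esub> g = b"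
proof -
  have "\<exists>!g. g \<in> homset A w (Dom A p') \<and> f' \<cdot>\<^bsub>A\<^esub> g = a \<and> p' \<cdot>\<^bsub>A\<^esub> g = b"
    using assms unfolding is_pullback_def homset_iff by blast
  then show thesis using that unfolding homset_iff by blast
qed

context exact_category
begin

lemma is_pullback_unique:
  assumes pb: "is_pullback A p f f' p'" and gh: "g \<in> Ar A" "h \<in> Ar A" "Dom A g = Dom A h"
    "Cod A g = Dom A p'" "Cod A h = Dom A p'"
    and eq: "f' \<cdot>\<^bsub>A\<^esub> g = f' \<cdot>\<^bsub>A\<^esub> h" "p' \<cdot>\<^bsub>A\<^esub> g = p' \<cdot>\<^bsub>A\<^esub> h"
  shows "g = h"
proof -
  note D = is_pullbackD[OF pb]
  have "p \<cdot>\<^bsub>A\<^esub> (f' \<cdot>\<^bsub>A\<^esub> h) = (p \<cdot>\<^bsub>A\<^esub> f') \<cdot>\<^bsub>A\<^esub> h" using D(1-8) gh by simp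
  also have "\<dots> = f \<cdot>\<^bsub>A\<^esub> (p' \<cdot>\<^bsub>A\<^esub> h)" unfolding D(9) using D(1-8) gh by simp
  finally have "p \<cdot>\<^bsub>A\<^esub> (f' \<cdot>\<^bsub>A\<^esub> h) = f \<cdot>\<^bsub>A\<^esub> (p' \<cdot>\<^bsub>A\<^esub> h)" .
  moreover have "f' \<cdot>\<^bsub>A\<^esub> h \<in> homset A (Dom A h) (Dom A p)" "p' \<cdot>\<^bsub>A\<^esub> h \<in> homset A (Dom A h) (Dom A f)"
    using D(1-8) gh by (simp_all add: homset_iff)
  ultimately have "\<exists>!k. k \<in> homset A (Dom A h) (Dom A p') \<and> f' \<cdot>\<^bsub>A\<^esub> k = f' \<cdot>\<^bsub>A\<^esub> h \<and> p' \<cdot>\<^bsub>A\<^esub> k = p' \<cdot>\<^bsub>A\<^esub> h"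
    using pb unfolding is_pullback_def by blast
  moreover have "g \<in> homset A (Dom A h) (Dom A p')" "h \<in> homset A (Dom A h) (Dom A p')"
    using gh by (simp_all add: homset_iff)
  ultimately show ?thesis using eq by blast
qed

text \<open>The identity is the deflation of some conflation; closure of conflations under
  isomorphism allows it to be replaced by \<open>f\<close>.\<close>

lemma is_iso_deflation: assumes "is_iso A f" shows "deflation A f"
proof -
  have f: "f \<in> Ar A" using assms by simp
  obtain i where i: "(i, Idt A (Dom A f)) \<in> Confl A"
    using deflation_Idt[of "Dom A f"] f by (auto simp: deflation_def)
  have i': "i \<in> Ar A" "Cod A i = Dom A f" using Confl_simps[OF i] f by simp_all
  have "(i, f) \<in> Confl A"
    by (rule Confl_iso[OF i, of "Idt A (Dom A i)" "Idt A (Dom A f)" f])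
      (use i' f assms in \<open>simp_all add: homset_iff\<close>)
  then show ?thesis by (auto simp: deflation_def)
qed

text \<open>The axiom provides some pullback whose projection is a deflation. The given
  \<open>p'\<close> differs from that projection by an isomorphism, and isomorphisms are
  deflations.\<close>

lemma deflation_of_pullback:
  assumes pb: "is_pullback A p f f' p'" and "deflation A p"
  shows "deflation A p'"
proof -
  note D = is_pullbackD[OF pb]
  obtain f2 p2 where pb2: "is_pullback A p f f2 p2" and p2: "deflation A p2"
    using deflation_pullback[OF assms(2) D(2,5)] by blast
  note D2 = is_pullbackD[OF pb2]
  obtain m where m: "m \<in> Ar A" "Dom A m = Dom A p'" "Cod A m = Dom A p2" "f2 \<cdot>\<^bsub>A\<^esub> m = f'" "p2 \<cdot>\<^bsub>A\<^esub> m = p'"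
    using is_pullback_ex[OF pb2 D(3,4,6,8,7) refl D(9)] .
  obtain n where n: "n \<in> Ar A" "Dom A n = Dom A p2" "Cod A n = Dom A p'" "f' \<cdot>\<^bsub>A\<^esub> n = f2" "p' \<cdot>\<^bsub>A\<^esub> n = p2"
    using is_pullback_ex[OF pb D2(3,4,6,8,7) refl D2(9)] .
  have "f' \<cdot>\<^bsub>A\<^esub> (n \<cdot>\<^bsub>A\<^esub> m) = (f' \<cdot>\<^bsub>A\<^esub> n) \<cdot>\<^bsub>A\<^esub> m" "p' \<cdot>\<^bsub>A\<^esub> (n \<cdot>\<^bsub>A\<^esub> m) = (p' \<cdot>\<^bsub>A\<^esub> n) \<cdot>\<^bsub>A\<^esub> m"
    using D m(1-3) n(1-3) by simp_all
  then have "f' \<cdot>\<^bsub>A\<^esub> (n \<cdot>\<^bsub>A\<^esub> m) = f' \<cdot>\<^bsub>A\<^esub> Idt A (Dom A p')" "p' \<cdot>\<^bsub>A\<^esub> (n \<cdot>\<^bsub>A\<^esub> m) = p' \<cdot>\<^bsub>A\<^esub> Idt A (Dom A p')"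
    unfolding n(4,5) m(4,5) using D by simp_all
  then have nm: "n \<cdot>\<^bsub>A\<^esub> m = Idt A (Dom A p')"
    by (rule is_pullback_unique[OF pb, rotated 5]) (use D m(1-3) n(1-3) in simp_all)
  have "f2 \<cdot>\<^bsub>A\<^esub> (m \<cdot>\<^bsub>A\<^esub> n) = (f2 \<cdot>\<^bsub>A\<^esub> m) \<cdot>\<^bsub>A\<^esub> n" "p2 \<cdot>\<^bsub>A\<^esub> (m \<cdot>\<^bsub>A\<^esub> n) = (p2 \<cdot>\<^bsub>A\<^esub> m) \<cdot>\<^bsub>A\<^esub> n"
    using D2 m(1-3) n(1-3) by simp_all
  then have "f2 \<cdot>\<^bsub>A\<^esub> (m \<cdot>\<^bsub>A\<^esub> n) = f2 \<cdot>\<^bsub>A\<^esub> Idt A (Dom A p2)" "p2 \<cdot>\<^bsub>A\<^esub> (m \<cdot>\<^bsub>A\<^esub> n) = p2 \<cdot>\<^bsub>A\<^esub> Idt A (Dom A p2)"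
    unfolding n(4,5) m(4,5) using D2 by simp_all
  then have mn: "m \<cdot>\<^bsub>A\<^esub> n = Idt A (Dom A p2)"
    by (rule is_pullback_unique[OF pb2, rotated 5]) (use D2 m(1-3) n(1-3) in simp_all)
  have "is_iso A m" using mn nm m(1-3) n(1-3) by (intro is_isoI[of m n]) simp_all
  then have "deflation A (p2 \<cdot>\<^bsub>A\<^esub> m)" by (rule deflation_Cmp[OF is_iso_deflation p2 m(3)])
  then show ?thesis unfolding m(5) .
qed

lemma is_kernelI:
  assumes "i \<in> Ar A" "p \<in> Ar A" "Cod A i = Dom A p" "p \<cdot>\<^bsub>A\<^esub> i = Zer A (Dom A i) (Cod A p)"
    and ex: "\<And>f. f \<in> Ar A \<Longrightarrow> Cod A f = Dom A p \<Longrightarrow> p \<cdot>\<^bsub>A\<^esub> f = Zer A (Dom A f) (Cod A p) \<Longrightarrow>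
      \<exists>g. g \<in> Ar A \<and> Dom A g = Dom A f \<and> Cod A g = Dom A i \<and> i \<cdot>\<^bsub>A\<^esub> g = f"
    and uniq: "\<And>g h. g \<in> Ar A \<Longrightarrow> h \<in> Ar A \<Longrightarrow> Dom A g = Dom A h \<Longrightarrow> Cod A g = Dom A i \<Longrightarrow>
      Cod A h = Dom A i \<Longrightarrow> i \<cdot>\<^bsub>A\<^esub> g = i \<cdot>\<^bsub>A\<^esub> h \<Longrightarrow> g = h"
  shows "is_kernel A i p"
  unfolding is_kernel_def
proof (intro conjI ballI impI)
  fix f assume *: "f \<in> Ar A" "Cod A f = Dom A p \<and> p \<cdot>\<^bsub>A\<^esub> f = Zer A (Dom A f) (Cod A p)"
  obtain g where g: "g \<in> Ar A" "Dom A g = Dom A f" "Cod A g = Dom A i" "i \<cdot>\<^bsub>A\<^esub> g = f"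
    using ex[of f] * by auto
  show "\<exists>!g. g \<in> homset A (Dom A f) (Dom A i) \<and> i \<cdot>\<^bsub>A\<^esub> g = f"
  proof (rule ex1I[of _ g])
    show "h = g" if "h \<in> homset A (Dom A f) (Dom A i) \<and> i \<cdot>\<^bsub>A\<^esub> h = f" for h
      by (rule uniq) (use that g * in \<open>simp_all add: homset_iff\<close>)
  qed (use g in \<open>simp add: homset_iff\<close>)
qed (use assms in simp_all)

text \<open>Two kernels of \<open>p\<close> differ by an isomorphism of their sources, and
  conflations are closed under isomorphism.\<close>

lemma Confl_if_deflation_kernel:
  assumes "deflation A p" and k: "is_kernel A k p"
  shows "(k, p) \<in> Confl A"
proof -
  obtain i where ip: "(i, p) \<in> Confl A" using assms(1) by (auto simp: deflation_def)
  have i: "i \<in> Ar A" "p \<in> Ar A" "Dom A p = Cod A i" "p \<cdot>\<^bsub>A\<^esub> i = Zer A (Dom A i) (Cod A p)"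
    using ip by simp_all
  have k': "k \<in> Ar A" "Cod A k = Cod A i" "p \<cdot>\<^bsub>A\<^esub> k = Zer A (Dom A k) (Cod A p)"
    using k i(3) by (simp_all add: is_kernel_def)
  obtain m where m: "m \<in> Ar A" "Dom A m = Dom A k" "Cod A m = Dom A i" "i \<cdot>\<^bsub>A\<^esub> m = k"
    using Confl_lift[OF ip k'(1,2) refl k'(3)] .
  have "\<exists>!n. n \<in> homset A (Dom A i) (Dom A k) \<and> k \<cdot>\<^bsub>A\<^esub> n = i"
    using k i by (simp add: is_kernel_def)
  then obtain n where n: "n \<in> Ar A" "Dom A n = Dom A i" "Cod A n = Dom A k" "k \<cdot>\<^bsub>A\<^esub> n = i"
    by (auto simp: homset_iff)
  have "i \<cdot>\<^bsub>A\<^esub> m \<cdot>\<^bsub>A\<^esub> n = (i \<cdot>\<^bsub>A\<^esub> m) \<cdot>\<^bsub>A\<^esub> n" using i m(1-3) n(1-3) by simp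
  also have "\<dots> = i \<cdot>\<^bsub>A\<^esub> Idt A (Dom A i)" unfolding m(4) n(4) using i by simp
  finally have mn: "m \<cdot>\<^bsub>A\<^esub> n = Idt A (Dom A i)"
    by (rule Confl_mono[OF ip, rotated 5]) (use i m(1-3) n(1-3) in simp_all)
  have kn: "k \<cdot>\<^bsub>A\<^esub> n \<cdot>\<^bsub>A\<^esub> m = k"
  proof -
    have "k \<cdot>\<^bsub>A\<^esub> n \<cdot>\<^bsub>A\<^esub> m = (k \<cdot>\<^bsub>A\<^esub> n) \<cdot>\<^bsub>A\<^esub> m" using k' m(1-3) n(1-3) by simp
    then show ?thesis unfolding n(4) m(4) .
  qed
  have "\<exists>!n. n \<in> homset A (Dom A k) (Dom A k) \<and> k \<cdot>\<^bsub>A\<^esub> n = k"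
    using k k' i by (simp add: is_kernel_def)
  moreover have "n \<cdot>\<^bsub>A\<^esub> m \<in> homset A (Dom A k) (Dom A k)" "Idt A (Dom A k) \<in> homset A (Dom A k) (Dom A k)"
    "k \<cdot>\<^bsub>A\<^esub> Idt A (Dom A k) = k"
    using m(1-3) n(1-3) k' by (simp_all add: homset_iff)
  ultimately have nm: "n \<cdot>\<^bsub>A\<^esub> m = Idt A (Dom A k)" using kn by blast
  have "is_iso A n" using mn nm m(1-3) n(1-3) by (intro is_isoI[of n m]) simp_all
  then show ?thesis
    by (intro Confl_iso[OF ip, of n "Idt A (Cod A i)" "Idt A (Cod A p)"])
      (use i k' n in \<open>simp_all add: homset_iff\<close>)
qed

text \<open>A cokernel of an identity has a zero object as target: \<open>p0\<close> is both zero
  and epic, so the identity of its target vanishes. In the form given by the last clause, pullbacks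
  over that target become products.\<close>

lemma zero_deflation:
  assumes "y \<in> Ob A"
  obtains p0 where "p0 \<in> Ar A" "Dom A p0 = y" "deflation A p0"
    "\<And>f g. f \<in> Ar A \<Longrightarrow> g \<in> Ar A \<Longrightarrow> Dom A f = Dom A g \<Longrightarrow> Cod A f = Cod A p0 \<Longrightarrow>
      Cod A g = Cod A p0 \<Longrightarrow> f = g"
proof -
  obtain p0 where c: "(Idt A y, p0) \<in> Confl A"
    using inflation_Idt[OF assms] by (auto simp: inflation_def)
  have p0: "p0 \<in> Ar A" "Dom A p0 = y" "p0 \<cdot>\<^bsub>A\<^esub> Idt A y = Zer A y (Cod A p0)"
    using Confl_simps[OF c] assms by simp_all
  then have z: "p0 = Zer A y (Cod A p0)" by simp
  have "Idt A (Cod A p0) \<cdot>\<^bsub>A\<^esub> p0 = Zer A (Cod A p0) (Cod A p0) \<cdot>\<^bsub>A\<^esub> p0"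
    using p0 z by simp
  then have i: "Idt A (Cod A p0) = Zer A (Cod A p0) (Cod A p0)"
    by (rule Confl_epi[OF c, rotated 5]) (use p0 in simp_all)
  have "f = Zer A (Dom A f) (Cod A p0)" if "f \<in> Ar A" "Cod A f = Cod A p0" for f
  proof -
    have "f = Idt A (Cod A p0) \<cdot>\<^bsub>A\<^esub> f" using that by simp
    also have "\<dots> = Zer A (Dom A f) (Cod A p0)" unfolding i using that p0 by simp
    finally show ?thesis .
  qed
  then show thesis using that[of p0] p0 c unfolding deflation_def by metis
qed

text \<open>The equations present \<open>Cod A i\<close> as a product of \<open>Dom A i\<close> and
  \<open>Cod A p\<close>, so \<open>p\<close> is a pullback of the deflation from
  \<open>Dom A i\<close> to a zero object. Conflations of complexes that split in each degree are
  thereby reduced to finite biproduct identities.\<close>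

lemma split_conflation:
  assumes ip: "i \<in> Ar A" "p \<in> Ar A" "Dom A p = Cod A i" "p \<cdot>\<^bsub>A\<^esub> i = Zer A (Dom A i) (Cod A p)"
    and r: "r \<in> Ar A" "Dom A r = Cod A i" "Cod A r = Dom A i" "r \<cdot>\<^bsub>A\<^esub> i = Idt A (Dom A i)"
    and s: "s \<in> Ar A" "Dom A s = Cod A p" "Cod A s = Cod A i" "p \<cdot>\<^bsub>A\<^esub> s = Idt A (Cod A p)"
    and rs: "r \<cdot>\<^bsub>A\<^esub> s = Zer A (Cod A p) (Dom A i)"
    and sum: "i \<cdot>\<^bsub>A\<^esub> r \<oplus>\<^bsub>A\<^esub> s \<cdot>\<^bsub>A\<^esub> p = Idt A (Cod A i)"
  shows "(i, p) \<in> Confl A"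
proof (rule Confl_if_deflation_kernel)
  have o: "Dom A i \<in> Ob A" "Cod A p \<in> Ob A" using ip by simp_all
  note c = Cmp_inverse_cancel[OF ip(1) r(1,2,4)] Cmp_inverse_cancel[OF s(1) ip(2)]
  have c0: "p \<cdot>\<^bsub>A\<^esub> i \<cdot>\<^bsub>A\<^esub> k = Zer A (Dom A k) (Cod A p)" if "k \<in> Ar A" "Cod A k = Dom A i" for k
    using Cmp_assoc'[of k i p] ip that o by simp
  have c1: "r \<cdot>\<^bsub>A\<^esub> s \<cdot>\<^bsub>A\<^esub> k = Zer A (Dom A k) (Dom A i)" if "k \<in> Ar A" "Cod A k = Cod A p" for k
    using Cmp_assoc'[of k s r] r s rs that o by simp
  have dec: "k = i \<cdot>\<^bsub>A\<^esub> (r \<cdot>\<^bsub>A\<^esub> k) \<oplus>\<^bsub>A\<^esub> s \<cdot>\<^bsub>A\<^esub> (p \<cdot>\<^bsub>A\<^esub> k)" if "k \<in> Ar A" "Cod A k = Cod A i" for k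
    using Add_Cmp[of k "i \<cdot>\<^bsub>A\<^esub> r" "s \<cdot>\<^bsub>A\<^esub> p"] ip(1-3) r(1-3) s(1-3) that sum by simp
  show "deflation A p"
  proof -
    obtain p0 where p0: "p0 \<in> Ar A" "Dom A p0 = Dom A i" "deflation A p0"
      and uniq: "\<And>f g. f \<in> Ar A \<Longrightarrow> g \<in> Ar A \<Longrightarrow> Dom A f = Dom A g \<Longrightarrow> Cod A f = Cod A p0 \<Longrightarrow>
        Cod A g = Cod A p0 \<Longrightarrow> f = g"
      by (rule zero_deflation[OF o(1)]) blast
    have "is_pullback A p0 (Zer A (Cod A p) (Cod A p0)) r p"
    proof (rule is_pullbackI)
      show "p0 \<cdot>\<^bsub>A\<^esub> r = Zer A (Cod A p) (Cod A p0) \<cdot>\<^bsub>A\<^esub> p"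
        by (rule uniq) (use ip r p0 o in simp_all)
      fix a b assume ab: "a \<in> Ar A" "b \<in> Ar A" "Cod A a = Dom A p0"
        "Cod A b = Dom A (Zer A (Cod A p) (Cod A p0))" "Dom A a = Dom A b"
      show "\<exists>g. g \<in> Ar A \<and> Dom A g = Dom A b \<and> Cod A g = Dom A p \<and> r \<cdot>\<^bsub>A\<^esub> g = a \<and> p \<cdot>\<^bsub>A\<^esub> g = b"
        by (rule exI[of _ "i \<cdot>\<^bsub>A\<^esub> a \<oplus>\<^bsub>A\<^esub> s \<cdot>\<^bsub>A\<^esub> b"])
          (use ab ip(1-3) r(1-3) s p0(1,2) o in \<open>simp add: c c0 c1\<close>)
    next
      fix g h assume gh: "g \<in> Ar A" "h \<in> Ar A" "Dom A g = Dom A h" "Cod A g = Dom A p"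
        "Cod A h = Dom A p" and eq: "r \<cdot>\<^bsub>A\<^esub> g = r \<cdot>\<^bsub>A\<^esub> h" "p \<cdot>\<^bsub>A\<^esub> g = p \<cdot>\<^bsub>A\<^esub> h"
      show "g = h" using dec[of g] dec[of h] gh ip(3) unfolding eq by simp
    qed (use ip r p0 o in simp_all)
    then show ?thesis using p0(3) by (rule deflation_of_pullback)
  qed
  show "is_kernel A i p"
  proof (rule is_kernelI)
    fix f assume f: "f \<in> Ar A" "Cod A f = Dom A p" "p \<cdot>\<^bsub>A\<^esub> f = Zer A (Dom A f) (Cod A p)"
    have "f = i \<cdot>\<^bsub>A\<^esub> r \<cdot>\<^bsub>A\<^esub> f" using dec[of f] f ip r s by simp
    then show "\<exists>g. g \<in> Ar A \<and> Dom A g = Dom A f \<and> Cod A g = Dom A i \<and> i \<cdot>\<^bsub>A\<^esub> g = f"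
      by (intro exI[of _ "r \<cdot>\<^bsub>A\<^esub> f"]) (use f ip r in simp)
  next
    fix g h assume gh: "g \<in> Ar A" "h \<in> Ar A" "Dom A g = Dom A h" "Cod A g = Dom A i"
        "Cod A h = Dom A i" and eq: "i \<cdot>\<^bsub>A\<^esub> g = i \<cdot>\<^bsub>A\<^esub> h"
    show "g = h" using c(1)[of g] c(1)[of h] gh unfolding eq by simp
  qed (use ip in simp_all)
qed

text \<open>One degree of the mapping cone of a map \<open>u\<close> of acyclic complexes.  The cocycles of the cone
  in degree \<open>0\<close> are the pairs \<open>(y, z)\<close> with \<open>q0 y + g1 z = 0\<close>, that is, the pullback \<open>k0\<close> of \<open>q0\<close>
  along \<open>- g1\<close>.  The map from the cone to the next cocycles \<open>k1\<close> is a deflation because it is a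
  pullback of \<open>q0\<close> followed by a pullback of \<open>- p1\<close>.\<close>

lemma cone_conflation:
  assumes W: "(j0, q0) \<in> Confl A" "(j1, q1) \<in> Confl A" "Dom A j1 = Cod A q0"
    and Z: "(i1, p1) \<in> Confl A"
    and u: "u \<in> Ar A" "Dom A u = Cod A i1" "Cod A u = Cod A j1"
    and g1: "g1 \<in> Ar A" "Dom A g1 = Dom A i1" "Cod A g1 = Dom A j1" "j1 \<cdot>\<^bsub>A\<^esub> g1 = u \<cdot>\<^bsub>A\<^esub> i1"
    and g2: "g2 \<in> Ar A" "Dom A g2 = Cod A p1" "Cod A g2 = Cod A q1" "g2 \<cdot>\<^bsub>A\<^esub> p1 = q1 \<cdot>\<^bsub>A\<^esub> u"
    and k0: "is_pullback A q0 (\<ominus>\<^bsub>A\<^esub> g1) f0 h0"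
    and k1: "is_pullback A q1 (\<ominus>\<^bsub>A\<^esub> g2) f1 h1" and h1: "deflation A h1"
  defines "y \<equiv> Cod A j0" and "x \<equiv> Cod A i1"
  obtains r where "r \<in> Ar A" "Dom A r = bsum A y x" "Cod A r = Dom A h1"
    "f1 \<cdot>\<^bsub>A\<^esub> r = j1 \<cdot>\<^bsub>A\<^esub> q0 \<cdot>\<^bsub>A\<^esub> pr1 A y x \<oplus>\<^bsub>A\<^esub> u \<cdot>\<^bsub>A\<^esub> pr2 A y x"
    "h1 \<cdot>\<^bsub>A\<^esub> r = \<ominus>\<^bsub>A\<^esub> (p1 \<cdot>\<^bsub>A\<^esub> pr2 A y x)"
    "(in1 A y x \<cdot>\<^bsub>A\<^esub> f0 \<oplus>\<^bsub>A\<^esub> in2 A y x \<cdot>\<^bsub>A\<^esub> i1 \<cdot>\<^bsub>A\<^esub> h0, r) \<in> Confl A"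
proof -
  have c: "j0 \<in> Ar A" "q0 \<in> Ar A" "Dom A q0 = y" "j1 \<in> Ar A" "q1 \<in> Ar A" "Dom A q1 = Cod A j1"
    "i1 \<in> Ar A" "p1 \<in> Ar A" "Dom A p1 = x" "Cod A i1 = x" "Cod A j0 = y"
    using W(1,2) Z by (simp_all add: y_def x_def)
  have z: "q1 \<cdot>\<^bsub>A\<^esub> j1 = Zer A (Dom A j1) (Cod A q1)" "p1 \<cdot>\<^bsub>A\<^esub> i1 = Zer A (Dom A i1) (Cod A p1)"
    using W(2) Z by simp_all
  have o: "y \<in> Ob A" "x \<in> Ob A" "Dom A j1 \<in> Ob A" "Dom A i1 \<in> Ob A" "Cod A p1 \<in> Ob A" "Cod A q1 \<in> Ob A"
    "Cod A j1 \<in> Ob A"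
    using c Dom_Ob[of q0] Dom_Ob[of p1] by simp_all
  note cz = o c(1-9) W(3) u[unfolded c(10)] g1(1-3) g2(1-3)
  note D0 = is_pullbackD[OF k0] and D1 = is_pullbackD[OF k1]
  have d0: "f0 \<in> Ar A" "h0 \<in> Ar A" "Cod A f0 = y" "Dom A f0 = Dom A h0" "Cod A h0 = Dom A i1"
    using D0(3,4,6-8) c g1 by simp_all
  have d1: "f1 \<in> Ar A" "h1 \<in> Ar A" "Cod A f1 = Cod A j1" "Dom A f1 = Dom A h1" "Cod A h1 = Cod A p1"
    using D1(3,4,6-8) c g2 by simp_all
  have qj: "q1 \<cdot>\<^bsub>A\<^esub> j1 \<cdot>\<^bsub>A\<^esub> t = Zer A (Dom A t) (Cod A q1)" if "t \<in> Ar A" "Cod A t = Dom A j1" for t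
    using Cmp_assoc'[of t j1 q1] that cz z by simp
  have gp: "g2 \<cdot>\<^bsub>A\<^esub> p1 \<cdot>\<^bsub>A\<^esub> t = q1 \<cdot>\<^bsub>A\<^esub> u \<cdot>\<^bsub>A\<^esub> t" if "t \<in> Ar A" "Cod A t = x" for t
    using Cmp_assoc'[of t p1 g2] Cmp_assoc'[of t u q1] that cz g2(4) by simp
  have jg: "j1 \<cdot>\<^bsub>A\<^esub> g1 \<cdot>\<^bsub>A\<^esub> t = u \<cdot>\<^bsub>A\<^esub> i1 \<cdot>\<^bsub>A\<^esub> t" if "t \<in> Ar A" "Cod A t = Dom A i1" for t
    using Cmp_assoc'[of t g1 j1] Cmp_assoc'[of t i1 u] that cz c(10) g1(4) by simp
  have pi: "p1 \<cdot>\<^bsub>A\<^esub> i1 \<cdot>\<^bsub>A\<^esub> t = Zer A (Dom A t) (Cod A p1)" if "t \<in> Ar A" "Cod A t = Dom A i1" for t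
    using Cmp_assoc'[of t i1 p1] that cz c(10) z by simp
  have sq0: "q0 \<cdot>\<^bsub>A\<^esub> f0 \<cdot>\<^bsub>A\<^esub> t = \<ominus>\<^bsub>A\<^esub> (g1 \<cdot>\<^bsub>A\<^esub> h0 \<cdot>\<^bsub>A\<^esub> t)" if "t \<in> Ar A" "Cod A t = Dom A h0" for t
    using Cmp_assoc'[of t f0 q0] D0(9) that cz d0 by simp
  have sq1: "q1 \<cdot>\<^bsub>A\<^esub> f1 \<cdot>\<^bsub>A\<^esub> t = \<ominus>\<^bsub>A\<^esub> (g2 \<cdot>\<^bsub>A\<^esub> h1 \<cdot>\<^bsub>A\<^esub> t)" if "t \<in> Ar A" "Cod A t = Dom A h1" for t
    using Cmp_assoc'[of t f1 q1] D1(9) that cz d1 by simp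
  let ?s = "bsum A y x" and ?i1 = "in1 A y x" and ?i2 = "in2 A y x"
    and ?p1 = "pr1 A y x" and ?p2 = "pr2 A y x"
  let ?a = "j1 \<cdot>\<^bsub>A\<^esub> q0 \<cdot>\<^bsub>A\<^esub> ?p1 \<oplus>\<^bsub>A\<^esub> u \<cdot>\<^bsub>A\<^esub> ?p2" and ?b = "\<ominus>\<^bsub>A\<^esub> (p1 \<cdot>\<^bsub>A\<^esub> ?p2)"
  let ?k = "?i1 \<cdot>\<^bsub>A\<^esub> f0 \<oplus>\<^bsub>A\<^esub> ?i2 \<cdot>\<^bsub>A\<^esub> i1 \<cdot>\<^bsub>A\<^esub> h0"
  have ab: "?a \<in> Ar A" "?b \<in> Ar A" "Cod A ?a = Dom A q1" "Cod A ?b = Dom A (\<ominus>\<^bsub>A\<^esub> g2)"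
    "Dom A ?a = ?s" "Dom A ?b = ?s" "q1 \<cdot>\<^bsub>A\<^esub> ?a = \<ominus>\<^bsub>A\<^esub> g2 \<cdot>\<^bsub>A\<^esub> ?b"
    by (simp_all add: cz qj gp)
  obtain r where r: "r \<in> Ar A" "Dom A r = ?s" "Cod A r = Dom A h1" and fr: "f1 \<cdot>\<^bsub>A\<^esub> r = ?a"
    and hr: "h1 \<cdot>\<^bsub>A\<^esub> r = ?b"
    using is_pullback_ex[OF k1 ab] .
  have k: "?k \<in> Ar A" "Dom A ?k = Dom A h0" "Cod A ?k = ?s"
    by (simp_all add: cz d0 c(10))
  have fr': "f1 \<cdot>\<^bsub>A\<^esub> r \<cdot>\<^bsub>A\<^esub> t = j1 \<cdot>\<^bsub>A\<^esub> q0 \<cdot>\<^bsub>A\<^esub> ?p1 \<cdot>\<^bsub>A\<^esub> t \<oplus>\<^bsub>A\<^esub> u \<cdot>\<^bsub>A\<^esub> ?p2 \<cdot>\<^bsub>A\<^esub> t"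
    and hr': "h1 \<cdot>\<^bsub>A\<^esub> r \<cdot>\<^bsub>A\<^esub> t = \<ominus>\<^bsub>A\<^esub> (p1 \<cdot>\<^bsub>A\<^esub> ?p2 \<cdot>\<^bsub>A\<^esub> t)"
    if "t \<in> Ar A" "Cod A t = ?s" for t
    using Cmp_assoc'[of t r f1] Cmp_assoc'[of t r h1] that cz d1 r by (simp_all add: fr hr)
  have "deflation A r"
  proof -
    have "deflation A (\<ominus>\<^bsub>A\<^esub> p1)"
    proof -
      have "deflation A (\<ominus>\<^bsub>A\<^esub> Idt A (Cod A p1) \<cdot>\<^bsub>A\<^esub> p1)"
      proof (rule deflation_Cmp)
        show "deflation A p1" using Z by (auto simp: deflation_def)
        show "deflation A (\<ominus>\<^bsub>A\<^esub> Idt A (Cod A p1))" using o by (intro is_iso_deflation is_iso_Neg) simp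
      qed (use o in simp)
      then show ?thesis using c o by simp
    qed
    then have "\<exists>b a. is_pullback A (\<ominus>\<^bsub>A\<^esub> p1) h1 b a \<and> deflation A a"
      by (rule deflation_pullback) (simp_all add: cz d1)
    then obtain a b where pb: "is_pullback A (\<ominus>\<^bsub>A\<^esub> p1) h1 b a" and a: "deflation A a" by blast
    note D = is_pullbackD[OF pb]
    have d: "a \<in> Ar A" "b \<in> Ar A" "Cod A a = Dom A h1" "Cod A b = x" "Dom A b = Dom A a"
      using D c by simp_all
    have sq: "h1 \<cdot>\<^bsub>A\<^esub> a \<cdot>\<^bsub>A\<^esub> t = \<ominus>\<^bsub>A\<^esub> (p1 \<cdot>\<^bsub>A\<^esub> b \<cdot>\<^bsub>A\<^esub> t)" if "t \<in> Ar A" "Cod A t = Dom A a" for t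
      using Cmp_assoc'[of t a h1] Cmp_assoc'[of t b "\<ominus>\<^bsub>A\<^esub> p1"] D(9) that cz d d1 by simp
    obtain m where m: "m \<in> Ar A" "Dom A m = ?s" "Cod A m = Dom A a" "b \<cdot>\<^bsub>A\<^esub> m = ?p2" "a \<cdot>\<^bsub>A\<^esub> m = r"
      by (rule is_pullback_ex[OF pb, of ?p2 r ?s]) (simp_all add: cz r hr d1)
    have m': "b \<cdot>\<^bsub>A\<^esub> m \<cdot>\<^bsub>A\<^esub> t = ?p2 \<cdot>\<^bsub>A\<^esub> t" "a \<cdot>\<^bsub>A\<^esub> m \<cdot>\<^bsub>A\<^esub> t = r \<cdot>\<^bsub>A\<^esub> t"
      if "t \<in> Ar A" "Cod A t = ?s" for t
      using Cmp_assoc'[of t m b] Cmp_assoc'[of t m a] that cz d m by simp_all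
    \<comment> \<open>Construction of the map along which \<open>q0\<close> is pulled back. Over
      \<open>a\<close> there is a next cocycle together with a lift \<open>b\<close> of its second
      component; subtracting \<open>u b\<close> from the first component leaves a map killed by
      \<open>q1\<close>, hence a map \<open>l\<close> into the kernel \<open>j1\<close>.\<close>
    let ?e = "f1 \<cdot>\<^bsub>A\<^esub> a \<oplus>\<^bsub>A\<^esub> \<ominus>\<^bsub>A\<^esub> (u \<cdot>\<^bsub>A\<^esub> b)"
    have e: "?e \<in> Ar A" "Dom A ?e = Dom A a" "Cod A ?e = Cod A j1" by (simp_all add: cz d d1)
    have "g2 \<cdot>\<^bsub>A\<^esub> h1 \<cdot>\<^bsub>A\<^esub> a = \<ominus>\<^bsub>A\<^esub> (q1 \<cdot>\<^bsub>A\<^esub> u \<cdot>\<^bsub>A\<^esub> b)"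
      using D(9)[symmetric] by (simp add: cz d d1 gp)
    then have "q1 \<cdot>\<^bsub>A\<^esub> ?e = Zer A (Dom A a) (Cod A q1)"
      by (simp add: cz d d1 sq1)
    then obtain l where l: "l \<in> Ar A" "Dom A l = Dom A a" "Cod A l = Dom A j1" "j1 \<cdot>\<^bsub>A\<^esub> l = ?e"
      using Confl_lift[OF W(2) e(1,3,2)] by blast
    have jl: "j1 \<cdot>\<^bsub>A\<^esub> l \<cdot>\<^bsub>A\<^esub> t = f1 \<cdot>\<^bsub>A\<^esub> a \<cdot>\<^bsub>A\<^esub> t \<oplus>\<^bsub>A\<^esub> \<ominus>\<^bsub>A\<^esub> (u \<cdot>\<^bsub>A\<^esub> b \<cdot>\<^bsub>A\<^esub> t)"
      if "t \<in> Ar A" "Cod A t = Dom A a" for t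
      using Cmp_assoc'[of t l j1] that cz d d1 l by simp
    have "is_pullback A q0 l ?p1 m"
    proof (rule is_pullbackI)
      show "q0 \<cdot>\<^bsub>A\<^esub> ?p1 = l \<cdot>\<^bsub>A\<^esub> m"
      proof (rule Confl_mono[OF W(2)])
        show "j1 \<cdot>\<^bsub>A\<^esub> q0 \<cdot>\<^bsub>A\<^esub> ?p1 = j1 \<cdot>\<^bsub>A\<^esub> l \<cdot>\<^bsub>A\<^esub> m"
          by (simp add: jl m cz fr)
      qed (simp_all add: cz l m)
    next
      fix s t assume st: "s \<in> Ar A" "t \<in> Ar A" "Cod A s = Dom A q0" "Cod A t = Dom A l"
        "Dom A s = Dom A t" "q0 \<cdot>\<^bsub>A\<^esub> s = l \<cdot>\<^bsub>A\<^esub> t"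
      have st': "Cod A s = y" "Cod A t = Dom A a" using st c l by simp_all
      let ?v = "?i1 \<cdot>\<^bsub>A\<^esub> s \<oplus>\<^bsub>A\<^esub> ?i2 \<cdot>\<^bsub>A\<^esub> b \<cdot>\<^bsub>A\<^esub> t"
      have v: "?v \<in> Ar A" "Dom A ?v = Dom A t" "Cod A ?v = ?s"
        using st(1,2,5) by (simp_all add: st' cz d)
      have pv: "?p1 \<cdot>\<^bsub>A\<^esub> ?v = s" "?p2 \<cdot>\<^bsub>A\<^esub> ?v = b \<cdot>\<^bsub>A\<^esub> t"
        using st(1,2,5) by (simp_all add: st' cz d)
      have jls: "j1 \<cdot>\<^bsub>A\<^esub> q0 \<cdot>\<^bsub>A\<^esub> s = f1 \<cdot>\<^bsub>A\<^esub> a \<cdot>\<^bsub>A\<^esub> t \<oplus>\<^bsub>A\<^esub> \<ominus>\<^bsub>A\<^esub> (u \<cdot>\<^bsub>A\<^esub> b \<cdot>\<^bsub>A\<^esub> t)"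
        unfolding st(6) using st(2) st'(2) by (rule jl)
      have rv: "r \<cdot>\<^bsub>A\<^esub> ?v = a \<cdot>\<^bsub>A\<^esub> t"
      proof (rule is_pullback_unique[OF k1])
        show "f1 \<cdot>\<^bsub>A\<^esub> r \<cdot>\<^bsub>A\<^esub> ?v = f1 \<cdot>\<^bsub>A\<^esub> a \<cdot>\<^bsub>A\<^esub> t"
          unfolding fr'[OF v(1,3)] pv jls using st(1,2,5) by (simp add: st' cz d d1)
        show "h1 \<cdot>\<^bsub>A\<^esub> r \<cdot>\<^bsub>A\<^esub> ?v = h1 \<cdot>\<^bsub>A\<^esub> a \<cdot>\<^bsub>A\<^esub> t"
          unfolding hr'[OF v(1,3)] pv using st(1,2,5) by (simp add: st' sq)
        show "r \<cdot>\<^bsub>A\<^esub> ?v \<in> Ar A" "Cod A (r \<cdot>\<^bsub>A\<^esub> ?v) = Dom A h1"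
          "Dom A (r \<cdot>\<^bsub>A\<^esub> ?v) = Dom A (a \<cdot>\<^bsub>A\<^esub> t)"
          using r v st d st' by (simp_all del: Cmp_Add)
      qed (use r d st st' in simp_all)
      have "m \<cdot>\<^bsub>A\<^esub> ?v = t"
      proof (rule is_pullback_unique[OF pb])
        show "b \<cdot>\<^bsub>A\<^esub> m \<cdot>\<^bsub>A\<^esub> ?v = b \<cdot>\<^bsub>A\<^esub> t" unfolding m'(1)[OF v(1,3)] pv ..
        show "a \<cdot>\<^bsub>A\<^esub> m \<cdot>\<^bsub>A\<^esub> ?v = a \<cdot>\<^bsub>A\<^esub> t" unfolding m'(2)[OF v(1,3)] rv ..
        show "m \<cdot>\<^bsub>A\<^esub> ?v \<in> Ar A" "Cod A (m \<cdot>\<^bsub>A\<^esub> ?v) = Dom A a" "Dom A (m \<cdot>\<^bsub>A\<^esub> ?v) = Dom A t"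
          using m v by (simp_all del: Cmp_Add)
      qed (use st st' in simp_all)
      then show "\<exists>v. v \<in> Ar A \<and> Dom A v = Dom A t \<and> Cod A v = Dom A m \<and> ?p1 \<cdot>\<^bsub>A\<^esub> v = s \<and> m \<cdot>\<^bsub>A\<^esub> v = t"
        using v pv m(2) by (intro exI[of _ ?v]) simp
    next
      fix v w assume vw: "v \<in> Ar A" "w \<in> Ar A" "Dom A v = Dom A w" "Cod A v = Dom A m"
        "Cod A w = Dom A m" "?p1 \<cdot>\<^bsub>A\<^esub> v = ?p1 \<cdot>\<^bsub>A\<^esub> w" "m \<cdot>\<^bsub>A\<^esub> v = m \<cdot>\<^bsub>A\<^esub> w"
      then have "?p2 \<cdot>\<^bsub>A\<^esub> v = ?p2 \<cdot>\<^bsub>A\<^esub> w"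
        using m'(1)[of v] m'(1)[of w] m(2) by simp
      then show "v = w" by (rule bsum_into_eq[OF o(1,2), rotated 5]) (use vw m(2) in simp_all)
    qed (simp_all add: cz l m)
    then have "deflation A m" by (rule deflation_of_pullback) (use W in \<open>auto simp: deflation_def\<close>)
    then have "deflation A (a \<cdot>\<^bsub>A\<^esub> m)" by (rule deflation_Cmp[OF _ a m(3)])
    then show ?thesis unfolding m(5) .
  qed
  moreover have "is_kernel A ?k r"
  proof (rule is_kernelI)
    show "r \<cdot>\<^bsub>A\<^esub> ?k = Zer A (Dom A ?k) (Cod A r)"
    proof (rule is_pullback_unique[OF k1])
      show "f1 \<cdot>\<^bsub>A\<^esub> r \<cdot>\<^bsub>A\<^esub> ?k = f1 \<cdot>\<^bsub>A\<^esub> Zer A (Dom A ?k) (Cod A r)"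
        unfolding fr'[OF k(1,3)]
        using sq0[of "Idt A (Dom A h0)"] by (simp add: cz d0 d1 c(10) r jg)
      show "h1 \<cdot>\<^bsub>A\<^esub> r \<cdot>\<^bsub>A\<^esub> ?k = h1 \<cdot>\<^bsub>A\<^esub> Zer A (Dom A ?k) (Cod A r)"
        unfolding hr'[OF k(1,3)] by (simp add: cz d0 d1 c(10) r pi)
    qed (use r k d0(1,2) d1 in \<open>simp_all del: Cmp_Add\<close>)
  next
    fix t assume t: "t \<in> Ar A" "Cod A t = Dom A r" "r \<cdot>\<^bsub>A\<^esub> t = Zer A (Dom A t) (Cod A r)"
    have t': "Cod A t = ?s" using t r by simp
    have a0: "j1 \<cdot>\<^bsub>A\<^esub> q0 \<cdot>\<^bsub>A\<^esub> ?p1 \<cdot>\<^bsub>A\<^esub> t \<oplus>\<^bsub>A\<^esub> u \<cdot>\<^bsub>A\<^esub> ?p2 \<cdot>\<^bsub>A\<^esub> t = Zer A (Dom A t) (Cod A j1)"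
      using fr'[OF t(1) t'] t r d1 by simp
    have "\<ominus>\<^bsub>A\<^esub> (p1 \<cdot>\<^bsub>A\<^esub> ?p2 \<cdot>\<^bsub>A\<^esub> t) = Zer A (Dom A t) (Cod A p1)"
      using hr'[OF t(1) t'] t r d1 by simp
    then have "p1 \<cdot>\<^bsub>A\<^esub> ?p2 \<cdot>\<^bsub>A\<^esub> t = Zer A (Dom A t) (Cod A p1)"
      using Neg_eq_iff[of "p1 \<cdot>\<^bsub>A\<^esub> ?p2 \<cdot>\<^bsub>A\<^esub> t" "Zer A (Dom A t) (Cod A p1)"] t t' by (simp add: cz)
    then obtain z where z': "z \<in> Ar A" "Dom A z = Dom A t" "Cod A z = Dom A i1" "i1 \<cdot>\<^bsub>A\<^esub> z = ?p2 \<cdot>\<^bsub>A\<^esub> t"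
      using Confl_lift[OF Z, of "?p2 \<cdot>\<^bsub>A\<^esub> t" "Dom A t"] t t' by (auto simp: cz c(10))
    \<comment> \<open>After composition with the monomorphism \<open>j1\<close> this is the
      vanishing of the first component of \<open>r t\<close>, since
      \<open>j1 g1 = u i1\<close>.\<close>
    have "q0 \<cdot>\<^bsub>A\<^esub> ?p1 \<cdot>\<^bsub>A\<^esub> t = \<ominus>\<^bsub>A\<^esub> (g1 \<cdot>\<^bsub>A\<^esub> z)"
    proof (rule Neg_unique[of "g1 \<cdot>\<^bsub>A\<^esub> z"])
      have "j1 \<cdot>\<^bsub>A\<^esub> (g1 \<cdot>\<^bsub>A\<^esub> z \<oplus>\<^bsub>A\<^esub> q0 \<cdot>\<^bsub>A\<^esub> ?p1 \<cdot>\<^bsub>A\<^esub> t) = j1 \<cdot>\<^bsub>A\<^esub> Zer A (Dom A t) (Dom A j1)"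
        using a0 t t' z' by (simp add: cz jg Add_commute)
      then have "g1 \<cdot>\<^bsub>A\<^esub> z \<oplus>\<^bsub>A\<^esub> q0 \<cdot>\<^bsub>A\<^esub> ?p1 \<cdot>\<^bsub>A\<^esub> t = Zer A (Dom A t) (Dom A j1)"
        by (rule Confl_mono[OF W(2), rotated 5]) (use t t' z' in \<open>simp_all add: cz\<close>)
      then show "g1 \<cdot>\<^bsub>A\<^esub> z \<oplus>\<^bsub>A\<^esub> q0 \<cdot>\<^bsub>A\<^esub> ?p1 \<cdot>\<^bsub>A\<^esub> t = Zer A (Dom A (g1 \<cdot>\<^bsub>A\<^esub> z)) (Cod A (g1 \<cdot>\<^bsub>A\<^esub> z))"
        using z' by (simp add: cz)
    qed (use t t' z' in \<open>simp_all add: cz\<close>)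
    then obtain s where s: "s \<in> Ar A" "Dom A s = Dom A t" "Cod A s = Dom A h0" "f0 \<cdot>\<^bsub>A\<^esub> s = ?p1 \<cdot>\<^bsub>A\<^esub> t"
      "h0 \<cdot>\<^bsub>A\<^esub> s = z"
      using is_pullback_ex[OF k0, of "?p1 \<cdot>\<^bsub>A\<^esub> t" z "Dom A t"] t t' z' by (auto simp: cz)
    have "?k \<cdot>\<^bsub>A\<^esub> s = t"
      by (rule bsum_into_eq[OF o(1,2)]) (use k d0 s t t' z' in \<open>simp_all add: cz c(10)\<close>)
    then show "\<exists>s. s \<in> Ar A \<and> Dom A s = Dom A t \<and> Cod A s = Dom A ?k \<and> ?k \<cdot>\<^bsub>A\<^esub> s = t"
      using s k(2) by (intro exI[of _ s]) simp
  next
    fix s t assume st: "s \<in> Ar A" "t \<in> Ar A" "Dom A s = Dom A t" "Cod A s = Dom A ?k"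
      "Cod A t = Dom A ?k" and eq: "?k \<cdot>\<^bsub>A\<^esub> s = ?k \<cdot>\<^bsub>A\<^esub> t"
    have st': "Cod A s = Dom A h0" "Cod A t = Dom A h0" using st k by simp_all
    have "?p1 \<cdot>\<^bsub>A\<^esub> (?k \<cdot>\<^bsub>A\<^esub> v) = f0 \<cdot>\<^bsub>A\<^esub> v" "?p2 \<cdot>\<^bsub>A\<^esub> (?k \<cdot>\<^bsub>A\<^esub> v) = i1 \<cdot>\<^bsub>A\<^esub> h0 \<cdot>\<^bsub>A\<^esub> v"
      if "v \<in> Ar A" "Cod A v = Dom A h0" for v
      using that d0 by (simp_all add: cz c(10))
    from this[OF st(1) st'(1)] this[OF st(2) st'(2)]
    have f: "f0 \<cdot>\<^bsub>A\<^esub> s = f0 \<cdot>\<^bsub>A\<^esub> t" and ih: "i1 \<cdot>\<^bsub>A\<^esub> h0 \<cdot>\<^bsub>A\<^esub> s = i1 \<cdot>\<^bsub>A\<^esub> h0 \<cdot>\<^bsub>A\<^esub> t"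
      unfolding eq by simp_all
    from ih have "h0 \<cdot>\<^bsub>A\<^esub> s = h0 \<cdot>\<^bsub>A\<^esub> t"
      by (rule Confl_mono[OF Z, rotated 5]) (use st(1-3) st' d0 in simp_all)
    then show "s = t" by (rule is_pullback_unique[OF k0 st(1-3) st' f])
  qed (simp_all add: k r)
  ultimately show thesis by (intro that[OF r fr hr] Confl_if_deflation_kernel)
qed

end

section \<open>Acyclic complexes of projectives\<close>

sublocale frobenius_category \<subseteq> stable_base A
proof unfold_locales
  show "projective A x \<Longrightarrow> injective A x" for x by (simp add: projective_iff_injective)
  show "x \<in> Ob A \<Longrightarrow> \<exists>i. inflation A i \<and> Dom A i = x \<and> projective A (Cod A i)" for x
    using enough_injectives by (simp add: projective_iff_injective)
qed

locale frobenius_complexes = frobenius_category E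
  for E :: "('o, 'm) excat"
begin

abbreviation AC where "AC \<equiv> Acyc E"

lemma AC_defs:
  "Ob AC = {X. acyclic_proj_complex E X}"
  "Ar AC = {u. acyclic_proj_complex E (csrc u) \<and> acyclic_proj_complex E (ctgt u) \<and> chain_map E u}"
  "Dom AC = csrc" "Cod AC = ctgt"
  "Idt AC X = \<lparr>csrc = X, ctgt = X, cmap = (\<lambda>n. Idt E (trm X n))\<rparr>"
  "Cmp AC v u = \<lparr>csrc = csrc u, ctgt = ctgt v, cmap = (\<lambda>n. cmap v n \<cdot>\<^bsub>E\<^esub> cmap u n)\<rparr>"
  "Add AC u v = \<lparr>csrc = csrc u, ctgt = ctgt u, cmap = (\<lambda>n. cmap u n \<oplus>\<^bsub>E\<^esub> cmap v n)\<rparr>"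
  "Zer AC X Y = \<lparr>csrc = X, ctgt = Y, cmap = (\<lambda>n. Zer E (trm X n) (trm Y n))\<rparr>"
  by (simp_all add: Acyc_def)

lemma ObD [simp]:
  assumes "X \<in> Ob AC"
  shows "projective E (trm X n)" "trm X n \<in> Ob E" "dif X n \<in> Ar E"
    "Dom E (dif X n) = trm X n" "Cod E (dif X n) = trm X (n + 1)"
  using assms by (auto simp: AC_defs acyclic_proj_complex_def homset_iff)

lemma ObE:
  assumes "X \<in> Ob AC"
  obtains Z i p where "\<forall>n. (i n, p n) \<in> Confl E \<and>
    i n \<in> Ar E \<and> Dom E (i n) = Z n \<and> Cod E (i n) = trm X n \<and>
    p n \<in> Ar E \<and> Dom E (p n) = trm X n \<and> Cod E (p n) = Z (n + 1) \<and>
    dif X n = i (n + 1) \<cdot>\<^bsub>E\<^esub> p n"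
  using assms unfolding AC_defs acyclic_proj_complex_def homset_iff mem_Collect_eq by blast

lemma ObI:
  assumes "\<And>n. projective E (trm X n)" "\<And>n. (i n, p n) \<in> Confl E"
    "\<And>n. Cod E (i n) = trm X n" "\<And>n. Cod E (p n) = Dom E (i (n + 1))"
    "\<And>n. dif X n = i (n + 1) \<cdot>\<^bsub>E\<^esub> p n"
  shows "X \<in> Ob AC"
proof -
  have c: "i n \<in> Ar E" "p n \<in> Ar E" "Dom E (p n) = trm X n" for n
    using Confl_simps[OF assms(2)] assms(3) by simp_all
  show ?thesis
    unfolding AC_defs acyclic_proj_complex_def homset_iff mem_Collect_eq
    by (rule conjI, use assms c in simp, rule exI[of _ "\<lambda>n. Dom E (i n)"], rule exI[of _ i],
        rule exI[of _ p]) (use assms c in simp)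
qed

lemma dif_dif [simp]:
  assumes "X \<in> Ob AC" "m = n + 1"
  shows "dif X m \<cdot>\<^bsub>E\<^esub> dif X n = Zer E (trm X n) (trm X (m + 1))"
proof -
  obtain Z i p where **: "\<forall>n. (i n, p n) \<in> Confl E \<and>
    i n \<in> Ar E \<and> Dom E (i n) = Z n \<and> Cod E (i n) = trm X n \<and>
    p n \<in> Ar E \<and> Dom E (p n) = trm X n \<and> Cod E (p n) = Z (n + 1) \<and>
    dif X n = i (n + 1) \<cdot>\<^bsub>E\<^esub> p n" using ObE[OF assms(1)] .
  have *: "(i n, p n) \<in> Confl E" "i n \<in> Ar E" "Dom E (i n) = Z n" "Cod E (i n) = trm X n"
    "p n \<in> Ar E" "Dom E (p n) = trm X n" "Cod E (p n) = Z (n + 1)"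
    "dif X n = i (n + 1) \<cdot>\<^bsub>E\<^esub> p n" for n using ** by blast+
  have Z: "Z n \<in> Ob E" for n using Dom_Ob[OF *(2)[of n]] *(3)[of n] by simp
  have "p (n + 1) \<cdot>\<^bsub>E\<^esub> i (n + 1) \<cdot>\<^bsub>E\<^esub> p n = Zer E (trm X n) (Z (n + 1 + 1))"
    using Cmp_assoc'[of "p n" "i (n + 1)" "p (n + 1)"] Confl_simps(4)[OF *(1)] Z by (simp add: *(2-7))
  then show ?thesis using *(2-7) Z by (simp add: *(8) assms)
qed

lemma dif_dif_cancel [simp]:
  assumes "X \<in> Ob AC" "m = n + 1" "k \<in> Ar E" "Cod E k = trm X n"
  shows "dif X m \<cdot>\<^bsub>E\<^esub> dif X n \<cdot>\<^bsub>E\<^esub> k = Zer E (Dom E k) (trm X (m + 1))"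
  using Cmp_assoc'[of k "dif X n" "dif X m"] assms by simp

lemma chain_map_iff:
  "chain_map E u \<longleftrightarrow> (\<forall>n. cmap u n \<in> Ar E \<and> Dom E (cmap u n) = trm (csrc u) n \<and>
     Cod E (cmap u n) = trm (ctgt u) n \<and>
     dif (ctgt u) n \<cdot>\<^bsub>E\<^esub> cmap u n = cmap u (n + 1) \<cdot>\<^bsub>E\<^esub> dif (csrc u) n)"
  unfolding chain_map_def homset_iff by blast

lemma Ar_iff: "u \<in> Ar AC \<longleftrightarrow> csrc u \<in> Ob AC \<and> ctgt u \<in> Ob AC \<and> chain_map E u"
  by (simp add: AC_defs)

lemma ArI:
  assumes "csrc u \<in> Ob AC" "ctgt u \<in> Ob AC"
    "\<And>n. cmap u n \<in> Ar E" "\<And>n. Dom E (cmap u n) = trm (csrc u) n"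
    "\<And>n. Cod E (cmap u n) = trm (ctgt u) n"
    "\<And>n. dif (ctgt u) n \<cdot>\<^bsub>E\<^esub> cmap u n = cmap u (n + 1) \<cdot>\<^bsub>E\<^esub> dif (csrc u) n"
  shows "u \<in> Ar AC"
  using assms by (simp add: Ar_iff chain_map_iff)

lemma ArD [simp]:
  assumes "u \<in> Ar AC"
  shows "csrc u \<in> Ob AC" "ctgt u \<in> Ob AC" "cmap u n \<in> Ar E" "Dom E (cmap u n) = trm (csrc u) n"
    "Cod E (cmap u n) = trm (ctgt u) n"
  using assms by (simp_all add: Ar_iff chain_map_iff)

text \<open>Oriented so that simplification moves differentials to the right past chain maps; the
  second form does the same inside right-nested composites.\<close>

lemma chain [simp]:
  assumes "u \<in> Ar AC" "ctgt u = Y"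
  shows "dif Y n \<cdot>\<^bsub>E\<^esub> cmap u n = cmap u (n + 1) \<cdot>\<^bsub>E\<^esub> dif (csrc u) n"
    "k \<in> Ar E \<Longrightarrow> Cod E k = trm (csrc u) n \<Longrightarrow>
       dif Y n \<cdot>\<^bsub>E\<^esub> cmap u n \<cdot>\<^bsub>E\<^esub> k = cmap u (n + 1) \<cdot>\<^bsub>E\<^esub> dif (csrc u) n \<cdot>\<^bsub>E\<^esub> k"
proof -
  show *: "dif Y n \<cdot>\<^bsub>E\<^esub> cmap u n = cmap u (n + 1) \<cdot>\<^bsub>E\<^esub> dif (csrc u) n"
    using assms unfolding Ar_iff chain_map_iff by blast
  show "k \<in> Ar E \<Longrightarrow> Cod E k = trm (csrc u) n \<Longrightarrow>
       dif Y n \<cdot>\<^bsub>E\<^esub> cmap u n \<cdot>\<^bsub>E\<^esub> k = cmap u (n + 1) \<cdot>\<^bsub>E\<^esub> dif (csrc u) n \<cdot>\<^bsub>E\<^esub> k"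
    using Cmp_assoc'[of k "cmap u n" "dif Y n"] Cmp_assoc'[of k "dif (csrc u) n" "cmap u (n + 1)"]
      assms * ArD(2)[OF assms(1)] by simp
qed

lemma chmap_eqI:
  fixes u v :: "('o, 'm) chmap"
  assumes "csrc u = csrc v" "ctgt u = ctgt v" "\<And>n. cmap u n = cmap v n"
  shows "u = v"
  using assms by (intro chmap.equality) auto

lemma cpx_eqI:
  fixes X Y :: "('o, 'm) cpx"
  assumes "\<And>n. trm X n = trm Y n" "\<And>n. dif X n = dif Y n"
  shows "X = Y"
  using assms by (intro cpx.equality) auto

lemma acyclic_preadditive: "preadditive_category AC"
proof (rule preadditive_category.intro)
  fix f assume "f \<in> Ar AC"
  then show "Dom AC f \<in> Ob AC" "Cod AC f \<in> Ob AC" by (simp_all add: AC_defs(3,4))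
next
  fix X assume "X \<in> Ob AC"
  then show "Idt AC X \<in> homset AC X X"
    unfolding homset_iff by (intro conjI ArI) (simp_all add: AC_defs(3-5))
next
  fix f g X Y Z assume "f \<in> homset AC X Y" "g \<in> homset AC Y Z"
  then show "g \<cdot>\<^bsub>AC\<^esub> f \<in> homset AC X Z"
    unfolding homset_iff by (intro conjI ArI) (auto simp: AC_defs(3-6))
next
  fix f X Y assume "f \<in> homset AC X Y"
  then show "Idt AC Y \<cdot>\<^bsub>AC\<^esub> f = f" "f \<cdot>\<^bsub>AC\<^esub> Idt AC X = f"
    unfolding homset_iff by (intro chmap_eqI; auto simp: AC_defs(3-6))+
next
  fix f g h W X Y Z assume "f \<in> homset AC W X" "g \<in> homset AC X Y" "h \<in> homset AC Y Z"
  then show "h \<cdot>\<^bsub>AC\<^esub> g \<cdot>\<^bsub>AC\<^esub> f = (h \<cdot>\<^bsub>AC\<^esub> g) \<cdot>\<^bsub>AC\<^esub> f"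
    unfolding homset_iff by (intro chmap_eqI; auto simp: AC_defs(3-6))
next
  fix f f' g X Y Z assume "f \<in> homset AC X Y" "f' \<in> homset AC X Y" "g \<in> homset AC Y Z"
  then show "g \<cdot>\<^bsub>AC\<^esub> (f \<oplus>\<^bsub>AC\<^esub> f') = g \<cdot>\<^bsub>AC\<^esub> f \<oplus>\<^bsub>AC\<^esub> g \<cdot>\<^bsub>AC\<^esub> f'"
    unfolding homset_iff by (intro chmap_eqI; auto simp: AC_defs(3-7))
next
  fix f g g' X Y Z assume "f \<in> homset AC X Y" "g \<in> homset AC Y Z" "g' \<in> homset AC Y Z"
  then show "(g \<oplus>\<^bsub>AC\<^esub> g') \<cdot>\<^bsub>AC\<^esub> f = g \<cdot>\<^bsub>AC\<^esub> f \<oplus>\<^bsub>AC\<^esub> g' \<cdot>\<^bsub>AC\<^esub> f"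
    unfolding homset_iff by (intro chmap_eqI; auto simp: AC_defs(3-7))
next
  fix X Y assume XY: "X \<in> Ob AC" "Y \<in> Ob AC"
  show "comm_group (hom_group AC X Y)"
  proof (rule comm_groupI; (unfold hom_group_simps)?)
    fix f g h assume f: "f \<in> homset AC X Y"
    show "Zer AC X Y \<oplus>\<^bsub>AC\<^esub> f = f"
      using f unfolding homset_iff by (intro chmap_eqI; auto simp: AC_defs(3-8))
    show "\<exists>g\<in>homset AC X Y. g \<oplus>\<^bsub>AC\<^esub> f = Zer AC X Y"
    proof (rule bexI)
      let ?g = "\<lparr>csrc = X, ctgt = Y, cmap = (\<lambda>n. \<ominus>\<^bsub>E\<^esub> cmap f n)\<rparr>"
      show "?g \<in> homset AC X Y"
        using f XY unfolding homset_iff by (intro conjI ArI) (auto simp: AC_defs(3-8))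
      show "?g \<oplus>\<^bsub>AC\<^esub> f = Zer AC X Y"
        using f XY unfolding homset_iff by (intro chmap_eqI; auto simp: AC_defs(3-8))
    qed
    assume g: "g \<in> homset AC X Y"
    show "f \<oplus>\<^bsub>AC\<^esub> g \<in> homset AC X Y"
      using f g unfolding homset_iff by (intro conjI ArI) (auto simp: AC_defs(3-8))
    show "f \<oplus>\<^bsub>AC\<^esub> g = g \<oplus>\<^bsub>AC\<^esub> f"
      using f g unfolding homset_iff by (intro chmap_eqI; auto simp: AC_defs(3-8) Add_commute)
    assume h: "h \<in> homset AC X Y"
    show "(f \<oplus>\<^bsub>AC\<^esub> g) \<oplus>\<^bsub>AC\<^esub> h = f \<oplus>\<^bsub>AC\<^esub> g \<oplus>\<^bsub>AC\<^esub> h"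
      using f g h unfolding homset_iff by (intro chmap_eqI; auto simp: AC_defs(3-8))
  next
    show "Zer AC X Y \<in> homset AC X Y"
      using XY unfolding homset_iff by (intro conjI ArI) (auto simp: AC_defs(3-8))
  qed
qed

end

sublocale frobenius_complexes \<subseteq> AC: preadditive_category "Acyc E"
  by (rule acyclic_preadditive)

context frobenius_complexes
begin

lemma AC_Neg: "f \<in> Ar AC \<Longrightarrow> \<ominus>\<^bsub>AC\<^esub> f = \<lparr>csrc = csrc f, ctgt = ctgt f, cmap = (\<lambda>n. \<ominus>\<^bsub>E\<^esub> cmap f n)\<rparr>"
proof (rule AC.Neg_unique[symmetric])
  let ?g = "\<lparr>csrc = csrc f, ctgt = ctgt f, cmap = (\<lambda>n. \<ominus>\<^bsub>E\<^esub> cmap f n)\<rparr>"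
  assume f: "f \<in> Ar AC"
  show "?g \<in> Ar AC" using f by (intro ArI) auto
  show "f \<oplus>\<^bsub>AC\<^esub> ?g = Zer AC (Dom AC f) (Cod AC f)"
    using f by (intro chmap_eqI) (auto simp: AC_defs(3-8))
qed (simp_all add: AC_defs)

lemmas chmap_simps = AC_defs(3-8) AC_Neg

section \<open>Degreewise conflations of complexes\<close>

lemma AC_Confl_iff:
  "(u, v) \<in> Confl AC \<longleftrightarrow> u \<in> Ar AC \<and> v \<in> Ar AC \<and> ctgt u = csrc v \<and>
     (\<forall>n. (cmap u n, cmap v n) \<in> Confl E)"
  by (auto simp: Acyc_def)

text \<open>The factorizations are taken degree by degree. They are chain maps because
  \<open>cmap i (n + 1)\<close> is monic and \<open>cmap p n\<close> is epic, so that compatibility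
  with the differentials can be tested after composing with these.\<close>

lemma AC_conflation_category: "conflation_category AC"
proof
  fix i p assume ip: "(i, p) \<in> Confl AC"
  have c: "i \<in> Ar AC" "p \<in> Ar AC" "csrc p = ctgt i" "(cmap i n, cmap p n) \<in> Confl E" for n
    using ip by (simp_all add: AC_Confl_iff)
  have pi: "cmap p n \<cdot>\<^bsub>E\<^esub> cmap i n = Zer E (trm (csrc i) n) (trm (ctgt p) n)" for n
    using Confl_simps(4)[OF c(4)] c by simp
  have pi0: "p \<cdot>\<^bsub>AC\<^esub> i = Zer AC (Dom AC i) (Cod AC p)"
    by (intro chmap_eqI) (simp_all add: chmap_simps pi)
  show "is_kernel AC i p"
    unfolding is_kernel_def
  proof (intro conjI ballI impI)
    fix f assume f: "f \<in> Ar AC" "Cod AC f = Dom AC p \<and> p \<cdot>\<^bsub>AC\<^esub> f = Zer AC (Dom AC f) (Cod AC p)"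
    have f': "ctgt f = ctgt i" and pf: "cmap p n \<cdot>\<^bsub>E\<^esub> cmap f n = Zer E (trm (csrc f) n) (trm (ctgt p) n)" for n
      using f c(3) by (auto simp: chmap_simps dest: fun_cong[of _ _ n])
    have "\<exists>g. g \<in> Ar E \<and> Dom E g = trm (csrc f) n \<and> Cod E g = trm (csrc i) n \<and>
      cmap i n \<cdot>\<^bsub>E\<^esub> g = cmap f n" for n
    proof -
      have "cmap f n \<in> Ar E" "Cod E (cmap f n) = Cod E (cmap i n)" "Dom E (cmap f n) = trm (csrc f) n"
        "cmap p n \<cdot>\<^bsub>E\<^esub> cmap f n = Zer E (trm (csrc f) n) (Cod E (cmap p n))"
        using f(1) f' c pf by simp_all
      from Confl_lift[OF c(4) this] show ?thesis using c(1) by (metis ArD(4))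
    qed
    then obtain g where g: "g n \<in> Ar E" "Dom E (g n) = trm (csrc f) n" "Cod E (g n) = trm (csrc i) n"
      "cmap i n \<cdot>\<^bsub>E\<^esub> g n = cmap f n" for n by metis
    have g': "cmap i n \<cdot>\<^bsub>E\<^esub> g n \<cdot>\<^bsub>E\<^esub> k = cmap f n \<cdot>\<^bsub>E\<^esub> k"
      if "k \<in> Ar E" "Cod E k = trm (csrc f) n" for n k
      using Cmp_assoc'[of k "g n" "cmap i n"] that g c f by simp
    have "dif (csrc i) n \<cdot>\<^bsub>E\<^esub> g n = g (n + 1) \<cdot>\<^bsub>E\<^esub> dif (csrc f) n" for n
    proof (rule Confl_mono[OF c(4)[of "n + 1"]])
      have "cmap i (n + 1) \<cdot>\<^bsub>E\<^esub> dif (csrc i) n \<cdot>\<^bsub>E\<^esub> g n = dif (ctgt i) n \<cdot>\<^bsub>E\<^esub> cmap i n \<cdot>\<^bsub>E\<^esub> g n"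
        using c f g(1-3) by simp
      then show "cmap i (n + 1) \<cdot>\<^bsub>E\<^esub> dif (csrc i) n \<cdot>\<^bsub>E\<^esub> g n
          = cmap i (n + 1) \<cdot>\<^bsub>E\<^esub> g (n + 1) \<cdot>\<^bsub>E\<^esub> dif (csrc f) n"
        using c f f' g by (simp add: g')
    qed (use c f g in simp_all)
    then have gAr: "\<lparr>csrc = csrc f, ctgt = csrc i, cmap = g\<rparr> \<in> Ar AC"
      using c f g by (intro ArI) simp_all
    show "\<exists>!g. g \<in> homset AC (Dom AC f) (Dom AC i) \<and> i \<cdot>\<^bsub>AC\<^esub> g = f"
    proof (rule ex1I)
      show "\<lparr>csrc = csrc f, ctgt = csrc i, cmap = g\<rparr> \<in> homset AC (Dom AC f) (Dom AC i) \<and>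
        i \<cdot>\<^bsub>AC\<^esub> \<lparr>csrc = csrc f, ctgt = csrc i, cmap = g\<rparr> = f"
        using gAr f' by (auto simp: homset_iff chmap_simps g intro!: chmap_eqI)
      fix h assume h: "h \<in> homset AC (Dom AC f) (Dom AC i) \<and> i \<cdot>\<^bsub>AC\<^esub> h = f"
      have "cmap h n = g n" for n
      proof (rule Confl_mono[OF c(4)[of n]])
        have "cmap (i \<cdot>\<^bsub>AC\<^esub> h) n = cmap f n" using h by simp
        then show "cmap i n \<cdot>\<^bsub>E\<^esub> cmap h n = cmap i n \<cdot>\<^bsub>E\<^esub> g n" by (simp add: chmap_simps g)
      qed (use h c g in \<open>auto simp: homset_iff chmap_simps\<close>)
      then show "h = \<lparr>csrc = csrc f, ctgt = csrc i, cmap = g\<rparr>"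
        using h by (intro chmap_eqI) (auto simp: homset_iff chmap_simps)
    qed
  qed (use c pi0 in \<open>simp_all add: AC_defs(3,4)\<close>)
  show "is_cokernel AC i p"
    unfolding is_cokernel_def
  proof (intro conjI ballI impI)
    fix f assume f: "f \<in> Ar AC" "Dom AC f = Cod AC i \<and> f \<cdot>\<^bsub>AC\<^esub> i = Zer AC (Dom AC i) (Cod AC f)"
    have f': "csrc f = ctgt i" and fi: "cmap f n \<cdot>\<^bsub>E\<^esub> cmap i n = Zer E (trm (csrc i) n) (trm (ctgt f) n)" for n
      using f c(3) by (auto simp: chmap_simps dest: fun_cong[of _ _ n])
    have "\<exists>g. g \<in> Ar E \<and> Dom E g = trm (ctgt p) n \<and> Cod E g = trm (ctgt f) n \<and>
      g \<cdot>\<^bsub>E\<^esub> cmap p n = cmap f n" for n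
    proof -
      have "cmap f n \<in> Ar E" "Dom E (cmap f n) = Cod E (cmap i n)" "Cod E (cmap f n) = trm (ctgt f) n"
        "cmap f n \<cdot>\<^bsub>E\<^esub> cmap i n = Zer E (Dom E (cmap i n)) (trm (ctgt f) n)"
        using f(1) f' c fi by simp_all
      from Confl_descend[OF c(4) this] show ?thesis using c(2) by (metis ArD(5))
    qed
    then obtain g where g: "g n \<in> Ar E" "Dom E (g n) = trm (ctgt p) n" "Cod E (g n) = trm (ctgt f) n"
      "g n \<cdot>\<^bsub>E\<^esub> cmap p n = cmap f n" for n by metis
    have "dif (ctgt f) n \<cdot>\<^bsub>E\<^esub> g n = g (n + 1) \<cdot>\<^bsub>E\<^esub> dif (ctgt p) n" for n
    proof (rule Confl_epi[OF c(4)[of n]])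
      have "(g (n + 1) \<cdot>\<^bsub>E\<^esub> dif (ctgt p) n) \<cdot>\<^bsub>E\<^esub> cmap p n = (g (n + 1) \<cdot>\<^bsub>E\<^esub> cmap p (n + 1)) \<cdot>\<^bsub>E\<^esub> dif (csrc p) n"
        using c f g(1-3) by simp
      then show "(dif (ctgt f) n \<cdot>\<^bsub>E\<^esub> g n) \<cdot>\<^bsub>E\<^esub> cmap p n = (g (n + 1) \<cdot>\<^bsub>E\<^esub> dif (ctgt p) n) \<cdot>\<^bsub>E\<^esub> cmap p n"
        using c f f' g by (simp del: chain) (simp add: g)
    qed (use c f g in simp_all)
    then have gAr: "\<lparr>csrc = ctgt p, ctgt = ctgt f, cmap = g\<rparr> \<in> Ar AC"
      using c f g by (intro ArI) simp_all
    show "\<exists>!g. g \<in> homset AC (Cod AC p) (Cod AC f) \<and> g \<cdot>\<^bsub>AC\<^esub> p = f"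
    proof (rule ex1I)
      show "\<lparr>csrc = ctgt p, ctgt = ctgt f, cmap = g\<rparr> \<in> homset AC (Cod AC p) (Cod AC f) \<and>
        \<lparr>csrc = ctgt p, ctgt = ctgt f, cmap = g\<rparr> \<cdot>\<^bsub>AC\<^esub> p = f"
        using gAr f' c by (auto simp: homset_iff chmap_simps g intro!: chmap_eqI)
      fix h assume h: "h \<in> homset AC (Cod AC p) (Cod AC f) \<and> h \<cdot>\<^bsub>AC\<^esub> p = f"
      have "cmap h n = g n" for n
      proof (rule Confl_epi[OF c(4)[of n]])
        have "cmap (h \<cdot>\<^bsub>AC\<^esub> p) n = cmap f n" using h by simp
        then show "cmap h n \<cdot>\<^bsub>E\<^esub> cmap p n = g n \<cdot>\<^bsub>E\<^esub> cmap p n" by (simp add: chmap_simps g)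
      qed (use h c g in \<open>auto simp: homset_iff chmap_simps\<close>)
      then show "h = \<lparr>csrc = ctgt p, ctgt = ctgt f, cmap = g\<rparr>"
        using h by (intro chmap_eqI) (auto simp: homset_iff chmap_simps)
    qed
  qed (use c pi0 in \<open>simp_all add: AC_defs(3,4)\<close>)
qed

end

sublocale frobenius_complexes \<subseteq> AC: conflation_category "Acyc E"
  by (rule AC_conflation_category)

section \<open>Shifts and mapping cones\<close>

lemma (in exact_category) Confl_Neg_right:
  assumes "(i, p) \<in> Confl A" shows "(i, \<ominus>\<^bsub>A\<^esub> p) \<in> Confl A"
proof -
  have c: "i \<in> Ar A" "p \<in> Ar A" "Dom A p = Cod A i" using assms by simp_all
  show ?thesis
    by (rule Confl_iso[OF assms, of "Idt A (Dom A i)" "Idt A (Cod A i)" "\<ominus>\<^bsub>A\<^esub> Idt A (Cod A p)"])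
      (use c in \<open>simp_all add: homset_iff is_iso_Neg\<close>)
qed

context frobenius_complexes
begin

lemma shift_cpx_simps [simp]:
  "trm (shift_cpx E k X) n = trm X (n + k)"
  "dif (shift_cpx E k X) n = (if even k then dif X (n + k) else \<ominus>\<^bsub>E\<^esub> dif X (n + k))"
  by (simp_all add: shift_cpx_def)

text \<open>For odd \<open>k\<close> the sign of the differential is absorbed by its deflation part,
  since \<open>(i, - p)\<close> is again a conflation.\<close>

lemma shift_cpx_Ob [simp]:
  assumes "X \<in> Ob AC" shows "shift_cpx E k X \<in> Ob AC"
proof -
  obtain Z i p where **: "\<forall>n. (i n, p n) \<in> Confl E \<and>
    i n \<in> Ar E \<and> Dom E (i n) = Z n \<and> Cod E (i n) = trm X n \<and>
    p n \<in> Ar E \<and> Dom E (p n) = trm X n \<and> Cod E (p n) = Z (n + 1) \<and>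
    dif X n = i (n + 1) \<cdot>\<^bsub>E\<^esub> p n" using ObE[OF assms] .
  have *: "(i n, p n) \<in> Confl E" "i n \<in> Ar E" "Dom E (i n) = Z n" "Cod E (i n) = trm X n"
    "p n \<in> Ar E" "Dom E (p n) = trm X n" "Cod E (p n) = Z (n + 1)" for n using ** by blast+
  have d: "dif X n = i (n + 1) \<cdot>\<^bsub>E\<^esub> p n" for n using ** by blast
  show ?thesis
    by (rule ObI[of _ "\<lambda>n. i (n + k)" "\<lambda>n. if even k then p (n + k) else \<ominus>\<^bsub>E\<^esub> p (n + k)"])
      (use assms * in \<open>simp_all add: d Confl_Neg_right ac_simps\<close>)
qed

lemma shift_simps [simp]:
  "fo (shift E k) = shift_cpx E k"
  "csrc (fa (shift E k) u) = shift_cpx E k (csrc u)"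
  "ctgt (fa (shift E k) u) = shift_cpx E k (ctgt u)"
  "cmap (fa (shift E k) u) n = cmap u (n + k)"
  by (simp_all add: shift_def)

lemma shift_Ar [simp]: "u \<in> Ar AC \<Longrightarrow> fa (shift E k) u \<in> Ar AC"
  by (rule ArI) (simp_all add: ac_simps)

lemma shift_Dom_Cod [simp]:
  "Dom AC (fa (shift E k) u) = shift_cpx E k (Dom AC u)"
  "Cod AC (fa (shift E k) u) = shift_cpx E k (Cod AC u)"
  by (simp_all add: chmap_simps)

lemma shift_exact: "exact_functor AC AC (shift E k)"
  unfolding exact_functor_def additive_functor_def homset_iff
proof (intro conjI ballI impI)
  fix X assume "X \<in> Ob AC"
  then show "fo (shift E k) X \<in> Ob AC" by simp
  show "fa (shift E k) (Idt AC X) = Idt AC (fo (shift E k) X)"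
    by (rule chmap_eqI) (simp_all add: chmap_simps)
next
  fix f assume "f \<in> Ar AC"
  then show "fa (shift E k) f \<in> Ar AC" by simp
  show "Dom AC (fa (shift E k) f) = fo (shift E k) (Dom AC f)"
    "Cod AC (fa (shift E k) f) = fo (shift E k) (Cod AC f)" by simp_all
  fix g
  show "fa (shift E k) (g \<cdot>\<^bsub>AC\<^esub> f) = fa (shift E k) g \<cdot>\<^bsub>AC\<^esub> fa (shift E k) f"
    by (rule chmap_eqI) (simp_all add: chmap_simps)
  show "fa (shift E k) (f \<oplus>\<^bsub>AC\<^esub> g) = fa (shift E k) f \<oplus>\<^bsub>AC\<^esub> fa (shift E k) g"
    by (rule chmap_eqI) (simp_all add: chmap_simps)
next
  fix c assume "c \<in> Confl AC"
  then show "case c of (i, p) \<Rightarrow> (fa (shift E k) i, fa (shift E k) p) \<in> Confl AC"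
    by (cases c) (simp add: AC_Confl_iff del: AC.Confl_simps)
qed

text \<open>Opposite shifts cancel on the nose, the two sign changes undoing each other. The rotated
  maps and the return from the shift to the identity functor depend on this strictness.\<close>

lemma shift_cpx_cancel [simp]:
  assumes "X \<in> Ob AC"
  shows "shift_cpx E (- k) (shift_cpx E k X) = X" "shift_cpx E k (shift_cpx E (- k) X) = X"
  using assms by (auto intro!: cpx_eqI)

lemma shift_cancel [simp]:
  assumes "u \<in> Ar AC"
  shows "fa (shift E (- k)) (fa (shift E k) u) = u" "fa (shift E k) (fa (shift E (- k)) u) = u"
  using assms by (auto intro!: chmap_eqI)

text \<open>Shifts preserve conflations and have strict inverses, so a lifting problem out of the
  shifted complex is carried back to one out of \<open>X\<close>.\<close>

lemma shift_projective:
  assumes "projective AC X" shows "projective AC (shift_cpx E k X)"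
proof -
  have X: "X \<in> Ob AC" using assms by simp
  interpret sh: additive_functor_between AC AC "shift E l" for l
    using shift_exact by unfold_locales (simp add: exact_functor_def)
  have "\<exists>g\<in>homset AC (shift_cpx E k X) (Dom AC p). p \<cdot>\<^bsub>AC\<^esub> g = f"
    if *: "deflation AC p" "f \<in> homset AC (shift_cpx E k X) (Cod AC p)" for p f
  proof -
    from *(1) obtain i where i: "(i, p) \<in> Confl AC" by (auto simp: deflation_def)
    have p: "p \<in> Ar AC" "Dom AC p = Cod AC i" using AC.Confl_simps[OF i] by simp_all
    have f: "f \<in> Ar AC" "Dom AC f = shift_cpx E k X" "Cod AC f = Cod AC p" using * by (simp_all add: homset_iff)
    have "(fa (shift E (- k)) i, fa (shift E (- k)) p) \<in> Confl AC"
      using i shift_exact by (auto simp: exact_functor_def)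
    moreover have "fa (shift E (- k)) f \<in> Ar AC" "Dom AC (fa (shift E (- k)) f) = X"
      "Cod AC (fa (shift E (- k)) f) = Cod AC (fa (shift E (- k)) p)"
      using f X p by simp_all
    ultimately obtain g where g: "g \<in> Ar AC" "Dom AC g = X" "Cod AC g = Cod AC (fa (shift E (- k)) i)"
      "fa (shift E (- k)) p \<cdot>\<^bsub>AC\<^esub> g = fa (shift E (- k)) f"
      using AC.projective_lift[OF assms] by blast
    have "fa (shift E k) (fa (shift E (- k)) p \<cdot>\<^bsub>AC\<^esub> g) = f" unfolding g(4) using f by simp
    then have "p \<cdot>\<^bsub>AC\<^esub> fa (shift E k) g = f" using g(1-3) p by simp
    then show ?thesis
      using g(1-3) p AC.Confl_simps(1)[OF i] by (intro bexI[of _ "fa (shift E k) g"]) (simp_all add: homset_iff)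
  qed
  then show ?thesis unfolding projective_def using shift_cpx_Ob[OF X] by blast
qed

section \<open>The mapping cone as an acyclic complex of projectives\<close>

lemma cone_trm [simp]: "trm (cone_cpx E u) n = bsum E (trm (ctgt u) n) (trm (csrc u) (n + 1))"
  by (simp add: cone_cpx_def Let_def)

lemma cone_dif:
  assumes "u \<in> Ar AC" "csrc u = X" "ctgt u = Y"
  shows "dif (cone_cpx E u) n =
    in1 E (trm Y (n + 1)) (trm X (n + 1 + 1)) \<cdot>\<^bsub>E\<^esub> dif Y n \<cdot>\<^bsub>E\<^esub> pr1 E (trm Y n) (trm X (n + 1)) \<oplus>\<^bsub>E\<^esub>
    in1 E (trm Y (n + 1)) (trm X (n + 1 + 1)) \<cdot>\<^bsub>E\<^esub> cmap u (n + 1) \<cdot>\<^bsub>E\<^esub> pr2 E (trm Y n) (trm X (n + 1)) \<oplus>\<^bsub>E\<^esub>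
    \<ominus>\<^bsub>E\<^esub> (in2 E (trm Y (n + 1)) (trm X (n + 1 + 1)) \<cdot>\<^bsub>E\<^esub> dif X (n + 1) \<cdot>\<^bsub>E\<^esub> pr2 E (trm Y n) (trm X (n + 1)))"
  using assms by (auto simp: cone_cpx_def Let_def)

text \<open>Acyclicity reduces to \<open>cone_conflation\<close> in each degree, once
  \<open>u\<close> has been restricted to cocycles. The terms are projective because the identity of
  a biproduct of projectives is a sum of two null maps.\<close>

lemma cone_Ob [simp]:
  assumes u: "u \<in> Ar AC" shows "cone_cpx E u \<in> Ob AC"
proof -
  define X Y where "X = csrc u" and "Y = ctgt u"
  have XY: "X \<in> Ob AC" "Y \<in> Ob AC" using u by (simp_all add: X_def Y_def)
  have un: "cmap u n \<in> Ar E" "Dom E (cmap u n) = trm X n" "Cod E (cmap u n) = trm Y n" for n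
    using u by (simp_all add: X_def Y_def)
  obtain Z i p where **: "\<forall>n. (i n, p n) \<in> Confl E \<and>
    i n \<in> Ar E \<and> Dom E (i n) = Z n \<and> Cod E (i n) = trm X n \<and>
    p n \<in> Ar E \<and> Dom E (p n) = trm X n \<and> Cod E (p n) = Z (n + 1) \<and>
    dif X n = i (n + 1) \<cdot>\<^bsub>E\<^esub> p n" using ObE[OF XY(1)] .
  have X: "(i n, p n) \<in> Confl E" "i n \<in> Ar E" "Dom E (i n) = Z n" "Cod E (i n) = trm X n"
    "p n \<in> Ar E" "Dom E (p n) = trm X n" "Cod E (p n) = Z (n + 1)"
    and dX: "dif X n = i (n + 1) \<cdot>\<^bsub>E\<^esub> p n" for n using ** by blast+
  obtain W j q where **: "\<forall>n. (j n, q n) \<in> Confl E \<and>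
    j n \<in> Ar E \<and> Dom E (j n) = W n \<and> Cod E (j n) = trm Y n \<and>
    q n \<in> Ar E \<and> Dom E (q n) = trm Y n \<and> Cod E (q n) = W (n + 1) \<and>
    dif Y n = j (n + 1) \<cdot>\<^bsub>E\<^esub> q n" using ObE[OF XY(2)] .
  have Y: "(j n, q n) \<in> Confl E" "j n \<in> Ar E" "Dom E (j n) = W n" "Cod E (j n) = trm Y n"
    "q n \<in> Ar E" "Dom E (q n) = trm Y n" "Cod E (q n) = W (n + 1)"
    and dY: "dif Y n = j (n + 1) \<cdot>\<^bsub>E\<^esub> q n" for n using ** by blast+
  have o: "Z n \<in> Ob E" "W n \<in> Ob E" for n
    using Dom_Ob[OF X(2)[of n]] Dom_Ob[OF Y(2)[of n]] by (simp_all add: X Y)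
  have ch: "j (n + 1) \<cdot>\<^bsub>E\<^esub> q n \<cdot>\<^bsub>E\<^esub> cmap u n = cmap u (n + 1) \<cdot>\<^bsub>E\<^esub> i (n + 1) \<cdot>\<^bsub>E\<^esub> p n" for n
  proof -
    have "dif Y n \<cdot>\<^bsub>E\<^esub> cmap u n = cmap u (n + 1) \<cdot>\<^bsub>E\<^esub> dif X n"
      using chain(1)[OF u refl] unfolding X_def Y_def .
    then show ?thesis using X Y un by (simp add: dX dY)
  qed
  \<comment> \<open>The map induced by \<open>u\<close> on cocycles: as \<open>j (n + 1)\<close> is
    monic, \<open>q n\<close> kills \<open>u i\<close>, which therefore factors through the kernel
    \<open>j n\<close>.\<close>
  have "\<exists>g. g \<in> Ar E \<and> Dom E g = Z n \<and> Cod E g = W n \<and> j n \<cdot>\<^bsub>E\<^esub> g = cmap u n \<cdot>\<^bsub>E\<^esub> i n" for n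
  proof -
    have 0: "p n \<cdot>\<^bsub>E\<^esub> i n = Zer E (Z n) (Z (n + 1))" using Confl_simps(4)[OF X(1)] X by simp
    have "j (n + 1) \<cdot>\<^bsub>E\<^esub> q n \<cdot>\<^bsub>E\<^esub> cmap u n \<cdot>\<^bsub>E\<^esub> i n = (j (n + 1) \<cdot>\<^bsub>E\<^esub> q n \<cdot>\<^bsub>E\<^esub> cmap u n) \<cdot>\<^bsub>E\<^esub> i n"
      using X Y un by simp
    also have "\<dots> = j (n + 1) \<cdot>\<^bsub>E\<^esub> Zer E (Z n) (W (n + 1))"
      unfolding ch using X Y un o 0 by simp
    finally have "q n \<cdot>\<^bsub>E\<^esub> cmap u n \<cdot>\<^bsub>E\<^esub> i n = Zer E (Z n) (W (n + 1))"
      by (rule Confl_mono[OF Y(1), rotated 5]) (use X Y un o in simp_all)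
    moreover have "cmap u n \<cdot>\<^bsub>E\<^esub> i n \<in> Ar E" "Cod E (cmap u n \<cdot>\<^bsub>E\<^esub> i n) = Cod E (j n)"
      "Dom E (cmap u n \<cdot>\<^bsub>E\<^esub> i n) = Z n" using X Y un by simp_all
    ultimately show ?thesis using Confl_lift[OF Y(1)[of n]] Y(3,7)[of n] by metis
  qed
  then obtain g where g: "g n \<in> Ar E" "Dom E (g n) = Z n" "Cod E (g n) = W n"
    "j n \<cdot>\<^bsub>E\<^esub> g n = cmap u n \<cdot>\<^bsub>E\<^esub> i n" for n by metis
  have gp: "g (n + 1) \<cdot>\<^bsub>E\<^esub> p n = q n \<cdot>\<^bsub>E\<^esub> cmap u n" for n
  proof (rule Confl_mono[OF Y(1)])
    have "j (n + 1) \<cdot>\<^bsub>E\<^esub> g (n + 1) \<cdot>\<^bsub>E\<^esub> p n = (j (n + 1) \<cdot>\<^bsub>E\<^esub> g (n + 1)) \<cdot>\<^bsub>E\<^esub> p n"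
      using X Y g(1-3) by simp
    then show "j (n + 1) \<cdot>\<^bsub>E\<^esub> g (n + 1) \<cdot>\<^bsub>E\<^esub> p n = j (n + 1) \<cdot>\<^bsub>E\<^esub> q n \<cdot>\<^bsub>E\<^esub> cmap u n"
      unfolding g(4) ch using X un by simp
  qed (use X Y un g in simp_all)
  \<comment> \<open>These pullbacks are the cocycle objects of the cone. They are fixed for all
    degrees at once, so that the object reached in one degree is the one that starts the next
    conflation.\<close>
  have "\<exists>f h. is_pullback E (q n) (\<ominus>\<^bsub>E\<^esub> g (n + 1)) f h \<and> deflation E h" for n
    by (rule deflation_pullback) (use Y g in \<open>auto simp: deflation_def\<close>)
  then obtain f h where fh: "is_pullback E (q n) (\<ominus>\<^bsub>E\<^esub> g (n + 1)) (f n) (h n)" "deflation E (h n)" for n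
    by metis
  let ?i1 = "\<lambda>n. in1 E (trm Y n) (trm X (n + 1))" and ?i2 = "\<lambda>n. in2 E (trm Y n) (trm X (n + 1))"
    and ?p1 = "\<lambda>n. pr1 E (trm Y n) (trm X (n + 1))" and ?p2 = "\<lambda>n. pr2 E (trm Y n) (trm X (n + 1))"
  let ?k = "\<lambda>n. ?i1 n \<cdot>\<^bsub>E\<^esub> f n \<oplus>\<^bsub>E\<^esub> ?i2 n \<cdot>\<^bsub>E\<^esub> i (n + 1) \<cdot>\<^bsub>E\<^esub> h n"
  have "\<exists>r. r \<in> Ar E \<and> Dom E r = bsum E (trm Y n) (trm X (n + 1)) \<and> Cod E r = Dom E (h (n + 1)) \<and>
      f (n + 1) \<cdot>\<^bsub>E\<^esub> r = j (n + 1) \<cdot>\<^bsub>E\<^esub> q n \<cdot>\<^bsub>E\<^esub> ?p1 n \<oplus>\<^bsub>E\<^esub> cmap u (n + 1) \<cdot>\<^bsub>E\<^esub> ?p2 n \<and>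
      h (n + 1) \<cdot>\<^bsub>E\<^esub> r = \<ominus>\<^bsub>E\<^esub> (p (n + 1) \<cdot>\<^bsub>E\<^esub> ?p2 n) \<and> (?k n, r) \<in> Confl E" for n
  proof -
    have "Dom E (j (n + 1)) = Cod E (q n)" "Dom E (cmap u (n + 1)) = Cod E (i (n + 1))"
      "Cod E (cmap u (n + 1)) = Cod E (j (n + 1))" "Dom E (g (n + 1)) = Dom E (i (n + 1))"
      "Cod E (g (n + 1)) = Dom E (j (n + 1))" "Dom E (g (n + 1 + 1)) = Cod E (p (n + 1))"
      "Cod E (g (n + 1 + 1)) = Cod E (q (n + 1))" by (simp_all only: X Y un g)
    note * = cone_conflation[OF Y(1)[of n] Y(1)[of "n + 1"] this(1) X(1)[of "n + 1"] un(1)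
        this(2,3) g(1) this(4,5) g(4) g(1) this(6,7) gp fh(1)[of n] fh[of "n + 1"]]
    show ?thesis using * unfolding X(4) Y(4) by blast
  qed
  then obtain r where r: "r n \<in> Ar E" "Dom E (r n) = bsum E (trm Y n) (trm X (n + 1))"
    "Cod E (r n) = Dom E (h (n + 1))"
    "f (n + 1) \<cdot>\<^bsub>E\<^esub> r n = j (n + 1) \<cdot>\<^bsub>E\<^esub> q n \<cdot>\<^bsub>E\<^esub> ?p1 n \<oplus>\<^bsub>E\<^esub> cmap u (n + 1) \<cdot>\<^bsub>E\<^esub> ?p2 n"
    "h (n + 1) \<cdot>\<^bsub>E\<^esub> r n = \<ominus>\<^bsub>E\<^esub> (p (n + 1) \<cdot>\<^bsub>E\<^esub> ?p2 n)" "(?k n, r n) \<in> Confl E" for n by metis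
  have fh': "f n \<in> Ar E" "h n \<in> Ar E" "Cod E (f n) = trm Y n" "Dom E (f n) = Dom E (h n)"
    "Cod E (h n) = Z (n + 1)" for n
    using is_pullbackD[OF fh(1)[of n]] g Y by simp_all
  show ?thesis
  proof (rule ObI[of _ ?k r])
    fix n
    show "(?k n, r n) \<in> Confl E" by (rule r(6))
    show "Cod E (?k n) = trm (cone_cpx E u) n"
      using X XY fh' by (simp add: X_def[symmetric] Y_def[symmetric])
    show "Cod E (r n) = Dom E (?k (n + 1))"
      using X XY fh' r(3)[of n] by simp
    have d: "dif (cone_cpx E u) n = ?i1 (n + 1) \<cdot>\<^bsub>E\<^esub> dif Y n \<cdot>\<^bsub>E\<^esub> ?p1 n \<oplus>\<^bsub>E\<^esub>
      ?i1 (n + 1) \<cdot>\<^bsub>E\<^esub> cmap u (n + 1) \<cdot>\<^bsub>E\<^esub> ?p2 n \<oplus>\<^bsub>E\<^esub> \<ominus>\<^bsub>E\<^esub> (?i2 (n + 1) \<cdot>\<^bsub>E\<^esub> dif X (n + 1) \<cdot>\<^bsub>E\<^esub> ?p2 n)"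
      by (rule cone_dif[OF u]) (simp_all add: X_def Y_def)
    have "?k (n + 1) \<cdot>\<^bsub>E\<^esub> r n = ?i1 (n + 1) \<cdot>\<^bsub>E\<^esub> (f (n + 1) \<cdot>\<^bsub>E\<^esub> r n) \<oplus>\<^bsub>E\<^esub>
      ?i2 (n + 1) \<cdot>\<^bsub>E\<^esub> i (n + 1 + 1) \<cdot>\<^bsub>E\<^esub> (h (n + 1) \<cdot>\<^bsub>E\<^esub> r n)"
      using X XY fh' r(1-3)[of n] by simp
    also have "\<dots> = dif (cone_cpx E u) n"
      unfolding r(4,5) d using X Y XY un o by (simp add: dX dY)
    finally show "dif (cone_cpx E u) n = ?k (n + 1) \<cdot>\<^bsub>E\<^esub> r n" ..
    show "projective E (trm (cone_cpx E u) n)"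
    proof -
      let ?B = "bsum E (trm Y n) (trm X (n + 1))"
      have "stably_null E (Idt E ?B)"
      proof -
        have "stably_null E (?i1 n \<cdot>\<^bsub>E\<^esub> ?p1 n)" "stably_null E (?i2 n \<cdot>\<^bsub>E\<^esub> ?p2 n)"
          by (rule nullI; use XY in simp)+
        then have "stably_null E (?i1 n \<cdot>\<^bsub>E\<^esub> ?p1 n \<oplus>\<^bsub>E\<^esub> ?i2 n \<cdot>\<^bsub>E\<^esub> ?p2 n)"
          by (rule null_Add) (use XY in simp_all)
        then show ?thesis using XY by simp
      qed
      then show ?thesis
        using XY by (simp add: projective_iff_null_Idt X_def[symmetric] Y_def[symmetric])
    qed
  qed
qed

end

section \<open>The cone conflation and the functoriality of cones\<close>

context frobenius_complexes
begin

lemma cone_in_simps [simp]: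
  "csrc (cone_in E u) = ctgt u" "ctgt (cone_in E u) = cone_cpx E u"
  "cmap (cone_in E u) n = in1 E (trm (ctgt u) n) (trm (csrc u) (n + 1))"
  by (simp_all add: cone_in_def)

lemma cone_pr_simps [simp]:
  "csrc (cone_pr E u) = cone_cpx E u" "ctgt (cone_pr E u) = shift_cpx E 1 (csrc u)"
  "cmap (cone_pr E u) n = pr2 E (trm (ctgt u) n) (trm (csrc u) (n + 1))"
  by (simp_all add: cone_pr_def)

lemma cone_in_Ar [simp]: "u \<in> Ar AC \<Longrightarrow> cone_in E u \<in> Ar AC"
  by (rule ArI) (simp_all add: cone_dif[OF _ refl refl])

lemma cone_pr_Ar [simp]: "u \<in> Ar AC \<Longrightarrow> cone_pr E u \<in> Ar AC"
  by (rule ArI) (simp_all add: cone_dif[OF _ refl refl])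

lemma cone_Dom_Cod [simp]:
  "Dom AC (cone_in E u) = Cod AC u" "Cod AC (cone_in E u) = cone_cpx E u"
  "Dom AC (cone_pr E u) = cone_cpx E u" "Cod AC (cone_pr E u) = shift_cpx E 1 (Dom AC u)"
  by (simp_all add: AC_defs)

lemma cone_Confl: assumes "u \<in> Ar AC" shows "(cone_in E u, cone_pr E u) \<in> Confl AC"
  unfolding AC_Confl_iff
proof (intro conjI allI)
  fix n
  show "(cmap (cone_in E u) n, cmap (cone_pr E u) n) \<in> Confl E"
    by (rule split_conflation[of _ _ "pr1 E (trm (ctgt u) n) (trm (csrc u) (n + 1))"
        "in2 E (trm (ctgt u) n) (trm (csrc u) (n + 1))"]) (use assms in simp_all)
qed (use assms in simp_all)

lemma cone_map_simps [simp]: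
  "csrc (cone_map E u u' a b) = cone_cpx E u" "ctgt (cone_map E u u' a b) = cone_cpx E u'"
  "cmap (cone_map E u u' a b) n =
    in1 E (trm (ctgt u') n) (trm (csrc u') (n + 1)) \<cdot>\<^bsub>E\<^esub> cmap b n \<cdot>\<^bsub>E\<^esub> pr1 E (trm (ctgt u) n) (trm (csrc u) (n + 1)) \<oplus>\<^bsub>E\<^esub>
    in2 E (trm (ctgt u') n) (trm (csrc u') (n + 1)) \<cdot>\<^bsub>E\<^esub> cmap a (n + 1) \<cdot>\<^bsub>E\<^esub> pr2 E (trm (ctgt u) n) (trm (csrc u) (n + 1))"
  by (simp_all add: cone_map_def Let_def)

lemma cone_map_Dom_Cod [simp]:
  "Dom AC (cone_map E u u' a b) = cone_cpx E u" "Cod AC (cone_map E u u' a b) = cone_cpx E u'"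
  by (simp_all add: AC_defs)

text \<open>Commutation is strict, not up to homotopy: only then is the map of cones determined by
  \<open>a\<close> and \<open>b\<close> alone, without a chosen homotopy, and compatible with
  composition.\<close>

definition cone_square where
  "cone_square u u' a b \<longleftrightarrow> u \<in> Ar AC \<and> u' \<in> Ar AC \<and> a \<in> Ar AC \<and> b \<in> Ar AC \<and>
     Dom AC a = Dom AC u \<and> Cod AC a = Dom AC u' \<and> Dom AC b = Cod AC u \<and> Cod AC b = Cod AC u' \<and>
     b \<cdot>\<^bsub>AC\<^esub> u = u' \<cdot>\<^bsub>AC\<^esub> a"

lemma cone_squareD:
  assumes "cone_square u u' a b"
  shows "u \<in> Ar AC" "u' \<in> Ar AC" "a \<in> Ar AC" "b \<in> Ar AC"
    "csrc a = csrc u" "ctgt a = csrc u'" "csrc b = ctgt u" "ctgt b = ctgt u'"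
    "cmap b n \<cdot>\<^bsub>E\<^esub> cmap u n = cmap u' n \<cdot>\<^bsub>E\<^esub> cmap a n"
proof -
  show "u \<in> Ar AC" "u' \<in> Ar AC" "a \<in> Ar AC" "b \<in> Ar AC"
    "csrc a = csrc u" "ctgt a = csrc u'" "csrc b = ctgt u" "ctgt b = ctgt u'"
    using assms by (simp_all add: cone_square_def AC_defs(3,4))
  have "cmap (b \<cdot>\<^bsub>AC\<^esub> u) n = cmap (u' \<cdot>\<^bsub>AC\<^esub> a) n" using assms by (simp add: cone_square_def)
  then show "cmap b n \<cdot>\<^bsub>E\<^esub> cmap u n = cmap u' n \<cdot>\<^bsub>E\<^esub> cmap a n" by (simp add: AC_defs)
qed

lemma cone_map_Ar [simp]:
  assumes "cone_square u u' a b" shows "cone_map E u u' a b \<in> Ar AC"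
proof -
  note s = cone_squareD[OF assms]
  have sq: "cmap b n \<cdot>\<^bsub>E\<^esub> cmap u n \<cdot>\<^bsub>E\<^esub> k = cmap u' n \<cdot>\<^bsub>E\<^esub> cmap a n \<cdot>\<^bsub>E\<^esub> k"
    if "k \<in> Ar E" "Cod E k = trm (csrc u) n" for k n
    using Cmp_assoc'[of k "cmap u n" "cmap b n"] Cmp_assoc'[of k "cmap a n" "cmap u' n"] that s
    by simp
  show ?thesis
    by (rule ArI)
      (use s(1-8) in \<open>simp_all add: cone_dif[OF _ refl refl] sq Add_commute Add_left_commute\<close>)
qed

lemma cone_map_Cmp:
  assumes "cone_square u u' a b" "cone_square u' u'' a' b'"
  shows "cone_map E u' u'' a' b' \<cdot>\<^bsub>AC\<^esub> cone_map E u u' a b = cone_map E u u'' (a' \<cdot>\<^bsub>AC\<^esub> a) (b' \<cdot>\<^bsub>AC\<^esub> b)"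
  by (rule chmap_eqI)
    (use cone_squareD(1-8)[OF assms(1)] cone_squareD(1-8)[OF assms(2)] in \<open>simp_all add: chmap_simps\<close>)

lemma cone_map_Idt:
  assumes "u \<in> Ar AC"
  shows "cone_map E u u (Idt AC (Dom AC u)) (Idt AC (Cod AC u)) = Idt AC (cone_cpx E u)"
  by (rule chmap_eqI) (use assms in \<open>simp_all add: chmap_simps\<close>)

lemma cone_map_Add:
  assumes "cone_square u u' a b" "cone_square u u' a' b'"
  shows "cone_map E u u' a b \<oplus>\<^bsub>AC\<^esub> cone_map E u u' a' b' = cone_map E u u' (a \<oplus>\<^bsub>AC\<^esub> a') (b \<oplus>\<^bsub>AC\<^esub> b')"
  by (rule chmap_eqI)
    (use cone_squareD(1-8)[OF assms(1)] cone_squareD(1-8)[OF assms(2)]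
      in \<open>simp_all add: chmap_simps Add_commute Add_left_commute\<close>)

lemma cone_map_in:
  assumes "cone_square u u' a b"
  shows "cone_map E u u' a b \<cdot>\<^bsub>AC\<^esub> cone_in E u = cone_in E u' \<cdot>\<^bsub>AC\<^esub> b"
  by (rule chmap_eqI) (use cone_squareD(1-8)[OF assms] in \<open>simp_all add: chmap_simps\<close>)

lemma cone_map_pr:
  assumes "cone_square u u' a b"
  shows "cone_pr E u' \<cdot>\<^bsub>AC\<^esub> cone_map E u u' a b = fa (shift E 1) a \<cdot>\<^bsub>AC\<^esub> cone_pr E u"
  by (rule chmap_eqI) (use cone_squareD(1-8)[OF assms] in \<open>simp_all add: chmap_simps\<close>)

text \<open>The deflation is factored as \<open>1 \<oplus> q\<close> after
  \<open>p \<oplus> 1\<close>; here \<open>?r1\<close> is a pullback of \<open>p\<close> and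
  \<open>?r2\<close> is a pullback of \<open>q\<close>. Exactness of cone functors comes from
  this.\<close>

lemma (in exact_category) bsum_Confl:
  assumes ip: "(i, p) \<in> Confl A" and jq: "(j, q) \<in> Confl A"
  defines "x \<equiv> Dom A i" and "y \<equiv> Cod A i" and "z \<equiv> Cod A p"
    and "x' \<equiv> Dom A j" and "y' \<equiv> Cod A j" and "z' \<equiv> Cod A q"
  shows "(in1 A y y' \<cdot>\<^bsub>A\<^esub> i \<cdot>\<^bsub>A\<^esub> pr1 A x x' \<oplus>\<^bsub>A\<^esub> in2 A y y' \<cdot>\<^bsub>A\<^esub> j \<cdot>\<^bsub>A\<^esub> pr2 A x x',
    in1 A z z' \<cdot>\<^bsub>A\<^esub> p \<cdot>\<^bsub>A\<^esub> pr1 A y y' \<oplus>\<^bsub>A\<^esub> in2 A z z' \<cdot>\<^bsub>A\<^esub> q \<cdot>\<^bsub>A\<^esub> pr2 A y y') \<in> Confl A"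
    (is "(?k, ?r) \<in> _")
proof (rule Confl_if_deflation_kernel)
  have c: "i \<in> Ar A" "p \<in> Ar A" "Dom A p = y" "Dom A i = x" "Cod A i = y" "Cod A p = z"
    and d: "j \<in> Ar A" "q \<in> Ar A" "Dom A q = y'" "Dom A j = x'" "Cod A j = y'" "Cod A q = z'"
    using ip jq by (simp_all add: x_def y_def z_def x'_def y'_def z'_def)
  have o: "x \<in> Ob A" "y \<in> Ob A" "z \<in> Ob A" "x' \<in> Ob A" "y' \<in> Ob A" "z' \<in> Ob A"
    using c d Cod_Ob[of p] Cod_Ob[of q] Dom_Ob[of i] Dom_Ob[of j] Cod_Ob[of i] Cod_Ob[of j] by simp_all
  have pi: "p \<cdot>\<^bsub>A\<^esub> i = Zer A x z" "q \<cdot>\<^bsub>A\<^esub> j = Zer A x' z'"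
    using Confl_simps(4)[OF ip] Confl_simps(4)[OF jq] c d by simp_all
  have pi': "p \<cdot>\<^bsub>A\<^esub> i \<cdot>\<^bsub>A\<^esub> k = Zer A (Dom A k) z" if "k \<in> Ar A" "Cod A k = x" for k
    using Cmp_assoc'[of k i p] that c o pi by simp
  have qj': "q \<cdot>\<^bsub>A\<^esub> j \<cdot>\<^bsub>A\<^esub> k = Zer A (Dom A k) z'" if "k \<in> Ar A" "Cod A k = x'" for k
    using Cmp_assoc'[of k j q] that d o pi by simp
  note [simp] = c d o pi pi' qj'
  let ?r1 = "in1 A z y' \<cdot>\<^bsub>A\<^esub> p \<cdot>\<^bsub>A\<^esub> pr1 A y y' \<oplus>\<^bsub>A\<^esub> in2 A z y' \<cdot>\<^bsub>A\<^esub> pr2 A y y'"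
  let ?r2 = "in1 A z z' \<cdot>\<^bsub>A\<^esub> pr1 A z y' \<oplus>\<^bsub>A\<^esub> in2 A z z' \<cdot>\<^bsub>A\<^esub> q \<cdot>\<^bsub>A\<^esub> pr2 A z y'"
  have "is_pullback A p (pr1 A z y') (pr1 A y y') ?r1"
  proof (rule is_pullbackI)
    fix a b assume ab: "a \<in> Ar A" "b \<in> Ar A" "Cod A a = Dom A p" "Cod A b = Dom A (pr1 A z y')"
      "Dom A a = Dom A b" "p \<cdot>\<^bsub>A\<^esub> a = pr1 A z y' \<cdot>\<^bsub>A\<^esub> b"
    let ?g = "in1 A y y' \<cdot>\<^bsub>A\<^esub> a \<oplus>\<^bsub>A\<^esub> in2 A y y' \<cdot>\<^bsub>A\<^esub> pr2 A z y' \<cdot>\<^bsub>A\<^esub> b"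
    have "?r1 \<cdot>\<^bsub>A\<^esub> ?g = b"
      by (rule bsum_into_eq[of z y']) (use ab in simp_all)
    then show "\<exists>g. g \<in> Ar A \<and> Dom A g = Dom A b \<and> Cod A g = Dom A ?r1 \<and> pr1 A y y' \<cdot>\<^bsub>A\<^esub> g = a \<and> ?r1 \<cdot>\<^bsub>A\<^esub> g = b"
      by (intro exI[of _ ?g] conjI) (use ab(1-5) in simp_all)
  next
    fix g h assume gh: "g \<in> Ar A" "h \<in> Ar A" "Dom A g = Dom A h" "Cod A g = Dom A ?r1"
      "Cod A h = Dom A ?r1" "pr1 A y y' \<cdot>\<^bsub>A\<^esub> g = pr1 A y y' \<cdot>\<^bsub>A\<^esub> h" "?r1 \<cdot>\<^bsub>A\<^esub> g = ?r1 \<cdot>\<^bsub>A\<^esub> h"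
    have "pr2 A z y' \<cdot>\<^bsub>A\<^esub> (?r1 \<cdot>\<^bsub>A\<^esub> k) = pr2 A y y' \<cdot>\<^bsub>A\<^esub> k" if "k \<in> Ar A" "Cod A k = bsum A y y'" for k
      using that by simp
    from this[of g] this[of h] have "pr2 A y y' \<cdot>\<^bsub>A\<^esub> g = pr2 A y y' \<cdot>\<^bsub>A\<^esub> h"
      unfolding gh(7) using gh(1-5) by simp
    then show "g = h" by (rule bsum_into_eq[of y y', rotated 7]) (use gh(1-6) in simp_all)
  qed simp_all
  then have r1: "deflation A ?r1"
    by (rule deflation_of_pullback) (use ip in \<open>auto simp: deflation_def\<close>)
  have "is_pullback A q (pr2 A z z') (pr2 A z y') ?r2"
  proof (rule is_pullbackI)
    fix a b assume ab: "a \<in> Ar A" "b \<in> Ar A" "Cod A a = Dom A q" "Cod A b = Dom A (pr2 A z z')"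
      "Dom A a = Dom A b" "q \<cdot>\<^bsub>A\<^esub> a = pr2 A z z' \<cdot>\<^bsub>A\<^esub> b"
    let ?g = "in1 A z y' \<cdot>\<^bsub>A\<^esub> pr1 A z z' \<cdot>\<^bsub>A\<^esub> b \<oplus>\<^bsub>A\<^esub> in2 A z y' \<cdot>\<^bsub>A\<^esub> a"
    have "?r2 \<cdot>\<^bsub>A\<^esub> ?g = b"
      by (rule bsum_into_eq[of z z']) (use ab in simp_all)
    then show "\<exists>g. g \<in> Ar A \<and> Dom A g = Dom A b \<and> Cod A g = Dom A ?r2 \<and> pr2 A z y' \<cdot>\<^bsub>A\<^esub> g = a \<and> ?r2 \<cdot>\<^bsub>A\<^esub> g = b"
      by (intro exI[of _ ?g] conjI) (use ab(1-5) in simp_all)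
  next
    fix g h assume gh: "g \<in> Ar A" "h \<in> Ar A" "Dom A g = Dom A h" "Cod A g = Dom A ?r2"
      "Cod A h = Dom A ?r2" "pr2 A z y' \<cdot>\<^bsub>A\<^esub> g = pr2 A z y' \<cdot>\<^bsub>A\<^esub> h" "?r2 \<cdot>\<^bsub>A\<^esub> g = ?r2 \<cdot>\<^bsub>A\<^esub> h"
    have "pr1 A z z' \<cdot>\<^bsub>A\<^esub> (?r2 \<cdot>\<^bsub>A\<^esub> k) = pr1 A z y' \<cdot>\<^bsub>A\<^esub> k" if "k \<in> Ar A" "Cod A k = bsum A z y'" for k
      using that by simp
    from this[of g] this[of h] have "pr1 A z y' \<cdot>\<^bsub>A\<^esub> g = pr1 A z y' \<cdot>\<^bsub>A\<^esub> h"
      unfolding gh(7) using gh(1-5) by simp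
    then show "g = h" by (rule bsum_into_eq[of z y', rotated 6]) (use gh(1-6) in simp_all)
  qed simp_all
  then have r2: "deflation A ?r2"
    by (rule deflation_of_pullback) (use jq in \<open>auto simp: deflation_def\<close>)
  have "deflation A (?r2 \<cdot>\<^bsub>A\<^esub> ?r1)" by (rule deflation_Cmp[OF r1 r2]) simp
  then show "deflation A ?r" by simp
  show "is_kernel A ?k ?r"
  proof (rule is_kernelI)
    fix f assume f: "f \<in> Ar A" "Cod A f = Dom A ?r" "?r \<cdot>\<^bsub>A\<^esub> f = Zer A (Dom A f) (Cod A ?r)"
    have f': "Cod A f = bsum A y y'" using f by simp
    have "pr1 A z z' \<cdot>\<^bsub>A\<^esub> (?r \<cdot>\<^bsub>A\<^esub> f) = p \<cdot>\<^bsub>A\<^esub> pr1 A y y' \<cdot>\<^bsub>A\<^esub> f"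
      "pr2 A z z' \<cdot>\<^bsub>A\<^esub> (?r \<cdot>\<^bsub>A\<^esub> f) = q \<cdot>\<^bsub>A\<^esub> pr2 A y y' \<cdot>\<^bsub>A\<^esub> f" using f(1) f' by simp_all
    then have 0: "p \<cdot>\<^bsub>A\<^esub> pr1 A y y' \<cdot>\<^bsub>A\<^esub> f = Zer A (Dom A f) (Cod A p)"
      "q \<cdot>\<^bsub>A\<^esub> pr2 A y y' \<cdot>\<^bsub>A\<^esub> f = Zer A (Dom A f) (Cod A q)" unfolding f(3) using f(1) by simp_all
    have "pr1 A y y' \<cdot>\<^bsub>A\<^esub> f \<in> Ar A" "Cod A (pr1 A y y' \<cdot>\<^bsub>A\<^esub> f) = Cod A i" "Dom A (pr1 A y y' \<cdot>\<^bsub>A\<^esub> f) = Dom A f"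
      using f(1) f' by simp_all
    from Confl_lift[OF ip this 0(1)] obtain g where g: "g \<in> Ar A" "Dom A g = Dom A f"
      "Cod A g = Dom A i" "i \<cdot>\<^bsub>A\<^esub> g = pr1 A y y' \<cdot>\<^bsub>A\<^esub> f" .
    have "pr2 A y y' \<cdot>\<^bsub>A\<^esub> f \<in> Ar A" "Cod A (pr2 A y y' \<cdot>\<^bsub>A\<^esub> f) = Cod A j" "Dom A (pr2 A y y' \<cdot>\<^bsub>A\<^esub> f) = Dom A f"
      using f(1) f' by simp_all
    from Confl_lift[OF jq this 0(2)] obtain h where h: "h \<in> Ar A" "Dom A h = Dom A f"
      "Cod A h = Dom A j" "j \<cdot>\<^bsub>A\<^esub> h = pr2 A y y' \<cdot>\<^bsub>A\<^esub> f" .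
    let ?g = "in1 A x x' \<cdot>\<^bsub>A\<^esub> g \<oplus>\<^bsub>A\<^esub> in2 A x x' \<cdot>\<^bsub>A\<^esub> h"
    have "?k \<cdot>\<^bsub>A\<^esub> ?g = f" by (rule bsum_into_eq[of y y']) (use f(1) f' g h in simp_all)
    then show "\<exists>g. g \<in> Ar A \<and> Dom A g = Dom A f \<and> Cod A g = Dom A ?k \<and> ?k \<cdot>\<^bsub>A\<^esub> g = f"
      by (intro exI[of _ ?g] conjI) (use g(1-3) h(1-3) in simp_all)
  next
    fix g h assume gh: "g \<in> Ar A" "h \<in> Ar A" "Dom A g = Dom A h" "Cod A g = Dom A ?k"
      "Cod A h = Dom A ?k" "?k \<cdot>\<^bsub>A\<^esub> g = ?k \<cdot>\<^bsub>A\<^esub> h"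
    have *: "pr1 A y y' \<cdot>\<^bsub>A\<^esub> (?k \<cdot>\<^bsub>A\<^esub> f) = i \<cdot>\<^bsub>A\<^esub> pr1 A x x' \<cdot>\<^bsub>A\<^esub> f"
      "pr2 A y y' \<cdot>\<^bsub>A\<^esub> (?k \<cdot>\<^bsub>A\<^esub> f) = j \<cdot>\<^bsub>A\<^esub> pr2 A x x' \<cdot>\<^bsub>A\<^esub> f" if "f \<in> Ar A" "Cod A f = bsum A x x'" for f
      using that by simp_all
    have k: "Cod A g = bsum A x x'" "Cod A h = bsum A x x'" using gh by simp_all
    have "i \<cdot>\<^bsub>A\<^esub> pr1 A x x' \<cdot>\<^bsub>A\<^esub> g = i \<cdot>\<^bsub>A\<^esub> pr1 A x x' \<cdot>\<^bsub>A\<^esub> h"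
      using *(1)[OF gh(1) k(1)] *(1)[OF gh(2) k(2)] unfolding gh(6) by simp
    then have 1: "pr1 A x x' \<cdot>\<^bsub>A\<^esub> g = pr1 A x x' \<cdot>\<^bsub>A\<^esub> h"
      by (rule Confl_mono[OF ip, rotated 5]) (use gh(1-3) k in simp_all)
    have "j \<cdot>\<^bsub>A\<^esub> pr2 A x x' \<cdot>\<^bsub>A\<^esub> g = j \<cdot>\<^bsub>A\<^esub> pr2 A x x' \<cdot>\<^bsub>A\<^esub> h"
      using *(2)[OF gh(1) k(1)] *(2)[OF gh(2) k(2)] unfolding gh(6) by simp
    then have 2: "pr2 A x x' \<cdot>\<^bsub>A\<^esub> g = pr2 A x x' \<cdot>\<^bsub>A\<^esub> h"
      by (rule Confl_mono[OF jq, rotated 5]) (use gh(1-3) k in simp_all)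
    show "g = h" by (rule bsum_into_eq[OF _ _ _ _ _ _ 1 2]) (use gh(1,2) k in simp_all)
  qed simp_all
qed

lemma cone_map_Confl:
  assumes s: "cone_square u u' i j" "cone_square u' u'' p q"
    and c: "(i, p) \<in> Confl AC" "(j, q) \<in> Confl AC"
  shows "(cone_map E u u' i j, cone_map E u' u'' p q) \<in> Confl AC"
proof -
  note d = cone_squareD(1-8)[OF s(1)] cone_squareD(1-8)[OF s(2)]
  have ip: "(cmap i n, cmap p n) \<in> Confl E" and jq: "(cmap j n, cmap q n) \<in> Confl E" for n
    using c unfolding AC_Confl_iff by blast+
  show ?thesis
    unfolding AC_Confl_iff
  proof (intro conjI allI)
    fix n
    \<comment> \<open>In degree \<open>n\<close> the cone is the target in degree \<open>n\<close>
      plus the source in degree \<open>n + 1\<close>; hence the order and the indices of the two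
      conflations.\<close>
    show "(cmap (cone_map E u u' i j) n, cmap (cone_map E u' u'' p q) n) \<in> Confl E"
      using bsum_Confl[OF jq[of n] ip[of "n + 1"]] d by simp
  qed (simp_all add: s)
qed

end

section \<open>The stable category of acyclic complexes\<close>

context frobenius_complexes
begin

text \<open>A chain map out of the cone of \<open>u\<close> is a chain map \<open>f\<close> out of the target together with a
  null homotopy of \<open>f u\<close>.\<close>

definition cone_out where
  "cone_out u f h = \<lparr>csrc = cone_cpx E u, ctgt = ctgt f,
     cmap = (\<lambda>n. cmap f n \<cdot>\<^bsub>E\<^esub> pr1 E (trm (ctgt u) n) (trm (csrc u) (n + 1)) \<oplus>\<^bsub>E\<^esub>
       h n \<cdot>\<^bsub>E\<^esub> pr2 E (trm (ctgt u) n) (trm (csrc u) (n + 1)))\<rparr>"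

lemma cone_out_simps [simp]:
  "csrc (cone_out u f h) = cone_cpx E u" "ctgt (cone_out u f h) = ctgt f"
  "cmap (cone_out u f h) n = cmap f n \<cdot>\<^bsub>E\<^esub> pr1 E (trm (ctgt u) n) (trm (csrc u) (n + 1)) \<oplus>\<^bsub>E\<^esub>
       h n \<cdot>\<^bsub>E\<^esub> pr2 E (trm (ctgt u) n) (trm (csrc u) (n + 1))"
  by (simp_all add: cone_out_def)

lemma cone_out_Ar:
  assumes u: "u \<in> Ar AC" and f: "f \<in> Ar AC" "csrc f = ctgt u"
    and h: "\<And>n. h n \<in> Ar E" "\<And>n. Dom E (h n) = trm (csrc u) (n + 1)" "\<And>n. Cod E (h n) = trm (ctgt f) n"
    and hom: "\<And>n. cmap f (n + 1) \<cdot>\<^bsub>E\<^esub> cmap u (n + 1) =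
      dif (ctgt f) n \<cdot>\<^bsub>E\<^esub> h n \<oplus>\<^bsub>E\<^esub> h (n + 1) \<cdot>\<^bsub>E\<^esub> dif (csrc u) (n + 1)"
  shows "cone_out u f h \<in> Ar AC"
proof (rule ArI)
  fix n
  have hom': "cmap f (n + 1) \<cdot>\<^bsub>E\<^esub> cmap u (n + 1) \<cdot>\<^bsub>E\<^esub> k =
      dif (ctgt f) n \<cdot>\<^bsub>E\<^esub> h n \<cdot>\<^bsub>E\<^esub> k \<oplus>\<^bsub>E\<^esub> h (n + 1) \<cdot>\<^bsub>E\<^esub> dif (csrc u) (n + 1) \<cdot>\<^bsub>E\<^esub> k"
    if "k \<in> Ar E" "Cod E k = trm (csrc u) (n + 1)" for k
    using Cmp_assoc'[of k "cmap u (n + 1)" "cmap f (n + 1)"] that u f h hom[of n] by simp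
  show "dif (ctgt (cone_out u f h)) n \<cdot>\<^bsub>E\<^esub> cmap (cone_out u f h) n =
    cmap (cone_out u f h) (n + 1) \<cdot>\<^bsub>E\<^esub> dif (csrc (cone_out u f h)) n"
    using u f h by (simp add: cone_dif[OF u refl refl] hom')
qed (use assms in simp_all)

text \<open>A chain map out of the cone of an identity is the same as an arbitrary family
  \<open>h\<close> of maps of degree \<open>-1\<close>: the component on the second summand is free,
  and the other one must be \<open>d h + h d\<close>. Such a family lifts degree by degree because
  the terms of \<open>X\<close> are projective.\<close>

lemma cone_Idt_projective:
  assumes X: "X \<in> Ob AC" shows "projective AC (cone_cpx E (Idt AC X))"
proof -
  let ?u = "Idt AC X"
  have u: "?u \<in> Ar AC" "csrc ?u = X" "ctgt ?u = X" "\<And>n. cmap ?u n = Idt E (trm X n)"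
    using X AC.Idt_simps[of X] by (simp_all add: AC_defs(3-5))
  have "\<exists>g\<in>homset AC (cone_cpx E ?u) (Dom AC p). p \<cdot>\<^bsub>AC\<^esub> g = \<phi>"
    if p: "deflation AC p" and \<phi>: "\<phi> \<in> homset AC (cone_cpx E ?u) (Cod AC p)" for p \<phi>
  proof -
    obtain i where "(i, p) \<in> Confl AC" using p by (auto simp: deflation_def)
    then have ip: "i \<in> Ar AC" "p \<in> Ar AC" "ctgt i = csrc p" "\<And>n. (cmap i n, cmap p n) \<in> Confl E"
      unfolding AC_Confl_iff by auto
    have f: "\<phi> \<in> Ar AC" "csrc \<phi> = cone_cpx E ?u" "ctgt \<phi> = ctgt p"
      using \<phi> by (simp_all add: homset_iff AC_defs(3,4))
    let ?i1 = "\<lambda>n. in1 E (trm X n) (trm X (n + 1))" and ?i2 = "\<lambda>n. in2 E (trm X n) (trm X (n + 1))"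
    let ?h = "\<lambda>n. cmap \<phi> n \<cdot>\<^bsub>E\<^esub> ?i2 n"
    have fd: "dif (ctgt p) n \<cdot>\<^bsub>E\<^esub> cmap \<phi> n = cmap \<phi> (n + 1) \<cdot>\<^bsub>E\<^esub> dif (cone_cpx E ?u) n" for n
      using chain(1)[OF f(1,3)] f(2) by simp
    have h_hom: "dif (ctgt p) n \<cdot>\<^bsub>E\<^esub> ?h n \<oplus>\<^bsub>E\<^esub> ?h (n + 1) \<cdot>\<^bsub>E\<^esub> dif X (n + 1) = cmap \<phi> (n + 1) \<cdot>\<^bsub>E\<^esub> ?i1 (n + 1)" for n
    proof -
      have "dif (ctgt p) n \<cdot>\<^bsub>E\<^esub> ?h n = (dif (ctgt p) n \<cdot>\<^bsub>E\<^esub> cmap \<phi> n) \<cdot>\<^bsub>E\<^esub> ?i2 n"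
        using f X u ip by (simp del: chain)
      also have "\<dots> = cmap \<phi> (n + 1) \<cdot>\<^bsub>E\<^esub> ?i1 (n + 1) \<oplus>\<^bsub>E\<^esub> \<ominus>\<^bsub>E\<^esub> (?h (n + 1) \<cdot>\<^bsub>E\<^esub> dif X (n + 1))"
        unfolding fd cone_dif[OF u(1-3)] using f X u by simp
      finally show ?thesis using f X u by simp
    qed
    have "\<exists>h. h \<in> Ar E \<and> Dom E h = trm X (n + 1) \<and> Cod E h = trm (csrc p) n \<and> cmap p n \<cdot>\<^bsub>E\<^esub> h = ?h n" for n
    proof -
      have "?h n \<in> Ar E" "Dom E (?h n) = trm X (n + 1)" "Cod E (?h n) = Cod E (cmap p n)"
        using f X u ip by simp_all
      from projective_lift[OF _ ip(4) this] show ?thesis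
        using ObD(1)[OF X] ip(1,3) by (metis ArD(5))
    qed
    then obtain h where h: "h n \<in> Ar E" "Dom E (h n) = trm X (n + 1)" "Cod E (h n) = trm (csrc p) n"
      "cmap p n \<cdot>\<^bsub>E\<^esub> h n = ?h n" for n by metis
    have ph: "cmap p n \<cdot>\<^bsub>E\<^esub> h n \<cdot>\<^bsub>E\<^esub> k = cmap \<phi> n \<cdot>\<^bsub>E\<^esub> ?i2 n \<cdot>\<^bsub>E\<^esub> k"
      if "k \<in> Ar E" "Cod E k = trm X (n + 1)" for n k
      using Cmp_assoc'[of k "h n" "cmap p n"] Cmp_assoc'[of k "?i2 n" "cmap \<phi> n"] that h ip f u X by simp
    \<comment> \<open>\<open>h (n - 1)\<close> starts in degree \<open>n\<close> and ends in degree
      \<open>n - 1\<close>, hence the index shift. With this definition the homotopy identity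
      required by \<open>cone_out_Ar\<close> holds by construction.\<close>
    define g where "g = \<lparr>csrc = X, ctgt = csrc p,
      cmap = (\<lambda>n. dif (csrc p) (n - 1) \<cdot>\<^bsub>E\<^esub> h (n - 1) \<oplus>\<^bsub>E\<^esub> h n \<cdot>\<^bsub>E\<^esub> dif X n)\<rparr>"
    have g_simps: "csrc g = X" "ctgt g = csrc p"
      "\<And>n. cmap g n = dif (csrc p) (n - 1) \<cdot>\<^bsub>E\<^esub> h (n - 1) \<oplus>\<^bsub>E\<^esub> h n \<cdot>\<^bsub>E\<^esub> dif X n"
      by (simp_all add: g_def)
    have d1: "Cod E (dif Y (n - 1)) = trm Y n" if "Y \<in> Ob AC" for Y n using that by simp
    have g: "g \<in> Ar AC"
      by (rule ArI) (use X ip(1-3) h(1-3) in \<open>simp_all add: g_simps\<close>)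
    have G: "cone_out ?u g h \<in> Ar AC"
      by (rule cone_out_Ar) (use X u g ip(1-3) h(1-3) in \<open>simp_all add: g_simps\<close>)
    have pg: "cmap p n \<cdot>\<^bsub>E\<^esub> cmap g n = cmap \<phi> n \<cdot>\<^bsub>E\<^esub> ?i1 n" for n
    proof -
      have "cmap p n \<cdot>\<^bsub>E\<^esub> cmap g n = dif (ctgt p) (n - 1) \<cdot>\<^bsub>E\<^esub> ?h (n - 1) \<oplus>\<^bsub>E\<^esub> ?h n \<cdot>\<^bsub>E\<^esub> dif X n"
      proof -
        have "cmap p n \<cdot>\<^bsub>E\<^esub> dif (csrc p) (n - 1) \<cdot>\<^bsub>E\<^esub> h (n - 1) = dif (ctgt p) (n - 1) \<cdot>\<^bsub>E\<^esub> cmap p (n - 1) \<cdot>\<^bsub>E\<^esub> h (n - 1)"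
          using ip h(1-3) X by simp
        then show ?thesis
          using X ip(1-3) h(1-3) f u by (simp add: g_simps h(4) ph del: chain)
      qed
      then show ?thesis using h_hom[of "n - 1"] by simp
    qed
    have "p \<cdot>\<^bsub>AC\<^esub> cone_out ?u g h = \<phi>"
    proof (rule chmap_eqI)
      fix n
      have "cmap p n \<cdot>\<^bsub>E\<^esub> cmap (cone_out ?u g h) n = cmap \<phi> n"
        by (rule bsum_from_eq[of "trm X n" "trm X (n + 1)"])
          (use g g_simps(1,2) ip f u X h(1-3) pg[of n] in \<open>simp_all add: h(4)\<close>)
      then show "cmap (p \<cdot>\<^bsub>AC\<^esub> cone_out ?u g h) n = cmap \<phi> n" by (simp add: chmap_simps(4))
    qed (simp_all add: chmap_simps(4) f)
    then show ?thesis
      using G f ip(3) by (intro bexI[of _ "cone_out ?u g h"]) (simp_all add: homset_iff AC_defs(3,4) g_simps)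
  qed
  then show ?thesis unfolding projective_def using cone_Ob[OF u(1)] by blast
qed

text \<open>Dually, a chain map into this cone is determined by its first component, an arbitrary
  degreewise family \<open>g\<close>, since the second one must be \<open>g d - d g\<close>. The
  family extends along \<open>i\<close> because projective terms are injective.\<close>

lemma cone_Idt_injective:
  assumes X: "X \<in> Ob AC" shows "injective AC (cone_cpx E (Idt AC X))"
proof -
  let ?u = "Idt AC X"
  have u: "?u \<in> Ar AC" "csrc ?u = X" "ctgt ?u = X" "\<And>n. cmap ?u n = Idt E (trm X n)"
    using X AC.Idt_simps[of X] by (simp_all add: AC_defs(3-5))
  have "\<exists>g\<in>homset AC (Cod AC i) (cone_cpx E ?u). g \<cdot>\<^bsub>AC\<^esub> i = \<phi>"
    if i: "inflation AC i" and \<phi>: "\<phi> \<in> homset AC (Dom AC i) (cone_cpx E ?u)" for i \<phi>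
  proof -
    obtain p where "(i, p) \<in> Confl AC" using i by (auto simp: inflation_def)
    then have ip: "i \<in> Ar AC" "\<And>n. (cmap i n, cmap p n) \<in> Confl E"
      unfolding AC_Confl_iff by auto
    have f: "\<phi> \<in> Ar AC" "csrc \<phi> = csrc i" "ctgt \<phi> = cone_cpx E ?u"
      using \<phi> by (simp_all add: homset_iff AC_defs(3,4))
    let ?i1 = "\<lambda>n. in1 E (trm X n) (trm X (n + 1))" and ?i2 = "\<lambda>n. in2 E (trm X n) (trm X (n + 1))"
      and ?p1 = "\<lambda>n. pr1 E (trm X n) (trm X (n + 1))" and ?p2 = "\<lambda>n. pr2 E (trm X n) (trm X (n + 1))"
    have fd: "dif (cone_cpx E ?u) n \<cdot>\<^bsub>E\<^esub> cmap \<phi> n = cmap \<phi> (n + 1) \<cdot>\<^bsub>E\<^esub> dif (csrc i) n" for n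
      using chain(1)[OF f(1,3)] f(2) by simp
    have f1: "?p1 (n + 1) \<cdot>\<^bsub>E\<^esub> cmap \<phi> (n + 1) \<cdot>\<^bsub>E\<^esub> dif (csrc i) n =
      dif X n \<cdot>\<^bsub>E\<^esub> ?p1 n \<cdot>\<^bsub>E\<^esub> cmap \<phi> n \<oplus>\<^bsub>E\<^esub> ?p2 n \<cdot>\<^bsub>E\<^esub> cmap \<phi> n" for n
      unfolding fd[symmetric] cone_dif[OF u(1-3)] using f X u ip(1) by simp
    have "\<exists>g. g \<in> Ar E \<and> Dom E g = trm (ctgt i) n \<and> Cod E g = trm X n \<and> g \<cdot>\<^bsub>E\<^esub> cmap i n = ?p1 n \<cdot>\<^bsub>E\<^esub> cmap \<phi> n" for n
    proof -
      have "?p1 n \<cdot>\<^bsub>E\<^esub> cmap \<phi> n \<in> Ar E" "Cod E (?p1 n \<cdot>\<^bsub>E\<^esub> cmap \<phi> n) = trm X n"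
        "Dom E (?p1 n \<cdot>\<^bsub>E\<^esub> cmap \<phi> n) = Dom E (cmap i n)"
        using f X u ip by simp_all
      from injective_extend[OF _ ip(2) this] show ?thesis
        using ObD(1)[OF X] ip(1) by (metis ArD(5))
    qed
    then obtain g where g: "g n \<in> Ar E" "Dom E (g n) = trm (ctgt i) n" "Cod E (g n) = trm X n"
      "g n \<cdot>\<^bsub>E\<^esub> cmap i n = ?p1 n \<cdot>\<^bsub>E\<^esub> cmap \<phi> n" for n by metis
    have gi: "g n \<cdot>\<^bsub>E\<^esub> cmap i n \<cdot>\<^bsub>E\<^esub> k = ?p1 n \<cdot>\<^bsub>E\<^esub> cmap \<phi> n \<cdot>\<^bsub>E\<^esub> k"
      if "k \<in> Ar E" "Cod E k = trm (csrc i) n" for n k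
      using Cmp_assoc'[of k "cmap i n" "g n"] Cmp_assoc'[of k "cmap \<phi> n" "?p1 n"] that g ip f u X by simp
    let ?h = "\<lambda>n. g (n + 1) \<cdot>\<^bsub>E\<^esub> dif (ctgt i) n \<oplus>\<^bsub>E\<^esub> \<ominus>\<^bsub>E\<^esub> (dif X n \<cdot>\<^bsub>E\<^esub> g n)"
    let ?G = "\<lparr>csrc = ctgt i, ctgt = cone_cpx E ?u,
      cmap = (\<lambda>n. ?i1 n \<cdot>\<^bsub>E\<^esub> g n \<oplus>\<^bsub>E\<^esub> ?i2 n \<cdot>\<^bsub>E\<^esub> ?h n)\<rparr>"
    have G: "?G \<in> Ar AC"
    proof (rule ArI)
      fix n
      show "dif (ctgt ?G) n \<cdot>\<^bsub>E\<^esub> cmap ?G n = cmap ?G (n + 1) \<cdot>\<^bsub>E\<^esub> dif (csrc ?G) n"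
        by (rule bsum_into_eq[of "trm X (n + 1)" "trm X (n + 1 + 1)"])
          (use X u ip(1) g(1-3) Add_commute in \<open>simp_all add: cone_dif[OF u(1-3)]\<close>)
    qed (use X u ip(1) g(1-3) in simp_all)
    have "?G \<cdot>\<^bsub>AC\<^esub> i = \<phi>"
    proof (rule chmap_eqI)
      fix n
      have "(?i1 n \<cdot>\<^bsub>E\<^esub> g n \<oplus>\<^bsub>E\<^esub> ?i2 n \<cdot>\<^bsub>E\<^esub> ?h n) \<cdot>\<^bsub>E\<^esub> cmap i n = cmap \<phi> n"
      proof (rule bsum_into_eq[of "trm X n" "trm X (n + 1)"])
        have "g (n + 1) \<cdot>\<^bsub>E\<^esub> cmap i (n + 1) \<cdot>\<^bsub>E\<^esub> dif (csrc i) n =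
          ?p1 (n + 1) \<cdot>\<^bsub>E\<^esub> cmap \<phi> (n + 1) \<cdot>\<^bsub>E\<^esub> dif (csrc i) n"
          by (rule gi) (use ip in simp_all)
        then show "?p2 n \<cdot>\<^bsub>E\<^esub> (?i1 n \<cdot>\<^bsub>E\<^esub> g n \<oplus>\<^bsub>E\<^esub> ?i2 n \<cdot>\<^bsub>E\<^esub> ?h n) \<cdot>\<^bsub>E\<^esub> cmap i n = ?p2 n \<cdot>\<^bsub>E\<^esub> cmap \<phi> n"
          unfolding f1 using X u ip(1) g f
            Add_left_commute[of "dif X n \<cdot>\<^bsub>E\<^esub> ?p1 n \<cdot>\<^bsub>E\<^esub> cmap \<phi> n" "?p2 n \<cdot>\<^bsub>E\<^esub> cmap \<phi> n"]
            Add_commute[of "?p2 n \<cdot>\<^bsub>E\<^esub> cmap \<phi> n" "\<ominus>\<^bsub>E\<^esub> (dif X n \<cdot>\<^bsub>E\<^esub> ?p1 n \<cdot>\<^bsub>E\<^esub> cmap \<phi> n)"]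
          by simp
      qed (use X u ip(1) g f in simp_all)
      then show "cmap (?G \<cdot>\<^bsub>AC\<^esub> i) n = cmap \<phi> n" by (simp add: chmap_simps(4))
    qed (simp_all add: chmap_simps(4) f)
    then show ?thesis
      using G by (intro bexI[of _ ?G]) (simp_all add: homset_iff AC_defs(3,4))
  qed
  then show ?thesis unfolding injective_def using cone_Ob[OF u(1)] by blast
qed

text \<open>\<open>P\<close> is a quotient of the cone of the identity of \<open>P[-1]\<close>.
  Being projective it is a retract of that cone, and a retract of an injective object is
  injective.\<close>

lemma AC_projective_injective:
  assumes P: "projective AC P" shows "injective AC P"
proof -
  have P': "P \<in> Ob AC" using P by simp
  let ?Q = "shift_cpx E (- 1) P"
  let ?u = "Idt AC ?Q"
  have Q: "?Q \<in> Ob AC" "?u \<in> Ar AC" using P' by simp_all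
  let ?C = "cone_cpx E ?u" and ?p = "cone_pr E ?u"
  have p: "?p \<in> Ar AC" "Dom AC ?p = ?C" "Cod AC ?p = P"
    using Q P' by simp_all
  have "deflation AC ?p" using cone_Confl[OF Q(2)] by (auto simp: deflation_def)
  moreover have "Idt AC P \<in> homset AC P (Cod AC ?p)" using p P' by (simp add: homset_iff)
  ultimately obtain s where s: "s \<in> homset AC P (Dom AC ?p)" "?p \<cdot>\<^bsub>AC\<^esub> s = Idt AC P"
    using P unfolding projective_def by blast
  have s': "s \<in> Ar AC" "Dom AC s = P" "Cod AC s = ?C" using s p by (simp_all add: homset_iff)
  have "\<exists>g\<in>homset AC (Cod AC i) P. g \<cdot>\<^bsub>AC\<^esub> i = f"
    if i: "inflation AC i" and f: "f \<in> homset AC (Dom AC i) P" for i f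
  proof -
    have i': "i \<in> Ar AC" using i AC.Confl_simps(1) by (auto simp: inflation_def)
    have f': "f \<in> Ar AC" "Dom AC f = Dom AC i" "Cod AC f = P" using f by (simp_all add: homset_iff)
    have "s \<cdot>\<^bsub>AC\<^esub> f \<in> homset AC (Dom AC i) ?C" using s' f' by (simp add: homset_iff)
    then obtain g where g: "g \<in> homset AC (Cod AC i) ?C" "g \<cdot>\<^bsub>AC\<^esub> i = s \<cdot>\<^bsub>AC\<^esub> f"
      using cone_Idt_injective[OF Q(1)] i unfolding injective_def by blast
    have g': "g \<in> Ar AC" "Dom AC g = Cod AC i" "Cod AC g = ?C" using g by (simp_all add: homset_iff)
    have "(?p \<cdot>\<^bsub>AC\<^esub> g) \<cdot>\<^bsub>AC\<^esub> i = ?p \<cdot>\<^bsub>AC\<^esub> (g \<cdot>\<^bsub>AC\<^esub> i)" using g' p i' by simp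
    also have "\<dots> = (?p \<cdot>\<^bsub>AC\<^esub> s) \<cdot>\<^bsub>AC\<^esub> f" unfolding g(2) using s' p f' by simp
    also have "\<dots> = f" unfolding s(2) using f' by simp
    finally show ?thesis
      using g' p by (intro bexI[of _ "?p \<cdot>\<^bsub>AC\<^esub> g"]) (simp_all add: homset_iff)
  qed
  then show ?thesis unfolding injective_def using P' by blast
qed

lemma AC_stable_base: "stable_base AC"
proof unfold_locales
  show "projective AC X \<Longrightarrow> injective AC X" for X by (rule AC_projective_injective)
  show "\<exists>i. inflation AC i \<and> Dom AC i = X \<and> projective AC (Cod AC i)" if X: "X \<in> Ob AC" for X
    using cone_Confl[of "Idt AC X"] cone_Idt_projective[OF X] X
    by (intro exI[of _ "cone_in E (Idt AC X)"]) (auto simp: inflation_def)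
qed

end

sublocale frobenius_complexes \<subseteq> AC: stable_base "Acyc E"
  by (rule AC_stable_base)

context frobenius_complexes
begin

text \<open>A null homotopy extends \<open>f\<close> over the cone of the identity of its source,
  and that cone is projective.\<close>

lemma null_if_homotopy:
  assumes f: "f \<in> Ar AC"
    and h: "\<And>n. h n \<in> Ar E" "\<And>n. Dom E (h n) = trm (csrc f) (n + 1)" "\<And>n. Cod E (h n) = trm (ctgt f) n"
    and hom: "\<And>n. cmap f (n + 1) =
      dif (ctgt f) n \<cdot>\<^bsub>E\<^esub> h n \<oplus>\<^bsub>E\<^esub> h (n + 1) \<cdot>\<^bsub>E\<^esub> dif (csrc f) (n + 1)"
  shows "stably_null AC f"
proof -
  let ?u = "Idt AC (csrc f)"
  have X: "csrc f \<in> Ob AC" using f by simp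
  have u: "?u \<in> Ar AC" "csrc ?u = csrc f" "ctgt ?u = csrc f" "\<And>n. cmap ?u n = Idt E (trm (csrc f) n)"
    using X AC.Idt_simps[of "csrc f"] by (simp_all add: AC_defs(3-5))
  have o: "cone_out ?u f h \<in> Ar AC"
    by (rule cone_out_Ar) (use f u h hom[symmetric] in simp_all)
  have "cone_out ?u f h \<cdot>\<^bsub>AC\<^esub> cone_in E ?u = f"
    by (rule chmap_eqI) (use f u h in \<open>simp_all add: chmap_simps\<close>)
  moreover have "stably_null AC (cone_out ?u f h \<cdot>\<^bsub>AC\<^esub> cone_in E ?u)"
    by (rule AC.nullI[OF cone_Idt_projective[OF X]]) (use o u(1) in \<open>simp_all add: AC_defs(3,4)\<close>)
  ultimately show ?thesis by simp
qed

text \<open>Both maps of the cone conflation are stably zero. The identity of the cone kills the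
  first one, hence factors stably through the second one, and so vanishes as well.\<close>

lemma cone_projective:
  assumes u: "u \<in> Ar AC" and "projective AC (Dom AC u)" "projective AC (Cod AC u)"
  shows "projective AC (cone_cpx E u)"
proof -
  let ?i = "cone_in E u" and ?p = "cone_pr E u" and ?C = "cone_cpx E u"
  have C: "?C \<in> Ob AC" using u by simp
  have i: "AC.cl ?i = Zer AC.S (Cod AC u) ?C"
    using AC.cl_zero_Dom[of ?i] u assms(3) by simp
  have p: "AC.cl ?p = Zer AC.S ?C (shift_cpx E 1 (Dom AC u))"
    using AC.cl_zero_Cod[of ?p] u shift_projective[OF assms(2), of 1] by simp
  have "Idt AC.S ?C \<in> Ar AC.S" "Dom AC.S (Idt AC.S ?C) = Cod AC ?i" "Cod AC.S (Idt AC.S ?C) = ?C"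
    using C by simp_all
  moreover have "Idt AC.S ?C \<cdot>\<^bsub>AC.S\<^esub> AC.cl ?i = Zer AC.S (Dom AC ?i) ?C"
    using u C by (simp add: i)
  ultimately obtain m where m: "m \<in> Ar AC.S" "Dom AC.S m = Cod AC ?p" "Cod AC.S m = ?C"
    "Idt AC.S ?C = m \<cdot>\<^bsub>AC.S\<^esub> AC.cl ?p"
    by (rule AC.Confl_weak_cokernel[OF cone_Confl[OF u]])
  then have "AC.cl (Idt AC ?C) = Zer AC.S ?C ?C"
    using u C by (simp add: p AC.cl_Idt[symmetric])
  then show ?thesis
    using C AC.cl_zero_iff[of "Idt AC ?C" ?C ?C] by (simp add: AC.projective_iff_null_Idt)
qed

end

lemma (in preadditive_category) is_iso_inverse:
  assumes "is_iso A f" "Dom A f = x" "Cod A f = y"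
  obtains g where "g \<in> Ar A" "Dom A g = y" "Cod A g = x" "g \<cdot>\<^bsub>A\<^esub> f = Idt A x" "f \<cdot>\<^bsub>A\<^esub> g = Idt A y"
  using is_isoE[OF assms(1)] assms(2,3) by metis

section \<open>Rotation of triangles\<close>

text \<open>The identity of an iterated biproduct expanded over its three summands, in the
  right-nested normal form of the simplifier; the degreewise splittings of cones of cones end in
  this equation or its mirror image.\<close>

lemma (in additive_category) bsum_bsum_left:
  assumes "a \<in> Ob A" "b \<in> Ob A" "c \<in> Ob A"
  defines "ab \<equiv> bsum A a b"
  shows "in1 A ab c \<cdot>\<^bsub>A\<^esub> in1 A a b \<cdot>\<^bsub>A\<^esub> pr1 A a b \<cdot>\<^bsub>A\<^esub> pr1 A ab c \<oplus>\<^bsub>A\<^esub>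
    in1 A ab c \<cdot>\<^bsub>A\<^esub> in2 A a b \<cdot>\<^bsub>A\<^esub> pr2 A a b \<cdot>\<^bsub>A\<^esub> pr1 A ab c \<oplus>\<^bsub>A\<^esub> in2 A ab c \<cdot>\<^bsub>A\<^esub> pr2 A ab c = Idt A (bsum A ab c)"
proof -
  let ?f = "in1 A a b \<cdot>\<^bsub>A\<^esub> pr1 A a b \<cdot>\<^bsub>A\<^esub> pr1 A ab c \<oplus>\<^bsub>A\<^esub> in2 A a b \<cdot>\<^bsub>A\<^esub> pr2 A a b \<cdot>\<^bsub>A\<^esub> pr1 A ab c"
  have "?f = pr1 A ab c" by (rule bsum_decomposition) (use assms in simp_all)
  then have "in1 A ab c \<cdot>\<^bsub>A\<^esub> ?f \<oplus>\<^bsub>A\<^esub> in2 A ab c \<cdot>\<^bsub>A\<^esub> pr2 A ab c = Idt A (bsum A ab c)"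
    using assms by (simp del: Cmp_Add)
  then show ?thesis using assms by simp
qed

lemma (in additive_category) bsum_bsum_right:
  assumes "a \<in> Ob A" "b \<in> Ob A" "c \<in> Ob A"
  defines "bc \<equiv> bsum A b c"
  shows "in1 A a bc \<cdot>\<^bsub>A\<^esub> pr1 A a bc \<oplus>\<^bsub>A\<^esub> in2 A a bc \<cdot>\<^bsub>A\<^esub> in1 A b c \<cdot>\<^bsub>A\<^esub> pr1 A b c \<cdot>\<^bsub>A\<^esub> pr2 A a bc \<oplus>\<^bsub>A\<^esub>
    in2 A a bc \<cdot>\<^bsub>A\<^esub> in2 A b c \<cdot>\<^bsub>A\<^esub> pr2 A b c \<cdot>\<^bsub>A\<^esub> pr2 A a bc = Idt A (bsum A a bc)"
proof -
  let ?f = "in1 A b c \<cdot>\<^bsub>A\<^esub> pr1 A b c \<cdot>\<^bsub>A\<^esub> pr2 A a bc \<oplus>\<^bsub>A\<^esub> in2 A b c \<cdot>\<^bsub>A\<^esub> pr2 A b c \<cdot>\<^bsub>A\<^esub> pr2 A a bc"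
  have "?f = pr2 A a bc" by (rule bsum_decomposition) (use assms in simp_all)
  then have "in1 A a bc \<cdot>\<^bsub>A\<^esub> pr1 A a bc \<oplus>\<^bsub>A\<^esub> in2 A a bc \<cdot>\<^bsub>A\<^esub> ?f = Idt A (bsum A a bc)"
    using assms by (simp del: Cmp_Add)
  then show ?thesis using assms by simp
qed

context frobenius_complexes
begin

lemma shift_stable_functor: "stable_functor AC AC (shift E k)"
  by unfold_locales (simp_all add: shift_exact shift_projective)

text \<open>The projection of the cone of \<open>cone_in E u\<close> onto the shifted source of \<open>u\<close>; its kernel is the
  cone of an identity.\<close>

definition cone_in_cone where
  "cone_in_cone u = \<lparr>csrc = cone_cpx E (cone_in E u), ctgt = shift_cpx E 1 (csrc u),
     cmap = (\<lambda>n. pr2 E (trm (ctgt u) n) (trm (csrc u) (n + 1)) \<cdot>\<^bsub>E\<^esub>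
       pr1 E (bsum E (trm (ctgt u) n) (trm (csrc u) (n + 1))) (trm (ctgt u) (n + 1)))\<rparr>"

lemma cone_in_cone_simps [simp]:
  "csrc (cone_in_cone u) = cone_cpx E (cone_in E u)" "ctgt (cone_in_cone u) = shift_cpx E 1 (csrc u)"
  "cmap (cone_in_cone u) n = pr2 E (trm (ctgt u) n) (trm (csrc u) (n + 1)) \<cdot>\<^bsub>E\<^esub>
     pr1 E (bsum E (trm (ctgt u) n) (trm (csrc u) (n + 1))) (trm (ctgt u) (n + 1))"
  by (simp_all add: cone_in_cone_def)

lemma cone_in_cone_Dom_Cod [simp]:
  "Dom AC (cone_in_cone u) = cone_cpx E (cone_in E u)" "Cod AC (cone_in_cone u) = shift_cpx E 1 (Dom AC u)"
  by (simp_all add: AC_defs(3,4))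

lemma dif_cone_cone_in:
  assumes u: "u \<in> Ar AC"
  defines "x \<equiv> trm (csrc u)" and "y \<equiv> trm (ctgt u)"
  shows "dif (cone_cpx E (cone_in E u)) n =
    in1 E (bsum E (y (n + 1)) (x (n + 1 + 1))) (y (n + 1 + 1)) \<cdot>\<^bsub>E\<^esub> dif (cone_cpx E u) n \<cdot>\<^bsub>E\<^esub> pr1 E (bsum E (y n) (x (n + 1))) (y (n + 1)) \<oplus>\<^bsub>E\<^esub>
    in1 E (bsum E (y (n + 1)) (x (n + 1 + 1))) (y (n + 1 + 1)) \<cdot>\<^bsub>E\<^esub> in1 E (y (n + 1)) (x (n + 1 + 1)) \<cdot>\<^bsub>E\<^esub> pr2 E (bsum E (y n) (x (n + 1))) (y (n + 1)) \<oplus>\<^bsub>E\<^esub>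
    \<ominus>\<^bsub>E\<^esub> (in2 E (bsum E (y (n + 1)) (x (n + 1 + 1))) (y (n + 1 + 1)) \<cdot>\<^bsub>E\<^esub> dif (ctgt u) (n + 1) \<cdot>\<^bsub>E\<^esub> pr2 E (bsum E (y n) (x (n + 1))) (y (n + 1)))"
  using cone_dif[OF cone_in_Ar[OF u] cone_in_simps(1,2), of n]
  unfolding x_def y_def cone_in_simps cone_trm .

lemma cone_in_cone_Ar [simp]: assumes u: "u \<in> Ar AC" shows "cone_in_cone u \<in> Ar AC"
proof (rule ArI)
  fix n
  have *: "pr2 E (trm (ctgt u) (n + 1)) (trm (csrc u) (n + 1 + 1)) \<cdot>\<^bsub>E\<^esub> dif (cone_cpx E u) n \<cdot>\<^bsub>E\<^esub> k =
    \<ominus>\<^bsub>E\<^esub> (dif (csrc u) (n + 1) \<cdot>\<^bsub>E\<^esub> pr2 E (trm (ctgt u) n) (trm (csrc u) (n + 1)) \<cdot>\<^bsub>E\<^esub> k)"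
    if "k \<in> Ar E" "Cod E k = bsum E (trm (ctgt u) n) (trm (csrc u) (n + 1))" for k
    unfolding cone_dif[OF u refl refl] using u that by simp
  show "dif (ctgt (cone_in_cone u)) n \<cdot>\<^bsub>E\<^esub> cmap (cone_in_cone u) n =
    cmap (cone_in_cone u) (n + 1) \<cdot>\<^bsub>E\<^esub> dif (csrc (cone_in_cone u)) n"
    unfolding cone_in_cone_simps dif_cone_cone_in[OF u] using u * by simp
qed (use u in simp_all)

lemma Idt_AC_simps [simp]: "csrc (Idt AC X) = X" "ctgt (Idt AC X) = X" "cmap (Idt AC X) n = Idt E (trm X n)"
  by (simp_all add: AC_defs(5))

text \<open>The kernel inclusion \<open>?i\<close> is the cone map of the square formed by the
  identity of \<open>Y\<close> and \<open>?v\<close>. Its source is projective, so the quotient map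
  becomes invertible in the stable category.\<close>

lemma cone_in_cone_iso:
  assumes u: "u \<in> Ar AC" shows "is_iso AC.S (AC.cl (cone_in_cone u))"
proof -
  let ?Y = "ctgt u" and ?v = "cone_in E u"
  let ?i = "cone_map E (Idt AC ?Y) ?v (Idt AC ?Y) ?v"
  have Y: "?Y \<in> Ob AC" using u by simp
  have sq: "cone_square (Idt AC ?Y) ?v (Idt AC ?Y) ?v"
    unfolding cone_square_def using u Y by (simp add: AC_defs(3,4))
  have "(?i, cone_in_cone u) \<in> Confl AC"
    unfolding AC_Confl_iff
  proof (intro conjI allI)
    fix n
    let ?a = "trm ?Y n" and ?b = "trm (csrc u) (n + 1)" and ?c = "trm ?Y (n + 1)"
    show "(cmap ?i n, cmap (cone_in_cone u) n) \<in> Confl E"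
      by (rule split_conflation[of _ _
          "in1 E ?a ?c \<cdot>\<^bsub>E\<^esub> pr1 E ?a ?b \<cdot>\<^bsub>E\<^esub> pr1 E (bsum E ?a ?b) ?c \<oplus>\<^bsub>E\<^esub> in2 E ?a ?c \<cdot>\<^bsub>E\<^esub> pr2 E (bsum E ?a ?b) ?c"
          "in1 E (bsum E ?a ?b) ?c \<cdot>\<^bsub>E\<^esub> in2 E ?a ?b"])
        (use u Y bsum_bsum_left[of ?a ?b ?c] in \<open>simp_all add: Add_commute Add_left_commute\<close>)
  qed (use u sq in simp_all)
  then show ?thesis
    by (rule AC.is_iso_if_projective_kernel) (simp add: cone_Idt_projective[OF Y])
qed

text \<open>The rotated map \<open>C(u)[-1] \<rightarrow> X\<close> of \<open>u : X \<rightarrow> Y\<close>, and the inclusion of \<open>Y\<close> into its cone,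
  whose cokernel is the cone of an identity.\<close>

abbreviation cocone_pr where "cocone_pr u \<equiv> fa (shift E (-1)) (cone_pr E u)"

text \<open>The shift by \<open>-1\<close> undoes the shift in the target of \<open>cone_pr\<close>
  strictly, so that the rotated map ends in the source of \<open>u\<close> itself and not in an
  isomorphic copy.\<close>

lemma cocone_pr_simps:
  assumes "u \<in> Ar AC"
  shows "cocone_pr u \<in> Ar AC" "csrc (cocone_pr u) = shift_cpx E (-1) (cone_cpx E u)"
    "ctgt (cocone_pr u) = csrc u" "Cod AC (cocone_pr u) = Dom AC u"
    "cmap (cocone_pr u) n = pr2 E (trm (ctgt u) (n - 1)) (trm (csrc u) n)"
    "Dom AC (cocone_pr u) = shift_cpx E (-1) (cone_cpx E u)"
proof -
  show "csrc (cocone_pr u) = shift_cpx E (-1) (cone_cpx E u)" by simp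
  show c: "ctgt (cocone_pr u) = csrc u" using shift_cpx_cancel(1)[of "csrc u" 1] assms by simp
  then show "Cod AC (cocone_pr u) = Dom AC u" unfolding AC_defs(3,4) .
qed (use assms in simp_all)

definition cocone_pr_in where
  "cocone_pr_in u = \<lparr>csrc = ctgt u, ctgt = cone_cpx E (cocone_pr u),
     cmap = (\<lambda>n. in2 E (trm (csrc u) n) (bsum E (trm (ctgt u) n) (trm (csrc u) (n + 1))) \<cdot>\<^bsub>E\<^esub>
       in1 E (trm (ctgt u) n) (trm (csrc u) (n + 1)))\<rparr>"

lemma cocone_pr_in_simps [simp]:
  "csrc (cocone_pr_in u) = ctgt u" "ctgt (cocone_pr_in u) = cone_cpx E (cocone_pr u)"
  "cmap (cocone_pr_in u) n = in2 E (trm (csrc u) n) (bsum E (trm (ctgt u) n) (trm (csrc u) (n + 1))) \<cdot>\<^bsub>E\<^esub>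
       in1 E (trm (ctgt u) n) (trm (csrc u) (n + 1))"
  by (simp_all add: cocone_pr_in_def)

lemma cocone_pr_in_Dom_Cod [simp]:
  "Dom AC (cocone_pr_in u) = Cod AC u" "Cod AC (cocone_pr_in u) = cone_cpx E (cocone_pr u)"
  by (simp_all add: AC_defs(3,4))

lemma trm_cone_cocone_pr:
  assumes "u \<in> Ar AC"
  shows "trm (cone_cpx E (cocone_pr u)) n = bsum E (trm (csrc u) n) (bsum E (trm (ctgt u) n) (trm (csrc u) (n + 1)))"
  using cocone_pr_simps(3)[OF assms] by simp

lemma dif_cone_cocone_pr:
  assumes u: "u \<in> Ar AC"
  defines "x \<equiv> trm (csrc u)" and "y \<equiv> trm (ctgt u)"
  shows "dif (cone_cpx E (cocone_pr u)) n =
    in1 E (x (n + 1)) (bsum E (y (n + 1)) (x (n + 1 + 1))) \<cdot>\<^bsub>E\<^esub> dif (csrc u) n \<cdot>\<^bsub>E\<^esub> pr1 E (x n) (bsum E (y n) (x (n + 1))) \<oplus>\<^bsub>E\<^esub>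
    in1 E (x (n + 1)) (bsum E (y (n + 1)) (x (n + 1 + 1))) \<cdot>\<^bsub>E\<^esub> pr2 E (y n) (x (n + 1)) \<cdot>\<^bsub>E\<^esub> pr2 E (x n) (bsum E (y n) (x (n + 1))) \<oplus>\<^bsub>E\<^esub>
    in2 E (x (n + 1)) (bsum E (y (n + 1)) (x (n + 1 + 1))) \<cdot>\<^bsub>E\<^esub> dif (cone_cpx E u) n \<cdot>\<^bsub>E\<^esub> pr2 E (x n) (bsum E (y n) (x (n + 1)))"
  using cone_dif[OF cocone_pr_simps(1)[OF u] cocone_pr_simps(2,3)[OF u], of n] u
  by (simp add: x_def y_def add.commute)

lemma cocone_pr_in_Ar [simp]: assumes u: "u \<in> Ar AC" shows "cocone_pr_in u \<in> Ar AC"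
proof (rule ArI)
  fix n
  have *: "dif (cone_cpx E u) n \<cdot>\<^bsub>E\<^esub> in1 E (trm (ctgt u) n) (trm (csrc u) (n + 1)) =
    in1 E (trm (ctgt u) (n + 1)) (trm (csrc u) (n + 1 + 1)) \<cdot>\<^bsub>E\<^esub> dif (ctgt u) n"
    unfolding cone_dif[OF u refl refl] using u by simp
  show "dif (ctgt (cocone_pr_in u)) n \<cdot>\<^bsub>E\<^esub> cmap (cocone_pr_in u) n =
    cmap (cocone_pr_in u) (n + 1) \<cdot>\<^bsub>E\<^esub> dif (csrc (cocone_pr_in u)) n"
    unfolding cocone_pr_in_simps dif_cone_cocone_pr[OF u] using u * by simp
qed (use u cocone_pr_simps[OF u] in \<open>simp_all add: trm_cone_cocone_pr\<close>)

text \<open>The cokernel map \<open>?p\<close> forgets \<open>Y\<close> and keeps the two copies of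
  \<open>X\<close>, which form the cone of an identity; a projective cokernel makes the inclusion a
  stable isomorphism.\<close>

lemma cocone_pr_in_iso:
  assumes u: "u \<in> Ar AC" shows "is_iso AC.S (AC.cl (cocone_pr_in u))"
proof -
  let ?X = "csrc u" and ?w = "cocone_pr u"
  let ?p = "cone_map E ?w (Idt AC ?X) ?w (Idt AC ?X)"
  have X: "?X \<in> Ob AC" using u by simp
  note w = cocone_pr_simps[OF u]
  have sq: "cone_square ?w (Idt AC ?X) ?w (Idt AC ?X)"
    unfolding cone_square_def using u X w by (simp add: AC_defs(3,4))
  have "(cocone_pr_in u, ?p) \<in> Confl AC"
    unfolding AC_Confl_iff
  proof (intro conjI allI)
    fix n
    let ?a = "trm ?X n" and ?b = "trm (ctgt u) n" and ?c = "trm ?X (n + 1)"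
    have p: "cmap ?p n = in1 E ?a ?c \<cdot>\<^bsub>E\<^esub> pr1 E ?a (bsum E ?b ?c) \<oplus>\<^bsub>E\<^esub> in2 E ?a ?c \<cdot>\<^bsub>E\<^esub> pr2 E ?b ?c \<cdot>\<^bsub>E\<^esub> pr2 E ?a (bsum E ?b ?c)"
      using u w(3) by simp
    show "(cmap (cocone_pr_in u) n, cmap ?p n) \<in> Confl E"
      unfolding p
      by (rule split_conflation[of _ _
          "pr1 E ?b ?c \<cdot>\<^bsub>E\<^esub> pr2 E ?a (bsum E ?b ?c)"
          "in1 E ?a (bsum E ?b ?c) \<cdot>\<^bsub>E\<^esub> pr1 E ?a ?c \<oplus>\<^bsub>E\<^esub> in2 E ?a (bsum E ?b ?c) \<cdot>\<^bsub>E\<^esub> in2 E ?b ?c \<cdot>\<^bsub>E\<^esub> pr2 E ?a ?c"])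
        (use u X bsum_bsum_right[of ?a ?b ?c] in \<open>simp_all add: Add_commute Add_left_commute\<close>)
  qed (use u sq in simp_all)
  then show ?thesis
    by (rule AC.is_iso_if_projective_cokernel) (simp add: cone_Idt_projective[OF X])
qed

text \<open>In the cone \<open>X \<oplus> (Y \<oplus> X[1])\<close> the inclusion of the last
  summand is a homotopy whose boundary is the sum of the two maps. This is the origin of the sign in
  a rotated triangle.\<close>

lemma cone_in_cocone_pr:
  assumes u: "u \<in> Ar AC"
  shows "AC.cl (cone_in E (cocone_pr u)) = \<ominus>\<^bsub>AC.S\<^esub> (AC.cl (cocone_pr_in u) \<cdot>\<^bsub>AC.S\<^esub> AC.cl u)"
proof -
  note w = cocone_pr_simps[OF u]
  let ?i = "cone_in E (cocone_pr u)" and ?j = "cocone_pr_in u" and ?X = "csrc u" and ?Y = "ctgt u"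
  have i: "?i \<in> Ar AC" "Dom AC ?i = Dom AC u" "Cod AC ?i = Cod AC ?j" using w by simp_all
  have j: "?j \<cdot>\<^bsub>AC\<^esub> u \<in> Ar AC" "Dom AC (?j \<cdot>\<^bsub>AC\<^esub> u) = Dom AC u" "Cod AC (?j \<cdot>\<^bsub>AC\<^esub> u) = Cod AC ?j"
    using u by simp_all
  let ?f = "?i \<oplus>\<^bsub>AC\<^esub> ?j \<cdot>\<^bsub>AC\<^esub> u"
  have f: "?f \<in> Ar AC" using i j by simp
  have fs: "csrc ?f = ?X" "ctgt ?f = cone_cpx E (cocone_pr u)"
    "\<And>n. cmap ?f n = in1 E (trm ?X n) (bsum E (trm ?Y n) (trm ?X (n + 1))) \<oplus>\<^bsub>E\<^esub>
      in2 E (trm ?X n) (bsum E (trm ?Y n) (trm ?X (n + 1))) \<cdot>\<^bsub>E\<^esub> in1 E (trm ?Y n) (trm ?X (n + 1)) \<cdot>\<^bsub>E\<^esub> cmap u n"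
    using w(3) u by (simp_all add: AC_defs(6,7))
  have "stably_null AC ?f"
  proof (rule null_if_homotopy[OF f, of "\<lambda>n. in2 E (trm ?X n) (bsum E (trm ?Y n) (trm ?X (n + 1))) \<cdot>\<^bsub>E\<^esub> in2 E (trm ?Y n) (trm ?X (n + 1))"])
    fix n
    have *: "dif (cone_cpx E u) n \<cdot>\<^bsub>E\<^esub> in2 E (trm ?Y n) (trm ?X (n + 1)) =
      in1 E (trm ?Y (n + 1)) (trm ?X (n + 1 + 1)) \<cdot>\<^bsub>E\<^esub> cmap u (n + 1) \<oplus>\<^bsub>E\<^esub>
      \<ominus>\<^bsub>E\<^esub> (in2 E (trm ?Y (n + 1)) (trm ?X (n + 1 + 1)) \<cdot>\<^bsub>E\<^esub> dif ?X (n + 1))"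
      unfolding cone_dif[OF u refl refl] using u by simp
    show "cmap ?f (n + 1) = dif (ctgt ?f) n \<cdot>\<^bsub>E\<^esub> in2 E (trm ?X n) (bsum E (trm ?Y n) (trm ?X (n + 1))) \<cdot>\<^bsub>E\<^esub> in2 E (trm ?Y n) (trm ?X (n + 1)) \<oplus>\<^bsub>E\<^esub>
      (in2 E (trm ?X (n + 1)) (bsum E (trm ?Y (n + 1)) (trm ?X (n + 1 + 1))) \<cdot>\<^bsub>E\<^esub> in2 E (trm ?Y (n + 1)) (trm ?X (n + 1 + 1))) \<cdot>\<^bsub>E\<^esub> dif (csrc ?f) (n + 1)"
      unfolding fs dif_cone_cocone_pr[OF u] using u * by simp
  qed (use u fs(1,2) in \<open>simp_all add: trm_cone_cocone_pr\<close>)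
  then have "AC.cl ?f = Zer AC.S (Dom AC u) (Cod AC ?j)"
    using AC.cl_zero_iff[OF f] i j by simp
  then have "AC.cl ?i \<oplus>\<^bsub>AC.S\<^esub> AC.cl (?j \<cdot>\<^bsub>AC\<^esub> u) = Zer AC.S (Dom AC u) (Cod AC ?j)"
    using i j by (simp add: AC.cl_Add)
  moreover have "AC.cl ?i \<oplus>\<^bsub>AC.S\<^esub> AC.cl (?j \<cdot>\<^bsub>AC\<^esub> u) = AC.cl (?j \<cdot>\<^bsub>AC\<^esub> u) \<oplus>\<^bsub>AC.S\<^esub> AC.cl ?i"
    by (rule AC.S.Add_commute) (use i j in simp_all)
  ultimately have "AC.cl ?i = \<ominus>\<^bsub>AC.S\<^esub> AC.cl (?j \<cdot>\<^bsub>AC\<^esub> u)"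
    by (intro AC.S.Neg_unique) (use i j in simp_all)
  then show ?thesis using u by (simp add: AC.cl_Cmp)
qed

lemma stably_exact_in_pr: "u \<in> Ar AC \<Longrightarrow> AC.stably_exact (AC.cl (cone_in E u)) (AC.cl (cone_pr E u))"
  by (rule AC.stably_exact_Confl[OF cone_Confl])

text \<open>Rotation: the pair is compared with the cone conflation of \<open>cocone_pr u\<close>.
  The sign from \<open>cone_in_cocone_pr\<close> is placed on the source of \<open>u\<close>, where
  it is harmless because minus the identity is invertible.\<close>

lemma stably_exact_map_in:
  assumes u: "u \<in> Ar AC" shows "AC.stably_exact (AC.cl u) (AC.cl (cone_in E u))"
proof -
  note w = cocone_pr_simps[OF u]
  let ?w = "cocone_pr u" and ?j = "cocone_pr_in u"
  have o: "Dom AC u \<in> Ob AC" "Cod AC u \<in> Ob AC" using u by simp_all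
  have c: "Cod AC (cone_pr E ?w) = cone_cpx E u"
    using shift_cpx_cancel(2)[of "cone_cpx E u" 1] u by (simp add: w(6))
  have pj: "cone_pr E ?w \<cdot>\<^bsub>AC\<^esub> ?j = cone_in E u"
  proof (rule chmap_eqI)
    show "ctgt (cone_pr E ?w \<cdot>\<^bsub>AC\<^esub> ?j) = ctgt (cone_in E u)"
      using c by (simp add: AC_defs(4,6))
    show "cmap (cone_pr E ?w \<cdot>\<^bsub>AC\<^esub> ?j) n = cmap (cone_in E u) n" for n
      using w(3) u by (simp add: AC_defs(6))
  qed (simp add: AC_defs(6))
  show ?thesis
  proof (rule AC.stably_exact_iso[OF stably_exact_in_pr[OF w(1)], of
      "\<ominus>\<^bsub>AC.S\<^esub> Idt AC.S (Dom AC u)" "AC.cl ?j" "Idt AC.S (cone_cpx E u)"])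
    show "AC.cl ?j \<cdot>\<^bsub>AC.S\<^esub> AC.cl u = AC.cl (cone_in E ?w) \<cdot>\<^bsub>AC.S\<^esub> \<ominus>\<^bsub>AC.S\<^esub> Idt AC.S (Dom AC u)"
      unfolding cone_in_cocone_pr[OF u] using u o by simp
    have "AC.cl (cone_pr E ?w) \<cdot>\<^bsub>AC.S\<^esub> AC.cl ?j = AC.cl (cone_in E u)"
      using u w(1) by (simp add: AC.cl_Cmp pj)
    then show "Idt AC.S (cone_cpx E u) \<cdot>\<^bsub>AC.S\<^esub> AC.cl (cone_in E u) = AC.cl (cone_pr E ?w) \<cdot>\<^bsub>AC.S\<^esub> AC.cl ?j"
      using u by simp
  qed (use u o w(1,4) c in \<open>simp_all add: cocone_pr_in_iso AC.S.is_iso_Neg\<close>)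
qed

text \<open>A further rotation, obtained from the preceding one for \<open>cocone_pr u\<close>; here
  the sign is carried by the comparison \<open>cocone_pr_in\<close>.\<close>

lemma stably_exact_cocone_map:
  assumes u: "u \<in> Ar AC" shows "AC.stably_exact (AC.cl (cocone_pr u)) (AC.cl u)"
proof -
  note w = cocone_pr_simps[OF u]
  let ?w = "cocone_pr u" and ?j = "cocone_pr_in u"
  have o: "Dom AC u \<in> Ob AC" "Cod AC u \<in> Ob AC" "Dom AC ?w \<in> Ob AC" using u w by simp_all
  show ?thesis
  proof (rule AC.stably_exact_iso[OF stably_exact_map_in[OF w(1)], of
      "Idt AC.S (Dom AC ?w)" "Idt AC.S (Dom AC u)" "\<ominus>\<^bsub>AC.S\<^esub> AC.cl ?j"])
    show "\<ominus>\<^bsub>AC.S\<^esub> AC.cl ?j \<cdot>\<^bsub>AC.S\<^esub> AC.cl u = AC.cl (cone_in E ?w) \<cdot>\<^bsub>AC.S\<^esub> Idt AC.S (Dom AC u)"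
      unfolding cone_in_cocone_pr[OF u] using u o by simp
  qed (use u o w(1,4) in \<open>simp_all add: cocone_pr_in_iso AC.S.is_iso_Neg\<close>)
qed

text \<open>The shift by one is applied to the preceding pair and turns \<open>cocone_pr u\<close>
  strictly back into \<open>cone_pr E u\<close>.\<close>

lemma stably_exact_pr_shift:
  assumes u: "u \<in> Ar AC" shows "AC.stably_exact (AC.cl (cone_pr E u)) (AC.cl (fa (shift E 1) u))"
proof -
  interpret sh: stable_functor AC AC "shift E 1" by (rule shift_stable_functor)
  show ?thesis
    using sh.bar_stably_exact[OF stably_exact_cocone_map[OF u]] u cocone_pr_simps(1)[OF u]
      shift_cancel(2)[OF cone_pr_Ar[OF u], of 1]
    by (simp add: sh.bar_cl)
qed

text \<open>A five lemma in which weak kernels and cokernels take the place of exact sequences of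
  hom groups. A first approximation \<open>m\<close> to an inverse is corrected by a term that
  factors through a neighbouring vertex of the triangle; the left inverse \<open>L\<close> and the
  right inverse \<open>R\<close> are obtained separately.\<close>

lemma cone_map_iso:
  assumes sq: "cone_square u u' a b"
    and a: "is_iso AC.S (AC.cl a)" and b: "is_iso AC.S (AC.cl b)"
  shows "is_iso AC.S (AC.cl (cone_map E u u' a b))"
proof -
  interpret sh: stable_functor AC AC "shift E 1" by (rule shift_stable_functor)
  let ?sh = "fa (shift E 1)"
  let ?U = "AC.cl u" and ?U' = "AC.cl u'" and ?V = "AC.cl (?sh u)" and ?V' = "AC.cl (?sh u')"
    and ?j = "AC.cl (cone_in E u)" and ?j' = "AC.cl (cone_in E u')"
    and ?q = "AC.cl (cone_pr E u)" and ?q' = "AC.cl (cone_pr E u')"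
    and ?a = "AC.cl a" and ?b = "AC.cl b" and ?a1 = "AC.cl (?sh a)" and ?b1 = "AC.cl (?sh b)"
  define K where "K = AC.cl (cone_map E u u' a b)"
  have ar: "u \<in> Ar AC" "u' \<in> Ar AC" "a \<in> Ar AC" "b \<in> Ar AC"
    and dc: "Dom AC a = Dom AC u" "Cod AC a = Dom AC u'" "Dom AC b = Cod AC u" "Cod AC b = Cod AC u'"
    and s: "b \<cdot>\<^bsub>AC\<^esub> u = u' \<cdot>\<^bsub>AC\<^esub> a"
    using sq by (simp_all add: cone_square_def)
  have K: "K \<in> Ar AC.S" "Dom AC.S K = cone_cpx E u" "Cod AC.S K = cone_cpx E u'"
    using sq by (simp_all add: K_def)
  have Kj: "K \<cdot>\<^bsub>AC.S\<^esub> ?j = ?j' \<cdot>\<^bsub>AC.S\<^esub> ?b"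
    using cone_map_in[OF sq] sq ar dc by (simp add: K_def AC.cl_Cmp)
  have qK: "?q' \<cdot>\<^bsub>AC.S\<^esub> K = ?a1 \<cdot>\<^bsub>AC.S\<^esub> ?q"
    using cone_map_pr[OF sq] sq ar dc by (simp add: K_def AC.cl_Cmp)
  have bU: "?b \<cdot>\<^bsub>AC.S\<^esub> ?U = ?U' \<cdot>\<^bsub>AC.S\<^esub> ?a" using s ar dc by (simp add: AC.cl_Cmp)
  have "?sh (b \<cdot>\<^bsub>AC\<^esub> u) = ?sh (u' \<cdot>\<^bsub>AC\<^esub> a)" by (simp only: s)
  then have bV: "?b1 \<cdot>\<^bsub>AC.S\<^esub> ?V = ?V' \<cdot>\<^bsub>AC.S\<^esub> ?a1" using ar dc by (simp add: AC.cl_Cmp)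
  have a1: "is_iso AC.S ?a1" and b1: "is_iso AC.S ?b1"
    using sh.bar.fa_is_iso[OF a] sh.bar.fa_is_iso[OF b] ar by (simp_all add: sh.bar_cl)
  have "Dom AC.S ?a = Dom AC u" "Cod AC.S ?a = Dom AC u'" using ar dc by simp_all
  from AC.S.is_iso_inverse[OF a this]
  obtain \<alpha> where \<alpha>: "\<alpha> \<in> Ar AC.S" "Dom AC.S \<alpha> = Dom AC u'" "Cod AC.S \<alpha> = Dom AC u"
    "\<alpha> \<cdot>\<^bsub>AC.S\<^esub> ?a = Idt AC.S (Dom AC u)" "?a \<cdot>\<^bsub>AC.S\<^esub> \<alpha> = Idt AC.S (Dom AC u')" .
  have "Dom AC.S ?b = Cod AC u" "Cod AC.S ?b = Cod AC u'" using ar dc by simp_all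
  from AC.S.is_iso_inverse[OF b this]
  obtain \<beta> where \<beta>: "\<beta> \<in> Ar AC.S" "Dom AC.S \<beta> = Cod AC u'" "Cod AC.S \<beta> = Cod AC u"
    "\<beta> \<cdot>\<^bsub>AC.S\<^esub> ?b = Idt AC.S (Cod AC u)" "?b \<cdot>\<^bsub>AC.S\<^esub> \<beta> = Idt AC.S (Cod AC u')" .
  have "Dom AC.S ?a1 = shift_cpx E 1 (Dom AC u)" "Cod AC.S ?a1 = shift_cpx E 1 (Dom AC u')" using ar dc by simp_all
  from AC.S.is_iso_inverse[OF a1 this]
  obtain \<alpha>1 where \<alpha>1: "\<alpha>1 \<in> Ar AC.S" "Dom AC.S \<alpha>1 = shift_cpx E 1 (Dom AC u')" "Cod AC.S \<alpha>1 = shift_cpx E 1 (Dom AC u)"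
    "\<alpha>1 \<cdot>\<^bsub>AC.S\<^esub> ?a1 = Idt AC.S (shift_cpx E 1 (Dom AC u))" "?a1 \<cdot>\<^bsub>AC.S\<^esub> \<alpha>1 = Idt AC.S (shift_cpx E 1 (Dom AC u'))" .
  have "Dom AC.S ?b1 = shift_cpx E 1 (Cod AC u)" "Cod AC.S ?b1 = shift_cpx E 1 (Cod AC u')" using ar dc by simp_all
  from AC.S.is_iso_inverse[OF b1 this]
  obtain \<beta>1 where \<beta>1: "\<beta>1 \<in> Ar AC.S" "Dom AC.S \<beta>1 = shift_cpx E 1 (Cod AC u')" "Cod AC.S \<beta>1 = shift_cpx E 1 (Cod AC u)"
    "\<beta>1 \<cdot>\<^bsub>AC.S\<^esub> ?b1 = Idt AC.S (shift_cpx E 1 (Cod AC u))" "?b1 \<cdot>\<^bsub>AC.S\<^esub> \<beta>1 = Idt AC.S (shift_cpx E 1 (Cod AC u'))" .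
  have o: "Dom AC u \<in> Ob AC" "Cod AC u \<in> Ob AC" "Dom AC u' \<in> Ob AC" "Cod AC u' \<in> Ob AC" using ar by simp_all
  have jU: "?j \<cdot>\<^bsub>AC.S\<^esub> ?U = Zer AC.S (Dom AC u) (cone_cpx E u)"
    using AC.stably_exact_zero[OF stably_exact_map_in[OF ar(1)]] ar by simp
  have Vq: "?V' \<cdot>\<^bsub>AC.S\<^esub> ?q' = Zer AC.S (cone_cpx E u') (shift_cpx E 1 (Cod AC u'))"
    using AC.stably_exact_zero[OF stably_exact_pr_shift[OF ar(2)]] ar by simp
  note [simp] = K o ar dc \<alpha>(1-3) \<beta>(1-3) \<alpha>1(1-3) \<beta>1(1-3)
  obtain L where L: "L \<in> Ar AC.S" "Dom AC.S L = cone_cpx E u'" "Cod AC.S L = cone_cpx E u"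
    "L \<cdot>\<^bsub>AC.S\<^esub> K = Idt AC.S (cone_cpx E u)"
  proof -
    have "(?j \<cdot>\<^bsub>AC.S\<^esub> \<beta>) \<cdot>\<^bsub>AC.S\<^esub> ?U' = ?j \<cdot>\<^bsub>AC.S\<^esub> \<beta> \<cdot>\<^bsub>AC.S\<^esub> (?U' \<cdot>\<^bsub>AC.S\<^esub> ?a) \<cdot>\<^bsub>AC.S\<^esub> \<alpha>"
      by (simp add: \<alpha>(5))
    also have "\<dots> = (?j \<cdot>\<^bsub>AC.S\<^esub> (\<beta> \<cdot>\<^bsub>AC.S\<^esub> ?b) \<cdot>\<^bsub>AC.S\<^esub> ?U) \<cdot>\<^bsub>AC.S\<^esub> \<alpha>"
      unfolding bU[symmetric] by simp
    also have "\<dots> = Zer AC.S (Dom AC u') (cone_cpx E u)"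
      unfolding \<beta>(4) by (simp add: jU del: AC.S.Cmp_assoc')
    finally have 0: "(?j \<cdot>\<^bsub>AC.S\<^esub> \<beta>) \<cdot>\<^bsub>AC.S\<^esub> ?U' = Zer AC.S (Dom AC.S ?U') (cone_cpx E u)" by simp
    have "?j \<cdot>\<^bsub>AC.S\<^esub> \<beta> \<in> Ar AC.S" "Dom AC.S (?j \<cdot>\<^bsub>AC.S\<^esub> \<beta>) = Cod AC.S ?U'"
      "Cod AC.S (?j \<cdot>\<^bsub>AC.S\<^esub> \<beta>) = cone_cpx E u" by simp_all
    from AC.stably_exact_weak_cokernel[OF stably_exact_map_in[OF ar(2)] this 0]
    obtain m where m: "m \<in> Ar AC.S" "Dom AC.S m = Cod AC.S ?j'" "Cod AC.S m = cone_cpx E u"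
      "?j \<cdot>\<^bsub>AC.S\<^esub> \<beta> = m \<cdot>\<^bsub>AC.S\<^esub> ?j'" .
    have m': "Dom AC.S m = cone_cpx E u'" using m(2) by simp
    \<comment> \<open>\<open>m\<close> inverts \<open>K\<close> on the image of \<open>?j\<close>,
      so the defect of \<open>m\<close> as a left inverse kills \<open>?j\<close> and factors as
      \<open>n\<close> after \<open>?q\<close>. Inserting \<open>\<alpha>1\<close> turns this factor
      into a correction through \<open>?q'\<close>.\<close>
    let ?e = "Idt AC.S (cone_cpx E u) \<oplus>\<^bsub>AC.S\<^esub> \<ominus>\<^bsub>AC.S\<^esub> (m \<cdot>\<^bsub>AC.S\<^esub> K)"
    have "m \<cdot>\<^bsub>AC.S\<^esub> K \<cdot>\<^bsub>AC.S\<^esub> ?j = (m \<cdot>\<^bsub>AC.S\<^esub> ?j') \<cdot>\<^bsub>AC.S\<^esub> ?b"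
      unfolding Kj using m(1,3) m' by simp
    also have "\<dots> = ?j" unfolding m(4)[symmetric] by (simp add: \<beta>(4))
    finally have "?e \<cdot>\<^bsub>AC.S\<^esub> ?j = Zer AC.S (Dom AC.S ?j) (cone_cpx E u)"
      using m(1,3) m' by simp
    moreover have "?e \<in> Ar AC.S" "Dom AC.S ?e = Cod AC.S ?j" "Cod AC.S ?e = cone_cpx E u"
      using m(1,3) m' by simp_all
    ultimately obtain n where n: "n \<in> Ar AC.S" "Dom AC.S n = Cod AC.S ?q" "Cod AC.S n = cone_cpx E u"
      "?e = n \<cdot>\<^bsub>AC.S\<^esub> ?q"
      using AC.stably_exact_weak_cokernel[OF stably_exact_in_pr[OF ar(1)]] by blast
    have n': "Dom AC.S n = shift_cpx E 1 (Dom AC u)" using n(2) by simp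
    have "(m \<oplus>\<^bsub>AC.S\<^esub> n \<cdot>\<^bsub>AC.S\<^esub> \<alpha>1 \<cdot>\<^bsub>AC.S\<^esub> ?q') \<cdot>\<^bsub>AC.S\<^esub> K = m \<cdot>\<^bsub>AC.S\<^esub> K \<oplus>\<^bsub>AC.S\<^esub> n \<cdot>\<^bsub>AC.S\<^esub> \<alpha>1 \<cdot>\<^bsub>AC.S\<^esub> (?q' \<cdot>\<^bsub>AC.S\<^esub> K)"
      using m(1,3) m' n(1,3) n' by simp
    also have "\<dots> = m \<cdot>\<^bsub>AC.S\<^esub> K \<oplus>\<^bsub>AC.S\<^esub> n \<cdot>\<^bsub>AC.S\<^esub> (\<alpha>1 \<cdot>\<^bsub>AC.S\<^esub> ?a1) \<cdot>\<^bsub>AC.S\<^esub> ?q"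
      unfolding qK using m(1,3) m' n(1,3) n' by simp
    also have "\<dots> = m \<cdot>\<^bsub>AC.S\<^esub> K \<oplus>\<^bsub>AC.S\<^esub> ?e" unfolding \<alpha>1(4) n(4) using n(1,3) n' by simp
    also have "\<dots> = Idt AC.S (cone_cpx E u)"
      using m(1,3) m' AC.S.Add_left_commute[of "m \<cdot>\<^bsub>AC.S\<^esub> K" "Idt AC.S (cone_cpx E u)" "\<ominus>\<^bsub>AC.S\<^esub> (m \<cdot>\<^bsub>AC.S\<^esub> K)"]
      by simp
    finally show thesis
      by (rule that[rotated 3]) (use m(1,3) m' n(1,3) n' in simp_all)
  qed
  obtain R where R: "R \<in> Ar AC.S" "Dom AC.S R = cone_cpx E u'" "Cod AC.S R = cone_cpx E u"
    "K \<cdot>\<^bsub>AC.S\<^esub> R = Idt AC.S (cone_cpx E u')"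
  proof -
    have "?V \<cdot>\<^bsub>AC.S\<^esub> \<alpha>1 \<cdot>\<^bsub>AC.S\<^esub> ?q' = (\<beta>1 \<cdot>\<^bsub>AC.S\<^esub> ?b1) \<cdot>\<^bsub>AC.S\<^esub> ?V \<cdot>\<^bsub>AC.S\<^esub> \<alpha>1 \<cdot>\<^bsub>AC.S\<^esub> ?q'"
      unfolding \<beta>1(4) by simp
    also have "\<dots> = \<beta>1 \<cdot>\<^bsub>AC.S\<^esub> (?b1 \<cdot>\<^bsub>AC.S\<^esub> ?V) \<cdot>\<^bsub>AC.S\<^esub> \<alpha>1 \<cdot>\<^bsub>AC.S\<^esub> ?q'" by simp
    also have "\<dots> = \<beta>1 \<cdot>\<^bsub>AC.S\<^esub> ?V' \<cdot>\<^bsub>AC.S\<^esub> (?a1 \<cdot>\<^bsub>AC.S\<^esub> \<alpha>1) \<cdot>\<^bsub>AC.S\<^esub> ?q'"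
      unfolding bV by simp
    also have "\<dots> = Zer AC.S (cone_cpx E u') (shift_cpx E 1 (Cod AC u))"
      unfolding \<alpha>1(5) by (simp add: Vq)
    finally have 0: "?V \<cdot>\<^bsub>AC.S\<^esub> \<alpha>1 \<cdot>\<^bsub>AC.S\<^esub> ?q' = Zer AC.S (cone_cpx E u') (Cod AC.S ?V)" by simp
    have "\<alpha>1 \<cdot>\<^bsub>AC.S\<^esub> ?q' \<in> Ar AC.S" "Cod AC.S (\<alpha>1 \<cdot>\<^bsub>AC.S\<^esub> ?q') = Dom AC.S ?V"
      "Dom AC.S (\<alpha>1 \<cdot>\<^bsub>AC.S\<^esub> ?q') = cone_cpx E u'" by simp_all
    from AC.stably_exact_weak_kernel[OF stably_exact_pr_shift[OF ar(1)] this 0]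
    obtain m where m: "m \<in> Ar AC.S" "Cod AC.S m = Dom AC.S ?q" "Dom AC.S m = cone_cpx E u'"
      "\<alpha>1 \<cdot>\<^bsub>AC.S\<^esub> ?q' = ?q \<cdot>\<^bsub>AC.S\<^esub> m" .
    have m': "Cod AC.S m = cone_cpx E u" using m(2) by simp
    \<comment> \<open>On this side \<open>?q'\<close> kills the defect, which therefore factors
      through \<open>?j'\<close>; \<open>\<beta>\<close> carries the correction back to the first
      cone.\<close>
    let ?e = "Idt AC.S (cone_cpx E u') \<oplus>\<^bsub>AC.S\<^esub> \<ominus>\<^bsub>AC.S\<^esub> (K \<cdot>\<^bsub>AC.S\<^esub> m)"
    have "?q' \<cdot>\<^bsub>AC.S\<^esub> K \<cdot>\<^bsub>AC.S\<^esub> m = (?q' \<cdot>\<^bsub>AC.S\<^esub> K) \<cdot>\<^bsub>AC.S\<^esub> m" using m(1,3) m' by simp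
    also have "\<dots> = ?a1 \<cdot>\<^bsub>AC.S\<^esub> (?q \<cdot>\<^bsub>AC.S\<^esub> m)" unfolding qK using m(1,3) m' by simp
    also have "\<dots> = (?a1 \<cdot>\<^bsub>AC.S\<^esub> \<alpha>1) \<cdot>\<^bsub>AC.S\<^esub> ?q'" unfolding m(4)[symmetric] by simp
    also have "\<dots> = ?q'" unfolding \<alpha>1(5) by simp
    finally have "?q' \<cdot>\<^bsub>AC.S\<^esub> ?e = Zer AC.S (cone_cpx E u') (Cod AC.S ?q')"
      using m(1,3) m' by simp
    moreover have "?e \<in> Ar AC.S" "Cod AC.S ?e = Dom AC.S ?q'" "Dom AC.S ?e = cone_cpx E u'"
      using m(1,3) m' by simp_all
    ultimately obtain n where n: "n \<in> Ar AC.S" "Cod AC.S n = Dom AC.S ?j'" "Dom AC.S n = cone_cpx E u'"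
      "?e = ?j' \<cdot>\<^bsub>AC.S\<^esub> n"
      using AC.stably_exact_weak_kernel[OF stably_exact_in_pr[OF ar(2)]] by blast
    have n': "Cod AC.S n = Cod AC u'" using n(2) by simp
    have "K \<cdot>\<^bsub>AC.S\<^esub> (m \<oplus>\<^bsub>AC.S\<^esub> ?j \<cdot>\<^bsub>AC.S\<^esub> \<beta> \<cdot>\<^bsub>AC.S\<^esub> n) = K \<cdot>\<^bsub>AC.S\<^esub> m \<oplus>\<^bsub>AC.S\<^esub> (K \<cdot>\<^bsub>AC.S\<^esub> ?j) \<cdot>\<^bsub>AC.S\<^esub> \<beta> \<cdot>\<^bsub>AC.S\<^esub> n"
      using m(1,3) m' n(1,3) n' by simp
    also have "\<dots> = K \<cdot>\<^bsub>AC.S\<^esub> m \<oplus>\<^bsub>AC.S\<^esub> ?j' \<cdot>\<^bsub>AC.S\<^esub> (?b \<cdot>\<^bsub>AC.S\<^esub> \<beta>) \<cdot>\<^bsub>AC.S\<^esub> n"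
      unfolding Kj using m(1,3) m' n(1,3) n' by simp
    also have "\<dots> = K \<cdot>\<^bsub>AC.S\<^esub> m \<oplus>\<^bsub>AC.S\<^esub> ?e" unfolding \<beta>(5) n(4) using n(1,3) n' by simp
    also have "\<dots> = Idt AC.S (cone_cpx E u')"
      using m(1,3) m' AC.S.Add_left_commute[of "K \<cdot>\<^bsub>AC.S\<^esub> m" "Idt AC.S (cone_cpx E u')" "\<ominus>\<^bsub>AC.S\<^esub> (K \<cdot>\<^bsub>AC.S\<^esub> m)"]
      by simp
    finally show thesis
      by (rule that[rotated 3]) (use m(1,3) m' n(1,3) n' in simp_all)
  qed
  show ?thesis
    unfolding K_def[symmetric]
    by (rule AC.S.is_iso_left_right[of K L R]) (use L R in simp_all)
qed

end

section \<open>Split short exact sequences in a preadditive category\<close>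

context preadditive_category
begin

text \<open>With explicit retraction and section the notion is purely equational, and hence
  preserved by every additive functor.\<close>

definition split_exact where
  "split_exact f g \<longleftrightarrow> f \<in> Ar A \<and> g \<in> Ar A \<and> Cod A f = Dom A g \<and>
     g \<cdot>\<^bsub>A\<^esub> f = Zer A (Dom A f) (Cod A g) \<and>
     (\<exists>l s. l \<in> homset A (Dom A g) (Dom A f) \<and> s \<in> homset A (Cod A g) (Dom A g) \<and>
        l \<cdot>\<^bsub>A\<^esub> f = Idt A (Dom A f) \<and> g \<cdot>\<^bsub>A\<^esub> s = Idt A (Cod A g) \<and>
        f \<cdot>\<^bsub>A\<^esub> l \<oplus>\<^bsub>A\<^esub> s \<cdot>\<^bsub>A\<^esub> g = Idt A (Dom A g))"

lemma split_exactE: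
  assumes "split_exact f g" "Dom A f = x" "Dom A g = y" "Cod A g = z"
  obtains l s where "f \<in> Ar A" "g \<in> Ar A" "Cod A f = y" "g \<cdot>\<^bsub>A\<^esub> f = Zer A x z"
    "l \<in> Ar A" "Dom A l = y" "Cod A l = x" "s \<in> Ar A" "Dom A s = z" "Cod A s = y"
    "l \<cdot>\<^bsub>A\<^esub> f = Idt A x" "g \<cdot>\<^bsub>A\<^esub> s = Idt A z" "f \<cdot>\<^bsub>A\<^esub> l \<oplus>\<^bsub>A\<^esub> s \<cdot>\<^bsub>A\<^esub> g = Idt A y"
  using assms unfolding split_exact_def homset_iff by blast

lemma split_exactI:
  assumes "f \<in> Ar A" "g \<in> Ar A" "Cod A f = Dom A g" "g \<cdot>\<^bsub>A\<^esub> f = Zer A (Dom A f) (Cod A g)"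
    "l \<in> Ar A" "Dom A l = Dom A g" "Cod A l = Dom A f" "s \<in> Ar A" "Dom A s = Cod A g" "Cod A s = Dom A g"
    "l \<cdot>\<^bsub>A\<^esub> f = Idt A (Dom A f)" "g \<cdot>\<^bsub>A\<^esub> s = Idt A (Cod A g)"
    "f \<cdot>\<^bsub>A\<^esub> l \<oplus>\<^bsub>A\<^esub> s \<cdot>\<^bsub>A\<^esub> g = Idt A (Dom A g)"
  shows "split_exact f g"
  using assms unfolding split_exact_def homset_iff by blast

lemma split_exact_iso:
  assumes fg: "split_exact f g" and iso: "is_iso A a" "is_iso A b" "is_iso A c"
    and ar: "f' \<in> Ar A" "g' \<in> Ar A" "Cod A f' = Dom A g'"
    and dc: "Dom A a = Dom A f" "Cod A a = Dom A f'" "Dom A b = Dom A g" "Cod A b = Dom A g'"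
      "Dom A c = Cod A g" "Cod A c = Cod A g'"
    and sq: "b \<cdot>\<^bsub>A\<^esub> f = f' \<cdot>\<^bsub>A\<^esub> a" "c \<cdot>\<^bsub>A\<^esub> g = g' \<cdot>\<^bsub>A\<^esub> b"
  shows "split_exact f' g'"
proof -
  obtain l s where *: "f \<in> Ar A" "g \<in> Ar A" "Cod A f = Dom A g" "g \<cdot>\<^bsub>A\<^esub> f = Zer A (Dom A f) (Cod A g)"
    "l \<in> Ar A" "Dom A l = Dom A g" "Cod A l = Dom A f" "s \<in> Ar A" "Dom A s = Cod A g" "Cod A s = Dom A g"
    "l \<cdot>\<^bsub>A\<^esub> f = Idt A (Dom A f)" "g \<cdot>\<^bsub>A\<^esub> s = Idt A (Cod A g)" "f \<cdot>\<^bsub>A\<^esub> l \<oplus>\<^bsub>A\<^esub> s \<cdot>\<^bsub>A\<^esub> g = Idt A (Dom A g)"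
    by (rule split_exactE[OF fg refl refl refl])
  obtain a' where a': "a' \<in> Ar A" "Dom A a' = Dom A f'" "Cod A a' = Dom A f"
    "a' \<cdot>\<^bsub>A\<^esub> a = Idt A (Dom A f)" "a \<cdot>\<^bsub>A\<^esub> a' = Idt A (Dom A f')" by (rule is_iso_inverse[OF iso(1) dc(1,2)])
  obtain b' where b': "b' \<in> Ar A" "Dom A b' = Dom A g'" "Cod A b' = Dom A g"
    "b' \<cdot>\<^bsub>A\<^esub> b = Idt A (Dom A g)" "b \<cdot>\<^bsub>A\<^esub> b' = Idt A (Dom A g')" by (rule is_iso_inverse[OF iso(2) dc(3,4)])
  obtain c' where c': "c' \<in> Ar A" "Dom A c' = Cod A g'" "Cod A c' = Cod A g"
    "c' \<cdot>\<^bsub>A\<^esub> c = Idt A (Cod A g)" "c \<cdot>\<^bsub>A\<^esub> c' = Idt A (Cod A g')" by (rule is_iso_inverse[OF iso(3) dc(5,6)])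
  have abc: "a \<in> Ar A" "b \<in> Ar A" "c \<in> Ar A" using iso by simp_all
  note [simp] = abc a' b' c' *(1-3,5-10) ar dc
  have o: "Dom A f' \<in> Ob A" "Dom A g' \<in> Ob A" "Cod A g' \<in> Ob A" "Dom A f \<in> Ob A" "Dom A g \<in> Ob A" "Cod A g \<in> Ob A"
    using ar *(1,2) Dom_Ob Cod_Ob by blast+
  note [simp] = o
  have f': "f' = b \<cdot>\<^bsub>A\<^esub> f \<cdot>\<^bsub>A\<^esub> a'"
  proof -
    have "f' = (f' \<cdot>\<^bsub>A\<^esub> a) \<cdot>\<^bsub>A\<^esub> a'" by simp
    then show ?thesis unfolding sq(1)[symmetric] by simp
  qed
  have g': "g' = c \<cdot>\<^bsub>A\<^esub> g \<cdot>\<^bsub>A\<^esub> b'"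
  proof -
    have "g' = (g' \<cdot>\<^bsub>A\<^esub> b) \<cdot>\<^bsub>A\<^esub> b'" by simp
    then show ?thesis unfolding sq(2)[symmetric] by simp
  qed
  note cancel = Cmp_inverse_cancel[of a a'] Cmp_inverse_cancel[of a' a] Cmp_inverse_cancel[of b b']
    Cmp_inverse_cancel[of b' b] Cmp_inverse_cancel[of c c'] Cmp_inverse_cancel[of c' c]
  show ?thesis
  proof (rule split_exactI[OF ar])
    have "g' \<cdot>\<^bsub>A\<^esub> f' = c \<cdot>\<^bsub>A\<^esub> g \<cdot>\<^bsub>A\<^esub> b' \<cdot>\<^bsub>A\<^esub> b \<cdot>\<^bsub>A\<^esub> f \<cdot>\<^bsub>A\<^esub> a'" by (subst f', subst g') simp
    also have "\<dots> = c \<cdot>\<^bsub>A\<^esub> (g \<cdot>\<^bsub>A\<^esub> f) \<cdot>\<^bsub>A\<^esub> a'" by (simp add: cancel)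
    finally show "g' \<cdot>\<^bsub>A\<^esub> f' = Zer A (Dom A f') (Cod A g')" unfolding *(4) by simp
    have "(a \<cdot>\<^bsub>A\<^esub> l \<cdot>\<^bsub>A\<^esub> b') \<cdot>\<^bsub>A\<^esub> f' = a \<cdot>\<^bsub>A\<^esub> l \<cdot>\<^bsub>A\<^esub> b' \<cdot>\<^bsub>A\<^esub> b \<cdot>\<^bsub>A\<^esub> f \<cdot>\<^bsub>A\<^esub> a'" by (subst f') simp
    also have "\<dots> = a \<cdot>\<^bsub>A\<^esub> (l \<cdot>\<^bsub>A\<^esub> f) \<cdot>\<^bsub>A\<^esub> a'" by (simp add: cancel)
    finally show "(a \<cdot>\<^bsub>A\<^esub> l \<cdot>\<^bsub>A\<^esub> b') \<cdot>\<^bsub>A\<^esub> f' = Idt A (Dom A f')" unfolding *(11) by simp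
    have "g' \<cdot>\<^bsub>A\<^esub> b \<cdot>\<^bsub>A\<^esub> s \<cdot>\<^bsub>A\<^esub> c' = c \<cdot>\<^bsub>A\<^esub> g \<cdot>\<^bsub>A\<^esub> b' \<cdot>\<^bsub>A\<^esub> b \<cdot>\<^bsub>A\<^esub> s \<cdot>\<^bsub>A\<^esub> c'" by (subst g') simp
    also have "\<dots> = c \<cdot>\<^bsub>A\<^esub> (g \<cdot>\<^bsub>A\<^esub> s) \<cdot>\<^bsub>A\<^esub> c'" by (simp add: cancel)
    finally show "g' \<cdot>\<^bsub>A\<^esub> b \<cdot>\<^bsub>A\<^esub> s \<cdot>\<^bsub>A\<^esub> c' = Idt A (Cod A g')" unfolding *(12) by simp
    have "f' \<cdot>\<^bsub>A\<^esub> a \<cdot>\<^bsub>A\<^esub> l \<cdot>\<^bsub>A\<^esub> b' = b \<cdot>\<^bsub>A\<^esub> f \<cdot>\<^bsub>A\<^esub> a' \<cdot>\<^bsub>A\<^esub> a \<cdot>\<^bsub>A\<^esub> l \<cdot>\<^bsub>A\<^esub> b'" by (subst f') simp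
    moreover have "(b \<cdot>\<^bsub>A\<^esub> s \<cdot>\<^bsub>A\<^esub> c') \<cdot>\<^bsub>A\<^esub> g' = b \<cdot>\<^bsub>A\<^esub> s \<cdot>\<^bsub>A\<^esub> c' \<cdot>\<^bsub>A\<^esub> c \<cdot>\<^bsub>A\<^esub> g \<cdot>\<^bsub>A\<^esub> b'" by (subst g') simp
    ultimately have "f' \<cdot>\<^bsub>A\<^esub> (a \<cdot>\<^bsub>A\<^esub> l \<cdot>\<^bsub>A\<^esub> b') \<oplus>\<^bsub>A\<^esub> (b \<cdot>\<^bsub>A\<^esub> s \<cdot>\<^bsub>A\<^esub> c') \<cdot>\<^bsub>A\<^esub> g' =
      b \<cdot>\<^bsub>A\<^esub> (f \<cdot>\<^bsub>A\<^esub> l \<oplus>\<^bsub>A\<^esub> s \<cdot>\<^bsub>A\<^esub> g) \<cdot>\<^bsub>A\<^esub> b'" by (simp add: cancel)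
    then show "f' \<cdot>\<^bsub>A\<^esub> (a \<cdot>\<^bsub>A\<^esub> l \<cdot>\<^bsub>A\<^esub> b') \<oplus>\<^bsub>A\<^esub> (b \<cdot>\<^bsub>A\<^esub> s \<cdot>\<^bsub>A\<^esub> c') \<cdot>\<^bsub>A\<^esub> g' = Idt A (Dom A g')"
      unfolding *(13) by simp
  qed simp_all
qed

text \<open>In the next three lemmas, \<open>q\<close> is a cokernel of the split monomorphism \<open>m\<close>, with retraction \<open>e\<close>
  of \<open>m\<close> and section \<open>t\<close> of \<open>q\<close>.\<close>

lemma cokernel_kernel_iso:
  assumes fe: "split_exact f e" "Dom A f = w" "Dom A e = y" "Cod A e = x"
    and m: "m \<in> Ar A" "Dom A m = x" "Cod A m = y" "e \<cdot>\<^bsub>A\<^esub> m = Idt A x"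
    and q: "q \<in> Ar A" "Dom A q = y" "Cod A q = z"
    and t: "t \<in> Ar A" "Dom A t = z" "Cod A t = y"
    and qt: "q \<cdot>\<^bsub>A\<^esub> t = Idt A z" and tq: "t \<cdot>\<^bsub>A\<^esub> q = Idt A y \<oplus>\<^bsub>A\<^esub> \<ominus>\<^bsub>A\<^esub> (m \<cdot>\<^bsub>A\<^esub> e)"
  shows "is_iso A (q \<cdot>\<^bsub>A\<^esub> f)"
proof -
  obtain l s where *: "f \<in> Ar A" "e \<in> Ar A" "Cod A f = y" "e \<cdot>\<^bsub>A\<^esub> f = Zer A w x"
    "l \<in> Ar A" "Dom A l = y" "Cod A l = w" "s \<in> Ar A" "Dom A s = x" "Cod A s = y"
    "l \<cdot>\<^bsub>A\<^esub> f = Idt A w" "e \<cdot>\<^bsub>A\<^esub> s = Idt A x" "f \<cdot>\<^bsub>A\<^esub> l \<oplus>\<^bsub>A\<^esub> s \<cdot>\<^bsub>A\<^esub> e = Idt A y"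
    by (rule split_exactE[OF fe])
  have o: "w \<in> Ob A" "x \<in> Ob A" "y \<in> Ob A" "z \<in> Ob A" using *(1) m(1-3) q fe(2) by auto
  note [simp] = o fe(2-4) m(1-3) q t *(1-3,5-10)
  have em: "e \<cdot>\<^bsub>A\<^esub> m \<cdot>\<^bsub>A\<^esub> k = k" if "k \<in> Ar A" "Cod A k = x" for k
    using Cmp_assoc'[of k m e] that m(4) by simp
  \<comment> \<open>\<open>t\<close> takes its values in the kernel of \<open>e\<close>: the
    idempotent \<open>t q = 1 - m e\<close> is annihilated by \<open>e\<close>, and
    \<open>q t = 1\<close>.\<close>
  have et: "e \<cdot>\<^bsub>A\<^esub> t = Zer A z x"
  proof -
    have "e \<cdot>\<^bsub>A\<^esub> t = e \<cdot>\<^bsub>A\<^esub> t \<cdot>\<^bsub>A\<^esub> (q \<cdot>\<^bsub>A\<^esub> t)" unfolding qt by simp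
    also have "\<dots> = e \<cdot>\<^bsub>A\<^esub> (t \<cdot>\<^bsub>A\<^esub> q) \<cdot>\<^bsub>A\<^esub> t" by simp
    also have "\<dots> = Zer A z x" unfolding tq by (simp add: em)
    finally show ?thesis .
  qed
  have fl: "f \<cdot>\<^bsub>A\<^esub> l = Idt A y \<oplus>\<^bsub>A\<^esub> \<ominus>\<^bsub>A\<^esub> (s \<cdot>\<^bsub>A\<^esub> e)" unfolding *(13)[symmetric] by simp
  have "(q \<cdot>\<^bsub>A\<^esub> f) \<cdot>\<^bsub>A\<^esub> l \<cdot>\<^bsub>A\<^esub> t = q \<cdot>\<^bsub>A\<^esub> (f \<cdot>\<^bsub>A\<^esub> l) \<cdot>\<^bsub>A\<^esub> t" by simp
  also have "\<dots> = Idt A z" unfolding fl by (simp add: et qt)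
  finally have 1: "(q \<cdot>\<^bsub>A\<^esub> f) \<cdot>\<^bsub>A\<^esub> l \<cdot>\<^bsub>A\<^esub> t = Idt A z" .
  have "(l \<cdot>\<^bsub>A\<^esub> t) \<cdot>\<^bsub>A\<^esub> q \<cdot>\<^bsub>A\<^esub> f = l \<cdot>\<^bsub>A\<^esub> (t \<cdot>\<^bsub>A\<^esub> q) \<cdot>\<^bsub>A\<^esub> f" by simp
  also have "\<dots> = Idt A w" unfolding tq by (simp add: *(4,11))
  finally have 2: "(l \<cdot>\<^bsub>A\<^esub> t) \<cdot>\<^bsub>A\<^esub> q \<cdot>\<^bsub>A\<^esub> f = Idt A w" .
  show ?thesis
  proof (rule is_isoI[of _ "l \<cdot>\<^bsub>A\<^esub> t"])
    show "(l \<cdot>\<^bsub>A\<^esub> t) \<cdot>\<^bsub>A\<^esub> q \<cdot>\<^bsub>A\<^esub> f = Idt A (Dom A (q \<cdot>\<^bsub>A\<^esub> f))" unfolding 2 by simp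
    show "(q \<cdot>\<^bsub>A\<^esub> f) \<cdot>\<^bsub>A\<^esub> l \<cdot>\<^bsub>A\<^esub> t = Idt A (Cod A (q \<cdot>\<^bsub>A\<^esub> f))" unfolding 1 by simp
  qed simp_all
qed

text \<open>Both \<open>g\<close> and \<open>q\<close> are cokernels of \<open>m\<close>, so
  \<open>g t\<close> is an isomorphism between their targets. From \<open>g c = (g t) (q c)\<close>
  invertibility passes to \<open>q c\<close>.\<close>

lemma cokernel_complement_iso:
  assumes mg: "split_exact m g" "Dom A m = x" "Dom A g = y" "Cod A g = w"
    and e: "e \<in> Ar A" "Dom A e = y" "Cod A e = x" "e \<cdot>\<^bsub>A\<^esub> m = Idt A x"
    and q: "q \<in> Ar A" "Dom A q = y" "Cod A q = z"
    and t: "t \<in> Ar A" "Dom A t = z" "Cod A t = y"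
    and qt: "q \<cdot>\<^bsub>A\<^esub> t = Idt A z" and tq: "t \<cdot>\<^bsub>A\<^esub> q = Idt A y \<oplus>\<^bsub>A\<^esub> \<ominus>\<^bsub>A\<^esub> (m \<cdot>\<^bsub>A\<^esub> e)"
    and c: "c \<in> Ar A" "Cod A c = y" "is_iso A (g \<cdot>\<^bsub>A\<^esub> c)"
  shows "is_iso A (q \<cdot>\<^bsub>A\<^esub> c)"
proof -
  obtain l s where *: "m \<in> Ar A" "g \<in> Ar A" "Cod A m = y" "g \<cdot>\<^bsub>A\<^esub> m = Zer A x w"
    "l \<in> Ar A" "Dom A l = y" "Cod A l = x" "s \<in> Ar A" "Dom A s = w" "Cod A s = y"
    "l \<cdot>\<^bsub>A\<^esub> m = Idt A x" "g \<cdot>\<^bsub>A\<^esub> s = Idt A w" "m \<cdot>\<^bsub>A\<^esub> l \<oplus>\<^bsub>A\<^esub> s \<cdot>\<^bsub>A\<^esub> g = Idt A y"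
    by (rule split_exactE[OF mg])
  have o: "w \<in> Ob A" "x \<in> Ob A" "y \<in> Ob A" "z \<in> Ob A" using *(2) e(1-3) q mg(4) by auto
  note [simp] = o mg(2-4) e(1-3) q t *(1-3,5-10) c(1,2)
  have gm: "g \<cdot>\<^bsub>A\<^esub> m \<cdot>\<^bsub>A\<^esub> k = Zer A (Dom A k) w" if "k \<in> Ar A" "Cod A k = x" for k
    using Cmp_assoc'[of k m g] that *(4) by simp
  have qm: "q \<cdot>\<^bsub>A\<^esub> m = Zer A x z"
  proof -
    have "q \<cdot>\<^bsub>A\<^esub> m = (q \<cdot>\<^bsub>A\<^esub> t) \<cdot>\<^bsub>A\<^esub> q \<cdot>\<^bsub>A\<^esub> m" unfolding qt by simp
    also have "\<dots> = q \<cdot>\<^bsub>A\<^esub> (t \<cdot>\<^bsub>A\<^esub> q) \<cdot>\<^bsub>A\<^esub> m" by simp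
    also have "\<dots> = Zer A x z" unfolding tq by (simp add: e(4))
    finally show ?thesis .
  qed
  have qm': "q \<cdot>\<^bsub>A\<^esub> m \<cdot>\<^bsub>A\<^esub> k = Zer A (Dom A k) z" if "k \<in> Ar A" "Cod A k = x" for k
    using Cmp_assoc'[of k m q] that qm by simp
  have "m \<cdot>\<^bsub>A\<^esub> l \<oplus>\<^bsub>A\<^esub> s \<cdot>\<^bsub>A\<^esub> g = s \<cdot>\<^bsub>A\<^esub> g \<oplus>\<^bsub>A\<^esub> m \<cdot>\<^bsub>A\<^esub> l" by (rule Add_commute) simp_all
  then have sg: "s \<cdot>\<^bsub>A\<^esub> g = Idt A y \<oplus>\<^bsub>A\<^esub> \<ominus>\<^bsub>A\<^esub> (m \<cdot>\<^bsub>A\<^esub> l)" unfolding *(13)[symmetric] by simp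
  have gtq: "(g \<cdot>\<^bsub>A\<^esub> t) \<cdot>\<^bsub>A\<^esub> q \<cdot>\<^bsub>A\<^esub> k = g \<cdot>\<^bsub>A\<^esub> k" if "k \<in> Ar A" "Cod A k = y" for k
  proof -
    have "(g \<cdot>\<^bsub>A\<^esub> t) \<cdot>\<^bsub>A\<^esub> q \<cdot>\<^bsub>A\<^esub> k = g \<cdot>\<^bsub>A\<^esub> (t \<cdot>\<^bsub>A\<^esub> q) \<cdot>\<^bsub>A\<^esub> k" using that by simp
    also have "\<dots> = g \<cdot>\<^bsub>A\<^esub> k" unfolding tq using that by (simp add: gm)
    finally show ?thesis .
  qed
  have gt: "is_iso A (g \<cdot>\<^bsub>A\<^esub> t)"
  proof (rule is_isoI[of _ "q \<cdot>\<^bsub>A\<^esub> s"])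
    have "(q \<cdot>\<^bsub>A\<^esub> s) \<cdot>\<^bsub>A\<^esub> g \<cdot>\<^bsub>A\<^esub> t = q \<cdot>\<^bsub>A\<^esub> (s \<cdot>\<^bsub>A\<^esub> g) \<cdot>\<^bsub>A\<^esub> t" by simp
    then show "(q \<cdot>\<^bsub>A\<^esub> s) \<cdot>\<^bsub>A\<^esub> g \<cdot>\<^bsub>A\<^esub> t = Idt A (Dom A (g \<cdot>\<^bsub>A\<^esub> t))"
      unfolding sg by (simp add: qm' qt)
    show "(g \<cdot>\<^bsub>A\<^esub> t) \<cdot>\<^bsub>A\<^esub> q \<cdot>\<^bsub>A\<^esub> s = Idt A (Cod A (g \<cdot>\<^bsub>A\<^esub> t))"
      using gtq[of s] *(12) by simp
  qed simp_all
  have "is_iso A ((g \<cdot>\<^bsub>A\<^esub> t) \<cdot>\<^bsub>A\<^esub> q \<cdot>\<^bsub>A\<^esub> c)" using gtq[of c] c(3) by simp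
  then show ?thesis by (rule is_iso_cancel_left[OF _ gt]) simp_all
qed

text \<open>The idempotent \<open>1 - m e\<close> is split by \<open>q\<close> and \<open>t\<close>
  as well as by \<open>l\<close> and \<open>k\<close>; two splittings of one idempotent are
  isomorphic.\<close>

lemma cokernel_section_iso:
  assumes m: "m \<in> Ar A" "Dom A m = x" "Cod A m = y"
    and e: "e \<in> Ar A" "Dom A e = y" "Cod A e = x" "e \<cdot>\<^bsub>A\<^esub> m = Idt A x"
    and q: "q \<in> Ar A" "Dom A q = y" "Cod A q = z"
    and t: "t \<in> Ar A" "Dom A t = z" "Cod A t = y"
    and qt: "q \<cdot>\<^bsub>A\<^esub> t = Idt A z" and tq: "t \<cdot>\<^bsub>A\<^esub> q = Idt A y \<oplus>\<^bsub>A\<^esub> \<ominus>\<^bsub>A\<^esub> (m \<cdot>\<^bsub>A\<^esub> e)"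
    and k: "k \<in> Ar A" "Dom A k = w" "Cod A k = y" "e \<cdot>\<^bsub>A\<^esub> k = Zer A w x"
    and l: "l \<in> Ar A" "Dom A l = y" "Cod A l = w" "l \<cdot>\<^bsub>A\<^esub> k = Idt A w"
      "k \<cdot>\<^bsub>A\<^esub> l = Idt A y \<oplus>\<^bsub>A\<^esub> \<ominus>\<^bsub>A\<^esub> (m \<cdot>\<^bsub>A\<^esub> e)"
  shows "is_iso A (q \<cdot>\<^bsub>A\<^esub> k)"
proof (rule is_isoI[of _ "l \<cdot>\<^bsub>A\<^esub> t"])
  have o: "w \<in> Ob A" "x \<in> Ob A" "y \<in> Ob A" "z \<in> Ob A" using k e(1-3) q by auto
  note [simp] = o m e(1-3) q t k(1-3) l(1-3)
  have "(l \<cdot>\<^bsub>A\<^esub> t) \<cdot>\<^bsub>A\<^esub> q \<cdot>\<^bsub>A\<^esub> k = l \<cdot>\<^bsub>A\<^esub> (t \<cdot>\<^bsub>A\<^esub> q) \<cdot>\<^bsub>A\<^esub> k" by simp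
  then show "(l \<cdot>\<^bsub>A\<^esub> t) \<cdot>\<^bsub>A\<^esub> q \<cdot>\<^bsub>A\<^esub> k = Idt A (Dom A (q \<cdot>\<^bsub>A\<^esub> k))" unfolding tq by (simp add: k(4) l(4))
  have "(q \<cdot>\<^bsub>A\<^esub> k) \<cdot>\<^bsub>A\<^esub> l \<cdot>\<^bsub>A\<^esub> t = q \<cdot>\<^bsub>A\<^esub> (k \<cdot>\<^bsub>A\<^esub> l) \<cdot>\<^bsub>A\<^esub> t" by simp
  also have "\<dots> = (q \<cdot>\<^bsub>A\<^esub> t) \<cdot>\<^bsub>A\<^esub> q \<cdot>\<^bsub>A\<^esub> t" unfolding l(5) tq[symmetric] by simp
  finally show "(q \<cdot>\<^bsub>A\<^esub> k) \<cdot>\<^bsub>A\<^esub> l \<cdot>\<^bsub>A\<^esub> t = Idt A (Cod A (q \<cdot>\<^bsub>A\<^esub> k))" unfolding qt by simp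
  show "q \<cdot>\<^bsub>A\<^esub> k \<in> Ar A" "l \<cdot>\<^bsub>A\<^esub> t \<in> Ar A" "Dom A (l \<cdot>\<^bsub>A\<^esub> t) = Cod A (q \<cdot>\<^bsub>A\<^esub> k)"
    "Cod A (l \<cdot>\<^bsub>A\<^esub> t) = Dom A (q \<cdot>\<^bsub>A\<^esub> k)" by simp_all
qed

end

lemma (in additive_functor_between) fa_split_exact:
  assumes "A.split_exact f g" shows "B.split_exact (fa H f) (fa H g)"
proof -
  obtain l s where *: "f \<in> Ar A" "g \<in> Ar A" "Cod A f = Dom A g" "g \<cdot>\<^bsub>A\<^esub> f = Zer A (Dom A f) (Cod A g)"
    "l \<in> Ar A" "Dom A l = Dom A g" "Cod A l = Dom A f" "s \<in> Ar A" "Dom A s = Cod A g" "Cod A s = Dom A g"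
    "l \<cdot>\<^bsub>A\<^esub> f = Idt A (Dom A f)" "g \<cdot>\<^bsub>A\<^esub> s = Idt A (Cod A g)" "f \<cdot>\<^bsub>A\<^esub> l \<oplus>\<^bsub>A\<^esub> s \<cdot>\<^bsub>A\<^esub> g = Idt A (Dom A g)"
    by (rule A.split_exactE[OF assms refl refl refl])
  note eqs = arg_cong[OF *(4), of "fa H"] arg_cong[OF *(11), of "fa H"] arg_cong[OF *(12), of "fa H"]
    arg_cong[OF *(13), of "fa H"]
  show ?thesis
    by (rule B.split_exactI[of _ _ "fa H l" "fa H s"]) (use eqs *(1-3,5-10) in simp_all)
qed

context frobenius_complexes
begin

text \<open>Vanishing of the third map makes \<open>cone_pr\<close> stably zero. The identity of the
  cone then lifts along \<open>cone_in\<close> by the weak kernel property, and this section yields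
  a retraction of \<open>u\<close> through \<open>stably_exact_split_epi\<close>.\<close>

lemma split_exact_dist_triangle:
  assumes t: "dist_triangle E f g (Zer AC.S z (shift_cpx E 1 x))"
    and x: "Dom AC.S f = x" and z: "Cod AC.S g = z"
  shows "AC.S.split_exact f g"
proof -
  interpret sh: stable_functor AC AC "shift E 1" by (rule shift_stable_functor)
  obtain X Y Z u a b c where *: "f \<in> homset AC.S X Y" "g \<in> homset AC.S Y Z" "u \<in> Ar AC"
    "a \<in> homset AC.S X (csrc u)" "b \<in> homset AC.S Y (ctgt u)" "c \<in> homset AC.S Z (cone_cpx E u)"
    and iso: "is_iso AC.S a" "is_iso AC.S b" "is_iso AC.S c"
    and sq: "b \<cdot>\<^bsub>AC.S\<^esub> f = AC.cl u \<cdot>\<^bsub>AC.S\<^esub> a" "c \<cdot>\<^bsub>AC.S\<^esub> g = AC.cl (cone_in E u) \<cdot>\<^bsub>AC.S\<^esub> b"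
      "fa (bar AC (shift E 1)) a \<cdot>\<^bsub>AC.S\<^esub> Zer AC.S z (shift_cpx E 1 x) = AC.cl (cone_pr E u) \<cdot>\<^bsub>AC.S\<^esub> c"
    using t unfolding dist_triangle_def Let_def by blast
  have fg: "f \<in> Ar AC.S" "Dom AC.S f = x" "Cod AC.S f = Dom AC.S g" "g \<in> Ar AC.S" "Cod AC.S g = z"
    using *(1,2) x z by (simp_all add: homset_iff)
  have abc: "a \<in> Ar AC.S" "Dom AC.S a = x" "Cod AC.S a = Dom AC u"
    "b \<in> Ar AC.S" "Dom AC.S b = Dom AC.S g" "Cod AC.S b = Cod AC u"
    "c \<in> Ar AC.S" "Dom AC.S c = z" "Cod AC.S c = cone_cpx E u"
    using *(1,2,4-6) x z by (simp_all add: homset_iff AC_defs(3,4))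
  have o: "x \<in> Ob AC" "z \<in> Ob AC" "Dom AC.S g \<in> Ob AC" "Dom AC u \<in> Ob AC" "Cod AC u \<in> Ob AC" "cone_cpx E u \<in> Ob AC"
    using fg *(3) by auto
  obtain a' where a': "a' \<in> Ar AC.S" "Dom AC.S a' = Dom AC u" "Cod AC.S a' = x"
    "a' \<cdot>\<^bsub>AC.S\<^esub> a = Idt AC.S x" "a \<cdot>\<^bsub>AC.S\<^esub> a' = Idt AC.S (Dom AC u)"
    by (rule AC.S.is_iso_inverse[OF iso(1) abc(2,3)])
  obtain b' where b': "b' \<in> Ar AC.S" "Dom AC.S b' = Cod AC u" "Cod AC.S b' = Dom AC.S g"
    "b' \<cdot>\<^bsub>AC.S\<^esub> b = Idt AC.S (Dom AC.S g)" "b \<cdot>\<^bsub>AC.S\<^esub> b' = Idt AC.S (Cod AC u)"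
    by (rule AC.S.is_iso_inverse[OF iso(2) abc(5,6)])
  obtain c' where c': "c' \<in> Ar AC.S" "Dom AC.S c' = cone_cpx E u" "Cod AC.S c' = z"
    "c' \<cdot>\<^bsub>AC.S\<^esub> c = Idt AC.S z" "c \<cdot>\<^bsub>AC.S\<^esub> c' = Idt AC.S (cone_cpx E u)"
    by (rule AC.S.is_iso_inverse[OF iso(3) abc(8,9)])
  let ?u = "AC.cl u" and ?i = "AC.cl (cone_in E u)" and ?p = "AC.cl (cone_pr E u)"
  note [simp] = *(3) fg abc o a'(1-3) b'(1-3) c'(1-3)
  have "?p = (?p \<cdot>\<^bsub>AC.S\<^esub> c) \<cdot>\<^bsub>AC.S\<^esub> c'" by (simp add: c'(5))
  also have "\<dots> = Zer AC.S (cone_cpx E u) (shift_cpx E 1 (Dom AC u))"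
    unfolding sq(3)[symmetric] by simp
  finally have p: "?p = Zer AC.S (cone_cpx E u) (shift_cpx E 1 (Dom AC u))" .
  have "Idt AC.S (cone_cpx E u) \<in> Ar AC.S" "Cod AC.S (Idt AC.S (cone_cpx E u)) = Dom AC.S ?p"
    "Dom AC.S (Idt AC.S (cone_cpx E u)) = cone_cpx E u"
    "?p \<cdot>\<^bsub>AC.S\<^esub> Idt AC.S (cone_cpx E u) = Zer AC.S (cone_cpx E u) (Cod AC.S ?p)"
    by (simp_all add: p)
  from AC.stably_exact_weak_kernel[OF stably_exact_in_pr[OF *(3)] this]
  obtain t where t: "t \<in> Ar AC.S" "Cod AC.S t = Dom AC.S ?i" "Dom AC.S t = cone_cpx E u"
    "Idt AC.S (cone_cpx E u) = ?i \<cdot>\<^bsub>AC.S\<^esub> t" .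
  have t': "Cod AC.S t = Cod AC u" using t(2) by simp
  have "Dom AC.S t = Cod AC.S ?i" "?i \<cdot>\<^bsub>AC.S\<^esub> t = Idt AC.S (Cod AC.S ?i)"
    using t(3) by (simp_all add: t(4)[symmetric])
  from AC.stably_exact_split_epi[OF stably_exact_map_in[OF *(3)] t(1,2) this]
  obtain l where l: "l \<in> Ar AC.S" "Dom AC.S l = Dom AC.S ?i" "Cod AC.S l = Dom AC.S ?u"
    "l \<cdot>\<^bsub>AC.S\<^esub> ?u = Idt AC.S (Dom AC.S ?u)"
    "?u \<cdot>\<^bsub>AC.S\<^esub> l = Idt AC.S (Dom AC.S ?i) \<oplus>\<^bsub>AC.S\<^esub> \<ominus>\<^bsub>AC.S\<^esub> (t \<cdot>\<^bsub>AC.S\<^esub> ?i)" .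
  have l': "Dom AC.S l = Cod AC u" "Cod AC.S l = Dom AC u" using l(2,3) by simp_all
  have "AC.S.split_exact ?u ?i"
  proof (rule AC.S.split_exactI[of _ _ l t])
    show "?i \<cdot>\<^bsub>AC.S\<^esub> ?u = Zer AC.S (Dom AC.S ?u) (Cod AC.S ?i)"
      by (rule AC.stably_exact_zero[OF stably_exact_map_in[OF *(3)]])
    show "?u \<cdot>\<^bsub>AC.S\<^esub> l \<oplus>\<^bsub>AC.S\<^esub> t \<cdot>\<^bsub>AC.S\<^esub> ?i = Idt AC.S (Dom AC.S ?i)"
      unfolding l(5) using t(1,3) t' by simp
  qed (use l(1,4) l' t(1,3) t' in \<open>simp_all add: t(4)[symmetric]\<close>)
  then show ?thesis
  proof (rule AC.S.split_exact_iso[of _ _ a' b' c'])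
    show "is_iso AC.S a'" by (rule AC.S.is_isoI[of a' a]) (simp_all add: a')
    show "is_iso AC.S b'" by (rule AC.S.is_isoI[of b' b]) (simp_all add: b')
    show "is_iso AC.S c'" by (rule AC.S.is_isoI[of c' c]) (simp_all add: c')
    have "b' \<cdot>\<^bsub>AC.S\<^esub> ?u = b' \<cdot>\<^bsub>AC.S\<^esub> (?u \<cdot>\<^bsub>AC.S\<^esub> a) \<cdot>\<^bsub>AC.S\<^esub> a'" by (simp add: a'(5))
    also have "\<dots> = (b' \<cdot>\<^bsub>AC.S\<^esub> b) \<cdot>\<^bsub>AC.S\<^esub> f \<cdot>\<^bsub>AC.S\<^esub> a'" unfolding sq(1)[symmetric] by simp
    finally show "b' \<cdot>\<^bsub>AC.S\<^esub> ?u = f \<cdot>\<^bsub>AC.S\<^esub> a'" unfolding b'(4) by simp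
    have "c' \<cdot>\<^bsub>AC.S\<^esub> ?i = c' \<cdot>\<^bsub>AC.S\<^esub> (?i \<cdot>\<^bsub>AC.S\<^esub> b) \<cdot>\<^bsub>AC.S\<^esub> b'" by (simp add: b'(5))
    also have "\<dots> = (c' \<cdot>\<^bsub>AC.S\<^esub> c) \<cdot>\<^bsub>AC.S\<^esub> g \<cdot>\<^bsub>AC.S\<^esub> b'" unfolding sq(2)[symmetric] by simp
    finally show "c' \<cdot>\<^bsub>AC.S\<^esub> ?i = g \<cdot>\<^bsub>AC.S\<^esub> b'" unfolding c'(4) by simp
  qed simp_all
qed

end

section \<open>1-arrows and 2-arrows\<close>

lemma compf_simps [simp]: "fo (G \<circ>\<^sub>F F) x = fo G (fo F x)" "fa (G \<circ>\<^sub>F F) f = fa G (fa F f)"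
  by (simp_all add: compf_def)

lemma idf_simps [simp]: "fo idf x = x" "fa idf f = f"
  by (simp_all add: idf_def)

lemma compf_assoc: "(H \<circ>\<^sub>F G) \<circ>\<^sub>F F = H \<circ>\<^sub>F G \<circ>\<^sub>F F"
  by (simp add: compf_def)

lemma one_arrow_idf: "one_arrow E E idf"
  by (auto simp: one_arrow_def exact_functor_def additive_functor_def homset_iff)

lemma one_arrow_comp:
  assumes F: "one_arrow E E' F" and G: "one_arrow E' E'' G"
  shows "one_arrow E E'' (G \<circ>\<^sub>F F)"
proof -
  have f: "fo F x \<in> Ob (Acyc E')" "fa F (Idt (Acyc E) x) = Idt (Acyc E') (fo F x)" if "x \<in> Ob (Acyc E)" for x
    using F that by (auto simp: one_arrow_def exact_functor_def additive_functor_def)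
  have f1: "fa F f \<in> Ar (Acyc E')" "Dom (Acyc E') (fa F f) = fo F (Dom (Acyc E) f)"
    "Cod (Acyc E') (fa F f) = fo F (Cod (Acyc E) f)" if "f \<in> Ar (Acyc E)" for f
    using F that by (auto simp: one_arrow_def exact_functor_def additive_functor_def homset_iff)
  have g: "fo G x \<in> Ob (Acyc E'')" "fa G (Idt (Acyc E') x) = Idt (Acyc E'') (fo G x)" if "x \<in> Ob (Acyc E')" for x
    using G that by (auto simp: one_arrow_def exact_functor_def additive_functor_def)
  have g1: "fa G f \<in> Ar (Acyc E'')" "Dom (Acyc E'') (fa G f) = fo G (Dom (Acyc E') f)"
    "Cod (Acyc E'') (fa G f) = fo G (Cod (Acyc E') f)" if "f \<in> Ar (Acyc E')" for f
    using G that by (auto simp: one_arrow_def exact_functor_def additive_functor_def homset_iff)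
  have "fa G (fa F (Cmp (Acyc E) g f)) = Cmp (Acyc E'') (fa G (fa F g)) (fa G (fa F f))"
    if "f \<in> Ar (Acyc E)" "g \<in> Ar (Acyc E)" "Cod (Acyc E) f = Dom (Acyc E) g" for f g
  proof -
    have "fa F (Cmp (Acyc E) g f) = Cmp (Acyc E') (fa F g) (fa F f)"
      using F that by (auto simp: one_arrow_def exact_functor_def additive_functor_def)
    then show ?thesis
      using G f1[OF that(1)] f1[OF that(2)] that(3)
      by (auto simp: one_arrow_def exact_functor_def additive_functor_def)
  qed
  moreover have "fa G (fa F (Add (Acyc E) f g)) = Add (Acyc E'') (fa G (fa F f)) (fa G (fa F g))"
    if "f \<in> Ar (Acyc E)" "g \<in> Ar (Acyc E)" "Dom (Acyc E) f = Dom (Acyc E) g" "Cod (Acyc E) f = Cod (Acyc E) g" for f g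
  proof -
    have "fa F (Add (Acyc E) f g) = Add (Acyc E') (fa F f) (fa F g)"
      using F that by (auto simp: one_arrow_def exact_functor_def additive_functor_def)
    then show ?thesis
      using G f1[OF that(1)] f1[OF that(2)] that(3,4)
      by (auto simp: one_arrow_def exact_functor_def additive_functor_def)
  qed
  ultimately have "additive_functor (Acyc E) (Acyc E'') (G \<circ>\<^sub>F F)"
    unfolding additive_functor_def homset_iff compf_simps
    by (auto simp: f g f1 g1)
  moreover have "(fa G (fa F i), fa G (fa F p)) \<in> Confl (Acyc E'')" if "(i, p) \<in> Confl (Acyc E)" for i p
    using F G that by (auto simp: one_arrow_def exact_functor_def)
  ultimately show ?thesis
    using F G by (auto simp: one_arrow_def exact_functor_def)
qed

lemma (in frobenius_complexes) one_arrow_shift: "one_arrow E E (shift E k)"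
  by (simp add: one_arrow_def shift_exact shift_projective)

locale frobenius_pair = E: frobenius_complexes E + E': frobenius_complexes E'
  for E :: "('o, 'm) excat" and E' :: "('p, 'n) excat"
begin

lemma one_arrow_iff: "one_arrow E E' F \<longleftrightarrow> stable_functor E.AC E'.AC F"
  unfolding one_arrow_def stable_functor_def stable_functor_axioms_def
  using E.AC_stable_base E'.AC_stable_base by blast

lemma hom1I:
  assumes "\<And>X. X \<in> Ob E.AC \<Longrightarrow> \<tau> X \<in> Ar E'.AC" "\<And>X. X \<in> Ob E.AC \<Longrightarrow> Dom E'.AC (\<tau> X) = fo F X"
    "\<And>X. X \<in> Ob E.AC \<Longrightarrow> Cod E'.AC (\<tau> X) = fo G X"
    "\<And>f. f \<in> Ar E.AC \<Longrightarrow> fa G f \<cdot>\<^bsub>E'.AC\<^esub> \<tau> (Dom E.AC f) = \<tau> (Cod E.AC f) \<cdot>\<^bsub>E'.AC\<^esub> fa F f"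
  shows "\<tau> \<in> hom1 E E' F G"
  using assms unfolding hom1_def nat_trans_def homset_iff by blast

lemma hom1D:
  assumes "\<tau> \<in> hom1 E E' F G"
  shows "X \<in> Ob E.AC \<Longrightarrow> \<tau> X \<in> Ar E'.AC" "X \<in> Ob E.AC \<Longrightarrow> Dom E'.AC (\<tau> X) = fo F X"
    "X \<in> Ob E.AC \<Longrightarrow> Cod E'.AC (\<tau> X) = fo G X"
    "f \<in> Ar E.AC \<Longrightarrow> fa G f \<cdot>\<^bsub>E'.AC\<^esub> \<tau> (Dom E.AC f) = \<tau> (Cod E.AC f) \<cdot>\<^bsub>E'.AC\<^esub> fa F f"
  using assms unfolding hom1_def nat_trans_def homset_iff by blast+

lemma one_arrowD:
  assumes "one_arrow E E' F"
  shows "X \<in> Ob E.AC \<Longrightarrow> fo F X \<in> Ob E'.AC" "X \<in> Ob E.AC \<Longrightarrow> fa F (Idt E.AC X) = Idt E'.AC (fo F X)"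
    "f \<in> Ar E.AC \<Longrightarrow> fa F f \<in> Ar E'.AC" "f \<in> Ar E.AC \<Longrightarrow> Dom E'.AC (fa F f) = fo F (Dom E.AC f)"
    "f \<in> Ar E.AC \<Longrightarrow> Cod E'.AC (fa F f) = fo F (Cod E.AC f)"
    "f \<in> Ar E.AC \<Longrightarrow> g \<in> Ar E.AC \<Longrightarrow> Cod E.AC f = Dom E.AC g \<Longrightarrow>
       fa F (g \<cdot>\<^bsub>E.AC\<^esub> f) = fa F g \<cdot>\<^bsub>E'.AC\<^esub> fa F f"
proof -
  interpret F: stable_functor E.AC E'.AC F using assms by (simp add: one_arrow_iff)
  show "X \<in> Ob E.AC \<Longrightarrow> fo F X \<in> Ob E'.AC" "X \<in> Ob E.AC \<Longrightarrow> fa F (Idt E.AC X) = Idt E'.AC (fo F X)"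
    "f \<in> Ar E.AC \<Longrightarrow> fa F f \<in> Ar E'.AC" "f \<in> Ar E.AC \<Longrightarrow> Dom E'.AC (fa F f) = fo F (Dom E.AC f)"
    "f \<in> Ar E.AC \<Longrightarrow> Cod E'.AC (fa F f) = fo F (Cod E.AC f)"
    "f \<in> Ar E.AC \<Longrightarrow> g \<in> Ar E.AC \<Longrightarrow> Cod E.AC f = Dom E.AC g \<Longrightarrow>
       fa F (g \<cdot>\<^bsub>E.AC\<^esub> f) = fa F g \<cdot>\<^bsub>E'.AC\<^esub> fa F f"
    by simp_all
qed

lemma hom1_Idt:
  assumes "one_arrow E E' F" shows "(\<lambda>X. Idt E'.AC (fo F X)) \<in> hom1 E E' F F"
  by (rule hom1I) (use one_arrowD[OF assms] in simp_all)

lemma hom1_Cmp: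
  assumes \<sigma>: "\<sigma> \<in> hom1 E E' F G" and \<tau>: "\<tau> \<in> hom1 E E' G H"
    and F: "one_arrow E E' F" and G: "one_arrow E E' G" and H: "one_arrow E E' H"
  shows "(\<lambda>X. \<tau> X \<cdot>\<^bsub>E'.AC\<^esub> \<sigma> X) \<in> hom1 E E' F H"
proof (rule hom1I)
  fix f assume f: "f \<in> Ar E.AC"
  have o: "Dom E.AC f \<in> Ob E.AC" "Cod E.AC f \<in> Ob E.AC" using f by simp_all
  note s = hom1D(1-3)[OF \<sigma> o(1)] hom1D(1-3)[OF \<sigma> o(2)] hom1D(1-3)[OF \<tau> o(1)] hom1D(1-3)[OF \<tau> o(2)]
    one_arrowD(3-5)[OF F f] one_arrowD(3-5)[OF G f] one_arrowD(3-5)[OF H f]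
  have "fa H f \<cdot>\<^bsub>E'.AC\<^esub> \<tau> (Dom E.AC f) \<cdot>\<^bsub>E'.AC\<^esub> \<sigma> (Dom E.AC f) = (fa H f \<cdot>\<^bsub>E'.AC\<^esub> \<tau> (Dom E.AC f)) \<cdot>\<^bsub>E'.AC\<^esub> \<sigma> (Dom E.AC f)"
    using s by simp
  also have "\<dots> = \<tau> (Cod E.AC f) \<cdot>\<^bsub>E'.AC\<^esub> (fa G f \<cdot>\<^bsub>E'.AC\<^esub> \<sigma> (Dom E.AC f))"
    unfolding hom1D(4)[OF \<tau> f] using s by simp
  also have "\<dots> = (\<tau> (Cod E.AC f) \<cdot>\<^bsub>E'.AC\<^esub> \<sigma> (Cod E.AC f)) \<cdot>\<^bsub>E'.AC\<^esub> fa F f"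
    unfolding hom1D(4)[OF \<sigma> f] using s by simp
  finally show "fa H f \<cdot>\<^bsub>E'.AC\<^esub> \<tau> (Dom E.AC f) \<cdot>\<^bsub>E'.AC\<^esub> \<sigma> (Dom E.AC f) = \<dots>" .
qed (use hom1D(1-3)[OF \<sigma>] hom1D(1-3)[OF \<tau>] in simp_all)

text \<open>Naturality squares of a genuine transformation commute strictly; this is why its
  pointwise cones fit together to a functor.\<close>

lemma cone_square_hom1:
  assumes P: "one_arrow E E' P" and Q: "one_arrow E E' Q" and \<phi>: "\<phi> \<in> hom1 E E' P Q" and f: "f \<in> Ar E.AC"
  shows "E'.cone_square (\<phi> (csrc f)) (\<phi> (ctgt f)) (fa P f) (fa Q f)"
proof -
  have o: "Dom E.AC f \<in> Ob E.AC" "Cod E.AC f \<in> Ob E.AC" using f by simp_all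
  show ?thesis
    unfolding E'.cone_square_def
    using hom1D(1-3)[OF \<phi> o(1)] hom1D(1-3)[OF \<phi> o(2)] hom1D(4)[OF \<phi> f]
      one_arrowD(3-5)[OF P f] one_arrowD(3-5)[OF Q f]
    by (simp add: E.AC_defs(3,4))
qed

section \<open>Cone functors and the naturality of their structural maps\<close>

lemma cone_functor_simps [simp]:
  "fo (cone_functor E' P Q \<phi>) X = cone_cpx E' (\<phi> X)"
  "fa (cone_functor E' P Q \<phi>) f = cone_map E' (\<phi> (csrc f)) (\<phi> (ctgt f)) (fa P f) (fa Q f)"
  by (simp_all add: cone_functor_def)

text \<open>Functoriality and additivity are the pointwise laws of \<open>cone_map\<close>,
  exactness comes from direct sums of conflations, and projectives are preserved because the cone of
  a map between projectives is projective.\<close>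

lemma cone_functor_one_arrow:
  assumes P: "one_arrow E E' P" and Q: "one_arrow E E' Q" and \<phi>: "\<phi> \<in> hom1 E E' P Q"
  shows "one_arrow E E' (cone_functor E' P Q \<phi>)"
proof -
  interpret P: stable_functor E.AC E'.AC P using P by (simp add: one_arrow_iff)
  interpret Q: stable_functor E.AC E'.AC Q using Q by (simp add: one_arrow_iff)
  note sq = cone_square_hom1[OF P Q \<phi>]
  note h = hom1D(1-3)[OF \<phi>]
  have cd: "csrc f = Dom E.AC f" "ctgt f = Cod E.AC f" for f by (simp_all add: E.AC_defs(3,4))
  have "additive_functor E.AC E'.AC (cone_functor E' P Q \<phi>)"
    unfolding additive_functor_def homset_iff cone_functor_simps
  proof (intro conjI ballI impI)
    fix X assume X: "X \<in> Ob E.AC"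
    then show "cone_cpx E' (\<phi> X) \<in> Ob E'.AC" using h by simp
    show "cone_map E' (\<phi> (csrc (Idt E.AC X))) (\<phi> (ctgt (Idt E.AC X))) (fa P (Idt E.AC X)) (fa Q (Idt E.AC X)) =
      Idt E'.AC (cone_cpx E' (\<phi> X))"
      using E'.cone_map_Idt[of "\<phi> X"] h[OF X] X by simp
  next
    fix f assume f: "f \<in> Ar E.AC"
    show "cone_map E' (\<phi> (csrc f)) (\<phi> (ctgt f)) (fa P f) (fa Q f) \<in> Ar E'.AC"
      by (rule E'.cone_map_Ar[OF sq[OF f]])
    show "Dom E'.AC (cone_map E' (\<phi> (csrc f)) (\<phi> (ctgt f)) (fa P f) (fa Q f)) = cone_cpx E' (\<phi> (Dom E.AC f))"
      "Cod E'.AC (cone_map E' (\<phi> (csrc f)) (\<phi> (ctgt f)) (fa P f) (fa Q f)) = cone_cpx E' (\<phi> (Cod E.AC f))"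
      by (simp_all add: cd)
  next
    fix f g assume fg: "f \<in> Ar E.AC" "g \<in> Ar E.AC" "Cod E.AC f = Dom E.AC g"
    show "cone_map E' (\<phi> (csrc (g \<cdot>\<^bsub>E.AC\<^esub> f))) (\<phi> (ctgt (g \<cdot>\<^bsub>E.AC\<^esub> f))) (fa P (g \<cdot>\<^bsub>E.AC\<^esub> f)) (fa Q (g \<cdot>\<^bsub>E.AC\<^esub> f)) =
      cone_map E' (\<phi> (csrc g)) (\<phi> (ctgt g)) (fa P g) (fa Q g) \<cdot>\<^bsub>E'.AC\<^esub>
      cone_map E' (\<phi> (csrc f)) (\<phi> (ctgt f)) (fa P f) (fa Q f)"
      using E'.cone_map_Cmp[of "\<phi> (csrc f)" "\<phi> (ctgt f)" "fa P f" "fa Q f" "\<phi> (ctgt g)" "fa P g" "fa Q g"]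
        sq[OF fg(1)] sq[OF fg(2)] fg by (simp add: cd)
  next
    fix f g assume fg: "f \<in> Ar E.AC" "g \<in> Ar E.AC" "Dom E.AC f = Dom E.AC g \<and> Cod E.AC f = Cod E.AC g"
    show "cone_map E' (\<phi> (csrc (f \<oplus>\<^bsub>E.AC\<^esub> g))) (\<phi> (ctgt (f \<oplus>\<^bsub>E.AC\<^esub> g))) (fa P (f \<oplus>\<^bsub>E.AC\<^esub> g)) (fa Q (f \<oplus>\<^bsub>E.AC\<^esub> g)) =
      cone_map E' (\<phi> (csrc f)) (\<phi> (ctgt f)) (fa P f) (fa Q f) \<oplus>\<^bsub>E'.AC\<^esub>
      cone_map E' (\<phi> (csrc g)) (\<phi> (ctgt g)) (fa P g) (fa Q g)"
      using E'.cone_map_Add[of "\<phi> (csrc f)" "\<phi> (ctgt f)" "fa P f" "fa Q f" "fa P g" "fa Q g"]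
        sq[OF fg(1)] sq[OF fg(2)] fg by (simp add: cd)
  qed
  moreover have "(cone_map E' (\<phi> (csrc i)) (\<phi> (ctgt i)) (fa P i) (fa Q i),
      cone_map E' (\<phi> (csrc p)) (\<phi> (ctgt p)) (fa P p) (fa Q p)) \<in> Confl E'.AC"
    if ip: "(i, p) \<in> Confl E.AC" for i p
  proof -
    have c: "i \<in> Ar E.AC" "p \<in> Ar E.AC" "csrc p = ctgt i" using E.AC.Confl_simps[OF ip] by (simp_all add: cd)
    show ?thesis
      using E'.cone_map_Confl[OF sq[OF c(1)] sq[OF c(2), unfolded c(3)] P.fa_Confl[OF ip] Q.fa_Confl[OF ip]]
      by (simp add: c(3))
  qed
  moreover have "projective E'.AC (cone_cpx E' (\<phi> X))" if X: "projective E.AC X" for X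
  proof -
    have "X \<in> Ob E.AC" using X by simp
    from h[OF this] show ?thesis
      using E'.cone_projective[of "\<phi> X"] P.fo_projective[OF X] Q.fo_projective[OF X] by simp
  qed
  ultimately show ?thesis by (auto simp: one_arrow_def exact_functor_def)
qed

lemma hom1_cone_in:
  assumes P: "one_arrow E E' P" and Q: "one_arrow E E' Q" and \<phi>: "\<phi> \<in> hom1 E E' P Q"
  shows "(\<lambda>X. cone_in E' (\<phi> X)) \<in> hom1 E E' Q (cone_functor E' P Q \<phi>)"
  by (rule hom1I)
    (use hom1D(1-3)[OF \<phi>] E'.cone_map_in[OF cone_square_hom1[OF P Q \<phi>]] in \<open>simp_all add: E.AC_defs(3,4)\<close>)

lemma hom1_cone_in_cone:
  assumes P: "one_arrow E E' P" and Q: "one_arrow E E' Q" and \<phi>: "\<phi> \<in> hom1 E E' P Q"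
  shows "(\<lambda>X. E'.cone_in_cone (\<phi> X)) \<in>
    hom1 E E' (cone_functor E' Q (cone_functor E' P Q \<phi>) (\<lambda>X. cone_in E' (\<phi> X))) (shift E' 1 \<circ>\<^sub>F P)"
proof (rule hom1I)
  fix f assume f: "f \<in> Ar E.AC"
  note d = E'.cone_squareD(1-8)[OF cone_square_hom1[OF P Q \<phi> f]]
  show "fa (shift E' 1 \<circ>\<^sub>F P) f \<cdot>\<^bsub>E'.AC\<^esub> E'.cone_in_cone (\<phi> (Dom E.AC f)) = E'.cone_in_cone (\<phi> (Cod E.AC f)) \<cdot>\<^bsub>E'.AC\<^esub>
    fa (cone_functor E' Q (cone_functor E' P Q \<phi>) (\<lambda>X. cone_in E' (\<phi> X))) f"
    unfolding E.AC_defs(3,4) by (rule E'.chmap_eqI) (use d in \<open>simp_all add: E'.chmap_simps\<close>)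
qed (use hom1D(1-3)[OF \<phi>] in simp_all)

lemma hom1_cocone_pr:
  assumes P: "one_arrow E E' P" and Q: "one_arrow E E' Q" and \<phi>: "\<phi> \<in> hom1 E E' P Q"
  shows "(\<lambda>X. E'.cocone_pr (\<phi> X)) \<in> hom1 E E' (cocone_functor E' P Q \<phi>) P"
proof (rule hom1I)
  fix X assume X: "X \<in> Ob E.AC"
  note h = hom1D(1-3)[OF \<phi> X]
  show "E'.cocone_pr (\<phi> X) \<in> Ar E'.AC" "Dom E'.AC (E'.cocone_pr (\<phi> X)) = fo (cocone_functor E' P Q \<phi>) X"
    "Cod E'.AC (E'.cocone_pr (\<phi> X)) = fo P X"
    using E'.cocone_pr_simps[OF h(1)] h by (simp_all add: cocone_functor_def)
next
  fix f assume f: "f \<in> Ar E.AC"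
  have sq: "E'.cone_square (\<phi> (Dom E.AC f)) (\<phi> (Cod E.AC f)) (fa P f) (fa Q f)"
    using cone_square_hom1[OF P Q \<phi> f] by (simp add: E.AC_defs(3,4))
  have d: "\<phi> (Dom E.AC f) \<in> Ar E'.AC" "\<phi> (Cod E.AC f) \<in> Ar E'.AC" "fa P f \<in> Ar E'.AC"
    "Dom E'.AC (fa P f) = Dom E'.AC (\<phi> (Dom E.AC f))" "Cod E'.AC (fa P f) = Dom E'.AC (\<phi> (Cod E.AC f))"
    using sq by (simp_all add: E'.cone_square_def)
  interpret sh: stable_functor E'.AC E'.AC "shift E' (-1)" by (rule E'.shift_stable_functor)
  \<comment> \<open>Naturality of the cone projection is shifted back by one degree; the shift on
    \<open>fa P f\<close> then cancels strictly.\<close>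
  have "fa (shift E' (-1)) (cone_pr E' (\<phi> (Cod E.AC f)) \<cdot>\<^bsub>E'.AC\<^esub> cone_map E' (\<phi> (Dom E.AC f)) (\<phi> (Cod E.AC f)) (fa P f) (fa Q f)) =
    fa (shift E' (-1)) (fa (shift E' 1) (fa P f) \<cdot>\<^bsub>E'.AC\<^esub> cone_pr E' (\<phi> (Dom E.AC f)))"
    by (simp only: E'.cone_map_pr[OF sq])
  then show "fa P f \<cdot>\<^bsub>E'.AC\<^esub> E'.cocone_pr (\<phi> (Dom E.AC f)) =
    E'.cocone_pr (\<phi> (Cod E.AC f)) \<cdot>\<^bsub>E'.AC\<^esub> fa (cocone_functor E' P Q \<phi>) f"
    using d sq E'.shift_cancel(1)[OF d(3), of 1] by (simp add: cocone_functor_def E.AC_defs(3,4))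
qed

lemma hom1_cocone_pr_in:
  assumes P: "one_arrow E E' P" and Q: "one_arrow E E' Q" and \<phi>: "\<phi> \<in> hom1 E E' P Q"
  shows "(\<lambda>X. E'.cocone_pr_in (\<phi> X)) \<in>
    hom1 E E' Q (cone_functor E' (cocone_functor E' P Q \<phi>) P (\<lambda>X. E'.cocone_pr (\<phi> X)))"
proof (rule hom1I)
  fix f assume f: "f \<in> Ar E.AC"
  note d = E'.cone_squareD(1-8)[OF cone_square_hom1[OF P Q \<phi> f]]
  note w = E'.cocone_pr_simps(3)[OF d(1)] E'.cocone_pr_simps(3)[OF d(2)]
  show "fa (cone_functor E' (cocone_functor E' P Q \<phi>) P (\<lambda>X. E'.cocone_pr (\<phi> X))) f \<cdot>\<^bsub>E'.AC\<^esub>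
    E'.cocone_pr_in (\<phi> (Dom E.AC f)) = E'.cocone_pr_in (\<phi> (Cod E.AC f)) \<cdot>\<^bsub>E'.AC\<^esub> fa Q f"
    unfolding E.AC_defs(3,4)
    by (rule E'.chmap_eqI) (use d w in \<open>simp_all add: E'.chmap_simps cocone_functor_def\<close>)
qed (use hom1D(1-3)[OF \<phi>] in simp_all)

section \<open>Zigzag isomorphisms of 1-arrows\<close>

lemma two_isoD:
  assumes "two_iso E E' F G s" "X \<in> Ob E.AC"
  shows "is_iso E'.AC.S (s X) \<and> Dom E'.AC.S (s X) = fo F X \<and> Cod E'.AC.S (s X) = fo G X"
  using assms
proof (induction rule: two_iso.induct)
  case (two_iso_arrow F G \<tau>)
  then show ?case using hom1D(1-3)[OF two_iso_arrow(3,5)] by (simp add: two_arrow_def)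
next
  case (two_iso_inverse F G s t)
  then have "inverse_arrows E'.AC.S (s X) (t X)" by simp
  then have t: "s X \<in> Ar E'.AC.S" "t X \<in> Ar E'.AC.S" "Dom E'.AC.S (t X) = Cod E'.AC.S (s X)"
    "Cod E'.AC.S (t X) = Dom E'.AC.S (s X)" "t X \<cdot>\<^bsub>E'.AC.S\<^esub> s X = Idt E'.AC.S (Dom E'.AC.S (s X))"
    "s X \<cdot>\<^bsub>E'.AC.S\<^esub> t X = Idt E'.AC.S (Cod E'.AC.S (s X))"
    by (simp_all add: inverse_arrows_def homset_iff)
  then have "is_iso E'.AC.S (t X)" by (intro E'.AC.S.is_isoI[of "t X" "s X"]) simp_all
  then show ?case using two_iso_inverse t by simp
next
  case (two_iso_comp F G s H t)
  then show ?case using E'.AC.S.is_iso_Cmp[of "s X" "t X"] by simp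
qed

text \<open>The conclusion asks only that a zigzag exist, so the stable family itself is forgotten;
  what remains is an equivalence relation between functors.\<close>

definition isomorphic where "isomorphic F G \<longleftrightarrow> (\<exists>s. two_iso E E' F G s)"

lemma isomorphicI:
  assumes "one_arrow E E' F" "one_arrow E E' G" "\<tau> \<in> hom1 E E' F G"
    "\<And>X. X \<in> Ob E.AC \<Longrightarrow> is_iso E'.AC.S (E'.AC.cl (\<tau> X))"
  shows "isomorphic F G"
  unfolding isomorphic_def using two_iso_arrow[OF assms(1-3)] assms(4) by (auto simp: two_arrow_def)

text \<open>Stable inverses are chosen object by object, which is all that the constructor for
  inverses asks for.\<close>

lemma isomorphic_sym: assumes "isomorphic F G" shows "isomorphic G F"
proof -
  obtain s where s: "two_iso E E' F G s" using assms by (auto simp: isomorphic_def)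
  have "\<forall>X. \<exists>g. X \<in> Ob E.AC \<longrightarrow> inverse_arrows E'.AC.S (s X) g"
    using two_isoD[OF s] by (auto simp: is_iso_def)
  then obtain t where "\<And>X. X \<in> Ob E.AC \<Longrightarrow> inverse_arrows E'.AC.S (s X) (t X)" by metis
  then show ?thesis unfolding isomorphic_def using two_iso_inverse[OF s] by blast
qed

lemma isomorphic_trans: "isomorphic F G \<Longrightarrow> isomorphic G H \<Longrightarrow> isomorphic F H"
  unfolding isomorphic_def using two_iso_comp by blast

text \<open>The passage from pointwise to functorial statements: maps of cones of strictly commuting
  natural squares are natural in \<open>X\<close>, so it is enough that the two sides be stably
  invertible at each object, and no natural inverse has to be found.\<close>

lemma isomorphic_cone:
  assumes P: "one_arrow E E' P" and Q: "one_arrow E E' Q" and \<phi>: "\<phi> \<in> hom1 E E' P Q"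
    and P': "one_arrow E E' P'" and Q': "one_arrow E E' Q'" and \<phi>': "\<phi>' \<in> hom1 E E' P' Q'"
    and \<sigma>: "\<sigma> \<in> hom1 E E' P P'" and \<tau>: "\<tau> \<in> hom1 E E' Q Q'"
    and sq: "\<And>X. X \<in> Ob E.AC \<Longrightarrow> \<tau> X \<cdot>\<^bsub>E'.AC\<^esub> \<phi> X = \<phi>' X \<cdot>\<^bsub>E'.AC\<^esub> \<sigma> X"
    and iso: "\<And>X. X \<in> Ob E.AC \<Longrightarrow> is_iso E'.AC.S (E'.AC.cl (\<sigma> X))"
      "\<And>X. X \<in> Ob E.AC \<Longrightarrow> is_iso E'.AC.S (E'.AC.cl (\<tau> X))"
  shows "isomorphic (cone_functor E' P Q \<phi>) (cone_functor E' P' Q' \<phi>')"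
proof (rule isomorphicI)
  have s: "E'.cone_square (\<phi> X) (\<phi>' X) (\<sigma> X) (\<tau> X)" if X: "X \<in> Ob E.AC" for X
    unfolding E'.cone_square_def
    using hom1D(1-3)[OF \<phi> X] hom1D(1-3)[OF \<phi>' X] hom1D(1-3)[OF \<sigma> X] hom1D(1-3)[OF \<tau> X] sq[OF X] by simp
  show "(\<lambda>X. cone_map E' (\<phi> X) (\<phi>' X) (\<sigma> X) (\<tau> X)) \<in> hom1 E E' (cone_functor E' P Q \<phi>) (cone_functor E' P' Q' \<phi>')"
  proof (rule hom1I)
    fix f assume f: "f \<in> Ar E.AC"
    have o: "Dom E.AC f \<in> Ob E.AC" "Cod E.AC f \<in> Ob E.AC" using f by simp_all
    have a: "E'.cone_square (\<phi> (Dom E.AC f)) (\<phi> (Cod E.AC f)) (fa P f) (fa Q f)"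
      and b: "E'.cone_square (\<phi>' (Dom E.AC f)) (\<phi>' (Cod E.AC f)) (fa P' f) (fa Q' f)"
      using cone_square_hom1[OF P Q \<phi> f] cone_square_hom1[OF P' Q' \<phi>' f] by (simp_all add: E.AC_defs(3,4))
    have "cone_map E' (\<phi>' (Dom E.AC f)) (\<phi>' (Cod E.AC f)) (fa P' f) (fa Q' f) \<cdot>\<^bsub>E'.AC\<^esub>
        cone_map E' (\<phi> (Dom E.AC f)) (\<phi>' (Dom E.AC f)) (\<sigma> (Dom E.AC f)) (\<tau> (Dom E.AC f)) =
      cone_map E' (\<phi> (Cod E.AC f)) (\<phi>' (Cod E.AC f)) (\<sigma> (Cod E.AC f)) (\<tau> (Cod E.AC f)) \<cdot>\<^bsub>E'.AC\<^esub>
        cone_map E' (\<phi> (Dom E.AC f)) (\<phi> (Cod E.AC f)) (fa P f) (fa Q f)"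
      unfolding E'.cone_map_Cmp[OF s[OF o(1)] b] E'.cone_map_Cmp[OF a s[OF o(2)]]
        hom1D(4)[OF \<sigma> f] hom1D(4)[OF \<tau> f] ..
    then show "fa (cone_functor E' P' Q' \<phi>') f \<cdot>\<^bsub>E'.AC\<^esub>
        cone_map E' (\<phi> (Dom E.AC f)) (\<phi>' (Dom E.AC f)) (\<sigma> (Dom E.AC f)) (\<tau> (Dom E.AC f)) =
      cone_map E' (\<phi> (Cod E.AC f)) (\<phi>' (Cod E.AC f)) (\<sigma> (Cod E.AC f)) (\<tau> (Cod E.AC f)) \<cdot>\<^bsub>E'.AC\<^esub>
        fa (cone_functor E' P Q \<phi>) f"
      by (simp add: E.AC_defs(3,4))
  qed (simp_all add: s)
  show "is_iso E'.AC.S (E'.AC.cl (cone_map E' (\<phi> X) (\<phi>' X) (\<sigma> X) (\<tau> X)))" if "X \<in> Ob E.AC" for X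
    by (rule E'.cone_map_iso[OF s iso]) (rule that)+
qed (rule cone_functor_one_arrow P Q \<phi> P' Q' \<phi>')+

end

section \<open>Whiskering, and naturality with respect to stable arrows\<close>

lemma hom1_whisker_right:
  assumes "frobenius_pair E E'" "frobenius_pair E' E''"
    and K: "one_arrow E E' K" and \<tau>: "\<tau> \<in> hom1 E' E'' F G"
  shows "(\<lambda>X. \<tau> (fo K X)) \<in> hom1 E E'' (F \<circ>\<^sub>F K) (G \<circ>\<^sub>F K)"
proof -
  interpret a: frobenius_pair E E' by fact
  interpret b: frobenius_pair E' E'' by fact
  interpret c: frobenius_pair E E'' ..
  note k = a.one_arrowD[OF K] and t = b.hom1D[OF \<tau>]
  show ?thesis
  proof (rule c.hom1I)
    fix f assume f: "f \<in> Ar (Acyc E)"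
    show "fa (G \<circ>\<^sub>F K) f \<cdot>\<^bsub>Acyc E''\<^esub> \<tau> (fo K (Dom (Acyc E) f)) = \<tau> (fo K (Cod (Acyc E) f)) \<cdot>\<^bsub>Acyc E''\<^esub> fa (F \<circ>\<^sub>F K) f"
      using t(4)[OF k(3)[OF f]] unfolding k(4,5)[OF f] by simp
  qed (simp_all add: k t)
qed

lemma hom1_whisker_left:
  assumes "frobenius_pair E E'" "frobenius_pair E' E''"
    and K: "one_arrow E' E'' K" and F: "one_arrow E E' F" and G: "one_arrow E E' G"
    and \<tau>: "\<tau> \<in> hom1 E E' F G"
  shows "(\<lambda>X. fa K (\<tau> X)) \<in> hom1 E E'' (K \<circ>\<^sub>F F) (K \<circ>\<^sub>F G)"
proof -
  interpret a: frobenius_pair E E' by fact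
  interpret b: frobenius_pair E' E'' by fact
  interpret c: frobenius_pair E E'' ..
  note k = b.one_arrowD[OF K] and t = a.hom1D[OF \<tau>] and f = a.one_arrowD[OF F] and g = a.one_arrowD[OF G]
  show ?thesis
  proof (rule c.hom1I)
    fix h assume h: "h \<in> Ar (Acyc E)"
    have o: "Dom (Acyc E) h \<in> Ob (Acyc E)" "Cod (Acyc E) h \<in> Ob (Acyc E)" using h by simp_all
    have "fa K (fa G h \<cdot>\<^bsub>Acyc E'\<^esub> \<tau> (Dom (Acyc E) h)) = fa K (\<tau> (Cod (Acyc E) h) \<cdot>\<^bsub>Acyc E'\<^esub> fa F h)"
      by (simp only: t(4)[OF h])
    then show "fa (K \<circ>\<^sub>F G) h \<cdot>\<^bsub>Acyc E''\<^esub> fa K (\<tau> (Dom (Acyc E) h)) = fa K (\<tau> (Cod (Acyc E) h)) \<cdot>\<^bsub>Acyc E''\<^esub> fa (K \<circ>\<^sub>F F) h"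
      using k(6)[of "\<tau> (Dom (Acyc E) h)" "fa G h"] k(6)[of "fa F h" "\<tau> (Cod (Acyc E) h)"]
        t(1-3)[OF o(1)] t(1-3)[OF o(2)] f(3-5)[OF h] g(3-5)[OF h] by simp
  qed (simp_all add: k t)
qed

lemma idf_comp [simp]: "idf \<circ>\<^sub>F K = K" "K \<circ>\<^sub>F idf = K"
  by (simp_all add: compf_def idf_def)

context frobenius_pair
begin

text \<open>Even for the identity functor, \<open>bar\<close> passes to a chosen representative and
  back to its class, so it fixes actual stable classes.\<close>

lemma bar_idf: "c \<in> Ar E.AC.S \<Longrightarrow> fa (bar E.AC idf) c = c"
proof -
  assume c: "c \<in> Ar E.AC.S"
  interpret EE: frobenius_pair E E ..
  interpret i: stable_functor E.AC E.AC idf using one_arrow_idf[of E] by (simp add: EE.one_arrow_iff)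
  show ?thesis using c by (auto elim!: E.AC.S_Ar_E simp: i.bar_cl)
qed

text \<open>Gives naturality at arrows known only stably, such as the components of
  \<open>\<alpha>\<close>: a representative is chosen and genuine naturality is applied to
  it.\<close>

lemma hom1_stable:
  assumes P: "one_arrow E E' P" and Q: "one_arrow E E' Q" and \<tau>: "\<tau> \<in> hom1 E E' P Q"
    and c: "c \<in> Ar E.AC.S" "Dom E.AC.S c = x" "Cod E.AC.S c = y"
  shows "fa (bar E'.AC Q) c \<cdot>\<^bsub>E'.AC.S\<^esub> E'.AC.cl (\<tau> x) = E'.AC.cl (\<tau> y) \<cdot>\<^bsub>E'.AC.S\<^esub> fa (bar E'.AC P) c"
proof -
  interpret P: stable_functor E.AC E'.AC P using P by (simp add: one_arrow_iff)
  interpret Q: stable_functor E.AC E'.AC Q using Q by (simp add: one_arrow_iff)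
  obtain f where f: "f \<in> Ar E.AC" "c = E.AC.cl f" using E.AC.S_Ar_E[OF c(1)] .
  have d: "Dom E.AC f = x" "Cod E.AC f = y" using c(2,3) f by simp_all
  have o: "x \<in> Ob E.AC" "y \<in> Ob E.AC" using d f by auto
  note t = hom1D(1-3)[OF \<tau> o(1)] hom1D(1-3)[OF \<tau> o(2)]
  show ?thesis
    using hom1D(4)[OF \<tau> f(1)] f t by (simp add: P.bar_cl Q.bar_cl E'.AC.cl_Cmp d)
qed

text \<open>The zigzag is whiskered piece by piece: it is generated by genuine transformations, and
  \<open>K\<close> can be applied to each of these.\<close>

lemma isomorphic_whisker:
  assumes K: "one_arrow E' E' K" and FG: "isomorphic F G"
  shows "isomorphic (K \<circ>\<^sub>F F) (K \<circ>\<^sub>F G)"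
proof -
  obtain s where "two_iso E E' F G s" using FG by (auto simp: isomorphic_def)
  then show ?thesis
  proof (induction rule: two_iso.induct)
    case (two_iso_arrow F G \<tau>)
    have EE': "frobenius_pair E E'" and E'E': "frobenius_pair E' E'" by unfold_locales
    interpret E'E': frobenius_pair E' E' by fact
    interpret K: stable_functor E'.AC E'.AC K using K by (simp add: E'E'.one_arrow_iff)
    show ?case
    proof (rule isomorphicI)
      show "one_arrow E E' (K \<circ>\<^sub>F F)" "one_arrow E E' (K \<circ>\<^sub>F G)"
        using two_iso_arrow(1,2) K by (auto intro: one_arrow_comp)
      show "(\<lambda>X. fa K (\<tau> X)) \<in> hom1 E E' (K \<circ>\<^sub>F F) (K \<circ>\<^sub>F G)"
        by (rule hom1_whisker_left[OF EE' E'E' K two_iso_arrow(1-3)])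
      show "is_iso E'.AC.S (E'.AC.cl (fa K (\<tau> X)))" if X: "X \<in> Ob E.AC" for X
        using K.bar.fa_is_iso[OF two_iso_arrow(4)[OF X]] hom1D(1)[OF two_iso_arrow(3) X]
        by (simp add: two_arrow_def K.bar_cl)
    qed
  next
    case (two_iso_inverse F G s t)
    show ?case by (rule isomorphic_sym[OF two_iso_inverse.IH])
  next
    case (two_iso_comp F G s H t)
    show ?case by (rule isomorphic_trans[OF two_iso_comp.IH])
  qed
qed

end

section \<open>The two adjoint pairs\<close>

text \<open>\<open>\<Psi>\<close> stands for the inverse of \<open>\<Phi>\<close>. The isomorphism
  \<open>\<alpha>\<close> from the identity to \<open>\<Phi> \<Psi>\<close> turns
  \<open>\<epsilon> \<Psi>\<close>, which starts at \<open>G F \<Phi> \<Psi>\<close>, into a map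
  from \<open>G F\<close> to \<open>\<Psi>\<close>.\<close>

locale split_adjunctions = C: frobenius_complexes C + D: frobenius_complexes D
  for C :: "('o, 'm) excat" and D :: "('p, 'n) excat" +
  fixes F :: "('o, 'm, 'p, 'n) arrow1" and G :: "('p, 'n, 'o, 'm) arrow1"
    and \<Phi> \<Psi> :: "('o, 'm, 'o, 'm) arrow1" and \<alpha> \<eta> \<epsilon> \<eta>' \<epsilon>'
  assumes F: "one_arrow C D F" and G: "one_arrow D C G"
    and equiv: "inverse_self_equivalences C \<Phi> \<Psi>"
    and \<alpha>: "two_iso C C idf (\<Phi> \<circ>\<^sub>F \<Psi>) \<alpha>"
    and adj: "adjoint_pair D C G (F \<circ>\<^sub>F \<Phi>) \<eta> \<epsilon>"
    and adj': "adjoint_pair C D F G \<eta>' \<epsilon>'"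
    and triangle: "dist_triangle_functors C C idf (G \<circ>\<^sub>F F) \<Psi>
           (two_arrow C \<eta>')
           (\<lambda>X. Cmp (stable (Acyc C)) (two_arrow C \<epsilon> (fo \<Psi> X)) (fa (bar (Acyc C) (G \<circ>\<^sub>F F)) (\<alpha> X)))
           (\<lambda>X. Zer (stable (Acyc C)) (fo \<Psi> X) (fo (shift C 1) X))"
begin

sublocale CC: frobenius_pair C C ..
sublocale CD: frobenius_pair C D ..
sublocale DC: frobenius_pair D C ..
sublocale DD: frobenius_pair D D ..

abbreviation "H \<equiv> F \<circ>\<^sub>F \<Phi> \<circ>\<^sub>F G"
abbreviation "\<Upsilon> \<equiv> cocone_functor D (F \<circ>\<^sub>F G) idf \<epsilon>'"
abbreviation "\<Upsilon>' \<equiv> cone_functor D idf H \<eta>"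

lemma \<Phi>: "one_arrow C C \<Phi>" and \<Psi>: "one_arrow C C \<Psi>"
  using equiv by (simp_all add: inverse_self_equivalences_def)

lemmas arrows = F G \<Phi> \<Psi> one_arrow_comp[OF G F] one_arrow_comp[OF F G] one_arrow_comp[OF \<Phi> F]
  one_arrow_comp[OF one_arrow_comp[OF \<Phi> F] G] one_arrow_comp[OF G one_arrow_comp[OF \<Phi> F], unfolded compf_assoc]

sublocale F: stable_functor "Acyc C" "Acyc D" F using F by (simp add: CD.one_arrow_iff)
sublocale G: stable_functor "Acyc D" "Acyc C" G using G by (simp add: DC.one_arrow_iff)
sublocale \<Phi>: stable_functor "Acyc C" "Acyc C" \<Phi> using \<Phi> by (simp add: CC.one_arrow_iff)
sublocale \<Psi>: stable_functor "Acyc C" "Acyc C" \<Psi> using \<Psi> by (simp add: CC.one_arrow_iff)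

section \<open>Induced functors and the adjunctions on stable arrows\<close>

abbreviation "Fb \<equiv> fa (bar (Acyc D) F)"
abbreviation "Gb \<equiv> fa (bar (Acyc C) G)"
abbreviation "\<Phi>b \<equiv> fa (bar (Acyc C) \<Phi>)"

text \<open>\<open>bar\<close> of a composite chooses one representative, while the iterated
  \<open>bar\<close> chooses one at each stage; on stable classes the results agree.\<close>

lemma bar_comp:
  "c \<in> Ar C.AC.S \<Longrightarrow> fa (bar (Acyc C) (G \<circ>\<^sub>F F)) c = Gb (Fb c)"
  "c \<in> Ar C.AC.S \<Longrightarrow> fa (bar (Acyc C) (G \<circ>\<^sub>F F \<circ>\<^sub>F \<Phi>)) c = Gb (Fb (\<Phi>b c))"
  "d \<in> Ar D.AC.S \<Longrightarrow> fa (bar (Acyc D) H) d = Fb (\<Phi>b (Gb d))"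
proof -
  interpret GF: stable_functor C.AC C.AC "G \<circ>\<^sub>F F" using arrows by (simp add: CC.one_arrow_iff)
  interpret GFP: stable_functor C.AC C.AC "G \<circ>\<^sub>F F \<circ>\<^sub>F \<Phi>" using arrows by (simp add: CC.one_arrow_iff)
  interpret H: stable_functor D.AC D.AC H using arrows by (simp add: DD.one_arrow_iff)
  show "c \<in> Ar C.AC.S \<Longrightarrow> fa (bar (Acyc C) (G \<circ>\<^sub>F F)) c = Gb (Fb c)"
    "c \<in> Ar C.AC.S \<Longrightarrow> fa (bar (Acyc C) (G \<circ>\<^sub>F F \<circ>\<^sub>F \<Phi>)) c = Gb (Fb (\<Phi>b c))"
    "d \<in> Ar D.AC.S \<Longrightarrow> fa (bar (Acyc D) H) d = Fb (\<Phi>b (Gb d))"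
    by (auto elim!: C.AC.S_Ar_E D.AC.S_Ar_E
        simp: GF.bar_cl GFP.bar_cl H.bar_cl F.bar_cl G.bar_cl \<Phi>.bar_cl)
qed

lemma \<eta>: "\<eta> \<in> hom1 D D idf H" and \<epsilon>: "\<epsilon> \<in> hom1 C C (G \<circ>\<^sub>F F \<circ>\<^sub>F \<Phi>) idf"
  and \<eta>': "\<eta>' \<in> hom1 C C idf (G \<circ>\<^sub>F F)" and \<epsilon>': "\<epsilon>' \<in> hom1 D D (F \<circ>\<^sub>F G) idf"
  using adj adj' by (simp_all add: adjoint_pair_def compf_assoc)

lemma unit_simps [simp]:
  "Y \<in> Ob D.AC \<Longrightarrow> \<eta> Y \<in> Ar D.AC" "Y \<in> Ob D.AC \<Longrightarrow> Dom D.AC (\<eta> Y) = Y"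
  "Y \<in> Ob D.AC \<Longrightarrow> Cod D.AC (\<eta> Y) = fo F (fo \<Phi> (fo G Y))"
  "X \<in> Ob C.AC \<Longrightarrow> \<epsilon> X \<in> Ar C.AC" "X \<in> Ob C.AC \<Longrightarrow> Dom C.AC (\<epsilon> X) = fo G (fo F (fo \<Phi> X))"
  "X \<in> Ob C.AC \<Longrightarrow> Cod C.AC (\<epsilon> X) = X"
  "X \<in> Ob C.AC \<Longrightarrow> \<eta>' X \<in> Ar C.AC" "X \<in> Ob C.AC \<Longrightarrow> Dom C.AC (\<eta>' X) = X"
  "X \<in> Ob C.AC \<Longrightarrow> Cod C.AC (\<eta>' X) = fo G (fo F X)"
  "Y \<in> Ob D.AC \<Longrightarrow> \<epsilon>' Y \<in> Ar D.AC" "Y \<in> Ob D.AC \<Longrightarrow> Dom D.AC (\<epsilon>' Y) = fo F (fo G Y)"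
  "Y \<in> Ob D.AC \<Longrightarrow> Cod D.AC (\<epsilon>' Y) = Y"
  using DD.hom1D(1-3)[OF \<eta>] CC.hom1D(1-3)[OF \<epsilon>] CC.hom1D(1-3)[OF \<eta>'] DD.hom1D(1-3)[OF \<epsilon>'] by simp_all

lemma triangle_identities:
  "Y \<in> Ob D.AC \<Longrightarrow> C.AC.cl (\<epsilon> (fo G Y)) \<cdot>\<^bsub>C.AC.S\<^esub> Gb (D.AC.cl (\<eta> Y)) = Idt C.AC.S (fo G Y)"
  "X \<in> Ob C.AC \<Longrightarrow> Fb (\<Phi>b (C.AC.cl (\<epsilon> X))) \<cdot>\<^bsub>D.AC.S\<^esub> D.AC.cl (\<eta> (fo F (fo \<Phi> X))) = Idt D.AC.S (fo F (fo \<Phi> X))"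
  "X \<in> Ob C.AC \<Longrightarrow> D.AC.cl (\<epsilon>' (fo F X)) \<cdot>\<^bsub>D.AC.S\<^esub> Fb (C.AC.cl (\<eta>' X)) = Idt D.AC.S (fo F X)"
  "Y \<in> Ob D.AC \<Longrightarrow> Gb (D.AC.cl (\<epsilon>' Y)) \<cdot>\<^bsub>C.AC.S\<^esub> C.AC.cl (\<eta>' (fo G Y)) = Idt C.AC.S (fo G Y)"
proof -
  have 1: "two_eq D C (\<lambda>X. \<epsilon> (fo G X) \<cdot>\<^bsub>C.AC\<^esub> fa G (\<eta> X)) (\<lambda>X. Idt C.AC (fo G X))"
    and 2: "two_eq C D (\<lambda>X. fa F (fa \<Phi> (\<epsilon> X)) \<cdot>\<^bsub>D.AC\<^esub> \<eta> (fo F (fo \<Phi> X))) (\<lambda>X. Idt D.AC (fo F (fo \<Phi> X)))"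
    and 3: "two_eq C D (\<lambda>X. \<epsilon>' (fo F X) \<cdot>\<^bsub>D.AC\<^esub> fa F (\<eta>' X)) (\<lambda>X. Idt D.AC (fo F X))"
    and 4: "two_eq D C (\<lambda>Y. fa G (\<epsilon>' Y) \<cdot>\<^bsub>C.AC\<^esub> \<eta>' (fo G Y)) (\<lambda>Y. Idt C.AC (fo G Y))"
    using adj adj' by (simp_all add: adjoint_pair_def)
  show "Y \<in> Ob D.AC \<Longrightarrow> C.AC.cl (\<epsilon> (fo G Y)) \<cdot>\<^bsub>C.AC.S\<^esub> Gb (D.AC.cl (\<eta> Y)) = Idt C.AC.S (fo G Y)"
    using 1 by (simp add: two_eq_def two_arrow_def G.bar_cl C.AC.cl_Cmp C.AC.cl_Idt)
  show "X \<in> Ob C.AC \<Longrightarrow> Fb (\<Phi>b (C.AC.cl (\<epsilon> X))) \<cdot>\<^bsub>D.AC.S\<^esub> D.AC.cl (\<eta> (fo F (fo \<Phi> X))) = Idt D.AC.S (fo F (fo \<Phi> X))"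
    using 2 by (simp add: two_eq_def two_arrow_def F.bar_cl \<Phi>.bar_cl D.AC.cl_Cmp D.AC.cl_Idt)
  show "X \<in> Ob C.AC \<Longrightarrow> D.AC.cl (\<epsilon>' (fo F X)) \<cdot>\<^bsub>D.AC.S\<^esub> Fb (C.AC.cl (\<eta>' X)) = Idt D.AC.S (fo F X)"
    using 3 by (simp add: two_eq_def two_arrow_def F.bar_cl D.AC.cl_Cmp D.AC.cl_Idt)
  show "Y \<in> Ob D.AC \<Longrightarrow> Gb (D.AC.cl (\<epsilon>' Y)) \<cdot>\<^bsub>C.AC.S\<^esub> C.AC.cl (\<eta>' (fo G Y)) = Idt C.AC.S (fo G Y)"
    using 4 by (simp add: two_eq_def two_arrow_def G.bar_cl C.AC.cl_Cmp C.AC.cl_Idt)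
qed

lemma \<alpha>_simps:
  assumes "X \<in> Ob C.AC"
  shows "is_iso C.AC.S (\<alpha> X)" "\<alpha> X \<in> Ar C.AC.S" "Dom C.AC.S (\<alpha> X) = X" "Cod C.AC.S (\<alpha> X) = fo \<Phi> (fo \<Psi> X)"
  using CC.two_isoD[OF \<alpha> assms] by simp_all

lemma \<eta>'_natural:
  assumes "c \<in> Ar C.AC.S" "Dom C.AC.S c = x" "Cod C.AC.S c = y"
  shows "Gb (Fb c) \<cdot>\<^bsub>C.AC.S\<^esub> C.AC.cl (\<eta>' x) = C.AC.cl (\<eta>' y) \<cdot>\<^bsub>C.AC.S\<^esub> c"
  using CC.hom1_stable[OF one_arrow_idf arrows(6) \<eta>' assms] assms(1) by (simp add: bar_comp CC.bar_idf)

lemma \<epsilon>_natural: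
  assumes "c \<in> Ar C.AC.S" "Dom C.AC.S c = x" "Cod C.AC.S c = y"
  shows "c \<cdot>\<^bsub>C.AC.S\<^esub> C.AC.cl (\<epsilon> x) = C.AC.cl (\<epsilon> y) \<cdot>\<^bsub>C.AC.S\<^esub> Gb (Fb (\<Phi>b c))"
proof -
  have "one_arrow C C (G \<circ>\<^sub>F F \<circ>\<^sub>F \<Phi>)" by (rule one_arrow_comp[OF one_arrow_comp[OF \<Phi> F] G])
  from CC.hom1_stable[OF this one_arrow_idf \<epsilon> assms] show ?thesis
    using assms(1) by (simp add: bar_comp CC.bar_idf)
qed

lemma H_arrow: "one_arrow D D H"
  by (rule one_arrow_comp[OF one_arrow_comp[OF G \<Phi>] F])

lemma \<eta>_natural:
  assumes "d \<in> Ar D.AC.S" "Dom D.AC.S d = x" "Cod D.AC.S d = y"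
  shows "Fb (\<Phi>b (Gb d)) \<cdot>\<^bsub>D.AC.S\<^esub> D.AC.cl (\<eta> x) = D.AC.cl (\<eta> y) \<cdot>\<^bsub>D.AC.S\<^esub> d"
  using DD.hom1_stable[OF one_arrow_idf H_arrow \<eta> assms] assms(1) by (simp add: bar_comp DD.bar_idf)

text \<open>The second map \<open>X -> G F X -> G F \<Phi> \<Psi> X -> \<Psi> X\<close> of the
  assumed triangle. Since it involves \<open>\<alpha>\<close>, it is handled as a stable arrow at
  each object, not as a transformation of complexes.\<close>

definition \<gamma> where
  "\<gamma> X = C.AC.cl (\<epsilon> (fo \<Psi> X)) \<cdot>\<^bsub>C.AC.S\<^esub> Gb (Fb (\<alpha> X))"

lemma split_\<gamma>:
  assumes X: "X \<in> Ob C.AC" shows "C.AC.S.split_exact (C.AC.cl (\<eta>' X)) (\<gamma> X)"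
proof -
  have "dist_triangle C (C.AC.cl (\<eta>' X)) (\<gamma> X) (Zer C.AC.S (fo \<Psi> X) (shift_cpx C 1 X))"
    unfolding \<gamma>_def bar_comp(1)[OF \<alpha>_simps(2)[OF X], symmetric]
    using triangle X by (simp add: dist_triangle_functors_def two_arrow_def Let_def)
  then show ?thesis
    by (rule C.split_exact_dist_triangle) (use X \<alpha>_simps[OF X] in \<open>simp_all add: \<gamma>_def\<close>)
qed

text \<open>The triangle on \<open>X\<close> is carried by \<open>\<alpha> X\<close> to \<open>\<Phi> V \<rightarrow> G F \<Phi> V \<rightarrow> V\<close> for \<open>V = \<Psi> X\<close>, and every
  \<open>V\<close> is stably isomorphic to one of this form.  No compatibility of \<open>\<alpha>\<close> with the
  isomorphism \<open>\<Psi> \<Phi> \<rightarrow> 1\<close> is needed, since the counit is natural.\<close>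

lemma split_\<epsilon>:
  assumes V: "V \<in> Ob C.AC" shows "C.AC.S.split_exact (C.AC.cl (\<eta>' (fo \<Phi> V))) (C.AC.cl (\<epsilon> V))"
proof -
  have 1: "C.AC.S.split_exact (C.AC.cl (\<eta>' (fo \<Phi> (fo \<Psi> X)))) (C.AC.cl (\<epsilon> (fo \<Psi> X)))"
    if X: "X \<in> Ob C.AC" for X
  proof -
    note a = \<alpha>_simps[OF X]
    show ?thesis
    proof (rule C.AC.S.split_exact_iso[OF split_\<gamma>[OF X] a(1), of "Gb (Fb (\<alpha> X))" "Idt C.AC.S (fo \<Psi> X)"])
      show "is_iso C.AC.S (Gb (Fb (\<alpha> X)))" by (rule G.bar.fa_is_iso[OF F.bar.fa_is_iso[OF a(1)]])
      show "Gb (Fb (\<alpha> X)) \<cdot>\<^bsub>C.AC.S\<^esub> C.AC.cl (\<eta>' X) = C.AC.cl (\<eta>' (fo \<Phi> (fo \<Psi> X))) \<cdot>\<^bsub>C.AC.S\<^esub> \<alpha> X"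
        by (rule \<eta>'_natural[OF a(2-4)])
    qed (use X a in \<open>simp_all add: \<gamma>_def\<close>)
  qed
  obtain t where t: "two_iso C C (\<Psi> \<circ>\<^sub>F \<Phi>) idf t" using equiv by (auto simp: inverse_self_equivalences_def)
  have c: "is_iso C.AC.S (t V)" "t V \<in> Ar C.AC.S" "Dom C.AC.S (t V) = fo \<Psi> (fo \<Phi> V)" "Cod C.AC.S (t V) = V"
    using CC.two_isoD[OF t V] by simp_all
  have p: "\<Phi>b (t V) \<in> Ar C.AC.S" "Dom C.AC.S (\<Phi>b (t V)) = fo \<Phi> (fo \<Psi> (fo \<Phi> V))" "Cod C.AC.S (\<Phi>b (t V)) = fo \<Phi> V"
    "is_iso C.AC.S (\<Phi>b (t V))"
    using c \<Phi>.bar.fa_is_iso[OF c(1)] by simp_all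
  show ?thesis
  proof (rule C.AC.S.split_exact_iso[OF 1, of "fo \<Phi> V" "\<Phi>b (t V)" "Gb (Fb (\<Phi>b (t V)))" "t V"])
    show "is_iso C.AC.S (Gb (Fb (\<Phi>b (t V))))" by (rule G.bar.fa_is_iso[OF F.bar.fa_is_iso[OF p(4)]])
    show "Gb (Fb (\<Phi>b (t V))) \<cdot>\<^bsub>C.AC.S\<^esub> C.AC.cl (\<eta>' (fo \<Phi> (fo \<Psi> (fo \<Phi> V)))) = C.AC.cl (\<eta>' (fo \<Phi> V)) \<cdot>\<^bsub>C.AC.S\<^esub> \<Phi>b (t V)"
      by (rule \<eta>'_natural[OF p(1-3)])
    show "t V \<cdot>\<^bsub>C.AC.S\<^esub> C.AC.cl (\<epsilon> (fo \<Psi> (fo \<Phi> V))) = C.AC.cl (\<epsilon> V) \<cdot>\<^bsub>C.AC.S\<^esub> Gb (Fb (\<Phi>b (t V)))"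
      by (rule \<epsilon>_natural[OF c(2-4)])
  qed (use V c p in simp_all)
qed

lemma \<Upsilon>_arrow: "one_arrow D D \<Upsilon>"
  unfolding cocone_functor_def
  by (rule one_arrow_comp[OF DD.cone_functor_one_arrow[OF one_arrow_comp[OF G F] one_arrow_idf \<epsilon>'] D.one_arrow_shift])

lemma \<Upsilon>'_arrow: "one_arrow D D \<Upsilon>'"
  by (rule DD.cone_functor_one_arrow[OF one_arrow_idf H_arrow \<eta>])

subsection \<open>\<open>\<Upsilon> \<Upsilon>'\<close>\<close>

definition \<theta> where "\<theta> Y = fa G (cone_in D (\<eta> Y)) \<cdot>\<^bsub>C.AC\<^esub> \<eta>' (fo \<Phi> (fo G Y))"

text \<open>One side of a triangle identity for \<open>(F, G)\<close> at \<open>\<Phi> G Y\<close>,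
  kept as a genuine map because it takes part in a strictly commuting square.\<close>

definition u where
  "u Y = \<epsilon>' (fo F (fo \<Phi> (fo G Y))) \<cdot>\<^bsub>D.AC\<^esub> fa F (\<eta>' (fo \<Phi> (fo G Y)))"

text \<open>By a triangle identity \<open>\<epsilon> G\<close> retracts \<open>G \<eta>\<close>, so
  \<open>G\<close> carries the cone inclusion of \<open>\<eta>\<close> to a cokernel of a split
  monomorphism. By \<open>split_\<epsilon>\<close> the kernel of this retraction is
  \<open>\<eta>' \<Phi> G\<close>, and the kernel of a retraction maps isomorphically onto the
  cokernel.\<close>

lemma \<theta>_iso:
  assumes Y: "Y \<in> Ob D.AC" shows "is_iso C.AC.S (C.AC.cl (\<theta> Y))"
proof -
  let ?m = "Gb (D.AC.cl (\<eta> Y))" and ?q = "Gb (D.AC.cl (cone_in D (\<eta> Y)))" and ?e = "C.AC.cl (\<epsilon> (fo G Y))"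
  let ?B = "fo G (fo F (fo \<Phi> (fo G Y)))"
  have m: "?m \<in> Ar C.AC.S" "Dom C.AC.S ?m = fo G Y" "Cod C.AC.S ?m = ?B"
    and q: "?q \<in> Ar C.AC.S" "Dom C.AC.S ?q = ?B" "Cod C.AC.S ?q = fo G (cone_cpx D (\<eta> Y))"
    and e: "?e \<in> Ar C.AC.S" "Dom C.AC.S ?e = ?B" "Cod C.AC.S ?e = fo G Y"
    using Y by simp_all
  have sx: "C.AC.stably_exact ?m ?q"
    by (rule G.bar_stably_exact[OF D.stably_exact_map_in]) (use Y in simp)
  obtain t where t: "t \<in> Ar C.AC.S" "Dom C.AC.S t = Cod C.AC.S ?q" "Cod C.AC.S t = Cod C.AC.S ?m"
    "?q \<cdot>\<^bsub>C.AC.S\<^esub> t = Idt C.AC.S (Cod C.AC.S ?q)"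
    "t \<cdot>\<^bsub>C.AC.S\<^esub> ?q = Idt C.AC.S (Cod C.AC.S ?m) \<oplus>\<^bsub>C.AC.S\<^esub> \<ominus>\<^bsub>C.AC.S\<^esub> (?m \<cdot>\<^bsub>C.AC.S\<^esub> ?e)"
    by (rule C.AC.stably_exact_split_mono[OF sx e(1)])
      (simp_all only: m q e triangle_identities(1)[OF Y])
  have "is_iso C.AC.S (?q \<cdot>\<^bsub>C.AC.S\<^esub> C.AC.cl (\<eta>' (fo \<Phi> (fo G Y))))"
    by (rule C.AC.S.cokernel_kernel_iso[OF split_\<epsilon> refl e(2,3) m triangle_identities(1)[OF Y] q t(1)
          t(2)[unfolded q] t(3)[unfolded m] t(4)[unfolded q] t(5)[unfolded m]])
      (use Y in simp)
  then show ?thesis using Y by (simp add: \<theta>_def G.bar_cl C.AC.cl_Cmp)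
qed

lemma u_iso:
  assumes Y: "Y \<in> Ob D.AC" shows "is_iso D.AC.S (D.AC.cl (u Y))"
proof -
  have "D.AC.cl (u Y) = Idt D.AC.S (fo F (fo \<Phi> (fo G Y)))"
    using triangle_identities(3)[of "fo \<Phi> (fo G Y)"] Y by (simp add: u_def F.bar_cl D.AC.cl_Cmp)
  then show ?thesis using Y by simp
qed

lemma pairs: "frobenius_pair C C" "frobenius_pair C D" "frobenius_pair D C" "frobenius_pair D D"
  by unfold_locales

lemma \<Upsilon>_\<Upsilon>': "DD.isomorphic (\<Upsilon> \<circ>\<^sub>F \<Upsilon>') idf"
proof -
  let ?FG = "F \<circ>\<^sub>F G" and ?in = "\<lambda>Y. cone_in D (\<eta> Y)"
  let ?\<phi> = "\<lambda>Y. ?in Y \<cdot>\<^bsub>D.AC\<^esub> u Y" and ?\<epsilon> = "\<lambda>Y. \<epsilon>' (fo \<Upsilon>' Y)"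
  have a: "one_arrow D D (?FG \<circ>\<^sub>F \<Upsilon>')" by (rule one_arrow_comp[OF \<Upsilon>'_arrow one_arrow_comp[OF G F]])
  have GU: "one_arrow D C (G \<circ>\<^sub>F \<Upsilon>')" by (rule one_arrow_comp[OF \<Upsilon>'_arrow G])
  have PG: "one_arrow D C (\<Phi> \<circ>\<^sub>F G)" by (rule one_arrow_comp[OF G \<Phi>])
  have GH: "one_arrow D C (G \<circ>\<^sub>F H)" by (rule one_arrow_comp[OF H_arrow G])
  have FGH: "one_arrow D D (?FG \<circ>\<^sub>F H)" by (rule one_arrow_comp[OF H_arrow one_arrow_comp[OF G F]])
  have inn: "?in \<in> hom1 D D H \<Upsilon>'" by (rule DD.hom1_cone_in[OF one_arrow_idf H_arrow \<eta>])
  have \<eta>'PG: "(\<lambda>Y. \<eta>' (fo (\<Phi> \<circ>\<^sub>F G) Y)) \<in> hom1 D C (\<Phi> \<circ>\<^sub>F G) (G \<circ>\<^sub>F H)"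
    using hom1_whisker_right[OF pairs(3,1) PG \<eta>'] by (simp add: compf_assoc)
  have "(\<lambda>Y. fa G (?in Y)) \<in> hom1 D C (G \<circ>\<^sub>F H) (G \<circ>\<^sub>F \<Upsilon>')"
    by (rule hom1_whisker_left[OF pairs(4,3) G H_arrow \<Upsilon>'_arrow inn])
  from DC.hom1_Cmp[OF \<eta>'PG this PG GH GU]
  have \<theta>: "\<theta> \<in> hom1 D C (\<Phi> \<circ>\<^sub>F G) (G \<circ>\<^sub>F \<Upsilon>')"
    unfolding \<theta>_def by simp
  have F\<theta>: "(\<lambda>Y. fa F (\<theta> Y)) \<in> hom1 D D H (?FG \<circ>\<^sub>F \<Upsilon>')"
    using hom1_whisker_left[OF pairs(3,2) F PG GU \<theta>] by (simp add: compf_assoc)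
  have 1: "(\<lambda>Y. fa F (\<eta>' (fo (\<Phi> \<circ>\<^sub>F G) Y))) \<in> hom1 D D H (?FG \<circ>\<^sub>F H)"
    using hom1_whisker_left[OF pairs(3,2) F PG GH \<eta>'PG] by (simp add: compf_assoc)
  have 2: "(\<lambda>Y. \<epsilon>' (fo H Y)) \<in> hom1 D D (?FG \<circ>\<^sub>F H) H"
    using hom1_whisker_right[OF pairs(4,4) H_arrow \<epsilon>'] by simp
  have u: "u \<in> hom1 D D H H"
    using DD.hom1_Cmp[OF 1 2 H_arrow FGH H_arrow] unfolding u_def by simp
  have \<phi>: "?\<phi> \<in> hom1 D D H \<Upsilon>'" by (rule DD.hom1_Cmp[OF u inn H_arrow H_arrow \<Upsilon>'_arrow])
  have \<epsilon>U: "?\<epsilon> \<in> hom1 D D (?FG \<circ>\<^sub>F \<Upsilon>') \<Upsilon>'"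
    using hom1_whisker_right[OF pairs(4,4) \<Upsilon>'_arrow \<epsilon>'] by simp
  have idU: "(\<lambda>Y. Idt D.AC (fo \<Upsilon>' Y)) \<in> hom1 D D \<Upsilon>' \<Upsilon>'" by (rule DD.hom1_Idt[OF \<Upsilon>'_arrow])
  have u_simps: "u Y \<in> Ar D.AC" "Dom D.AC (u Y) = fo F (fo \<Phi> (fo G Y))" "Cod D.AC (u Y) = fo F (fo \<Phi> (fo G Y))"
    if "Y \<in> Ob D.AC" for Y using that by (simp_all add: u_def)
  have i1: "DD.isomorphic (cone_functor D H \<Upsilon>' ?\<phi>) (cone_functor D (?FG \<circ>\<^sub>F \<Upsilon>') \<Upsilon>' ?\<epsilon>)"
  proof (rule DD.isomorphic_cone[OF H_arrow \<Upsilon>'_arrow \<phi> a \<Upsilon>'_arrow \<epsilon>U F\<theta> idU])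
    fix Y assume Y: "Y \<in> Ob D.AC"
    have i: "?in Y \<in> Ar D.AC" using Y by simp
    \<comment> \<open>Genuine naturality of \<open>\<epsilon>'\<close> at the cone inclusion.
      Precomposition with \<open>F \<eta>' \<Phi> G\<close> turns the left side into
      \<open>\<epsilon>'\<close> after \<open>F \<theta>\<close> and the right side into
      \<open>?in\<close> after \<open>u\<close>.\<close>
    have "\<epsilon>' (cone_cpx D (\<eta> Y)) \<cdot>\<^bsub>D.AC\<^esub> fa F (fa G (?in Y)) = ?in Y \<cdot>\<^bsub>D.AC\<^esub> \<epsilon>' (fo F (fo \<Phi> (fo G Y)))"
      using DD.hom1D(4)[OF \<epsilon>' i] Y by simp
    then have "(\<epsilon>' (cone_cpx D (\<eta> Y)) \<cdot>\<^bsub>D.AC\<^esub> fa F (fa G (?in Y))) \<cdot>\<^bsub>D.AC\<^esub> fa F (\<eta>' (fo \<Phi> (fo G Y))) =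
      (?in Y \<cdot>\<^bsub>D.AC\<^esub> \<epsilon>' (fo F (fo \<Phi> (fo G Y)))) \<cdot>\<^bsub>D.AC\<^esub> fa F (\<eta>' (fo \<Phi> (fo G Y)))" by simp
    then show "Idt D.AC (fo \<Upsilon>' Y) \<cdot>\<^bsub>D.AC\<^esub> ?in Y \<cdot>\<^bsub>D.AC\<^esub> u Y = ?\<epsilon> Y \<cdot>\<^bsub>D.AC\<^esub> fa F (\<theta> Y)"
      using Y by (simp add: \<theta>_def u_def)
    have "\<theta> Y \<in> Ar C.AC" using Y by (simp add: \<theta>_def)
    then show "is_iso D.AC.S (D.AC.cl (fa F (\<theta> Y)))"
      using F.bar.fa_is_iso[OF \<theta>_iso[OF Y]] by (simp add: F.bar_cl)
    have "Idt D.AC.S (fo \<Upsilon>' Y) = D.AC.cl (Idt D.AC (fo \<Upsilon>' Y))" by (rule D.AC.cl_Idt)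
    then show "is_iso D.AC.S (D.AC.cl (Idt D.AC (fo \<Upsilon>' Y)))"
      using D.AC.S.is_iso_Idt[of "fo \<Upsilon>' Y"] Y by simp
  qed
  \<comment> \<open>A second genuine square removes \<open>u\<close>: the same cone also maps to the
    cone of the bare inclusion, so the two comparisons form a zigzag with common source.\<close>
  have i2: "DD.isomorphic (cone_functor D H \<Upsilon>' ?\<phi>) (cone_functor D H \<Upsilon>' ?in)"
  proof (rule DD.isomorphic_cone[OF H_arrow \<Upsilon>'_arrow \<phi> H_arrow \<Upsilon>'_arrow inn u idU])
    fix Y assume Y: "Y \<in> Ob D.AC"
    show "Idt D.AC (fo \<Upsilon>' Y) \<cdot>\<^bsub>D.AC\<^esub> ?in Y \<cdot>\<^bsub>D.AC\<^esub> u Y = ?in Y \<cdot>\<^bsub>D.AC\<^esub> u Y"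
      using Y u_simps[OF Y] by simp
    show "is_iso D.AC.S (D.AC.cl (u Y))" by (rule u_iso[OF Y])
    have "Idt D.AC.S (fo \<Upsilon>' Y) = D.AC.cl (Idt D.AC (fo \<Upsilon>' Y))" by (rule D.AC.cl_Idt)
    then show "is_iso D.AC.S (D.AC.cl (Idt D.AC (fo \<Upsilon>' Y)))"
      using D.AC.S.is_iso_Idt[of "fo \<Upsilon>' Y"] Y by simp
  qed
  have i3: "DD.isomorphic (cone_functor D H \<Upsilon>' ?in) (shift D 1)"
  proof (rule DD.isomorphicI)
    show "one_arrow D D (cone_functor D H \<Upsilon>' ?in)" by (rule DD.cone_functor_one_arrow[OF H_arrow \<Upsilon>'_arrow inn])
    show "one_arrow D D (shift D 1)" by (rule D.one_arrow_shift)
    show "(\<lambda>Y. D.cone_in_cone (\<eta> Y)) \<in> hom1 D D (cone_functor D H \<Upsilon>' ?in) (shift D 1)"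
      using DD.hom1_cone_in_cone[OF one_arrow_idf H_arrow \<eta>] by simp
    show "is_iso D.AC.S (D.AC.cl (D.cone_in_cone (\<eta> Y)))" if "Y \<in> Ob D.AC" for Y
      by (rule D.cone_in_cone_iso) (use that in simp)
  qed
  \<comment> \<open>On acyclic complexes and their chain maps opposite shifts compose to the
    identity strictly, so identity maps already form the transformation.\<close>
  have i4: "DD.isomorphic (shift D (-1) \<circ>\<^sub>F shift D 1) idf"
  proof (rule DD.isomorphicI)
    show "one_arrow D D (shift D (-1) \<circ>\<^sub>F shift D 1)" by (rule one_arrow_comp[OF D.one_arrow_shift D.one_arrow_shift])
    show "one_arrow D D idf" by (rule one_arrow_idf)
    show "Idt D.AC \<in> hom1 D D (shift D (-1) \<circ>\<^sub>F shift D 1) idf"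
      by (rule DD.hom1I) (use D.shift_cpx_cancel(1)[where k = 1] D.shift_cancel(1)[where k = 1] in simp_all)
    show "is_iso D.AC.S (D.AC.cl (Idt D.AC Y))" if "Y \<in> Ob D.AC" for Y
      using that by (simp add: D.AC.cl_Idt[symmetric])
  qed
  have "DD.isomorphic (cone_functor D (?FG \<circ>\<^sub>F \<Upsilon>') \<Upsilon>' ?\<epsilon>) (shift D 1)"
    by (rule DD.isomorphic_trans[OF DD.isomorphic_sym[OF i1] DD.isomorphic_trans[OF i2 i3]])
  then have "DD.isomorphic (shift D (-1) \<circ>\<^sub>F cone_functor D (?FG \<circ>\<^sub>F \<Upsilon>') \<Upsilon>' ?\<epsilon>) idf"
    by (rule DD.isomorphic_trans[OF DD.isomorphic_whisker[OF D.one_arrow_shift] i4])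
  \<comment> \<open>Cones are formed pointwise and thus commute with precomposition on the nose;
    this is an equality of functors.\<close>
  moreover have "\<Upsilon> \<circ>\<^sub>F \<Upsilon>' = shift D (-1) \<circ>\<^sub>F cone_functor D (?FG \<circ>\<^sub>F \<Upsilon>') \<Upsilon>' ?\<epsilon>"
    by (simp add: compf_def cocone_functor_def cone_functor_def idf_def)
  ultimately show ?thesis by simp
qed

subsection \<open>\<open>\<Upsilon>' \<Upsilon>\<close>\<close>

definition n where "n Y = fa F (fa \<Phi> (\<eta>' (fo G Y)))"

definition \<beta> where "\<beta> Y = cone_in D (n Y) \<cdot>\<^bsub>D.AC\<^esub> \<eta> (fo F (fo G Y))"

definition \<delta> where
  "\<delta> Y = cone_in D (n Y) \<cdot>\<^bsub>D.AC\<^esub> fa F (fa \<Phi> (fa G (D.cocone_pr (\<epsilon>' Y))))"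

lemma n_simps [simp]:
  assumes "Y \<in> Ob D.AC"
  shows "n Y \<in> Ar D.AC" "Dom D.AC (n Y) = fo F (fo \<Phi> (fo G Y))"
    "Cod D.AC (n Y) = fo F (fo \<Phi> (fo G (fo F (fo G Y))))"
  using assms by (simp_all add: n_def)

lemma cocone_pr_\<epsilon>' [simp]:
  assumes "Y \<in> Ob D.AC"
  shows "D.cocone_pr (\<epsilon>' Y) \<in> Ar D.AC" "Dom D.AC (D.cocone_pr (\<epsilon>' Y)) = fo \<Upsilon> Y"
    "Cod D.AC (D.cocone_pr (\<epsilon>' Y)) = fo F (fo G Y)"
  using D.cocone_pr_simps[of "\<epsilon>' Y"] assms by (simp_all add: cocone_functor_def)

text \<open>A triangle identity makes \<open>F \<Phi> G \<epsilon>'\<close> a retraction of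
  \<open>n\<close>, so the cone of \<open>n\<close> is a cokernel of a split monomorphism. For
  \<open>\<beta>\<close> it is compared with another cokernel of \<open>n\<close>, the image of
  \<open>\<gamma>\<close> at \<open>G Y\<close> under \<open>F \<Phi>\<close>. For
  \<open>\<delta>\<close> the image of the cocone map under \<open>F \<Phi> G\<close> splits the
  same idempotent as the cone inclusion.\<close>

lemma \<beta>_\<delta>_iso:
  assumes Y: "Y \<in> Ob D.AC"
  shows "is_iso D.AC.S (D.AC.cl (\<beta> Y))" "is_iso D.AC.S (D.AC.cl (\<delta> Y))"
proof -
  let ?H = "\<lambda>d. Fb (\<Phi>b (Gb d))"
  let ?m = "D.AC.cl (n Y)" and ?q = "D.AC.cl (cone_in D (n Y))" and ?e = "?H (D.AC.cl (\<epsilon>' Y))"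
    and ?g = "Fb (\<Phi>b (\<gamma> (fo G Y)))" and ?k = "?H (D.AC.cl (D.cocone_pr (\<epsilon>' Y)))"
    and ?c = "D.AC.cl (\<eta> (fo F (fo G Y)))"
  let ?A = "fo F (fo \<Phi> (fo G Y))" and ?B = "fo F (fo \<Phi> (fo G (fo F (fo G Y))))"
  have GY: "fo G Y \<in> Ob C.AC" using Y by simp
  note a = \<alpha>_simps[OF GY]
  have m: "?m \<in> Ar D.AC.S" "Dom D.AC.S ?m = ?A" "Cod D.AC.S ?m = ?B"
    and q: "?q \<in> Ar D.AC.S" "Dom D.AC.S ?q = ?B" "Cod D.AC.S ?q = cone_cpx D (n Y)"
    and e: "?e \<in> Ar D.AC.S" "Dom D.AC.S ?e = ?B" "Cod D.AC.S ?e = ?A"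
    and k: "?k \<in> Ar D.AC.S" "Dom D.AC.S ?k = fo F (fo \<Phi> (fo G (fo \<Upsilon> Y)))" "Cod D.AC.S ?k = ?B"
    and c: "?c \<in> Ar D.AC.S" "Cod D.AC.S ?c = ?B"
    and g: "Dom D.AC.S ?g = ?B" "Cod D.AC.S ?g = fo F (fo \<Phi> (fo \<Psi> (fo G Y)))"
    using Y a by (simp_all add: \<gamma>_def cocone_functor_def)
  have mb: "?m = Fb (\<Phi>b (C.AC.cl (\<eta>' (fo G Y))))" using Y by (simp add: n_def F.bar_cl \<Phi>.bar_cl)
  have "Fb (\<Phi>b (Gb (D.AC.cl (\<epsilon>' Y)) \<cdot>\<^bsub>C.AC.S\<^esub> C.AC.cl (\<eta>' (fo G Y)))) = Idt D.AC.S ?A"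
    unfolding triangle_identities(4)[OF Y] using Y by simp
  then have em: "?e \<cdot>\<^bsub>D.AC.S\<^esub> ?m = Idt D.AC.S ?A" unfolding mb using Y by simp
  have sx: "D.AC.stably_exact ?m ?q" by (rule D.stably_exact_map_in) (use Y in simp)
  obtain t where t: "t \<in> Ar D.AC.S" "Dom D.AC.S t = Cod D.AC.S ?q" "Cod D.AC.S t = Cod D.AC.S ?m"
    "?q \<cdot>\<^bsub>D.AC.S\<^esub> t = Idt D.AC.S (Cod D.AC.S ?q)"
    "t \<cdot>\<^bsub>D.AC.S\<^esub> ?q = Idt D.AC.S (Cod D.AC.S ?m) \<oplus>\<^bsub>D.AC.S\<^esub> \<ominus>\<^bsub>D.AC.S\<^esub> (?m \<cdot>\<^bsub>D.AC.S\<^esub> ?e)"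
    by (rule D.AC.stably_exact_split_mono[OF sx e(1)]) (simp_all only: m q e em)
  note t = t(1) t(2)[unfolded q] t(3)[unfolded m] t(4)[unfolded q] t(5)[unfolded m]
  have mg: "D.AC.S.split_exact ?m ?g"
    unfolding mb by (rule F.bar.fa_split_exact[OF \<Phi>.bar.fa_split_exact[OF split_\<gamma>[OF GY]]])
  \<comment> \<open>Naturality of \<open>\<eta>\<close> at the stable arrow
    \<open>F \<alpha>\<close> moves \<open>\<eta>\<close> in front of the counit; the triangle
    identity at \<open>\<Psi> G Y\<close> cancels both and leaves the isomorphism
    \<open>F \<alpha>\<close>.\<close>
  have "is_iso D.AC.S (?g \<cdot>\<^bsub>D.AC.S\<^esub> ?c)"
  proof -
    have Fa: "Fb (\<alpha> (fo G Y)) \<in> Ar D.AC.S" "Dom D.AC.S (Fb (\<alpha> (fo G Y))) = fo F (fo G Y)"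
      "Cod D.AC.S (Fb (\<alpha> (fo G Y))) = fo F (fo \<Phi> (fo \<Psi> (fo G Y)))" using a by simp_all
    have "?g \<cdot>\<^bsub>D.AC.S\<^esub> ?c = Fb (\<Phi>b (C.AC.cl (\<epsilon> (fo \<Psi> (fo G Y))))) \<cdot>\<^bsub>D.AC.S\<^esub> (?H (Fb (\<alpha> (fo G Y))) \<cdot>\<^bsub>D.AC.S\<^esub> ?c)"
      using Y a by (simp add: \<gamma>_def)
    also have "\<dots> = (Fb (\<Phi>b (C.AC.cl (\<epsilon> (fo \<Psi> (fo G Y))))) \<cdot>\<^bsub>D.AC.S\<^esub> D.AC.cl (\<eta> (fo F (fo \<Phi> (fo \<Psi> (fo G Y)))))) \<cdot>\<^bsub>D.AC.S\<^esub> Fb (\<alpha> (fo G Y))"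
      unfolding \<eta>_natural[OF Fa] using Y a by simp
    also have "\<dots> = Fb (\<alpha> (fo G Y))"
      using triangle_identities(2)[of "fo \<Psi> (fo G Y)"] Fa Y by simp
    finally show ?thesis using F.bar.fa_is_iso[OF a(1)] by simp
  qed
  from D.AC.S.cokernel_complement_iso[OF mg m(2) g e em q t c this]
  show "is_iso D.AC.S (D.AC.cl (\<beta> Y))" using Y by (simp add: \<beta>_def D.AC.cl_Cmp)
  have "D.AC.stably_exact (D.AC.cl (D.cocone_pr (\<epsilon>' Y))) (D.AC.cl (\<epsilon>' Y))"
    by (rule D.stably_exact_cocone_map) (use Y in simp)
  \<comment> \<open>\<open>F \<Phi> G\<close> is applied to the rotated pair of the cocone map and
    \<open>\<epsilon>'\<close>. Since \<open>?m\<close> is a section of \<open>?e\<close>, the pair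
    splits, and \<open>l\<close> is the resulting retraction of \<open>?k\<close>.\<close>
  then have ke: "D.AC.stably_exact ?k ?e"
    by (rule F.bar_stably_exact[OF \<Phi>.bar_stably_exact[OF G.bar_stably_exact]])
  obtain l where l: "l \<in> Ar D.AC.S" "Dom D.AC.S l = Dom D.AC.S ?e" "Cod D.AC.S l = Dom D.AC.S ?k"
    "l \<cdot>\<^bsub>D.AC.S\<^esub> ?k = Idt D.AC.S (Dom D.AC.S ?k)"
    "?k \<cdot>\<^bsub>D.AC.S\<^esub> l = Idt D.AC.S (Dom D.AC.S ?e) \<oplus>\<^bsub>D.AC.S\<^esub> \<ominus>\<^bsub>D.AC.S\<^esub> (?m \<cdot>\<^bsub>D.AC.S\<^esub> ?e)"
    by (rule D.AC.stably_exact_split_epi[OF ke m(1)]) (simp_all only: m q e em)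
  note l = l(1) l(2)[unfolded e] l(3)[unfolded k] l(4)[unfolded k] l(5)[unfolded e]
  have ek: "?e \<cdot>\<^bsub>D.AC.S\<^esub> ?k = Zer D.AC.S (fo F (fo \<Phi> (fo G (fo \<Upsilon> Y)))) ?A"
    using D.AC.stably_exact_zero[OF ke] unfolding k e .
  from D.AC.S.cokernel_section_iso[OF m e em q t k ek l]
  show "is_iso D.AC.S (D.AC.cl (\<delta> Y))" using Y by (simp add: \<delta>_def F.bar_cl \<Phi>.bar_cl G.bar_cl D.AC.cl_Cmp)
qed

lemma \<Upsilon>'_\<Upsilon>: "DD.isomorphic (\<Upsilon>' \<circ>\<^sub>F \<Upsilon>) idf"
proof -
  let ?FG = "F \<circ>\<^sub>F G" and ?pr = "\<lambda>Y. D.cocone_pr (\<epsilon>' Y)" and ?\<eta> = "\<lambda>Y. \<eta> (fo \<Upsilon> Y)"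
  let ?Q = "cone_functor D H (H \<circ>\<^sub>F ?FG) n"
  let ?\<nu> = "\<lambda>Y. \<beta> Y \<cdot>\<^bsub>D.AC\<^esub> ?pr Y"
  have FG: "one_arrow D D ?FG" and PG: "one_arrow D C (\<Phi> \<circ>\<^sub>F G)" by (rule one_arrow_comp[OF G F] one_arrow_comp[OF G \<Phi>])+
  have FP: "one_arrow C D (F \<circ>\<^sub>F \<Phi>)" by (rule one_arrow_comp[OF \<Phi> F])
  have GFG: "one_arrow D C (G \<circ>\<^sub>F ?FG)" by (rule one_arrow_comp[OF FG G])
  have HFG: "one_arrow D D (H \<circ>\<^sub>F ?FG)" by (rule one_arrow_comp[OF FG H_arrow])
  have HU: "one_arrow D D (H \<circ>\<^sub>F \<Upsilon>)" by (rule one_arrow_comp[OF \<Upsilon>_arrow H_arrow])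
  have "(\<lambda>Y. \<eta>' (fo G Y)) \<in> hom1 D C G (G \<circ>\<^sub>F ?FG)"
    using hom1_whisker_right[OF pairs(3,1) G \<eta>'] by (simp add: compf_assoc)
  from hom1_whisker_left[OF pairs(3,2) FP G GFG this]
  have n: "n \<in> hom1 D D H (H \<circ>\<^sub>F ?FG)" unfolding n_def by (simp add: compf_assoc)
  have Q: "one_arrow D D ?Q" by (rule DD.cone_functor_one_arrow[OF H_arrow HFG n])
  have inn: "(\<lambda>Y. cone_in D (n Y)) \<in> hom1 D D (H \<circ>\<^sub>F ?FG) ?Q" by (rule DD.hom1_cone_in[OF H_arrow HFG n])
  have pr: "?pr \<in> hom1 D D \<Upsilon> ?FG" by (rule DD.hom1_cocone_pr[OF FG one_arrow_idf \<epsilon>'])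
  have "(\<lambda>Y. \<eta> (fo ?FG Y)) \<in> hom1 D D ?FG (H \<circ>\<^sub>F ?FG)"
    using hom1_whisker_right[OF pairs(4,4) FG \<eta>] by simp
  from DD.hom1_Cmp[OF this inn FG HFG Q] have \<beta>: "\<beta> \<in> hom1 D D ?FG ?Q" unfolding \<beta>_def by simp
  have "(\<lambda>Y. fa H (?pr Y)) \<in> hom1 D D (H \<circ>\<^sub>F \<Upsilon>) (H \<circ>\<^sub>F ?FG)"
    by (rule hom1_whisker_left[OF pairs(4,4) H_arrow \<Upsilon>_arrow FG pr])
  from DD.hom1_Cmp[OF this inn HU HFG Q] have \<delta>: "\<delta> \<in> hom1 D D (H \<circ>\<^sub>F \<Upsilon>) ?Q" unfolding \<delta>_def by simp
  have \<nu>: "?\<nu> \<in> hom1 D D \<Upsilon> ?Q" by (rule DD.hom1_Cmp[OF pr \<beta> \<Upsilon>_arrow FG Q])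
  have \<eta>U: "?\<eta> \<in> hom1 D D \<Upsilon> (H \<circ>\<^sub>F \<Upsilon>)" using hom1_whisker_right[OF pairs(4,4) \<Upsilon>_arrow \<eta>] by simp
  have idU: "(\<lambda>Y. Idt D.AC (fo \<Upsilon> Y)) \<in> hom1 D D \<Upsilon> \<Upsilon>" by (rule DD.hom1_Idt[OF \<Upsilon>_arrow])
  have U: "fo \<Upsilon> Y \<in> Ob D.AC" if "Y \<in> Ob D.AC" for Y by (rule DD.one_arrowD(1)[OF \<Upsilon>_arrow that])
  have idU_iso: "is_iso D.AC.S (D.AC.cl (Idt D.AC (fo \<Upsilon> Y)))" if "Y \<in> Ob D.AC" for Y
    unfolding D.AC.cl_Idt[symmetric] by (rule D.AC.S.is_iso_Idt) (use U[OF that] in simp)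
  have j1: "DD.isomorphic (cone_functor D \<Upsilon> (H \<circ>\<^sub>F \<Upsilon>) ?\<eta>) (cone_functor D \<Upsilon> ?Q ?\<nu>)"
  proof (rule DD.isomorphic_cone[OF \<Upsilon>_arrow HU \<eta>U \<Upsilon>_arrow Q \<nu> idU \<delta>])
    fix Y assume Y: "Y \<in> Ob D.AC"
    \<comment> \<open>Naturality of \<open>\<eta>\<close> at the cocone map. Followed by the
      inclusion into the cone of \<open>n\<close>, its two sides become \<open>\<delta>\<close>
      after \<open>?\<eta>\<close> and \<open>?\<nu>\<close>.\<close>
    have "fa F (fa \<Phi> (fa G (?pr Y))) \<cdot>\<^bsub>D.AC\<^esub> ?\<eta> Y = \<eta> (fo F (fo G Y)) \<cdot>\<^bsub>D.AC\<^esub> ?pr Y"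
      using DD.hom1D(4)[OF \<eta> cocone_pr_\<epsilon>'(1)[OF Y]] Y by (simp add: cocone_functor_def)
    then have "cone_in D (n Y) \<cdot>\<^bsub>D.AC\<^esub> (fa F (fa \<Phi> (fa G (?pr Y))) \<cdot>\<^bsub>D.AC\<^esub> ?\<eta> Y) =
      cone_in D (n Y) \<cdot>\<^bsub>D.AC\<^esub> (\<eta> (fo F (fo G Y)) \<cdot>\<^bsub>D.AC\<^esub> ?pr Y)" by simp
    then show "\<delta> Y \<cdot>\<^bsub>D.AC\<^esub> ?\<eta> Y = ?\<nu> Y \<cdot>\<^bsub>D.AC\<^esub> Idt D.AC (fo \<Upsilon> Y)"
      using Y U[OF Y] by (simp add: \<delta>_def \<beta>_def cocone_functor_def)
  qed (rule idU_iso \<beta>_\<delta>_iso, assumption)+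
  \<comment> \<open>Both comparisons end in the cone of \<open>?\<nu>\<close> and meet there, so
    neither \<open>\<beta>\<close> nor \<open>\<delta>\<close> has to be inverted on
    complexes.\<close>
  have j2: "DD.isomorphic (cone_functor D \<Upsilon> ?FG ?pr) (cone_functor D \<Upsilon> ?Q ?\<nu>)"
  proof (rule DD.isomorphic_cone[OF \<Upsilon>_arrow FG pr \<Upsilon>_arrow Q \<nu> idU \<beta>])
    fix Y assume Y: "Y \<in> Ob D.AC"
    show "\<beta> Y \<cdot>\<^bsub>D.AC\<^esub> ?pr Y = ?\<nu> Y \<cdot>\<^bsub>D.AC\<^esub> Idt D.AC (fo \<Upsilon> Y)"
      using Y U[OF Y] by (simp add: \<beta>_def cocone_functor_def)
  qed (rule idU_iso \<beta>_\<delta>_iso, assumption)+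
  have j3: "DD.isomorphic idf (cone_functor D \<Upsilon> ?FG ?pr)"
  proof (rule DD.isomorphicI)
    show "one_arrow D D idf" by (rule one_arrow_idf)
    show "one_arrow D D (cone_functor D \<Upsilon> ?FG ?pr)" by (rule DD.cone_functor_one_arrow[OF \<Upsilon>_arrow FG pr])
    show "(\<lambda>Y. D.cocone_pr_in (\<epsilon>' Y)) \<in> hom1 D D idf (cone_functor D \<Upsilon> ?FG ?pr)"
      by (rule DD.hom1_cocone_pr_in[OF FG one_arrow_idf \<epsilon>'])
    show "is_iso D.AC.S (D.AC.cl (D.cocone_pr_in (\<epsilon>' Y)))" if "Y \<in> Ob D.AC" for Y
      by (rule D.cocone_pr_in_iso) (use that in simp)
  qed
  have "DD.isomorphic (cone_functor D \<Upsilon> (H \<circ>\<^sub>F \<Upsilon>) ?\<eta>) idf"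
    by (rule DD.isomorphic_trans[OF j1 DD.isomorphic_sym[OF DD.isomorphic_trans[OF j3 j2]]])
  moreover have "\<Upsilon>' \<circ>\<^sub>F \<Upsilon> = cone_functor D \<Upsilon> (H \<circ>\<^sub>F \<Upsilon>) ?\<eta>"
    by (simp add: compf_def cocone_functor_def cone_functor_def idf_def)
  ultimately show ?thesis by simp
qed

lemma inverse: "inverse_self_equivalences D \<Upsilon> \<Upsilon>'"
  using \<Upsilon>_arrow \<Upsilon>'_arrow DD.isomorphic_sym[OF \<Upsilon>_\<Upsilon>'] \<Upsilon>'_\<Upsilon>
  by (simp add: inverse_self_equivalences_def DD.isomorphic_def)

end

theorem proposition2p1:
  fixes C :: "('o, 'm) excat" and D :: "('p, 'n) excat"
    and F :: "('o, 'm, 'p, 'n) arrow1" and G :: "('p, 'n, 'o, 'm) arrow1"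
    and \<Phi> \<Psi> :: "('o, 'm, 'o, 'm) arrow1"
  assumes "frobenius_category C" and "frobenius_category D"
    and "one_arrow C D F" and "one_arrow D C G"
    and "inverse_self_equivalences C \<Phi> \<Psi>"
    and "two_iso C C idf (\<Phi> \<circ>\<^sub>F \<Psi>) \<alpha>"
    and "adjoint_pair D C G (F \<circ>\<^sub>F \<Phi>) \<eta> \<epsilon>"
    and "adjoint_pair C D F G \<eta>' \<epsilon>'"
    and "dist_triangle_functors C C idf (G \<circ>\<^sub>F F) \<Psi>
           (two_arrow C \<eta>')
           (\<lambda>X. Cmp (stable (Acyc C)) (two_arrow C \<epsilon> (fo \<Psi> X)) (fa (bar (Acyc C) (G \<circ>\<^sub>F F)) (\<alpha> X)))
           (\<lambda>X. Zer (stable (Acyc C)) (fo \<Psi> X) (fo (shift C 1) X))"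
  shows "inverse_self_equivalences D
           (cocone_functor D (F \<circ>\<^sub>F G) idf \<epsilon>')
           (cone_functor D idf (F \<circ>\<^sub>F \<Phi> \<circ>\<^sub>F G) \<eta>)"
proof -
  interpret split_adjunctions C D F G \<Phi> \<Psi> \<alpha> \<eta> \<epsilon> \<eta>' \<epsilon>'
    using assms by (intro split_adjunctions.intro frobenius_complexes.intro split_adjunctions_axioms.intro)
  show ?thesis by (rule inverse)
qed

end
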